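(* Let $\Gamma$ be a finite group. The multiplication $m$ and the comultiplication $\Delta$ on $R_\Gamma^-=\bigoplus_{n\ge0}R^-(\widetilde\Gamma_n)$ given by $$m:R^-(\widetilde\Gamma_n)\otimes R^-(\widetilde\Gamma_m)\xrightarrow{\ \phi_{n,m}\ }R^-(\widetilde\Gamma_n\hat\times\widetilde\Gamma_m)\xrightarrow{\ \mathrm{Ind}\ }R^-(\widetilde\Gamma_{n+m}),$$ $$\Delta:R^-(\widetilde\Gamma_n)\xrightarrow{\ \mathrm{Res}\ }\bigoplus_{m=0}^nR^-(\widetilde\Gamma_{n-m}\hat\times\widetilde\Gamma_m)\xrightarrow{\ \oplus\phi_{n-m,m}^{-1}\ }\bigoplus_{m=0}^nR^-(\widetilde\Gamma_{n-m})\otimes R^-(\widetilde\Gamma_m)$$ define a Hopf algebra structure on $R_\Gamma^-$ over $\mathbb C$.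
   Context: For $n\ge0$, $\widetilde S_n$ is the group generated by $z,t_1,\dots,t_{n-1}$ with relations $z^2=1$, $zt_i=t_iz$, $t_i^2=(t_it_{i+1})^3=z$, $t_it_j=zt_jt_i$ for $i>j+1$; it maps onto $S_n$ by $t_i\mapsto(i,i+1)$, $z\mapsto1$ ($\widetilde S_0=\widetilde S_1=\{1,z\}$). It acts on $\Gamma^n$ through $S_n$ by $s(g_1,\dots,g_n)=(g_{s^{-1}(1)},\dots,g_{s^{-1}(n)})$, and $\widetilde\Gamma_n=\Gamma^n\rtimes\widetilde S_n$ with $(g,t)(h,s)=(g\,t(h),ts)$; $\Gamma_n=\Gamma\wr S_n=\widetilde\Gamma_n/\{1,z\}$. The parity is the homomorphism $d:\widetilde\Gamma_n\to\mathbb Z/2$ with $d(g,t_i)=1$, $d(g,z)=0$. $R^-(\widetilde\Gamma_n)$ is the space of spin super class functions, i.e. class functions $f:\widetilde\Gamma_n\to\mathbb C$ with $f(zx)=-f(x)$ that vanish on odd elements; it is spanned by the characters of spin supermodules ($\mathbb Z/2$-graded modules with $z$ acting as $-\mathrm{Id}$). $\widetilde\Gamma_n\tilde\times\widetilde\Gamma_m$ is the set $\widetilde\Gamma_n\times\widetilde\Gamma_m$ with multiplication $(t,t')(s,s')=(ts\,z^{d(t')d(s)},t's')$, and $\widetilde\Gamma_n\hat\times\widetilde\Gamma_m=(\widetilde\Gamma_n\tilde\times\widetilde\Gamma_m)/\{(1,1),(z,z)\}$; it is embedded in $\widetilde\Gamma_{n+m}$ as the preimage of $\Gamma_n\times\Gamma_m$,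 with $t_i$ of the first factor going to $t_i$ and $t_j$ of the second to $t_{n+j}$. $R^-(\widetilde\Gamma_n\hat\times\widetilde\Gamma_m)$ is the space of class functions on it that change sign under multiplication by $z$ and vanish on odd elements. $\phi_{n,m}$ is the linear isomorphism induced by the super outer tensor product $U\otimes V$ of supermodules, $(t,s)(u\otimes v)=(-1)^{d(s)d(u)}(tu\otimes sv)$; on class functions, $\phi_{n,m}(f\otimes g)(x,y)=f(x)g(y)$ if $x,y$ are both even, and $0$ otherwise. Ind and Res are induction and restriction of class functions (equivalently of supermodules, $\mathrm{Ind}_H^GW=\mathbb C[G]\otimes_{\mathbb C[H]}W$). *)

theory Defs
  imports Complex_Main "HOL-Algebra.Module" "HOL-Algebra.AbelCoset"
    "HOL-Algebra.Elementary_Groups" "HOL-Algebra.Sym_Groups"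
begin

section \<open>Groups given by generators and relations\<close>

text \<open>A word is a list of letters, \<open>(x, True)\<close> standing for the generator \<open>x\<close> and
  \<open>(x, False)\<close> for its inverse. A relation is a pair of words. The group presented by
  \<open>X\<close> and \<open>Q\<close> consists of the equivalence classes of words over \<open>X\<close>.\<close>

type_synonym 'x gword = "('x \<times> bool) list"

definition gwords :: "'x set \<Rightarrow> 'x gword set" where
  "gwords X = lists (X \<times> UNIV)"

inductive pres_eq :: "'x set \<Rightarrow> ('x gword \<times> 'x gword) set \<Rightarrow> 'x gword \<Rightarrow> 'x gword \<Rightarrow> bool"
  for X :: "'x set" and Q :: "('x gword \<times> 'x gword) set" where
  refl: "w \<in> gwords X \<Longrightarrow> pres_eq X Q w w"
| sym: "pres_eq X Q v w \<Longrightarrow> pres_eq X Q w v"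
| trans: "pres_eq X Q u v \<Longrightarrow> pres_eq X Q v w \<Longrightarrow> pres_eq X Q u w"
| cancel: "u \<in> gwords X \<Longrightarrow> v \<in> gwords X \<Longrightarrow> x \<in> X \<Longrightarrow>
    pres_eq X Q (u @ [(x, b), (x, \<not> b)] @ v) (u @ v)"
| relation: "u \<in> gwords X \<Longrightarrow> v \<in> gwords X \<Longrightarrow> (l, r) \<in> Q \<Longrightarrow>
    pres_eq X Q (u @ l @ v) (u @ r @ v)"

definition pres_class :: "'x set \<Rightarrow> ('x gword \<times> 'x gword) set \<Rightarrow> 'x gword \<Rightarrow> 'x gword set" where
  "pres_class X Q w = {v. pres_eq X Q w v}"

definition presented_group ::
    "'x set \<Rightarrow> ('x gword \<times> 'x gword) set \<Rightarrow> 'x gword set monoid" where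
  "presented_group X Q =
    \<lparr>carrier = gwords X // {(v, w). pres_eq X Q v w},
     monoid.mult = (\<lambda>A B. \<Union>a\<in>A. \<Union>b\<in>B. pres_class X Q (a @ b)),
     one = pres_class X Q []\<rparr>"

definition word_eval :: "('h, 'm) monoid_scheme \<Rightarrow> ('x \<Rightarrow> 'h) \<Rightarrow> 'x gword \<Rightarrow> 'h" where
  "word_eval H \<phi> w =
    foldr (\<lambda>(x, b) y. (if b then \<phi> x else inv\<^bsub>H\<^esub> (\<phi> x)) \<otimes>\<^bsub>H\<^esub> y) w \<one>\<^bsub>H\<^esub>"

text \<open>The homomorphism from a presented group to \<open>H\<close> that sends each generator \<open>x\<close> to
  \<open>\<phi> x\<close>. Here and below, \<open>the_elem (f ` A)\<close> is the common value of \<open>f\<close> on the class \<open>A\<close>.\<close>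

definition pres_lift ::
    "('h, 'm) monoid_scheme \<Rightarrow> ('x \<Rightarrow> 'h) \<Rightarrow> 'x gword set \<Rightarrow> 'h" where
  "pres_lift H \<phi> A = the_elem (word_eval H \<phi> ` A)"


section \<open>The double cover of the symmetric group and of the wreath product\<close>

datatype gen = Z | T nat

definition spin_gens :: "nat \<Rightarrow> gen set" where
  "spin_gens n = insert Z (T ` {1..<n})"

definition pos_word :: "gen list \<Rightarrow> gen gword" where
  "pos_word xs = map (\<lambda>x. (x, True)) xs"

definition spin_rels :: "nat \<Rightarrow> (gen gword \<times> gen gword) set" where
  "spin_rels n =
    {(pos_word [Z, Z], pos_word [])}
    \<union> {(pos_word [Z, T i], pos_word [T i, Z]) | i. i \<in> {1..<n}}
    \<union> {(pos_word [T i, T i], pos_word [Z]) | i. i \<in> {1..<n}}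
    \<union> {(pos_word [T i, T (i+1), T i, T (i+1), T i, T (i+1)], pos_word [Z]) | i.
         i \<in> {1..<n} \<and> i + 1 \<in> {1..<n}}
    \<union> {(pos_word [T i, T j], pos_word [Z, T j, T i]) | i j.
         i \<in> {1..<n} \<and> j \<in> {1..<n} \<and> i > j + 1}"

type_synonym spin = "gen gword set"

definition spin_sym :: "nat \<Rightarrow> spin monoid" where
  "spin_sym n = presented_group (spin_gens n) (spin_rels n)"

definition spin_elt :: "nat \<Rightarrow> gen \<Rightarrow> spin" where
  "spin_elt n x = pres_class (spin_gens n) (spin_rels n) (pos_word [x])"

definition spin_perm :: "nat \<Rightarrow> spin \<Rightarrow> nat \<Rightarrow> nat" where
  "spin_perm n =
    pres_lift (sym_group n) (\<lambda>x. case x of Z \<Rightarrow> id | T i \<Rightarrow> transpose i (i + 1))"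

definition spin_parity :: "spin \<Rightarrow> int" where
  "spin_parity = pres_lift (integer_mod_group 2) (\<lambda>x. case x of Z \<Rightarrow> 0 | T i \<Rightarrow> 1)"

text \<open>\<open>spin_shift k n\<close> is the homomorphism \<open>t\<^sub>j \<mapsto> t\<^bsub>k+j\<^esub>\<close>, \<open>z \<mapsto> z\<close> into the double
  cover for \<open>n\<close>. For \<open>k = 0\<close> it is the map from a smaller to a larger cover.\<close>

definition spin_shift :: "nat \<Rightarrow> nat \<Rightarrow> spin \<Rightarrow> spin" where
  "spin_shift k n =
    pres_lift (spin_sym n) (\<lambda>x. case x of Z \<Rightarrow> spin_elt n Z | T j \<Rightarrow> spin_elt n (T (k + j)))"

type_synonym 'a wr = "(nat \<Rightarrow> 'a) \<times> spin"

definition place_action :: "nat \<Rightarrow> (nat \<Rightarrow> nat) \<Rightarrow> (nat \<Rightarrow> 'a) \<Rightarrow> nat \<Rightarrow> 'a" where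
  "place_action n s g = (\<lambda>i\<in>{1..n}. g (inv_into UNIV s i))"

definition spin_wreath :: "('a, 'b) monoid_scheme \<Rightarrow> nat \<Rightarrow> 'a wr monoid" where
  "spin_wreath \<Gamma> n =
    \<lparr>carrier = ({1..n} \<rightarrow>\<^sub>E carrier \<Gamma>) \<times> carrier (spin_sym n),
     monoid.mult = (\<lambda>(g, t) (h, s).
       (\<lambda>i\<in>{1..n}. g i \<otimes>\<^bsub>\<Gamma>\<^esub> place_action n (spin_perm n t) h i, t \<otimes>\<^bsub>spin_sym n\<^esub> s)),
     one = (\<lambda>i\<in>{1..n}. \<one>\<^bsub>\<Gamma>\<^esub>, \<one>\<^bsub>spin_sym n\<^esub>)\<rparr>"

definition wreath_z :: "('a, 'b) monoid_scheme \<Rightarrow> nat \<Rightarrow> 'a wr" where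
  "wreath_z \<Gamma> n = (\<lambda>i\<in>{1..n}. \<one>\<^bsub>\<Gamma>\<^esub>, spin_elt n Z)"

definition wreath_parity :: "'a wr \<Rightarrow> int" where
  "wreath_parity x = spin_parity (snd x)"


section \<open>The twisted products and their embeddings\<close>

definition tilde_prod ::
    "('a, 'b) monoid_scheme \<Rightarrow> nat \<Rightarrow> nat \<Rightarrow> ('a wr \<times> 'a wr) monoid" where
  "tilde_prod \<Gamma> n m =
    \<lparr>carrier = carrier (spin_wreath \<Gamma> n) \<times> carrier (spin_wreath \<Gamma> m),
     monoid.mult = (\<lambda>(t, t') (s, s').
       (t \<otimes>\<^bsub>spin_wreath \<Gamma> n\<^esub> s \<otimes>\<^bsub>spin_wreath \<Gamma> n\<^esub>
          (wreath_z \<Gamma> n [^]\<^bsub>spin_wreath \<Gamma> n\<^esub> (wreath_parity t' * wreath_parity s)),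
        t' \<otimes>\<^bsub>spin_wreath \<Gamma> m\<^esub> s')),
     one = (\<one>\<^bsub>spin_wreath \<Gamma> n\<^esub>, \<one>\<^bsub>spin_wreath \<Gamma> m\<^esub>)\<rparr>"

type_synonym 'a hat = "('a wr \<times> 'a wr) set"

definition hat_prod :: "('a, 'b) monoid_scheme \<Rightarrow> nat \<Rightarrow> nat \<Rightarrow> 'a hat monoid" where
  "hat_prod \<Gamma> n m =
    tilde_prod \<Gamma> n m Mod {\<one>\<^bsub>tilde_prod \<Gamma> n m\<^esub>, (wreath_z \<Gamma> n, wreath_z \<Gamma> m)}"

definition hat_z :: "('a, 'b) monoid_scheme \<Rightarrow> nat \<Rightarrow> nat \<Rightarrow> 'a hat" where
  "hat_z \<Gamma> n m =
    {\<one>\<^bsub>tilde_prod \<Gamma> n m\<^esub>, (wreath_z \<Gamma> n, wreath_z \<Gamma> m)}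
      #>\<^bsub>tilde_prod \<Gamma> n m\<^esub> (wreath_z \<Gamma> n, \<one>\<^bsub>spin_wreath \<Gamma> m\<^esub>)"

definition hat_parity :: "'a hat \<Rightarrow> int" where
  "hat_parity C = the_elem ((\<lambda>(x, y). (wreath_parity x + wreath_parity y) mod 2) ` C)"

definition hat_embed ::
    "('a, 'b) monoid_scheme \<Rightarrow> nat \<Rightarrow> nat \<Rightarrow> 'a hat \<Rightarrow> 'a wr" where
  "hat_embed \<Gamma> n m C = the_elem
    ((\<lambda>((g, t), (h, s)).
        (\<lambda>i\<in>{1..n+m}. if i \<le> n then g i else h (i - n),
         spin_shift 0 (n+m) t \<otimes>\<^bsub>spin_sym (n+m)\<^esub> spin_shift n (n+m) s)) ` C)"


section \<open>Spin super class functions, induction and restriction\<close>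

definition complex_ring :: "complex ring" where
  "complex_ring = \<lparr>carrier = UNIV, monoid.mult = (*), one = 1, zero = 0, add = (+)\<rparr>"

text \<open>Class functions are extended by \<open>0\<close> outside the carrier of the group. The fields
  \<open>mult\<close> and \<open>one\<close> of the library's \<open>module\<close> record play no role in a module and are left
  \<open>undefined\<close> throughout.\<close>

definition super_cf ::
    "('g, 'm) monoid_scheme \<Rightarrow> 'g \<Rightarrow> ('g \<Rightarrow> int) \<Rightarrow> (complex, 'g \<Rightarrow> complex) module" where
  "super_cf G z d =
    \<lparr>carrier = {f. (\<forall>x. x \<notin> carrier G \<longrightarrow> f x = 0)
        \<and> (\<forall>x\<in>carrier G. \<forall>s\<in>carrier G. f (s \<otimes>\<^bsub>G\<^esub> x \<otimes>\<^bsub>G\<^esub> inv\<^bsub>G\<^esub> s) = f x)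
        \<and> (\<forall>x\<in>carrier G. f (z \<otimes>\<^bsub>G\<^esub> x) = - f x)
        \<and> (\<forall>x\<in>carrier G. d x = 1 \<longrightarrow> f x = 0)},
     monoid.mult = undefined, one = undefined,
     zero = (\<lambda>x. 0), add = (\<lambda>f g x. f x + g x), smult = (\<lambda>c f x. c * f x)\<rparr>"

definition R_spin ::
    "('a, 'b) monoid_scheme \<Rightarrow> nat \<Rightarrow> (complex, 'a wr \<Rightarrow> complex) module" where
  "R_spin \<Gamma> n = super_cf (spin_wreath \<Gamma> n) (wreath_z \<Gamma> n) wreath_parity"

definition R_hat ::
    "('a, 'b) monoid_scheme \<Rightarrow> nat \<Rightarrow> nat \<Rightarrow> (complex, 'a hat \<Rightarrow> complex) module" where
  "R_hat \<Gamma> n m = super_cf (hat_prod \<Gamma> n m) (hat_z \<Gamma> n m) hat_parity"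

text \<open>Induction and restriction along an injective homomorphism \<open>\<iota>\<close> from \<open>H\<close> to \<open>G\<close>.\<close>

definition cf_ind ::
    "('h, 'm) monoid_scheme \<Rightarrow> ('g, 'n) monoid_scheme \<Rightarrow> ('h \<Rightarrow> 'g) \<Rightarrow>
     ('h \<Rightarrow> complex) \<Rightarrow> 'g \<Rightarrow> complex" where
  "cf_ind H G \<iota> f = (\<lambda>x. if x \<in> carrier G then
      (\<Sum>s | s \<in> carrier G \<and> inv\<^bsub>G\<^esub> s \<otimes>\<^bsub>G\<^esub> x \<otimes>\<^bsub>G\<^esub> s \<in> \<iota> ` carrier H.
         f (inv_into (carrier H) \<iota> (inv\<^bsub>G\<^esub> s \<otimes>\<^bsub>G\<^esub> x \<otimes>\<^bsub>G\<^esub> s))) / of_nat (order H)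
    else 0)"

definition cf_res ::
    "('h, 'm) monoid_scheme \<Rightarrow> ('h \<Rightarrow> 'g) \<Rightarrow> ('g \<Rightarrow> complex) \<Rightarrow> 'h \<Rightarrow> complex" where
  "cf_res H \<iota> f = (\<lambda>x. if x \<in> carrier H then f (\<iota> x) else 0)"


section \<open>Tensor products of modules\<close>

definition mod_hom ::
    "('r, 'k) ring_scheme \<Rightarrow> ('r, 'm, 'p) module_scheme \<Rightarrow> ('r, 'n, 'q) module_scheme \<Rightarrow>
     ('m \<Rightarrow> 'n) set" where
  "mod_hom R M N = {f \<in> carrier M \<rightarrow> carrier N.
     (\<forall>x\<in>carrier M. \<forall>y\<in>carrier M. f (x \<oplus>\<^bsub>M\<^esub> y) = f x \<oplus>\<^bsub>N\<^esub> f y) \<and>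
     (\<forall>r\<in>carrier R. \<forall>x\<in>carrier M. f (r \<odot>\<^bsub>M\<^esub> x) = r \<odot>\<^bsub>N\<^esub> f x)}"

definition self_module :: "('r, 'k) ring_scheme \<Rightarrow> ('r, 'r) module" where
  "self_module R =
    \<lparr>carrier = carrier R, monoid.mult = undefined, one = undefined,
     zero = \<zero>\<^bsub>R\<^esub>, add = add R, smult = monoid.mult R\<rparr>"

definition free_module :: "('r, 'k) ring_scheme \<Rightarrow> 'x set \<Rightarrow> ('r, 'x \<Rightarrow> 'r) module" where
  "free_module R X =
    \<lparr>carrier = {c. (\<forall>x\<in>X. c x \<in> carrier R) \<and> (\<forall>x. x \<notin> X \<longrightarrow> c x = \<zero>\<^bsub>R\<^esub>)
        \<and> finite {x. c x \<noteq> \<zero>\<^bsub>R\<^esub>}},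
     monoid.mult = undefined, one = undefined,
     zero = (\<lambda>x. \<zero>\<^bsub>R\<^esub>), add = (\<lambda>c d x. c x \<oplus>\<^bsub>R\<^esub> d x), smult = (\<lambda>r c x. r \<otimes>\<^bsub>R\<^esub> c x)\<rparr>"

definition free_basis :: "('r, 'k) ring_scheme \<Rightarrow> 'x \<Rightarrow> 'x \<Rightarrow> 'r" where
  "free_basis R x = (\<lambda>y. if y = x then \<one>\<^bsub>R\<^esub> else \<zero>\<^bsub>R\<^esub>)"

definition submodule_span ::
    "('r, 'k) ring_scheme \<Rightarrow> ('r, 'm) module \<Rightarrow> 'm set \<Rightarrow> 'm set" where
  "submodule_span R M S = \<Inter>{N. submodule N R M \<and> S \<subseteq> N}"

definition quotient_module :: "('r, 'm) module \<Rightarrow> 'm set \<Rightarrow> ('r, 'm set) module" where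
  "quotient_module M N =
    \<lparr>carrier = a_rcosets\<^bsub>M\<^esub> N, monoid.mult = undefined, one = undefined,
     zero = N, add = set_add M, smult = (\<lambda>r C. \<Union>x\<in>C. N +>\<^bsub>M\<^esub> (r \<odot>\<^bsub>M\<^esub> x))\<rparr>"

definition bilinear_rels ::
    "('r, 'k) ring_scheme \<Rightarrow> ('r, 'm) module \<Rightarrow> ('r, 'n) module \<Rightarrow> ('m \<times> 'n \<Rightarrow> 'r) set" where
  "bilinear_rels R M N = (let F = free_module R (carrier M \<times> carrier N); e = free_basis R in
     {e (x \<oplus>\<^bsub>M\<^esub> x', y) \<ominus>\<^bsub>F\<^esub> (e (x, y) \<oplus>\<^bsub>F\<^esub> e (x', y)) | x x' y.
        x \<in> carrier M \<and> x' \<in> carrier M \<and> y \<in> carrier N}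
   \<union> {e (x, y \<oplus>\<^bsub>N\<^esub> y') \<ominus>\<^bsub>F\<^esub> (e (x, y) \<oplus>\<^bsub>F\<^esub> e (x, y')) | x y y'.
        x \<in> carrier M \<and> y \<in> carrier N \<and> y' \<in> carrier N}
   \<union> {e (r \<odot>\<^bsub>M\<^esub> x, y) \<ominus>\<^bsub>F\<^esub> (r \<odot>\<^bsub>F\<^esub> e (x, y)) | r x y.
        r \<in> carrier R \<and> x \<in> carrier M \<and> y \<in> carrier N}
   \<union> {e (x, r \<odot>\<^bsub>N\<^esub> y) \<ominus>\<^bsub>F\<^esub> (r \<odot>\<^bsub>F\<^esub> e (x, y)) | r x y.
        r \<in> carrier R \<and> x \<in> carrier M \<and> y \<in> carrier N})"

definition tensor_null ::
    "('r, 'k) ring_scheme \<Rightarrow> ('r, 'm) module \<Rightarrow> ('r, 'n) module \<Rightarrow> ('m \<times> 'n \<Rightarrow> 'r) set" where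
  "tensor_null R M N =
    submodule_span R (free_module R (carrier M \<times> carrier N)) (bilinear_rels R M N)"

definition tensor ::
    "('r, 'k) ring_scheme \<Rightarrow> ('r, 'm) module \<Rightarrow> ('r, 'n) module \<Rightarrow>
     ('r, ('m \<times> 'n \<Rightarrow> 'r) set) module" where
  "tensor R M N =
    quotient_module (free_module R (carrier M \<times> carrier N)) (tensor_null R M N)"

definition pure_tensor ::
    "('r, 'k) ring_scheme \<Rightarrow> ('r, 'm) module \<Rightarrow> ('r, 'n) module \<Rightarrow>
     'm \<Rightarrow> 'n \<Rightarrow> ('m \<times> 'n \<Rightarrow> 'r) set" where
  "pure_tensor R M N x y =
    tensor_null R M N +>\<^bsub>free_module R (carrier M \<times> carrier N)\<^esub> free_basis R (x, y)"

text \<open>The linear map on the tensor product of \<open>M\<close> and \<open>N\<close> induced by a bilinear map \<open>f\<close>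
  with values in \<open>P\<close>: it sends the class of \<open>\<Sum> c(x,y) (x,y)\<close> to \<open>\<Sum> c(x,y) f(x,y)\<close>.\<close>

definition tensor_lift ::
    "('r, 'k) ring_scheme \<Rightarrow> ('r, 'm) module \<Rightarrow> ('r, 'n) module \<Rightarrow> ('r, 'p) module \<Rightarrow>
     ('m \<Rightarrow> 'n \<Rightarrow> 'p) \<Rightarrow> ('m \<times> 'n \<Rightarrow> 'r) set \<Rightarrow> 'p" where
  "tensor_lift R M N P f C = the_elem
    ((\<lambda>c. \<Oplus>\<^bsub>P\<^esub>p\<in>{p \<in> carrier M \<times> carrier N. c p \<noteq> \<zero>\<^bsub>R\<^esub>}.
             c p \<odot>\<^bsub>P\<^esub> f (fst p) (snd p)) ` C)"

definition tensor_map ::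
    "('r, 'k) ring_scheme \<Rightarrow> ('r, 'm) module \<Rightarrow> ('r, 'n) module \<Rightarrow>
     ('r, 'm1) module \<Rightarrow> ('r, 'n1) module \<Rightarrow> ('m \<Rightarrow> 'm1) \<Rightarrow> ('n \<Rightarrow> 'n1) \<Rightarrow>
     ('m \<times> 'n \<Rightarrow> 'r) set \<Rightarrow> ('m1 \<times> 'n1 \<Rightarrow> 'r) set" where
  "tensor_map R M N M' N' f g =
    tensor_lift R M N (tensor R M' N') (\<lambda>x y. pure_tensor R M' N' (f x) (g y))"

definition tensor_assoc ::
    "('r, 'k) ring_scheme \<Rightarrow> ('r, 'm) module \<Rightarrow> ('r, 'n) module \<Rightarrow> ('r, 'p) module \<Rightarrow>
     (('m \<times> 'n \<Rightarrow> 'r) set \<times> 'p \<Rightarrow> 'r) set \<Rightarrow> ('m \<times> ('n \<times> 'p \<Rightarrow> 'r) set \<Rightarrow> 'r) set" where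
  "tensor_assoc R M N P =
    (let NP = tensor R N P; Q = tensor R M NP in
      tensor_lift R (tensor R M N) P Q
        (\<lambda>X c. tensor_lift R M N Q (\<lambda>a b. pure_tensor R M NP a (pure_tensor R N P b c)) X))"

text \<open>The isomorphism of \<open>(K \<otimes> L) \<otimes> (M \<otimes> N)\<close> with \<open>(K \<otimes> M) \<otimes> (L \<otimes> N)\<close> that exchanges
  the two middle factors, with no sign.\<close>

definition tensor_swap ::
    "('r, 'k) ring_scheme \<Rightarrow> ('r, 'l1) module \<Rightarrow> ('r, 'l2) module \<Rightarrow>
     ('r, 'm) module \<Rightarrow> ('r, 'n) module \<Rightarrow>
     (('l1 \<times> 'l2 \<Rightarrow> 'r) set \<times> ('m \<times> 'n \<Rightarrow> 'r) set \<Rightarrow> 'r) set \<Rightarrow>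
     (('l1 \<times> 'm \<Rightarrow> 'r) set \<times> ('l2 \<times> 'n \<Rightarrow> 'r) set \<Rightarrow> 'r) set" where
  "tensor_swap R K L M N =
    (let KM = tensor R K M; LN = tensor R L N; Q = tensor R KM LN in
      tensor_lift R (tensor R K L) (tensor R M N) Q
        (\<lambda>X Y. tensor_lift R K L Q
          (\<lambda>a b. tensor_lift R M N Q
            (\<lambda>c d. pure_tensor R KM LN (pure_tensor R K M a c) (pure_tensor R L N b d)) Y) X))"


section \<open>Hopf algebras\<close>

text \<open>Multiplication and comultiplication are linear maps \<open>\<mu>\<close> from and \<open>\<delta>\<close> to the tensor
  square; the unit is given by the element \<open>e\<close>. Commutativity is not assumed, unlike in the
  library's locale \<^locale>\<open>algebra\<close>. The compatibility of \<open>\<delta>\<close> with \<open>\<mu>\<close> is the ordinary one, without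
  super signs.\<close>

locale assoc_algebra = module R A
  for R :: "('r, 'k) ring_scheme" (structure) and A :: "('r, 'm) module" +
  fixes \<mu> :: "('m \<times> 'm \<Rightarrow> 'r) set \<Rightarrow> 'm" and e :: 'm
  assumes mu_hom: "\<mu> \<in> mod_hom R (tensor R A A) A"
    and unit_mem: "e \<in> carrier A"
    and assoc: "X \<in> carrier (tensor R (tensor R A A) A) \<Longrightarrow>
      \<mu> (tensor_map R (tensor R A A) A A A \<mu> (\<lambda>a. a) X) =
      \<mu> (tensor_map R A (tensor R A A) A A (\<lambda>a. a) \<mu> (tensor_assoc R A A A X))"
    and l_unit: "a \<in> carrier A \<Longrightarrow> \<mu> (pure_tensor R A A e a) = a"
    and r_unit: "a \<in> carrier A \<Longrightarrow> \<mu> (pure_tensor R A A a e) = a"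

locale coassoc_coalgebra = module R A
  for R :: "('r, 'k) ring_scheme" (structure) and A :: "('r, 'm) module" +
  fixes \<delta> :: "'m \<Rightarrow> ('m \<times> 'm \<Rightarrow> 'r) set" and \<epsilon> :: "'m \<Rightarrow> 'r"
  assumes delta_hom: "\<delta> \<in> mod_hom R A (tensor R A A)"
    and counit_hom: "\<epsilon> \<in> mod_hom R A (self_module R)"
    and coassoc: "a \<in> carrier A \<Longrightarrow>
      tensor_assoc R A A A (tensor_map R A A (tensor R A A) A \<delta> (\<lambda>b. b) (\<delta> a)) =
      tensor_map R A A A (tensor R A A) (\<lambda>b. b) \<delta> (\<delta> a)"
    and l_counit: "a \<in> carrier A \<Longrightarrow>
      tensor_lift R A A A (\<lambda>b c. \<epsilon> b \<odot>\<^bsub>A\<^esub> c) (\<delta> a) = a"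
    and r_counit: "a \<in> carrier A \<Longrightarrow>
      tensor_lift R A A A (\<lambda>b c. \<epsilon> c \<odot>\<^bsub>A\<^esub> b) (\<delta> a) = a"

locale bialgebra = assoc_algebra R A \<mu> e + coassoc_coalgebra R A \<delta> \<epsilon>
  for R :: "('r, 'k) ring_scheme" (structure) and A :: "('r, 'm) module"
    and \<mu> :: "('m \<times> 'm \<Rightarrow> 'r) set \<Rightarrow> 'm" and e :: 'm
    and \<delta> :: "'m \<Rightarrow> ('m \<times> 'm \<Rightarrow> 'r) set" and \<epsilon> :: "'m \<Rightarrow> 'r" +
  assumes delta_mult: "X \<in> carrier (tensor R A A) \<Longrightarrow>
      \<delta> (\<mu> X) =
      tensor_map R (tensor R A A) (tensor R A A) A A \<mu> \<mu>
        (tensor_swap R A A A A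
          (tensor_map R A A (tensor R A A) (tensor R A A) \<delta> \<delta> X))"
    and delta_unit: "\<delta> e = pure_tensor R A A e e"
    and counit_mult: "a \<in> carrier A \<Longrightarrow> b \<in> carrier A \<Longrightarrow>
      \<epsilon> (\<mu> (pure_tensor R A A a b)) = \<epsilon> a \<otimes> \<epsilon> b"
    and counit_unit: "\<epsilon> e = \<one>"

locale hopf_algebra = bialgebra R A \<mu> e \<delta> \<epsilon>
  for R :: "('r, 'k) ring_scheme" (structure) and A :: "('r, 'm) module"
    and \<mu> :: "('m \<times> 'm \<Rightarrow> 'r) set \<Rightarrow> 'm" and e :: 'm
    and \<delta> :: "'m \<Rightarrow> ('m \<times> 'm \<Rightarrow> 'r) set" and \<epsilon> :: "'m \<Rightarrow> 'r" +
  fixes S :: "'m \<Rightarrow> 'm"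
  assumes antipode_hom: "S \<in> mod_hom R A A"
    and l_antipode: "a \<in> carrier A \<Longrightarrow>
      \<mu> (tensor_map R A A A A S (\<lambda>b. b) (\<delta> a)) = \<epsilon> a \<odot>\<^bsub>A\<^esub> e"
    and r_antipode: "a \<in> carrier A \<Longrightarrow>
      \<mu> (tensor_map R A A A A (\<lambda>b. b) S (\<delta> a)) = \<epsilon> a \<odot>\<^bsub>A\<^esub> e"


section \<open>The direct sum of the spaces of spin super class functions\<close>

type_synonym 'a spin_seq = "nat \<Rightarrow> 'a wr \<Rightarrow> complex"

definition R_total :: "('a, 'b) monoid_scheme \<Rightarrow> (complex, 'a spin_seq) module" where
  "R_total \<Gamma> =
    \<lparr>carrier = {F. (\<forall>n. F n \<in> carrier (R_spin \<Gamma> n)) \<and> finite {n. F n \<noteq> \<zero>\<^bsub>R_spin \<Gamma> n\<^esub>}},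
     monoid.mult = undefined, one = undefined,
     zero = (\<lambda>n. \<zero>\<^bsub>R_spin \<Gamma> n\<^esub>),
     add = (\<lambda>F H n. F n \<oplus>\<^bsub>R_spin \<Gamma> n\<^esub> H n),
     smult = (\<lambda>c F n. c \<odot>\<^bsub>R_spin \<Gamma> n\<^esub> F n)\<rparr>"

definition R_incl ::
    "('a, 'b) monoid_scheme \<Rightarrow> nat \<Rightarrow> ('a wr \<Rightarrow> complex) \<Rightarrow> 'a spin_seq" where
  "R_incl \<Gamma> n f = (\<lambda>k. if k = n then f else \<zero>\<^bsub>R_spin \<Gamma> k\<^esub>)"

definition outer_prod ::
    "('a, 'b) monoid_scheme \<Rightarrow> nat \<Rightarrow> nat \<Rightarrow>
     ('a wr \<Rightarrow> complex) \<Rightarrow> ('a wr \<Rightarrow> complex) \<Rightarrow> 'a hat \<Rightarrow> complex" where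
  "outer_prod \<Gamma> n m f g = (\<lambda>C. if C \<in> carrier (hat_prod \<Gamma> n m) then
      the_elem ((\<lambda>(x, y). if wreath_parity x = 0 \<and> wreath_parity y = 0
                          then f x * g y else 0) ` C)
    else 0)"

definition phi ::
    "('a, 'b) monoid_scheme \<Rightarrow> nat \<Rightarrow> nat \<Rightarrow>
     (('a wr \<Rightarrow> complex) \<times> ('a wr \<Rightarrow> complex) \<Rightarrow> complex) set \<Rightarrow> 'a hat \<Rightarrow> complex" where
  "phi \<Gamma> n m =
    tensor_lift complex_ring (R_spin \<Gamma> n) (R_spin \<Gamma> m) (R_hat \<Gamma> n m) (outer_prod \<Gamma> n m)"

definition phi_inv ::
    "('a, 'b) monoid_scheme \<Rightarrow> nat \<Rightarrow> nat \<Rightarrow> ('a hat \<Rightarrow> complex) \<Rightarrow>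
     (('a wr \<Rightarrow> complex) \<times> ('a wr \<Rightarrow> complex) \<Rightarrow> complex) set" where
  "phi_inv \<Gamma> n m =
    inv_into (carrier (tensor complex_ring (R_spin \<Gamma> n) (R_spin \<Gamma> m))) (phi \<Gamma> n m)"

definition mult_comp ::
    "('a, 'b) monoid_scheme \<Rightarrow> nat \<Rightarrow> nat \<Rightarrow>
     (('a wr \<Rightarrow> complex) \<times> ('a wr \<Rightarrow> complex) \<Rightarrow> complex) set \<Rightarrow> 'a wr \<Rightarrow> complex" where
  "mult_comp \<Gamma> n m X =
    cf_ind (hat_prod \<Gamma> n m) (spin_wreath \<Gamma> (n + m)) (hat_embed \<Gamma> n m) (phi \<Gamma> n m X)"

definition comult_comp ::
    "('a, 'b) monoid_scheme \<Rightarrow> nat \<Rightarrow> nat \<Rightarrow> ('a wr \<Rightarrow> complex) \<Rightarrow>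
     (('a wr \<Rightarrow> complex) \<times> ('a wr \<Rightarrow> complex) \<Rightarrow> complex) set" where
  "comult_comp \<Gamma> n m f =
    phi_inv \<Gamma> (n - m) m (cf_res (hat_prod \<Gamma> (n - m) m) (hat_embed \<Gamma> (n - m) m) f)"

definition R_mult ::
    "('a, 'b) monoid_scheme \<Rightarrow> ('a spin_seq \<times> 'a spin_seq \<Rightarrow> complex) set \<Rightarrow> 'a spin_seq" where
  "R_mult \<Gamma> =
    tensor_lift complex_ring (R_total \<Gamma>) (R_total \<Gamma>) (R_total \<Gamma>)
      (\<lambda>F H k. \<Oplus>\<^bsub>R_spin \<Gamma> k\<^esub>n\<in>{..k}.
         mult_comp \<Gamma> n (k - n)
           (pure_tensor complex_ring (R_spin \<Gamma> n) (R_spin \<Gamma> (k - n)) (F n) (H (k - n))))"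

text \<open>The summand \<open>R(n-m) \<otimes> R(m)\<close> is mapped into the tensor square of the direct sum by the
  tensor product of the two inclusions.\<close>

definition R_comult ::
    "('a, 'b) monoid_scheme \<Rightarrow> 'a spin_seq \<Rightarrow> ('a spin_seq \<times> 'a spin_seq \<Rightarrow> complex) set" where
  "R_comult \<Gamma> F =
    (let RR = tensor complex_ring (R_total \<Gamma>) (R_total \<Gamma>) in
      \<Oplus>\<^bsub>RR\<^esub>n\<in>{n. F n \<noteq> \<zero>\<^bsub>R_spin \<Gamma> n\<^esub>}. \<Oplus>\<^bsub>RR\<^esub>m\<in>{..n}.
        tensor_map complex_ring (R_spin \<Gamma> (n - m)) (R_spin \<Gamma> m) (R_total \<Gamma>) (R_total \<Gamma>)
          (R_incl \<Gamma> (n - m)) (R_incl \<Gamma> m) (comult_comp \<Gamma> n m (F n)))"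

end

theory Submission
  imports Defs
begin

text \<open>A spin super class function is determined by its values at the even elements, and pairs of
  such evaluations separate the points of the tensor square of the direct sum. The coproduct
  of \<open>F\<close> evaluated at \<open>(x, y)\<close> is the value of \<open>F\<close> at the juxtaposition of \<open>x\<close> and \<open>y\<close>, so coassociativity
  is associativity of juxtaposition. The product evaluated at \<open>w\<close> is a sum over the
  \<open>w\<close>-stable subsets \<open>A\<close> of \<open>{1..k}\<close> of the product of the values at the parts of \<open>w\<close> on \<open>A\<close> and on its complement,
  as long as both parts are even. A subset stable under a juxtaposition consists of
  a subset of each of the two blocks, which gives the compatibility of product and coproduct; no signs
  remain because all parts are even. The antipode multiplies \<open>F\<close> by \<open>(-1)\<close> to the number of orbits
  of \<open>w\<close>: the antipode axiom becomes the vanishing of the alternating sum over the stable subsets.\<close>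

section \<open>Presented groups\<close>

text \<open>The group is given by words only, so its structure has to be found from two sides. A
  coset decomposition bounds it from above: the map to permutations has kernel at most
  \<open>{1, z}\<close>. A Clifford representation, with \<open>z\<close> acting as
  \<open>-1\<close> and \<open>t_i\<close> as \<open>(c_i - c_(i+1)) / sqrt 2\<close>, bounds it
  from below. This representation is faithful and shows that moving \<open>x\<close> past a
  block-shifted \<open>s\<close> costs \<open>z\<close> to the product of the parities; every sign
  in the statements on juxtaposition comes from this rule.

  Restricting attention to even parts rests on a cancellation: if both parts of a juxtaposition are
  odd, conjugation by one of them multiplies the whole by \<open>z\<close>, so a spin class function
  vanishes there even though the element itself is even.

  The coproduct is defined through an \<open>inv_into\<close>. Averaging indicator functions over
  conjugates shows that restrictions lie in the image of \<open>phi\<close>; from then on only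
  evaluations are used.

  The antipode is modelled on symmetric functions, where the power sums satisfy S(p_r) = -p_r and a
  cycle type with l cycles gets the sign (-1)^l.\<close>

locale presentation =
  fixes X :: "'x set" and Q :: "('x gword \<times> 'x gword) set"
  assumes rels: "Q \<subseteq> gwords X \<times> gwords X"
begin

abbreviation cls where "cls \<equiv> pres_class X Q"
abbreviation PG where "PG \<equiv> presented_group X Q"

lemma gwords_append [simp]: "u @ v \<in> gwords X \<longleftrightarrow> u \<in> gwords X \<and> v \<in> gwords X"
  by (simp add: gwords_def)

lemma gwords_Nil [simp]: "[] \<in> gwords X"
  by (simp add: gwords_def)

lemma gwords_Cons [simp]: "x # u \<in> gwords X \<longleftrightarrow> fst x \<in> X \<and> u \<in> gwords X"
  by (cases x) (auto simp: gwords_def)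

lemma pres_eq_gwords: "pres_eq X Q v w \<Longrightarrow> v \<in> gwords X \<and> w \<in> gwords X"
  by (induction rule: pres_eq.induct) (use rels in auto)

lemma equiv_pres: "equiv (gwords X) {(v, w). pres_eq X Q v w}"
  by (rule equivI) (auto simp: refl_on_def sym_def trans_def pres_eq_gwords
      intro: pres_eq.refl pres_eq.sym pres_eq.trans)

lemma pres_eq_cong:
  assumes "pres_eq X Q v w" "a \<in> gwords X" "b \<in> gwords X"
  shows "pres_eq X Q (a @ v @ b) (a @ w @ b)"
  using assms
proof (induction rule: pres_eq.induct)
  case (refl w) then show ?case by (auto intro: pres_eq.refl)
next
  case (sym v w) then show ?case by (blast intro: pres_eq.sym)
next
  case (trans u v w) then show ?case by (blast intro: pres_eq.trans)
next
  case (cancel u v x c)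
  then have "pres_eq X Q ((a @ u) @ [(x, c), (x, \<not> c)] @ (v @ b)) ((a @ u) @ (v @ b))"
    by (intro pres_eq.cancel) auto
  then show ?case by simp
next
  case (relation u v l r)
  then have "pres_eq X Q ((a @ u) @ l @ (v @ b)) ((a @ u) @ r @ (v @ b))"
    by (intro pres_eq.relation) auto
  then show ?case by simp
qed

lemma pres_eq_append:
  assumes "pres_eq X Q v v'" "pres_eq X Q w w'"
  shows "pres_eq X Q (v @ w) (v' @ w')"
  using pres_eq_cong[OF assms(1), of "[]" w] pres_eq_cong[OF assms(2), of v' "[]"]
    pres_eq_gwords[OF assms(1)] pres_eq_gwords[OF assms(2)]
  by (auto intro: pres_eq.trans)

lemma cls_eq_iff: "v \<in> gwords X \<Longrightarrow> w \<in> gwords X \<Longrightarrow> cls v = cls w \<longleftrightarrow> pres_eq X Q v w"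
  using eq_equiv_class_iff[OF equiv_pres, of v w]
  by (simp add: pres_class_def Image_def)

lemma carrier_PG: "carrier PG = cls ` gwords X"
  by (auto simp: presented_group_def quotient_def pres_class_def Image_def)

lemma cls_closed [simp]: "w \<in> gwords X \<Longrightarrow> cls w \<in> carrier PG"
  by (simp add: carrier_PG)

lemma one_PG: "\<one>\<^bsub>PG\<^esub> = cls []"
  by (simp add: presented_group_def)

lemma mult_cls:
  assumes "v \<in> gwords X" "w \<in> gwords X"
  shows "cls v \<otimes>\<^bsub>PG\<^esub> cls w = cls (v @ w)"
proof -
  have "cls (a @ b) = cls (v @ w)" if "a \<in> cls v" "b \<in> cls w" for a b
    using that pres_eq_append[of v a w b] pres_eq_gwords[of v a] pres_eq_gwords[of w b]
    by (subst cls_eq_iff) (auto simp: pres_class_def intro: pres_eq.sym)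
  then have "(\<Union>a\<in>cls v. \<Union>b\<in>cls w. cls (a @ b)) = (\<Union>a\<in>cls v. \<Union>b\<in>cls w. cls (v @ w))"
    by (meson SUP_cong)
  also have "v \<in> cls v" "w \<in> cls w" using assms by (auto simp: pres_class_def intro: pres_eq.refl)
  then have "(\<Union>a\<in>cls v. \<Union>b\<in>cls w. cls (v @ w)) = cls (v @ w)" by blast
  finally show ?thesis by (simp add: presented_group_def)
qed

lemma gwords_rev_inverse:
  "w \<in> gwords X \<Longrightarrow> rev (map (\<lambda>(x, b). (x, \<not> b)) w) \<in> gwords X"
  by (auto simp: gwords_def)

lemma pres_eq_inverse:
  "w \<in> gwords X \<Longrightarrow> pres_eq X Q (rev (map (\<lambda>(x, b). (x, \<not> b)) w) @ w) []"
proof (induction w)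
  case Nil then show ?case by (auto intro: pres_eq.refl)
next
  case (Cons p w)
  obtain x b where p: "p = (x, b)" by (cases p)
  let ?i = "rev (map (\<lambda>(x, b). (x, \<not> b)) w)"
  have "pres_eq X Q (?i @ [(x, \<not> b), (x, \<not> \<not> b)] @ w) (?i @ w)"
    using Cons p gwords_rev_inverse[of w] by (intro pres_eq.cancel) auto
  then show ?case using Cons p by (auto intro: pres_eq.trans)
qed

lemma group_PG: "group PG"
proof (rule groupI)
  fix A assume "A \<in> carrier PG"
  then obtain w where w: "w \<in> gwords X" "A = cls w" by (auto simp: carrier_PG)
  then show "\<exists>B\<in>carrier PG. B \<otimes>\<^bsub>PG\<^esub> A = \<one>\<^bsub>PG\<^esub>"
    using pres_eq_inverse[OF w(1)] gwords_rev_inverse[OF w(1)]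
    by (intro bexI[of _ "cls (rev (map (\<lambda>(x, b). (x, \<not> b)) w))"])
      (auto simp: mult_cls one_PG cls_eq_iff)
qed (auto simp: carrier_PG mult_cls one_PG)

end

section \<open>Evaluation of words and the universal property of a presentation\<close>

lemma (in group) word_eval_closed:
  assumes "w \<in> gwords X" "\<phi> \<in> X \<rightarrow> carrier G"
  shows "word_eval G \<phi> w \<in> carrier G"
  using assms by (induction w) (auto simp: word_eval_def gwords_def Pi_iff split_beta)

lemma (in group) word_eval_append:
  assumes "v \<in> gwords X" "w \<in> gwords X" "\<phi> \<in> X \<rightarrow> carrier G"
  shows "word_eval G \<phi> (v @ w) = word_eval G \<phi> v \<otimes> word_eval G \<phi> w"
  using assms(1)
proof (induction v)
  case Nil then show ?case using word_eval_closed[OF assms(2,3)] by (simp add: word_eval_def)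
next
  case (Cons p v)
  obtain x b where p: "p = (x, b)" "x \<in> X" "v \<in> gwords X" using Cons.prems by (cases p) (auto simp: gwords_def)
  have "\<phi> x \<in> carrier G" using p assms by auto
  then show ?case
    using Cons p word_eval_closed[OF assms(2,3)] word_eval_closed[OF p(3) assms(3)]
    by (cases b; simp add: word_eval_def m_assoc)
qed

lemma (in group) word_eval_pos_word:
  "word_eval G \<phi> (pos_word xs) = foldr (\<lambda>x y. \<phi> x \<otimes> y) xs \<one>"
  by (induction xs) (auto simp: pos_word_def word_eval_def)

text \<open>Von Dyck's theorem: an assignment of the generators that respects the relations is
  constant on classes of words, and this gives the \<open>the_elem\<close> in
  \<open>pres_lift\<close> a meaning.\<close>

locale presentation_map = presentation X Q + H: group H
  for X :: "'x set" and Q and H :: "('h, 'm) monoid_scheme" +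
  fixes \<phi> :: "'x \<Rightarrow> 'h"
  assumes phi_closed: "\<phi> \<in> X \<rightarrow> carrier H"
    and phi_rels: "(l, r) \<in> Q \<Longrightarrow> word_eval H \<phi> l = word_eval H \<phi> r"
begin

lemma word_eval_pres_eq: "pres_eq X Q v w \<Longrightarrow> word_eval H \<phi> v = word_eval H \<phi> w"
proof (induction rule: pres_eq.induct)
  case (cancel u v x b)
  have x: "\<phi> x \<in> carrier H" using phi_closed cancel by auto
  note we = H.word_eval_append[OF _ _ phi_closed] and wc = H.word_eval_closed[OF _ phi_closed]
  have "word_eval H \<phi> [(x, b), (x, \<not> b)] = \<one>\<^bsub>H\<^esub>"
    using x by (cases b) (auto simp: word_eval_def)
  then show ?case using cancel wc by (simp add: we del: append_Cons append_Nil)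
next
  case (relation u v l r)
  then have "l \<in> gwords X" "r \<in> gwords X" using rels by auto
  then show ?case
    using relation phi_rels by (simp add: H.word_eval_append[OF _ _ phi_closed])
qed auto

lemma pres_lift_cls:
  assumes "w \<in> gwords X" shows "pres_lift H \<phi> (cls w) = word_eval H \<phi> w"
proof -
  have "word_eval H \<phi> ` cls w = {word_eval H \<phi> w}"
    using assms word_eval_pres_eq by (auto simp: pres_class_def intro: pres_eq.refl)
  then show ?thesis by (simp add: pres_lift_def)
qed

lemma pres_lift_hom: "pres_lift H \<phi> \<in> hom PG H"
  by (rule homI)
    (auto simp: carrier_PG mult_cls pres_lift_cls H.word_eval_append[OF _ _ phi_closed]
      H.word_eval_closed[OF _ phi_closed])

lemma pres_lift_gen: "x \<in> X \<Longrightarrow> pres_lift H \<phi> (cls [(x, True)]) = \<phi> x"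
  using phi_closed by (subst pres_lift_cls) (auto simp: word_eval_def Pi_iff)

end


section \<open>The double cover of the symmetric group\<close>

interpretation spin: presentation "spin_gens n" "spin_rels n" for n
  by unfold_locales (auto simp: spin_rels_def spin_gens_def pos_word_def gwords_def)

interpretation spin: group "spin_sym n" for n
  unfolding spin_sym_def by (rule spin.group_PG)

abbreviation zz where "zz n \<equiv> spin_elt n Z"
abbreviation tt where "tt n i \<equiv> spin_elt n (T i)"

lemma spin_elt_closed: "x \<in> spin_gens n \<Longrightarrow> spin_elt n x \<in> carrier (spin_sym n)"
  by (simp add: spin_elt_def spin_sym_def pos_word_def)

lemma zz_closed [simp]: "zz n \<in> carrier (spin_sym n)"
  by (simp add: spin_elt_closed spin_gens_def)

lemma tt_closed [simp]: "1 \<le> i \<Longrightarrow> i < n \<Longrightarrow> tt n i \<in> carrier (spin_sym n)"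
  by (simp add: spin_elt_closed spin_gens_def)

lemma foldr_spin_elt:
  assumes "set xs \<subseteq> spin_gens n"
  shows "pres_class (spin_gens n) (spin_rels n) (pos_word xs)
    = foldr (\<lambda>x y. spin_elt n x \<otimes>\<^bsub>spin_sym n\<^esub> y) xs \<one>\<^bsub>spin_sym n\<^esub>"
  using assms
proof (induction xs)
  case Nil then show ?case by (simp add: pos_word_def spin_sym_def spin.one_PG)
next
  case (Cons x xs)
  have "pos_word xs \<in> gwords (spin_gens n)" using Cons by (auto simp: pos_word_def gwords_def)
  then show ?case using Cons spin.mult_cls[of "[(x,True)]" n "pos_word xs"]
    by (simp add: pos_word_def spin_elt_def spin_sym_def)
qed

lemma spin_relation:
  assumes "(pos_word xs, pos_word ys) \<in> spin_rels n"
  shows "foldr (\<lambda>x y. spin_elt n x \<otimes>\<^bsub>spin_sym n\<^esub> y) xs \<one>\<^bsub>spin_sym n\<^esub>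
    = foldr (\<lambda>x y. spin_elt n x \<otimes>\<^bsub>spin_sym n\<^esub> y) ys \<one>\<^bsub>spin_sym n\<^esub>"
proof -
  have g: "pos_word xs \<in> gwords (spin_gens n)" "pos_word ys \<in> gwords (spin_gens n)"
    using assms spin.rels by auto
  then have s: "set xs \<subseteq> spin_gens n" "set ys \<subseteq> spin_gens n"
    by (auto simp: pos_word_def gwords_def)
  have "pres_eq (spin_gens n) (spin_rels n) ([] @ pos_word xs @ []) ([] @ pos_word ys @ [])"
    using assms by (intro pres_eq.relation) auto
  then show ?thesis using foldr_spin_elt s spin.cls_eq_iff[OF g] by fastforce
qed

lemma zz_zz: "zz n \<otimes>\<^bsub>spin_sym n\<^esub> zz n = \<one>\<^bsub>spin_sym n\<^esub>"
  using spin_relation[of "[Z,Z]" "[]" n] by (simp add: spin_rels_def)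

lemma zz_tt: "1 \<le> i \<Longrightarrow> i < n \<Longrightarrow>
    zz n \<otimes>\<^bsub>spin_sym n\<^esub> tt n i = tt n i \<otimes>\<^bsub>spin_sym n\<^esub> zz n"
  using spin_relation[of "[Z,T i]" "[T i, Z]" n] by (auto simp: spin_rels_def pos_word_def)

lemma tt_tt: "1 \<le> i \<Longrightarrow> i < n \<Longrightarrow> tt n i \<otimes>\<^bsub>spin_sym n\<^esub> tt n i = zz n"
  using spin_relation[of "[T i,T i]" "[Z]" n] by (auto simp: spin_rels_def pos_word_def)

lemma tt_tt_cubed: "1 \<le> i \<Longrightarrow> i + 1 < n \<Longrightarrow>
    tt n i \<otimes>\<^bsub>spin_sym n\<^esub> (tt n (i+1) \<otimes>\<^bsub>spin_sym n\<^esub> (tt n i \<otimes>\<^bsub>spin_sym n\<^esub> (tt n (i+1)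
      \<otimes>\<^bsub>spin_sym n\<^esub> (tt n i \<otimes>\<^bsub>spin_sym n\<^esub> tt n (i+1))))) = zz n"
  using spin_relation[of "[T i, T (i+1), T i, T (i+1), T i, T (i+1)]" "[Z]" n]
  by (auto simp: spin_rels_def pos_word_def)

lemma tt_far: "1 \<le> j \<Longrightarrow> j + 1 < i \<Longrightarrow> i < n \<Longrightarrow>
    tt n i \<otimes>\<^bsub>spin_sym n\<^esub> tt n j = zz n \<otimes>\<^bsub>spin_sym n\<^esub> (tt n j \<otimes>\<^bsub>spin_sym n\<^esub> tt n i)"
  using spin_relation[of "[T i, T j]" "[Z, T j, T i]" n]
  by (auto simp: spin_rels_def pos_word_def)

text \<open>Inverse letters can be traded for positive ones, because \<open>z\<close> is its own
  inverse and the inverse of \<open>t_i\<close> is \<open>z t_i\<close>. Hence left multiplication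
  by \<open>z\<close> and the \<open>t_i\<close> reaches every element.\<close>

lemma spin_induct [consumes 1, case_names one Z T]:
  assumes "x \<in> carrier (spin_sym n)"
    and "P \<one>\<^bsub>spin_sym n\<^esub>"
    and Z: "\<And>x. x \<in> carrier (spin_sym n) \<Longrightarrow> P x \<Longrightarrow> P (zz n \<otimes>\<^bsub>spin_sym n\<^esub> x)"
    and T: "\<And>i x. 1 \<le> i \<Longrightarrow> i < n \<Longrightarrow> x \<in> carrier (spin_sym n) \<Longrightarrow> P x
      \<Longrightarrow> P (tt n i \<otimes>\<^bsub>spin_sym n\<^esub> x)"
  shows "P x"
proof -
  let ?c = "pres_class (spin_gens n) (spin_rels n)"
  have "P (?c w)" if "w \<in> gwords (spin_gens n)" for w
    using that
  proof (induction w)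
    case Nil then show ?case using assms by (simp add: spin_sym_def spin.one_PG)
  next
    case (Cons p w)
    obtain x b where p: "p = (x, b)" "x \<in> spin_gens n" "w \<in> gwords (spin_gens n)"
      using Cons.prems by (cases p) (auto simp: gwords_def)
    define a where "a = ?c w"
    have a: "P a" "a \<in> carrier (spin_sym n)" using Cons p by (auto simp: a_def spin_sym_def)
    have "?c [(x, b)] \<otimes>\<^bsub>spin_sym n\<^esub> ?c [(x, \<not>b)] = \<one>\<^bsub>spin_sym n\<^esub>"
      using p pres_eq.cancel[of "[]" "spin_gens n" "[]" x "spin_rels n" b]
      by (simp add: spin_sym_def spin.mult_cls spin.one_PG spin.cls_eq_iff)
    then have b: "?c [(x, b)] = (if b then spin_elt n x else inv\<^bsub>spin_sym n\<^esub> (spin_elt n x))"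
      using p spin.inv_equality[where n=n and y="?c [(x, b)]" and x="spin_elt n x"] spin_elt_closed[OF p(2)]
      by (cases b) (simp_all add: spin_elt_def pos_word_def spin_sym_def)
    have eq: "?c (p # w) = ?c [(x, b)] \<otimes>\<^bsub>spin_sym n\<^esub> a"
      using p by (simp add: a_def spin_sym_def spin.mult_cls)
    have *: "spin_elt n x = inv\<^bsub>spin_sym n\<^esub> (spin_elt n x) \<or>
      inv\<^bsub>spin_sym n\<^esub> (spin_elt n x) = zz n \<otimes>\<^bsub>spin_sym n\<^esub> spin_elt n x"
    proof (cases x)
      case Z then show ?thesis using spin.inv_equality[OF zz_zz] by simp
    next
      case (T i)
      then have i: "1 \<le> i" "i < n" using p by (auto simp: spin_gens_def)
      have "(zz n \<otimes>\<^bsub>spin_sym n\<^esub> tt n i) \<otimes>\<^bsub>spin_sym n\<^esub> tt n i = \<one>\<^bsub>spin_sym n\<^esub>"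
        using i by (simp add: spin.m_assoc tt_tt zz_zz)
      then show ?thesis using spin.inv_equality i T by (metis spin.m_closed tt_closed zz_closed)
    qed
    have x: "spin_elt n x \<in> carrier (spin_sym n)" using p by (auto simp: spin_gens_def)
    have "P (spin_elt n x \<otimes>\<^bsub>spin_sym n\<^esub> a)"
      using assms a p by (cases x) (auto simp: spin_gens_def)
    moreover from this have "P ((zz n \<otimes>\<^bsub>spin_sym n\<^esub> spin_elt n x) \<otimes>\<^bsub>spin_sym n\<^esub> a)"
      using x a by (simp add: spin.m_assoc Z)
    ultimately show ?case using * b eq by (metis (full_types))
  qed
  then show ?thesis using assms by (auto simp: spin_sym_def spin.carrier_PG)
qed

lemma zz_commute:
  assumes "x \<in> carrier (spin_sym n)"
  shows "zz n \<otimes>\<^bsub>spin_sym n\<^esub> x = x \<otimes>\<^bsub>spin_sym n\<^esub> zz n"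
  using assms
proof (induction rule: spin_induct)
  case (Z x) then show ?case by (metis spin.m_assoc zz_closed)
next
  case (T i x) then show ?case
    by (metis spin.m_assoc tt_closed zz_closed zz_tt)
qed auto

text \<open>The hypotheses are the defining relations in the right-nested form that
  \<open>word_eval\<close> gives to a positive word. Parity, permutation, shifts and the Clifford
  representation are all obtained from this lemma.\<close>

lemma spin_lift:
  assumes H: "group H"
    and z: "\<phi> Z \<in> carrier H" "\<phi> Z \<otimes>\<^bsub>H\<^esub> \<phi> Z = \<one>\<^bsub>H\<^esub>"
    and t: "\<And>i. 1 \<le> i \<Longrightarrow> i < n \<Longrightarrow> \<phi> (T i) \<in> carrier H"
      "\<And>i. 1 \<le> i \<Longrightarrow> i < n \<Longrightarrow> \<phi> Z \<otimes>\<^bsub>H\<^esub> \<phi> (T i) = \<phi> (T i) \<otimes>\<^bsub>H\<^esub> \<phi> Z"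
      "\<And>i. 1 \<le> i \<Longrightarrow> i < n \<Longrightarrow> \<phi> (T i) \<otimes>\<^bsub>H\<^esub> \<phi> (T i) = \<phi> Z"
      "\<And>i. 1 \<le> i \<Longrightarrow> i + 1 < n \<Longrightarrow> \<phi> (T i) \<otimes>\<^bsub>H\<^esub> (\<phi> (T (i+1)) \<otimes>\<^bsub>H\<^esub> (\<phi> (T i) \<otimes>\<^bsub>H\<^esub>
         (\<phi> (T (i+1)) \<otimes>\<^bsub>H\<^esub> (\<phi> (T i) \<otimes>\<^bsub>H\<^esub> \<phi> (T (i+1)))))) = \<phi> Z"
      "\<And>i j. 1 \<le> j \<Longrightarrow> j + 1 < i \<Longrightarrow> i < n \<Longrightarrow>
         \<phi> (T i) \<otimes>\<^bsub>H\<^esub> \<phi> (T j) = \<phi> Z \<otimes>\<^bsub>H\<^esub> (\<phi> (T j) \<otimes>\<^bsub>H\<^esub> \<phi> (T i))"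
  shows "pres_lift H \<phi> \<in> hom (spin_sym n) H"
    and "pres_lift H \<phi> (zz n) = \<phi> Z"
    and "1 \<le> i \<Longrightarrow> i < n \<Longrightarrow> pres_lift H \<phi> (tt n i) = \<phi> (T i)"
proof -
  interpret H: group H by fact
  have c: "\<phi> \<in> spin_gens n \<rightarrow> carrier H" using z t by (auto simp: spin_gens_def)
  interpret presentation_map "spin_gens n" "spin_rels n" H \<phi>
  proof unfold_locales
    fix l r assume lr: "(l, r) \<in> spin_rels n"
    show "word_eval H \<phi> l = word_eval H \<phi> r"
      using lr z t unfolding spin_rels_def
      by (auto simp: H.word_eval_pos_word)
  qed (use c in auto)
  show "pres_lift H \<phi> \<in> hom (spin_sym n) H" using pres_lift_hom by (simp add: spin_sym_def)
  show "pres_lift H \<phi> (zz n) = \<phi> Z"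
    using pres_lift_gen[of Z] by (simp add: spin_elt_def pos_word_def spin_gens_def)
  show "1 \<le> i \<Longrightarrow> i < n \<Longrightarrow> pres_lift H \<phi> (tt n i) = \<phi> (T i)"
    using pres_lift_gen[of "T i"] by (simp add: spin_elt_def pos_word_def spin_gens_def)
qed

lemma
  shows spin_parity_hom: "spin_parity \<in> hom (spin_sym n) (integer_mod_group 2)"
    and spin_parity_zz [simp]: "spin_parity (zz n) = 0"
    and spin_parity_tt [simp]: "1 \<le> i \<Longrightarrow> i < n \<Longrightarrow> spin_parity (tt n i) = 1"
  unfolding spin_parity_def
  using spin_lift[of "integer_mod_group 2" "\<lambda>x. case x of Z \<Rightarrow> 0 | T i \<Rightarrow> 1" n]
  by (auto simp: carrier_integer_mod_group)

lemma spin_parity_range: "x \<in> carrier (spin_sym n) \<Longrightarrow> spin_parity x = 0 \<or> spin_parity x = 1"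
  using hom_in_carrier[OF spin_parity_hom, of x n] by (auto simp: carrier_integer_mod_group)

lemma spin_parity_mult: "x \<in> carrier (spin_sym n) \<Longrightarrow> y \<in> carrier (spin_sym n) \<Longrightarrow>
    spin_parity (x \<otimes>\<^bsub>spin_sym n\<^esub> y) = (spin_parity x + spin_parity y) mod 2"
  using hom_mult[OF spin_parity_hom, of x n y] by simp

lemma spin_parity_one [simp]: "spin_parity \<one>\<^bsub>spin_sym n\<^esub> = 0"
  using hom_one[OF spin_parity_hom, of n] by simp

lemma
  shows spin_perm_hom: "spin_perm n \<in> hom (spin_sym n) (sym_group n)"
    and spin_perm_zz [simp]: "spin_perm n (zz n) = id"
    and spin_perm_tt [simp]: "1 \<le> i \<Longrightarrow> i < n \<Longrightarrow> spin_perm n (tt n i) = transpose i (i + 1)"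
  unfolding spin_perm_def
  using spin_lift[of "sym_group n" "\<lambda>x. case x of Z \<Rightarrow> id | T i \<Rightarrow> transpose i (i + 1)" n]
  by (auto simp: sym_group_is_group sym_group_carrier sym_group_mult sym_group_one permutes_id
      permutes_swap_id fun_eq_iff transpose_def)

lemma spin_perm_permutes: "x \<in> carrier (spin_sym n) \<Longrightarrow> spin_perm n x permutes {1..n}"
  using hom_in_carrier[OF spin_perm_hom] by (auto simp: sym_group_carrier)

lemma spin_perm_mult: "x \<in> carrier (spin_sym n) \<Longrightarrow> y \<in> carrier (spin_sym n) \<Longrightarrow>
    spin_perm n (x \<otimes>\<^bsub>spin_sym n\<^esub> y) = spin_perm n x \<circ> spin_perm n y"
  using hom_mult[OF spin_perm_hom, of x n y] by (simp add: sym_group_mult)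

lemma spin_perm_one [simp]: "spin_perm n \<one>\<^bsub>spin_sym n\<^esub> = id"
  using hom_one[OF spin_perm_hom, of n] by (simp add: sym_group_one sym_group_is_group)

lemma
  assumes "k + m \<le> n"
  shows spin_shift_hom: "spin_shift k n \<in> hom (spin_sym m) (spin_sym n)"
    and spin_shift_zz [simp]: "spin_shift k n (zz m) = zz n"
    and spin_shift_tt [simp]: "1 \<le> i \<Longrightarrow> i < m \<Longrightarrow> spin_shift k n (tt m i) = tt n (k + i)"
proof -
  let ?\<phi> = "\<lambda>x. case x of Z \<Rightarrow> zz n | T j \<Rightarrow> tt n (k + j)"
  have l: "pres_lift (spin_sym n) ?\<phi> \<in> hom (spin_sym m) (spin_sym n)
    \<and> pres_lift (spin_sym n) ?\<phi> (zz m) = ?\<phi> Z \<and>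
    (1 \<le> i \<longrightarrow> i < m \<longrightarrow> pres_lift (spin_sym n) ?\<phi> (tt m i) = ?\<phi> (T i))" for i
    using spin_lift[of "spin_sym n" ?\<phi> m] assms
      zz_zz zz_tt tt_tt tt_tt_cubed[of "k + _" n] tt_far[of "k + _" "k + _" n]
    by (auto simp: spin.is_group)
  show "spin_shift k n \<in> hom (spin_sym m) (spin_sym n)"
    "spin_shift k n (zz m) = zz n"
    "1 \<le> i \<Longrightarrow> i < m \<Longrightarrow> spin_shift k n (tt m i) = tt n (k + i)"
    using l[of i] unfolding spin_shift_def by auto
qed

section \<open>A Clifford representation of the double cover\<close>

definition flip :: "nat \<Rightarrow> nat set \<Rightarrow> nat set" where
  "flip i S = (if i \<in> S then S - {i} else insert i S)"

text \<open>The Jordan-Wigner form of the Clifford generators on functions of subsets: toggle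
  \<open>i\<close>, with the sign counting the elements of \<open>S\<close> below \<open>i\<close>.
  The factor \<open>\<i>\<close> makes the square \<open>-1\<close>. Only the part of
  \<open>S\<close> below \<open>i\<close> is counted, so infinite \<open>S\<close> cause no trouble
  and one space serves all \<open>n\<close>.\<close>

definition clif :: "nat \<Rightarrow> (nat set \<Rightarrow> complex) \<Rightarrow> nat set \<Rightarrow> complex" where
  "clif i f S = \<i> * (-1) ^ card {j\<in>S. j < i} * f (flip i S)"

lemma flip_flip [simp]: "flip i (flip i S) = S"
  by (auto simp: flip_def)

lemma flip_commute: "flip i (flip j S) = flip j (flip i S)"
  by (auto simp: flip_def)

lemma card_flip_same: "card {j \<in> flip i S. j < k} = card {j\<in>S. j < k}" if "k \<le> i"
  by (rule arg_cong[where f = card]) (use that in \<open>auto simp: flip_def\<close>)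

lemma sign_card_flip:
  assumes "i < k"
  shows "(-1) ^ card {j \<in> flip i S. j < k} = - ((-1) ^ card {j\<in>S. j < k} :: complex)"
proof (cases "i \<in> S")
  case True
  then have "{j\<in>S. j < k} = insert i {j \<in> flip i S. j < k}" "i \<notin> {j \<in> flip i S. j < k}"
    using assms by (auto simp: flip_def)
  then have "card {j\<in>S. j < k} = Suc (card {j \<in> flip i S. j < k})" by simp
  then show ?thesis by simp
next
  case False
  then have "{j \<in> flip i S. j < k} = insert i {j\<in>S. j < k}" "i \<notin> {j\<in>S. j < k}"
    using assms by (auto simp: flip_def)
  then have "card {j \<in> flip i S. j < k} = Suc (card {j\<in>S. j < k})" by simp
  then show ?thesis by simp
qed

lemma clif_sq: "clif i (clif i f) = (\<lambda>S. - f S)"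
proof
  fix S show "clif i (clif i f) S = - f S"
    by (cases "even (card {j\<in>S. j < i})") (simp_all add: clif_def card_flip_same)
qed

lemma clif_anti:
  assumes "i \<noteq> j" shows "clif i (clif j f) = (\<lambda>S. - clif j (clif i f) S)"
proof -
  have "clif i (clif j f) S = - clif j (clif i f) S" if "i < j" for i j S
    using that by (simp add: clif_def card_flip_same sign_card_flip flip_commute[of i j])
  from this[of i j] this[of j i] show ?thesis using assms by (cases "i < j") (auto simp: fun_eq_iff)
qed

lemma clif_linear:
  "clif i (\<lambda>S. (f S - g S) / r) = (\<lambda>S. (clif i f S - clif i g S) / r)"
  "clif i (\<lambda>S. - f S) = (\<lambda>S. - clif i f S)"
  "clif i (\<lambda>S. c * f S) = (\<lambda>S. c * clif i f S)"
  "clif i (\<lambda>S. f S + g S) = (\<lambda>S. clif i f S + clif i g S)"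
  by (auto simp: clif_def fun_eq_iff field_simps diff_divide_distrib)

text \<open>Schur's basic spin representation. As \<open>c_i\<close> and \<open>c_(i+1)\<close>
  anticommute with square \<open>-1\<close>, their difference has square \<open>-2\<close>; the
  normalisation yields \<open>-1\<close>, the action of \<open>z\<close>.\<close>

definition clif_t :: "nat \<Rightarrow> (nat set \<Rightarrow> complex) \<Rightarrow> nat set \<Rightarrow> complex" where
  "clif_t i f = (\<lambda>S. (clif i f S - clif (Suc i) f S) / complex_of_real (sqrt 2))"

lemma sqrt2_sqrt2: "complex_of_real (sqrt 2) * complex_of_real (sqrt 2) = 2"
  by (simp flip: of_real_mult)

lemma div_sqrt2_sqrt2: "x / complex_of_real (sqrt 2) / complex_of_real (sqrt 2) = x / 2"
  by (simp add: sqrt2_sqrt2)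

lemma clif_t_linear:
  "clif_t i (\<lambda>S. - f S) = (\<lambda>S. - clif_t i f S)"
  "clif_t i (\<lambda>S. c * f S) = (\<lambda>S. c * clif_t i f S)"
  "clif_t i (\<lambda>S. f S + g S) = (\<lambda>S. clif_t i f S + clif_t i g S)"
  by (simp_all add: clif_t_def clif_linear fun_eq_iff right_diff_distrib add_divide_distrib diff_divide_distrib)

lemma clif_t_diff:
  "clif_t i (\<lambda>S. (f S - g S) / r) = (\<lambda>S. (clif_t i f S - clif_t i g S) / r)"
proof -
  have "((a - b) / r - (c - d) / r) / s = ((a - c) / s - (b - d) / s) / r" for a b c d s :: complex
    by (cases "r = 0"; cases "s = 0") (simp_all add: field_simps)
  then show ?thesis unfolding clif_t_def clif_linear by (intro ext)
qed

text \<open>Doubling removes the square roots, so that identities between products of the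
  \<open>clif_t\<close> reduce to \<open>clif_sq\<close> and \<open>clif_anti\<close>.\<close>

lemma clif_t_clif_t: "2 * clif_t i (clif_t j f) S =
    clif i (clif j f) S - clif i (clif (Suc j) f) S
      - (clif (Suc i) (clif j f) S - clif (Suc i) (clif (Suc j) f) S)"
  unfolding clif_t_def clif_linear
  by (simp add: diff_divide_distrib[symmetric] div_sqrt2_sqrt2 del: divide_divide_eq_left)

lemma clif_eqI: "(\<And>S. 2 * f S = 2 * g S) \<Longrightarrow> f = (g :: nat set \<Rightarrow> complex)"
  by auto

lemma clif_t_sq: "clif_t i (clif_t i f) = (\<lambda>S. - f S)"
  by (rule clif_eqI) (simp add: clif_t_clif_t clif_sq clif_anti[of "Suc i" i])

lemma clif_t_far: "Suc j < i \<Longrightarrow> clif_t i (clif_t j f) = (\<lambda>S. - clif_t j (clif_t i f) S)"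
  by (rule clif_eqI)
    (simp add: clif_t_clif_t clif_anti[of i] clif_anti[of "Suc i"] algebra_simps)

lemma clif_t_adjacent: "clif_t (Suc i) (clif_t i f) = (\<lambda>S. f S + - clif_t i (clif_t (Suc i) f) S)"
  by (rule clif_eqI)
    (simp add: clif_t_clif_t clif_sq clif_anti[of "Suc (Suc i)"] clif_anti[of "Suc i" i] algebra_simps)

text \<open>For \<open>q = t_i t_(i+1)\<close>, the rule \<open>clif_t_adjacent\<close> and
  \<open>t^2 = -1\<close> give \<open>q^2 = q - 1\<close>, the equation of a primitive sixth root of
  unity; hence \<open>q^3 = q^2 - q = -1\<close>.\<close>

lemma clif_t_sixfold:
  "clif_t i (clif_t (Suc i) (clif_t i (clif_t (Suc i) (clif_t i (clif_t (Suc i) f))))) = (\<lambda>S. - f S)"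
proof -
  define q where "q f = clif_t i (clif_t (Suc i) f)" for f
  have qq: "q (q f) = (\<lambda>S. q f S + - f S)" for f
    unfolding q_def clif_t_adjacent by (simp add: clif_t_linear clif_t_sq)
  have "q (q (q f)) = (\<lambda>S. q (q f) S + - q f S)" by (rule qq)
  also have "\<dots> = (\<lambda>S. - f S)" unfolding qq by simp
  finally have "q (q (q f)) = (\<lambda>S. - f S)" .
  then show ?thesis by (simp add: q_def)
qed

text \<open>Moving a unit vector past a Clifford generator applies the reflection in that vector, up
  to a sign. The reflection in the direction of \<open>c_i - c_(i+1)\<close> exchanges these two
  generators and fixes the others.\<close>

lemma clif_t_clif: "clif_t i (clif j f) = (\<lambda>S. - clif (transpose i (Suc i) j) (clif_t i f) S)"
proof -
  consider "j = i" | "j = Suc i" | "j \<noteq> i" "j \<noteq> Suc i" by blast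
  then show ?thesis
    by cases (simp_all add: fun_eq_iff clif_t_def clif_linear clif_sq clif_anti[of "Suc i" i]
        clif_anti[of j] minus_divide_left)
qed

definition bij_group :: "('x \<Rightarrow> 'x) monoid" where
  "bij_group = \<lparr>carrier = {f. bij f}, monoid.mult = (\<circ>), one = id\<rparr>"

lemma bij_group_sel [simp]:
  "carrier bij_group = {f. bij f}" "monoid.mult bij_group = (\<circ>)" "one bij_group = id"
  by (simp_all add: bij_group_def)

lemma group_bij_group: "group bij_group"
proof (rule groupI)
  fix f :: "'x \<Rightarrow> 'x" assume "f \<in> carrier bij_group"
  then show "\<exists>g\<in>carrier bij_group. g \<otimes>\<^bsub>bij_group\<^esub> f = \<one>\<^bsub>bij_group\<^esub>"
    by (intro bexI[of _ "inv_into UNIV f"]) (auto simp: bij_imp_bij_inv bij_is_inj)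
qed (auto simp: bij_comp)

definition spin_rep :: "spin \<Rightarrow> (nat set \<Rightarrow> complex) \<Rightarrow> nat set \<Rightarrow> complex" where
  "spin_rep = pres_lift bij_group (\<lambda>x. case x of Z \<Rightarrow> (\<lambda>f S. - f S) | T i \<Rightarrow> clif_t i)"

lemma
  shows spin_rep_hom: "spin_rep \<in> hom (spin_sym n) bij_group"
    and spin_rep_zz: "spin_rep (zz n) = (\<lambda>f S. - f S)"
    and spin_rep_tt: "1 \<le> i \<Longrightarrow> i < n \<Longrightarrow> spin_rep (tt n i) = clif_t i"
proof -
  let ?\<phi> = "\<lambda>x. case x of Z \<Rightarrow> (\<lambda>f S. - f S) | T i \<Rightarrow> clif_t i"
  have b: "bij (\<lambda>(f :: nat set \<Rightarrow> complex) S. - f S)" by (rule o_bij[of "\<lambda>f S. - f S"]) auto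
  have t: "bij (clif_t i)" for i
    by (rule o_bij[of "\<lambda>f S. - clif_t i f S"]) (auto simp: fun_eq_iff clif_t_sq clif_t_linear)
  note l = spin_lift[where H = bij_group and \<phi> = ?\<phi> and n = n, OF group_bij_group,
      folded spin_rep_def]
  have "spin_rep \<in> hom (spin_sym n) bij_group \<and> spin_rep (zz n) = (\<lambda>f S. - f S)
      \<and> (1 \<le> i \<longrightarrow> i < n \<longrightarrow> spin_rep (tt n i) = clif_t i)"
    using b t l
    by (simp add: bij_group_sel fun_eq_iff clif_t_linear clif_t_sq clif_t_sixfold clif_t_far)
  then show "spin_rep \<in> hom (spin_sym n) bij_group" "spin_rep (zz n) = (\<lambda>f S. - f S)"
    "1 \<le> i \<Longrightarrow> i < n \<Longrightarrow> spin_rep (tt n i) = clif_t i"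
    by auto
qed

lemma spin_rep_mult: "x \<in> carrier (spin_sym n) \<Longrightarrow> y \<in> carrier (spin_sym n) \<Longrightarrow>
    spin_rep (x \<otimes>\<^bsub>spin_sym n\<^esub> y) f = spin_rep x (spin_rep y f)"
  using hom_mult[OF spin_rep_hom, of x n y] by simp

lemma spin_rep_one [simp]: "spin_rep \<one>\<^bsub>spin_sym n\<^esub> = id"
  using hom_one[OF spin_rep_hom, of n] by (simp add: group_bij_group)

text \<open>The relations alone do not reveal whether \<open>z\<close> collapses; the
  representation, where it acts as \<open>-1\<close>, shows that it does not.\<close>

lemma zz_neq_one: "zz n \<noteq> \<one>\<^bsub>spin_sym n\<^esub>"
proof
  assume "zz n = \<one>\<^bsub>spin_sym n\<^esub>"
  then have "spin_rep (zz n) (\<lambda>S. 1) {} = 1" by simp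
  then show False by (simp add: spin_rep_zz)
qed

text \<open>Each \<open>t_i\<close> contributes a sign and a transposition by
  \<open>clif_t_clif\<close>. Thus both the parity and the permutation of \<open>x\<close> can be
  read off from how it moves past the Clifford generators.\<close>

lemma spin_rep_clif:
  assumes "x \<in> carrier (spin_sym n)"
  shows "spin_rep x (clif j f) =
    (\<lambda>S. (if spin_parity x = 0 then 1 else -1) * clif (spin_perm n x j) (spin_rep x f) S)"
  using assms
proof (induction arbitrary: j f rule: spin_induct)
  case one then show ?case by simp
next
  case (Z x)
  then show ?case
    by (simp add: spin_rep_mult spin_rep_zz spin_parity_mult spin_perm_mult clif_linear)
      (use spin_parity_range[of x n] in auto)
next
  case (T i x)
  then show ?case
    using spin_parity_range[of x n]
    by (auto simp add: spin_rep_mult spin_rep_tt spin_parity_mult spin_perm_mult clif_t_linear clif_t_clif)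
qed

section \<open>The kernel of the map to the symmetric group\<close>

text \<open>Equality modulo \<open>{1, z}\<close>. It is kept as a relation inside the cover,
  because the identification of the quotient with the symmetric group is still to be proved.\<close>

definition eqz :: "nat \<Rightarrow> spin \<Rightarrow> spin \<Rightarrow> bool" where
  "eqz n x y \<longleftrightarrow> x \<in> carrier (spin_sym n) \<and> (y = x \<or> y = zz n \<otimes>\<^bsub>spin_sym n\<^esub> x)"

lemma eqz_refl: "x \<in> carrier (spin_sym n) \<Longrightarrow> eqz n x x"
  by (simp add: eqz_def)

lemma zz_zz_mult: "x \<in> carrier (spin_sym n) \<Longrightarrow>
    zz n \<otimes>\<^bsub>spin_sym n\<^esub> (zz n \<otimes>\<^bsub>spin_sym n\<^esub> x) = x"
  by (metis spin.l_one spin.m_assoc zz_closed zz_zz)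

lemma eqz_sym: "eqz n x y \<Longrightarrow> eqz n y x"
  by (auto simp: eqz_def zz_zz_mult)

lemma eqz_trans [trans]: "eqz n x y \<Longrightarrow> eqz n y w \<Longrightarrow> eqz n x w"
  by (auto simp: eqz_def zz_zz_mult)

lemma eqz_mult:
  assumes "eqz n a b" "eqz n c d"
  shows "eqz n (a \<otimes>\<^bsub>spin_sym n\<^esub> c) (b \<otimes>\<^bsub>spin_sym n\<^esub> d)"
proof -
  have ac: "a \<in> carrier (spin_sym n)" "c \<in> carrier (spin_sym n)" using assms by (auto simp: eqz_def)
  have "a \<otimes>\<^bsub>spin_sym n\<^esub> (zz n \<otimes>\<^bsub>spin_sym n\<^esub> c) = zz n \<otimes>\<^bsub>spin_sym n\<^esub> (a \<otimes>\<^bsub>spin_sym n\<^esub> c)"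
    using ac by (metis spin.m_assoc zz_closed zz_commute)
  moreover have "(zz n \<otimes>\<^bsub>spin_sym n\<^esub> a) \<otimes>\<^bsub>spin_sym n\<^esub> e = zz n \<otimes>\<^bsub>spin_sym n\<^esub> (a \<otimes>\<^bsub>spin_sym n\<^esub> e)"
    if "e \<in> carrier (spin_sym n)" for e
    using ac that by (simp add: spin.m_assoc)
  ultimately show ?thesis using assms ac unfolding eqz_def
    by (elim conjE disjE) (simp_all add: zz_zz_mult)
qed

lemma eqz_left: "x \<in> carrier (spin_sym n) \<Longrightarrow> eqz n a b \<Longrightarrow>
    eqz n (x \<otimes>\<^bsub>spin_sym n\<^esub> a) (x \<otimes>\<^bsub>spin_sym n\<^esub> b)"
  by (intro eqz_mult eqz_refl)

lemma eqz_right: "x \<in> carrier (spin_sym n) \<Longrightarrow> eqz n a b \<Longrightarrow>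
    eqz n (a \<otimes>\<^bsub>spin_sym n\<^esub> x) (b \<otimes>\<^bsub>spin_sym n\<^esub> x)"
  by (intro eqz_mult eqz_refl)

lemma eqz_zz: "x \<in> carrier (spin_sym n) \<Longrightarrow> eqz n (zz n \<otimes>\<^bsub>spin_sym n\<^esub> x) x"
  by (rule eqz_sym) (simp add: eqz_def)

lemma eqz_tt_tt: "1 \<le> i \<Longrightarrow> i < n \<Longrightarrow> x \<in> carrier (spin_sym n) \<Longrightarrow>
    eqz n (tt n i \<otimes>\<^bsub>spin_sym n\<^esub> (tt n i \<otimes>\<^bsub>spin_sym n\<^esub> x)) x"
  by (simp add: spin.m_assoc[symmetric] tt_tt eqz_zz)

lemma eqz_far:
  assumes "1 \<le> i" "1 \<le> j" "i + 1 < j \<or> j + 1 < i" "i < n" "j < n"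
  shows "eqz n (tt n i \<otimes>\<^bsub>spin_sym n\<^esub> tt n j) (tt n j \<otimes>\<^bsub>spin_sym n\<^esub> tt n i)"
proof (cases "i + 1 < j")
  case True
  then show ?thesis using assms tt_far[of i j n] by (simp add: eqz_def)
next
  case False
  then show ?thesis using assms tt_far[of j i n] by (intro eqz_sym[of n "tt n j \<otimes>\<^bsub>spin_sym n\<^esub> tt n i"]) (simp add: eqz_def)
qed

text \<open>With \<open>a = t_i\<close> and \<open>b = t_(i+1)\<close>, both
  \<open>(aba)(bab)\<close>, by the cubic relation, and \<open>(bab)(bab)\<close>, by the squares,
  equal \<open>z\<close>. Cancelling \<open>bab\<close> gives the braid relation without any factor
  \<open>z\<close>.\<close>

lemma tt_braid:
  assumes i: "1 \<le> i" "i + 1 < n"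
  shows "tt n i \<otimes>\<^bsub>spin_sym n\<^esub> (tt n (i+1) \<otimes>\<^bsub>spin_sym n\<^esub> tt n i) =
    tt n (i+1) \<otimes>\<^bsub>spin_sym n\<^esub> (tt n i \<otimes>\<^bsub>spin_sym n\<^esub> tt n (i+1))"
proof -
  define a b where "a = tt n i" and "b = tt n (i+1)"
  note m = spin.m_assoc[where n = n]
  have c: "a \<in> carrier (spin_sym n)" "b \<in> carrier (spin_sym n)" using i by (auto simp: a_def b_def)
  have aa: "a \<otimes>\<^bsub>spin_sym n\<^esub> a = zz n" "b \<otimes>\<^bsub>spin_sym n\<^esub> b = zz n"
    using i by (auto simp: a_def b_def tt_tt)
  have aax: "a \<otimes>\<^bsub>spin_sym n\<^esub> (a \<otimes>\<^bsub>spin_sym n\<^esub> x) = zz n \<otimes>\<^bsub>spin_sym n\<^esub> x"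
    "b \<otimes>\<^bsub>spin_sym n\<^esub> (b \<otimes>\<^bsub>spin_sym n\<^esub> x) = zz n \<otimes>\<^bsub>spin_sym n\<^esub> x" if "x \<in> carrier (spin_sym n)" for x
    using that c aa by (auto simp: m[symmetric])
  define bab where "bab = b \<otimes>\<^bsub>spin_sym n\<^esub> (a \<otimes>\<^bsub>spin_sym n\<^esub> b)"
  have bab: "bab \<in> carrier (spin_sym n)" using c by (simp add: bab_def)
  have "bab \<otimes>\<^bsub>spin_sym n\<^esub> bab = b \<otimes>\<^bsub>spin_sym n\<^esub> (a \<otimes>\<^bsub>spin_sym n\<^esub> (zz n \<otimes>\<^bsub>spin_sym n\<^esub> (a \<otimes>\<^bsub>spin_sym n\<^esub> b)))"
    using c by (simp add: bab_def m aax)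
  also have "\<dots> = b \<otimes>\<^bsub>spin_sym n\<^esub> (zz n \<otimes>\<^bsub>spin_sym n\<^esub> (a \<otimes>\<^bsub>spin_sym n\<^esub> (a \<otimes>\<^bsub>spin_sym n\<^esub> b)))"
    using c by (metis m spin.m_closed zz_closed zz_commute)
  also have "\<dots> = zz n" using c by (simp add: aax zz_zz_mult aa)
  finally have 1: "bab \<otimes>\<^bsub>spin_sym n\<^esub> bab = zz n" .
  have "(a \<otimes>\<^bsub>spin_sym n\<^esub> (b \<otimes>\<^bsub>spin_sym n\<^esub> a)) \<otimes>\<^bsub>spin_sym n\<^esub> bab = zz n"
    using c tt_tt_cubed[OF i, folded a_def b_def] by (simp add: bab_def m)
  with 1 have "a \<otimes>\<^bsub>spin_sym n\<^esub> (b \<otimes>\<^bsub>spin_sym n\<^esub> a) = bab"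
    using c bab by (metis spin.m_closed spin.right_cancel)
  then show ?thesis by (simp add: bab_def a_def b_def)
qed

text \<open>\<open>cyc n l\<close> is \<open>t\<^bsub>n-l\<^esub> \<dots> t\<^bsub>n-1\<^esub>\<close>, which represents a coset of the cover for \<open>n - 1\<close>.\<close>

primrec cyc :: "nat \<Rightarrow> nat \<Rightarrow> spin" where
  "cyc n 0 = \<one>\<^bsub>spin_sym n\<^esub>"
| "cyc n (Suc l) = tt n (n - Suc l) \<otimes>\<^bsub>spin_sym n\<^esub> cyc n l"

lemma cyc_closed [simp]: "l < n \<Longrightarrow> cyc n l \<in> carrier (spin_sym n)"
  by (induction l) auto

lemma spin_perm_cyc: "l < n \<Longrightarrow> spin_perm n (cyc n l) n = n - l"
proof (induction l)
  case (Suc l)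
  then show ?case
    by (simp add: spin_perm_mult transpose_def Suc_diff_Suc)
qed simp

lemma eqz_tt_cyc_below:
  "1 \<le> i \<Longrightarrow> i + 1 < n - l \<Longrightarrow> eqz n (tt n i \<otimes>\<^bsub>spin_sym n\<^esub> cyc n l) (cyc n l \<otimes>\<^bsub>spin_sym n\<^esub> tt n i)"
proof (induction l)
  case 0 then show ?case by (auto intro!: eqz_refl)
next
  case (Suc l)
  let ?k = "n - Suc l"
  have "eqz n ((tt n i \<otimes>\<^bsub>spin_sym n\<^esub> tt n ?k) \<otimes>\<^bsub>spin_sym n\<^esub> cyc n l)
      ((tt n ?k \<otimes>\<^bsub>spin_sym n\<^esub> tt n i) \<otimes>\<^bsub>spin_sym n\<^esub> cyc n l)"
    using Suc.prems by (intro eqz_right eqz_far) auto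
  also have "(tt n ?k \<otimes>\<^bsub>spin_sym n\<^esub> tt n i) \<otimes>\<^bsub>spin_sym n\<^esub> cyc n l =
      tt n ?k \<otimes>\<^bsub>spin_sym n\<^esub> (tt n i \<otimes>\<^bsub>spin_sym n\<^esub> cyc n l)"
    using Suc.prems by (intro spin.m_assoc) auto
  also have "eqz n \<dots> (tt n ?k \<otimes>\<^bsub>spin_sym n\<^esub> (cyc n l \<otimes>\<^bsub>spin_sym n\<^esub> tt n i))"
    using Suc by (intro eqz_left) auto
  finally show ?case using Suc.prems by (simp add: spin.m_assoc)
qed

text \<open>Passing through the cycle lowers the index by one. This happens at the letters
  \<open>t_(i-1) t_i\<close>, by the braid relation; the remaining letters commute with the
  generator being moved up to \<open>z\<close>.\<close>

lemma eqz_tt_cyc_above: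
  "n - l < i \<Longrightarrow> i < n \<Longrightarrow> l < n \<Longrightarrow>
    eqz n (tt n i \<otimes>\<^bsub>spin_sym n\<^esub> cyc n l) (cyc n l \<otimes>\<^bsub>spin_sym n\<^esub> tt n (i - 1))"
proof (induction l)
  case 0 then show ?case by simp
next
  case (Suc l)
  let ?k = "n - Suc l"
  show ?case
  proof (cases "i = Suc ?k")
    case True
    then obtain r where l: "l = Suc r" using Suc.prems by (cases l) auto
    have k: "n - l = i" "?k = i - 1" "1 \<le> i - 1" "i - 1 + 1 = i" using True Suc.prems by auto
    have c: "cyc n (Suc l) = tt n (i - 1) \<otimes>\<^bsub>spin_sym n\<^esub> (tt n i \<otimes>\<^bsub>spin_sym n\<^esub> cyc n r)"
      using k l by simp
    have "tt n i \<otimes>\<^bsub>spin_sym n\<^esub> cyc n (Suc l) =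
      (tt n i \<otimes>\<^bsub>spin_sym n\<^esub> (tt n (i - 1) \<otimes>\<^bsub>spin_sym n\<^esub> tt n i)) \<otimes>\<^bsub>spin_sym n\<^esub> cyc n r"
      unfolding c using Suc.prems k l by (simp add: spin.m_assoc)
    also have "\<dots> = (tt n (i - 1) \<otimes>\<^bsub>spin_sym n\<^esub> (tt n i \<otimes>\<^bsub>spin_sym n\<^esub> tt n (i - 1))) \<otimes>\<^bsub>spin_sym n\<^esub> cyc n r"
      using tt_braid[of "i - 1" n] Suc.prems k by simp
    also have "\<dots> = (tt n (i - 1) \<otimes>\<^bsub>spin_sym n\<^esub> tt n i) \<otimes>\<^bsub>spin_sym n\<^esub> (tt n (i - 1) \<otimes>\<^bsub>spin_sym n\<^esub> cyc n r)"
      using Suc.prems k l by (simp add: spin.m_assoc)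
    also have "eqz n \<dots> ((tt n (i - 1) \<otimes>\<^bsub>spin_sym n\<^esub> tt n i) \<otimes>\<^bsub>spin_sym n\<^esub> (cyc n r \<otimes>\<^bsub>spin_sym n\<^esub> tt n (i - 1)))"
      using Suc.prems k l by (intro eqz_left eqz_tt_cyc_below spin.m_closed) auto
    finally show ?thesis unfolding c using Suc.prems k l by (simp add: spin.m_assoc)
  next
    case False
    have "eqz n ((tt n i \<otimes>\<^bsub>spin_sym n\<^esub> tt n ?k) \<otimes>\<^bsub>spin_sym n\<^esub> cyc n l)
        ((tt n ?k \<otimes>\<^bsub>spin_sym n\<^esub> tt n i) \<otimes>\<^bsub>spin_sym n\<^esub> cyc n l)"
      using Suc.prems False by (intro eqz_right eqz_far) auto
    also have "(tt n ?k \<otimes>\<^bsub>spin_sym n\<^esub> tt n i) \<otimes>\<^bsub>spin_sym n\<^esub> cyc n l =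
        tt n ?k \<otimes>\<^bsub>spin_sym n\<^esub> (tt n i \<otimes>\<^bsub>spin_sym n\<^esub> cyc n l)"
      using Suc.prems by (intro spin.m_assoc) auto
    also have "eqz n \<dots> (tt n ?k \<otimes>\<^bsub>spin_sym n\<^esub> (cyc n l \<otimes>\<^bsub>spin_sym n\<^esub> tt n (i - 1)))"
      using Suc False by (intro eqz_left Suc.IH) auto
    finally show ?thesis using Suc.prems by (simp add: spin.m_assoc)
  qed
qed

section \<open>Shifts, coset decomposition and the kernel of the map to permutations\<close>

lemma spin_shift_closed [simp]:
  "x \<in> carrier (spin_sym m) \<Longrightarrow> k + m \<le> n \<Longrightarrow> spin_shift k n x \<in> carrier (spin_sym n)"
  using hom_in_carrier[OF spin_shift_hom] by blast

lemma spin_shift_mult: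
  "k + m \<le> n \<Longrightarrow> x \<in> carrier (spin_sym m) \<Longrightarrow> y \<in> carrier (spin_sym m) \<Longrightarrow>
    spin_shift k n (x \<otimes>\<^bsub>spin_sym m\<^esub> y) = spin_shift k n x \<otimes>\<^bsub>spin_sym n\<^esub> spin_shift k n y"
  using hom_mult[OF spin_shift_hom] by blast

lemma spin_shift_one [simp]: "k + m \<le> n \<Longrightarrow> spin_shift k n \<one>\<^bsub>spin_sym m\<^esub> = \<one>\<^bsub>spin_sym n\<^esub>"
  using hom_one[OF spin_shift_hom] by blast

lemma spin_shift_parity [simp]:
  assumes "x \<in> carrier (spin_sym m)" "k + m \<le> n"
  shows "spin_parity (spin_shift k n x) = spin_parity x"
  using assms by (induction rule: spin_induct) (simp_all add: spin_shift_mult spin_parity_mult)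

lemma spin_shift_perm:
  assumes "x \<in> carrier (spin_sym m)" "k + m \<le> n"
  shows "spin_perm n (spin_shift k n x) i = (if i \<le> k then i else k + spin_perm m x (i - k))"
  using assms
proof (induction arbitrary: i rule: spin_induct)
  case one then show ?case by simp
next
  case (Z x) then show ?case by (simp add: spin_shift_mult spin_perm_mult)
next
  case (T j x)
  have "spin_perm m x (i - k) \<noteq> 0" if "i > k"
    using permutes_in_image[OF spin_perm_permutes[OF T.hyps(3)], of "i - k"]
      permutes_not_in[OF spin_perm_permutes[OF T.hyps(3)], of "i - k"] that
    by (cases "i - k \<le> m") force+
  with T show ?case by (auto simp: spin_shift_mult spin_perm_mult transpose_def)
qed

lemma spin_shift_shift:
  assumes "b + k \<le> m" "a + m \<le> n" "x \<in> carrier (spin_sym k)"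
  shows "spin_shift a n (spin_shift b m x) = spin_shift (a + b) n x"
  using assms(3,1,2)
  by (induction rule: spin_induct) (simp_all add: spin_shift_mult add.assoc)

lemma spin_shift_id: "x \<in> carrier (spin_sym n) \<Longrightarrow> spin_shift 0 n x = x"
  by (induction rule: spin_induct) (simp_all add: spin_shift_mult)

text \<open>Up to \<open>z\<close>, left multiplication by a generator permutes the
  \<open>n + 1\<close> cosets represented by the cycles: a letter \<open>t_i\<close> passes through
  the cycle, lengthens it or shortens it. This is the bound from above on the size of the
  cover.\<close>

lemma spin_coset_decomposition:
  assumes "x \<in> carrier (spin_sym (Suc n))"
  shows "\<exists>l\<le>n. \<exists>y\<in>carrier (spin_sym n).
    eqz (Suc n) x (cyc (Suc n) l \<otimes>\<^bsub>spin_sym (Suc n)\<^esub> spin_shift 0 (Suc n) y)"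
  using assms
proof (induction rule: spin_induct)
  case one
  then show ?case by (intro exI[of _ 0] conjI bexI[of _ "\<one>\<^bsub>spin_sym n\<^esub>"]) (auto intro: eqz_refl)
next
  case (Z x)
  then show ?case by (meson eqz_trans eqz_zz)
next
  case (T i x)
  let ?N = "Suc n" and ?m = "monoid.mult (spin_sym (Suc n))"
  obtain l y where ly: "l \<le> n" "y \<in> carrier (spin_sym n)"
    "eqz ?N x (?m (cyc ?N l) (spin_shift 0 ?N y))"
    using T by blast
  have sy: "spin_shift 0 ?N y \<in> carrier (spin_sym ?N)" using ly by simp
  have "eqz ?N (?m (tt ?N i) x) (?m (tt ?N i) (?m (cyc ?N l) (spin_shift 0 ?N y)))"
    using T ly by (intro eqz_left) auto
  also have "?m (tt ?N i) (?m (cyc ?N l) (spin_shift 0 ?N y)) = ?m (?m (tt ?N i) (cyc ?N l)) (spin_shift 0 ?N y)"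
    using T ly sy by (simp add: spin.m_assoc)
  finally have 1: "eqz ?N (?m (tt ?N i) x) (?m (?m (tt ?N i) (cyc ?N l)) (spin_shift 0 ?N y))" .
  have *: ?case if "eqz ?N (?m (tt ?N i) (cyc ?N l)) (?m (cyc ?N l) (tt ?N j))" "1 \<le> j" "j < n" for j
  proof -
    have "eqz ?N (?m (?m (tt ?N i) (cyc ?N l)) (spin_shift 0 ?N y)) (?m (?m (cyc ?N l) (tt ?N j)) (spin_shift 0 ?N y))"
      using that sy by (intro eqz_right) auto
    also have "?m (?m (cyc ?N l) (tt ?N j)) (spin_shift 0 ?N y) =
        ?m (cyc ?N l) (spin_shift 0 ?N (tt n j \<otimes>\<^bsub>spin_sym n\<^esub> y))"
      using that sy ly by (simp add: spin_shift_mult spin.m_assoc)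
    finally show ?case using 1 ly that
      by (intro exI[of _ l] conjI bexI[of _ "tt n j \<otimes>\<^bsub>spin_sym n\<^esub> y"]) (auto intro: eqz_trans)
  qed
  \<comment> \<open>The cycle starts with \<open>t_(N-l)\<close>. The cases are: \<open>t_i\<close>
    is far below this letter and commutes, precedes it and lengthens the cycle, equals it and
    cancels it, or lies above it and passes with its index lowered.\<close>
  consider "i + 1 < ?N - l" | "i + 1 = ?N - l" | "i = ?N - l" | "?N - l < i" by linarith
  then show ?case
  proof cases
    case 1
    then show ?thesis using * T eqz_tt_cyc_below[of i ?N l] by (simp add: less_diff_conv)
  next
    case 2
    then have "i = ?N - Suc l" "Suc l \<le> n" using T by auto
    then have "?m (tt ?N i) (cyc ?N l) = cyc ?N (Suc l)" "Suc l \<le> n" by (simp_all only: cyc.simps)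
    then show ?thesis using 1 ly by metis
  next
    case 3
    then obtain r where r: "l = Suc r" using T by (cases l) auto
    have "eqz ?N (?m (tt ?N i) (cyc ?N l)) (cyc ?N r)"
      using T 3 r ly eqz_tt_tt[of i ?N "cyc ?N r"] by simp
    then have "eqz ?N (?m (?m (tt ?N i) (cyc ?N l)) (spin_shift 0 ?N y)) (?m (cyc ?N r) (spin_shift 0 ?N y))"
      using sy by (intro eqz_right) auto
    then show ?thesis using 1 ly r by (meson Suc_leD eqz_trans)
  next
    case 4
    then show ?thesis using * T eqz_tt_cyc_above[of ?N l i] ly by auto
  qed
qed

lemma eqz_perm: "eqz n x y \<Longrightarrow> spin_perm n y = spin_perm n x"
  by (auto simp: eqz_def spin_perm_mult)

text \<open>A trivial permutation fixes the last point, so the cycle in the coset decomposition is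
  empty and, up to \<open>z\<close>, the element comes from the cover one size smaller.\<close>

lemma spin_perm_kernel:
  "x \<in> carrier (spin_sym n) \<Longrightarrow> spin_perm n x = id \<Longrightarrow> x = \<one>\<^bsub>spin_sym n\<^esub> \<or> x = zz n"
proof (induction n arbitrary: x)
  case 0
  then show ?case by (induction rule: spin_induct) (auto simp: zz_zz spin_perm_mult)
next
  case (Suc n)
  let ?N = "Suc n" and ?m = "monoid.mult (spin_sym (Suc n))"
  obtain l y where ly: "l \<le> n" "y \<in> carrier (spin_sym n)"
    "eqz ?N x (?m (cyc ?N l) (spin_shift 0 ?N y))"
    using spin_coset_decomposition[OF Suc.prems(1)] by blast
  have sy: "spin_shift 0 ?N y \<in> carrier (spin_sym ?N)" using ly by simp
  have p: "spin_perm ?N (?m (cyc ?N l) (spin_shift 0 ?N y)) = id"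
    using HOL.trans[OF eqz_perm[OF ly(3)] Suc.prems(2)] .
  have fixN: "spin_perm ?N (spin_shift 0 ?N y) ?N = ?N"
    using ly permutes_not_in[OF spin_perm_permutes[OF ly(2)], of ?N] by (simp add: spin_shift_perm)
  have "spin_perm ?N (cyc ?N l) (spin_perm ?N (spin_shift 0 ?N y) ?N) = ?N"
    using fun_cong[OF p, of ?N] ly sy by (simp add: spin_perm_mult)
  then have l0: "l = 0" using fixN ly by (simp add: spin_perm_cyc)
  then have p': "spin_perm ?N (spin_shift 0 ?N y) = id" using p sy by simp
  have "spin_perm n y i = i" for i
    using fun_cong[OF p', of i] ly permutes_not_in[OF spin_perm_permutes[OF ly(2)], of 0]
    by (cases "i = 0") (auto simp: spin_shift_perm)
  then have "y = \<one>\<^bsub>spin_sym n\<^esub> \<or> y = zz n" using Suc.IH ly by (auto simp: fun_eq_iff)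
  then have "spin_shift 0 ?N y = \<one>\<^bsub>spin_sym ?N\<^esub> \<or> spin_shift 0 ?N y = zz ?N" by auto
  moreover have "eqz ?N (spin_shift 0 ?N y) x" using eqz_sym[OF ly(3)] l0 sy by simp
  then have "x = spin_shift 0 ?N y \<or> x = ?m (zz ?N) (spin_shift 0 ?N y)" by (simp add: eqz_def)
  ultimately show ?case by (metis spin.r_one zz_closed zz_zz)
qed

lemma spin_perm_eq:
  assumes "x \<in> carrier (spin_sym n)" "y \<in> carrier (spin_sym n)" "spin_perm n x = spin_perm n y"
  shows "eqz n x y"
proof -
  let ?i = "inv\<^bsub>spin_sym n\<^esub> x"
  have "spin_perm n ?i \<circ> spin_perm n x = id" 
    using assms spin_perm_mult[of ?i n x] by simp
  then have "spin_perm n (?i \<otimes>\<^bsub>spin_sym n\<^esub> y) = id" using assms by (simp add: spin_perm_mult)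
  then have "?i \<otimes>\<^bsub>spin_sym n\<^esub> y = \<one>\<^bsub>spin_sym n\<^esub> \<or> ?i \<otimes>\<^bsub>spin_sym n\<^esub> y = zz n"
    using assms by (intro spin_perm_kernel) auto
  then have "y = x \<or> y = x \<otimes>\<^bsub>spin_sym n\<^esub> zz n"
    using assms by (metis spin.inv_solve_left spin.one_closed spin.r_one zz_closed)
  then show ?thesis using assms by (auto simp: eqz_def zz_commute)
qed

text \<open>After composing with the inverse of a cycle that carries the last point to its image,
  only a permutation of the remaining points is left to be lifted.\<close>

lemma spin_perm_surj: "p permutes {1..n} \<Longrightarrow> \<exists>x\<in>carrier (spin_sym n). spin_perm n x = p"
proof (induction n arbitrary: p)
  case 0 then show ?case by (intro bexI[of _ "\<one>\<^bsub>spin_sym 0\<^esub>"]) auto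
next
  case (Suc n)
  let ?N = "Suc n"
  have k: "p ?N \<in> {1..?N}" using permutes_in_image[OF Suc.prems, of ?N] by simp
  define c where "c = cyc ?N (?N - p ?N)"
  have c: "c \<in> carrier (spin_sym ?N)" using k by (simp add: c_def)
  have pc: "spin_perm ?N c permutes {1..?N}" using spin_perm_permutes[OF c] .
  define q where "q = inv' (spin_perm ?N c) \<circ> p"
  have "spin_perm ?N c ?N = p ?N" using k by (simp add: c_def spin_perm_cyc)
  then have "q ?N = ?N" unfolding q_def using permutes_inv_eq[OF pc] by simp
  moreover have "q permutes {1..?N}" unfolding q_def
    using permutes_compose[OF Suc.prems permutes_inv[OF pc]] .
  ultimately have "q permutes {1..n}"
    by (intro permutes_superset[of q "{1..?N}" "{1..n}"]) (auto simp: le_Suc_eq)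
  then obtain y where y: "y \<in> carrier (spin_sym n)" "spin_perm n y = q" using Suc.IH by blast
  have "q 0 = 0" using permutes_not_in[OF \<open>q permutes {1..n}\<close>, of 0] by simp
  then have "spin_perm ?N (spin_shift 0 ?N y) = q"
    using y by (auto simp: fun_eq_iff spin_shift_perm)
  moreover have "spin_perm ?N c \<circ> q = p" unfolding q_def
    using permutes_inv_o(1)[OF pc] by (simp add: o_assoc)
  ultimately show ?case using c y
    by (intro bexI[of _ "c \<otimes>\<^bsub>spin_sym ?N\<^esub> spin_shift 0 ?N y"]) (auto simp: spin_perm_mult)
qed

text \<open>Each fibre of \<open>spin_perm n\<close> has at most two elements, \<open>x\<close> and
  \<open>z x\<close>, and its values lie in the finite set of permutations of
  \<open>{1..n}\<close>.\<close>

lemma finite_spin_sym: "finite (carrier (spin_sym n))"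
proof -
  have "finite {p. p permutes {1..n}}" by (rule finite_permutations) simp
  moreover have "finite {x \<in> carrier (spin_sym n). spin_perm n x = p}" for p
  proof (cases "\<exists>x\<in>carrier (spin_sym n). spin_perm n x = p")
    case True
    then obtain x where "x \<in> carrier (spin_sym n)" "spin_perm n x = p" by blast
    then have "y \<in> {x, zz n \<otimes>\<^bsub>spin_sym n\<^esub> x}"
      if "y \<in> carrier (spin_sym n)" "spin_perm n y = p" for y
      using spin_perm_eq[of x n y] that by (simp add: eqz_def)
    then have "{x \<in> carrier (spin_sym n). spin_perm n x = p} \<subseteq> {x, zz n \<otimes>\<^bsub>spin_sym n\<^esub> x}" by blast
    then show ?thesis by (rule finite_subset) simp
  next
    case False
    then have e: "{x \<in> carrier (spin_sym n). spin_perm n x = p} = {}" by blast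
    show ?thesis unfolding e by (rule finite.emptyI)
  qed
  ultimately have "finite (\<Union>p\<in>{p. p permutes {1..n}}. {x \<in> carrier (spin_sym n). spin_perm n x = p})"
    by (intro finite_UN_I) auto
  moreover have "(\<Union>p\<in>{p. p permutes {1..n}}. {x \<in> carrier (spin_sym n). spin_perm n x = p}) = carrier (spin_sym n)"
    using spin_perm_permutes by blast
  ultimately show ?thesis by simp
qed

text \<open>An element that acts trivially moves no Clifford generator, so its permutation is
  trivial and it is \<open>1\<close> or \<open>z\<close>; and \<open>z\<close> acts as
  \<open>-1\<close>. Identities in the cover may therefore be checked in the representation.\<close>

lemma spin_rep_inj:
  assumes x: "x \<in> carrier (spin_sym n)" and y: "y \<in> carrier (spin_sym n)"
    and e: "spin_rep x = spin_rep y"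
  shows "x = y"
proof -
  define w where "w = inv\<^bsub>spin_sym n\<^esub> x \<otimes>\<^bsub>spin_sym n\<^esub> y"
  have w: "w \<in> carrier (spin_sym n)" using x y by (simp add: w_def)
  have r: "spin_rep w f = f" for f
    using x y e spin_rep_mult[of "inv\<^bsub>spin_sym n\<^esub> x" n x f] by (simp add: w_def spin_rep_mult)
  have "spin_perm n w j = j" for j
  proof (rule ccontr)
    assume j: "spin_perm n w j \<noteq> j"
    \<comment> \<open>For the indicator function of the empty set, \<open>clif j f\<close> is
      supported at the singleton \<open>{j}\<close>. It therefore tells \<open>j\<close> from every
      other index.\<close>
    define f :: "nat set \<Rightarrow> complex" where "f S = (if S = {} then 1 else 0)" for S
    have "clif j f {j} = (if spin_parity w = 0 then 1 else -1) * clif (spin_perm n w j) f {j}"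
      using fun_cong[OF spin_rep_clif[OF w, of j f], of "{j}"] by (simp add: r)
    then show False using j by (auto simp: clif_def f_def flip_def split: if_splits)
  qed
  then have "w = \<one>\<^bsub>spin_sym n\<^esub> \<or> w = zz n" using spin_perm_kernel[OF w] by (simp add: fun_eq_iff)
  moreover have "w \<noteq> zz n" using fun_cong[OF r[of "\<lambda>S. 1"], of "{}"] by (auto simp: spin_rep_zz)
  ultimately show ?thesis using x y unfolding w_def
    by (metis spin.inv_solve_left spin.one_closed spin.r_one)
qed

section \<open>Signs of conjugation in the double cover\<close>

definition zpow :: "nat \<Rightarrow> int \<Rightarrow> spin" where
  "zpow n e = (if even e then \<one>\<^bsub>spin_sym n\<^esub> else zz n)"

lemma zpow_closed [simp]: "zpow n e \<in> carrier (spin_sym n)"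
  by (simp add: zpow_def)

lemma zpow_add: "zpow n (a + b) = zpow n a \<otimes>\<^bsub>spin_sym n\<^esub> zpow n b"
  by (simp add: zpow_def zz_zz)

lemma zpow_commute: "x \<in> carrier (spin_sym n) \<Longrightarrow>
    x \<otimes>\<^bsub>spin_sym n\<^esub> zpow n e = zpow n e \<otimes>\<^bsub>spin_sym n\<^esub> x"
  by (simp add: zpow_def zz_commute)

lemma zpow_lcomm: "x \<in> carrier (spin_sym n) \<Longrightarrow> y \<in> carrier (spin_sym n) \<Longrightarrow>
    x \<otimes>\<^bsub>spin_sym n\<^esub> (zpow n e \<otimes>\<^bsub>spin_sym n\<^esub> y) = zpow n e \<otimes>\<^bsub>spin_sym n\<^esub> (x \<otimes>\<^bsub>spin_sym n\<^esub> y)"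
  by (metis spin.m_assoc zpow_closed zpow_commute)

lemma zpow_cong: "even (a - b) \<Longrightarrow> zpow n a = zpow n b"
  by (auto simp: zpow_def)

text \<open>In the faithful representation \<open>t_i\<close> is a normalised difference of two
  Clifford generators. Moving \<open>x\<close> past it carries these to the generators
  \<open>k\<close> and \<open>k + 1\<close>, both with the same sign given by the parity of
  \<open>x\<close>.\<close>

lemma spin_conj_tt:
  assumes x: "x \<in> carrier (spin_sym n)" and i: "1 \<le> i" "i < n" "1 \<le> k" "k < n"
    and p: "spin_perm n x i = k" "spin_perm n x (Suc i) = Suc k"
  shows "x \<otimes>\<^bsub>spin_sym n\<^esub> tt n i = zpow n (spin_parity x) \<otimes>\<^bsub>spin_sym n\<^esub> (tt n k \<otimes>\<^bsub>spin_sym n\<^esub> x)"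
proof (rule spin_rep_inj)
  \<comment> \<open>The one instance of linearity that is needed, for the combination in
    \<open>clif_t\<close>, proved over the generators of the cover.\<close>
  have *: "spin_rep x (\<lambda>S. (f S - g S) / complex_of_real (sqrt 2)) =
      (\<lambda>S. (spin_rep x f S - spin_rep x g S) / complex_of_real (sqrt 2))" for f g
    using x
  proof (induction arbitrary: f g rule: spin_induct)
    case (Z x) then show ?case by (simp add: spin_rep_mult spin_rep_zz minus_divide_left)
  next
    case (T i x) then show ?case by (simp add: spin_rep_mult spin_rep_tt clif_t_diff)
  qed simp
  have "spin_rep x (clif_t i f) = spin_rep (zpow n (spin_parity x)) (clif_t k (spin_rep x f))" for f
    unfolding clif_t_def * using x i p spin_parity_range[OF x]
    by (auto simp: spin_rep_clif zpow_def spin_rep_zz fun_eq_iff field_simps)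
  then show "spin_rep (x \<otimes>\<^bsub>spin_sym n\<^esub> tt n i) =
      spin_rep (zpow n (spin_parity x) \<otimes>\<^bsub>spin_sym n\<^esub> (tt n k \<otimes>\<^bsub>spin_sym n\<^esub> x))"
    using x i by (auto simp: fun_eq_iff spin_rep_mult spin_rep_tt)
qed (use assms in auto)

text \<open>The source of all later signs. If \<open>x\<close> carries one block to another in
  order, each letter of \<open>s\<close> that it passes contributes \<open>z\<close> to the parity
  of \<open>x\<close>, hence the product of the parities in total.\<close>

lemma spin_conj_shift:
  assumes "x \<in> carrier (spin_sym n)" "s \<in> carrier (spin_sym m)" "a + m \<le> n" "b + m \<le> n"
    and p: "\<And>i. 1 \<le> i \<Longrightarrow> i \<le> m \<Longrightarrow> spin_perm n x (a + i) = b + i"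
  shows "x \<otimes>\<^bsub>spin_sym n\<^esub> spin_shift a n s =
    zpow n (spin_parity x * spin_parity s) \<otimes>\<^bsub>spin_sym n\<^esub> (spin_shift b n s \<otimes>\<^bsub>spin_sym n\<^esub> x)"
  using assms(2,1,3-)
proof (induction rule: spin_induct)
  case one then show ?case by (simp add: zpow_def)
next
  case (Z s)
  let ?m = "monoid.mult (spin_sym n)"
  have z: "zpow n (spin_parity x * spin_parity (zz m \<otimes>\<^bsub>spin_sym m\<^esub> s)) = zpow n (spin_parity x * spin_parity s)"
    using Z spin_parity_range[of s m] by (auto simp: spin_parity_mult)
  let ?s = "spin_shift a n s" and ?s' = "spin_shift b n s" and ?e = "spin_parity x * spin_parity s"
  have cl: "?s \<in> carrier (spin_sym n)" "?s' \<in> carrier (spin_sym n)" using Z by simp_all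
  have zl: "?m y (?m (zz n) w) = ?m (zz n) (?m y w)"
    if "y \<in> carrier (spin_sym n)" "w \<in> carrier (spin_sym n)" for y w
    using zpow_lcomm[OF that, of 1] by (simp add: zpow_def)
  have "?m x (?m (zz n) ?s) = ?m (zz n) (?m (zpow n ?e) (?m ?s' x))"
    using zl[OF Z.prems(1) cl(1)] Z.IH[OF Z.prems] by simp
  also have "\<dots> = ?m (zpow n ?e) (?m (?m (zz n) ?s') x)"
    using zl[of "zpow n ?e" "?m ?s' x"] cl Z.prems(1) by (simp add: spin.m_assoc)
  finally show ?case unfolding z using Z by (simp add: spin_shift_mult)
next
  case (T i s)
  let ?m = "monoid.mult (spin_sym n)"
  let ?s = "spin_shift a n s" and ?s' = "spin_shift b n s" and ?p = "spin_parity x"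
  have cl: "?s \<in> carrier (spin_sym n)" "?s' \<in> carrier (spin_sym n)" using T by simp_all
  have "?m x (?m (tt n (a + i)) ?s) = ?m (?m x (tt n (a + i))) ?s"
    using T cl by (simp add: spin.m_assoc)
  also have "?m x (tt n (a + i)) = ?m (zpow n ?p) (?m (tt n (b + i)) x)"
    using T.prems T.hyps T.prems(4)[of "Suc i"] by (intro spin_conj_tt) auto
  also have "?m (?m (zpow n ?p) (?m (tt n (b + i)) x)) ?s = ?m (zpow n ?p) (?m (tt n (b + i)) (?m x ?s))"
    using T cl by (simp add: spin.m_assoc)
  also have "?m x ?s = ?m (zpow n (?p * spin_parity s)) (?m ?s' x)" using T by blast
  also have "?m (tt n (b + i)) (?m (zpow n (?p * spin_parity s)) (?m ?s' x)) =
      ?m (zpow n (?p * spin_parity s)) (?m (tt n (b + i)) (?m ?s' x))"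
    using T cl by (intro zpow_lcomm) auto
  also have "?m (zpow n ?p) (?m (zpow n (?p * spin_parity s)) (?m (tt n (b + i)) (?m ?s' x))) =
      ?m (zpow n (?p + ?p * spin_parity s)) (?m (?m (tt n (b + i)) ?s') x)"
    using T cl by (simp add: spin.m_assoc zpow_add)
  \<comment> \<open>Parities add modulo 2, whereas the exponents add as integers; the two agree
    modulo 2, and this is all that \<open>zpow\<close> sees.\<close>
  also have "zpow n (?p + ?p * spin_parity s) = zpow n (?p * spin_parity (tt m i \<otimes>\<^bsub>spin_sym m\<^esub> s))"
    using T spin_parity_range[of s m] by (intro zpow_cong) (auto simp: spin_parity_mult)
  finally show ?case using T by (simp add: spin_shift_mult)
qed

section \<open>The double cover of the wreath product\<close>

lemma zpow_zpow: "x \<in> carrier (spin_sym n) \<Longrightarrow>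
    zpow n a \<otimes>\<^bsub>spin_sym n\<^esub> (zpow n b \<otimes>\<^bsub>spin_sym n\<^esub> x) = zpow n (a + b) \<otimes>\<^bsub>spin_sym n\<^esub> x"
  by (simp add: zpow_add spin.m_assoc)

lemma spin_perm_inv: "x \<in> carrier (spin_sym n) \<Longrightarrow>
    spin_perm n (inv\<^bsub>spin_sym n\<^esub> x) = inv' (spin_perm n x)"
  using spin_perm_mult[of "inv\<^bsub>spin_sym n\<^esub> x" n x] spin_perm_permutes[of x n]
  by (intro inv_unique_comp[symmetric]) (simp_all add: spin_perm_mult[symmetric])

lemma spin_perm_range: "x \<in> carrier (spin_sym n) \<Longrightarrow>
    spin_perm n x i \<in> {1..n} \<longleftrightarrow> i \<in> {1..n}"
  using permutes_in_image[OF spin_perm_permutes] by blast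

lemma spin_perm_inv_range: "x \<in> carrier (spin_sym n) \<Longrightarrow>
    inv' (spin_perm n x) i \<in> {1..n} \<longleftrightarrow> i \<in> {1..n}"
  using permutes_in_image[OF permutes_inv[OF spin_perm_permutes]] by blast

definition wpow :: "('a, 'b) monoid_scheme \<Rightarrow> nat \<Rightarrow> int \<Rightarrow> 'a wr" where
  "wpow \<Gamma> n e = (if even e then \<one>\<^bsub>spin_wreath \<Gamma> n\<^esub> else wreath_z \<Gamma> n)"

definition wperm :: "nat \<Rightarrow> 'a wr \<Rightarrow> nat \<Rightarrow> nat" where
  "wperm n x = spin_perm n (snd x)"

text \<open>This is \<open>hat_embed\<close> on representatives. Working with pairs instead of
  classes keeps the two preimages \<open>(x, y)\<close> and \<open>(z x, z y)\<close>
  visible.\<close>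

definition jx :: "nat \<Rightarrow> nat \<Rightarrow> 'a wr \<Rightarrow> 'a wr \<Rightarrow> 'a wr" where
  "jx n m x y = (\<lambda>i\<in>{1..n+m}. if i \<le> n then fst x i else fst y (i - n),
     spin_shift 0 (n+m) (snd x) \<otimes>\<^bsub>spin_sym (n+m)\<^esub> spin_shift n (n+m) (snd y))"

locale finite_base = group \<Gamma> for \<Gamma> :: "('a, 'b) monoid_scheme" (structure) +
  assumes finite_base: "finite (carrier \<Gamma>)"
begin

abbreviation G where "G n \<equiv> spin_wreath \<Gamma> n"
abbreviation wz where "wz n \<equiv> wreath_z \<Gamma> n"
abbreviation wp where "wp n e \<equiv> wpow \<Gamma> n e"
abbreviation gm where "gm n \<equiv> monoid.mult (spin_wreath \<Gamma> n)"
abbreviation par :: "'a wr \<Rightarrow> int" where "par \<equiv> wreath_parity"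

lemma carrier_G: "carrier (G n) = ({1..n} \<rightarrow>\<^sub>E carrier \<Gamma>) \<times> carrier (spin_sym n)"
  by (simp add: spin_wreath_def)

lemma mult_G: "gm n (g, t) (h, s) =
    (\<lambda>i\<in>{1..n}. g i \<otimes> h (inv' (spin_perm n t) i), t \<otimes>\<^bsub>spin_sym n\<^esub> s)"
  by (auto simp: spin_wreath_def place_action_def fun_eq_iff)

lemma one_G: "\<one>\<^bsub>G n\<^esub> = (\<lambda>i\<in>{1..n}. \<one>, \<one>\<^bsub>spin_sym n\<^esub>)"
  by (simp add: spin_wreath_def)

lemma finite_G: "finite (carrier (G n))"
  unfolding carrier_G by (intro finite_cartesian_product finite_PiE finite_spin_sym) (auto simp: finite_base)

lemma group_G: "group (G n)"
proof (rule groupI)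
  fix x y assume "x \<in> carrier (G n)" "y \<in> carrier (G n)"
  then obtain g t h s where x: "x = (g, t)" "y = (h, s)" "t \<in> carrier (spin_sym n)"
    "s \<in> carrier (spin_sym n)" "g \<in> {1..n} \<rightarrow>\<^sub>E carrier \<Gamma>" "h \<in> {1..n} \<rightarrow>\<^sub>E carrier \<Gamma>"
    by (auto simp: carrier_G)
  have "h (inv' (spin_perm n t) i) \<in> carrier \<Gamma>" if "i \<in> {1..n}" for i
    using spin_perm_inv_range[OF x(3), of i] x(6) that by (auto simp: PiE_iff)
  then show "gm n x y \<in> carrier (G n)" using x
    unfolding carrier_G x mult_G by (auto simp: PiE_iff)
next
  show "\<one>\<^bsub>G n\<^esub> \<in> carrier (G n)" by (simp add: carrier_G one_G)
next
  fix x y w assume "x \<in> carrier (G n)" "y \<in> carrier (G n)" "w \<in> carrier (G n)"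
  then obtain g t h s k r where x: "x = (g, t)" "y = (h, s)" "w = (k, r)" "t \<in> carrier (spin_sym n)"
    "s \<in> carrier (spin_sym n)" "r \<in> carrier (spin_sym n)" "g \<in> {1..n} \<rightarrow>\<^sub>E carrier \<Gamma>"
    "h \<in> {1..n} \<rightarrow>\<^sub>E carrier \<Gamma>" "k \<in> {1..n} \<rightarrow>\<^sub>E carrier \<Gamma>"
    by (auto simp: carrier_G)
  note ir = spin_perm_inv_range[OF x(4)] spin_perm_inv_range[OF x(5)]
  have i: "inv' (spin_perm n (t \<otimes>\<^bsub>spin_sym n\<^esub> s)) i = inv' (spin_perm n s) (inv' (spin_perm n t) i)" for i
    using x o_inv_distrib[OF permutes_bij[OF spin_perm_permutes[OF x(4)]] permutes_bij[OF spin_perm_permutes[OF x(5)]]]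
    by (simp add: spin_perm_mult)
  have "g i \<otimes> h (inv' (spin_perm n t) i) \<otimes> k (inv' (spin_perm n s) (inv' (spin_perm n t) i)) =
      g i \<otimes> (h (inv' (spin_perm n t) i) \<otimes> k (inv' (spin_perm n s) (inv' (spin_perm n t) i)))"
    if "i \<in> {1..n}" for i
    using x(7-9) that ir by (intro m_assoc) (auto simp: PiE_iff)
  then show "gm n (gm n x y) w = gm n x (gm n y w)"
    using ir x(4-6) unfolding x mult_G i by (auto simp: spin.m_assoc intro!: restrict_ext)
next
  fix x assume "x \<in> carrier (G n)"
  then obtain g t where x: "x = (g, t)" "t \<in> carrier (spin_sym n)" "g \<in> {1..n} \<rightarrow>\<^sub>E carrier \<Gamma>"
    by (auto simp: carrier_G)
  show "gm n \<one>\<^bsub>G n\<^esub> x = x"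
    unfolding x one_G mult_G using x by (auto simp: fun_eq_iff PiE_iff extensional_def)
  have c: "g (spin_perm n t i) \<in> carrier \<Gamma>" if "i \<in> {1..n}" for i
    using spin_perm_range[OF x(2), of i] x(3) that by (auto simp: PiE_iff)
  have i: "inv' (spin_perm n (inv\<^bsub>spin_sym n\<^esub> t)) = spin_perm n t"
    using x spin_perm_permutes[OF x(2)] by (simp add: spin_perm_inv inv_inv_eq permutes_bij)
  show "\<exists>y\<in>carrier (G n). gm n y x = \<one>\<^bsub>G n\<^esub>"
    using x c
    by (intro bexI[of _ "(\<lambda>i\<in>{1..n}. inv (g (spin_perm n t i)), inv\<^bsub>spin_sym n\<^esub> t)"])
      (auto simp: carrier_G mult_G one_G i intro!: restrict_ext)
qed

sublocale W: group "spin_wreath \<Gamma> n" for n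
  by (rule group_G)

lemma wz_closed [simp]: "wz n \<in> carrier (G n)"
  by (simp add: wreath_z_def carrier_G)

lemma wp_closed [simp]: "wp n e \<in> carrier (G n)"
  by (simp add: wpow_def)

lemma wp_eq: "wp n e = (\<lambda>i\<in>{1..n}. \<one>, zpow n e)"
  by (simp add: wpow_def wreath_z_def one_G zpow_def)

lemma spin_perm_zpow [simp]: "spin_perm n (zpow n e) = id"
  by (simp add: zpow_def)

lemma wp_mult_pair:
  assumes "(g, t) \<in> carrier (G n)"
  shows "gm n (wp n e) (g, t) = (g, zpow n e \<otimes>\<^bsub>spin_sym n\<^esub> t)"
    "gm n (g, t) (wp n e) = (g, zpow n e \<otimes>\<^bsub>spin_sym n\<^esub> t)"
proof -
  have t: "t \<in> carrier (spin_sym n)" and g: "g \<in> {1..n} \<rightarrow>\<^sub>E carrier \<Gamma>"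
    using assms by (auto simp: carrier_G)
  have "(\<lambda>i\<in>{1..n}. (\<lambda>i\<in>{1..n}. \<one>) i \<otimes> g (inv' (spin_perm n (zpow n e)) i)) = g"
    using g by (auto simp: fun_eq_iff PiE_iff extensional_def)
  then show "gm n (wp n e) (g, t) = (g, zpow n e \<otimes>\<^bsub>spin_sym n\<^esub> t)"
    unfolding wp_eq mult_G by simp
  have "(\<lambda>i\<in>{1..n}. g i \<otimes> (\<lambda>i\<in>{1..n}. \<one>) (inv' (spin_perm n t) i)) = g"
    using g spin_perm_inv_range[OF t] by (auto simp: fun_eq_iff PiE_iff extensional_def)
  then show "gm n (g, t) (wp n e) = (g, zpow n e \<otimes>\<^bsub>spin_sym n\<^esub> t)"
    unfolding wp_eq mult_G using zpow_commute[OF t] by simp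
qed

lemma wp_commute: "x \<in> carrier (G n) \<Longrightarrow> gm n x (wp n e) = gm n (wp n e) x"
  by (cases x) (simp add: wp_mult_pair)

lemma wp_add: "wp n (a + b) = gm n (wp n a) (wp n b)"
proof -
  have "(\<lambda>i\<in>{1..n}. \<one>, zpow n b) \<in> carrier (G n)" by (simp add: carrier_G)
  from wp_mult_pair(1)[OF this] show ?thesis unfolding wp_eq[of n b] by (simp only: wp_eq zpow_add)
qed

lemma wp_cong: "even (a - b) \<Longrightarrow> wp n a = wp n b"
  by (auto simp: wpow_def)

lemma wp_wp: "x \<in> carrier (G n) \<Longrightarrow> gm n (wp n a) (gm n (wp n b) x) = gm n (wp n (a + b)) x"
  by (simp add: wp_add W.m_assoc)

lemma wp_left: "x \<in> carrier (G n) \<Longrightarrow> y \<in> carrier (G n) \<Longrightarrow>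
    gm n x (gm n (wp n e) y) = gm n (wp n e) (gm n x y)"
  by (metis W.m_assoc wp_closed wp_commute)

lemma wp_even [simp]: "even e \<Longrightarrow> wp n e = \<one>\<^bsub>G n\<^esub>"
  by (simp add: wpow_def)

lemma wz_wp: "wz n = wp n 1"
  by (simp add: wpow_def)

lemma wz_wz: "gm n (wz n) (wz n) = \<one>\<^bsub>G n\<^esub>"
  by (simp add: wz_wp wp_add[symmetric])

lemma wz_wz_mult: "x \<in> carrier (G n) \<Longrightarrow> gm n (wz n) (gm n (wz n) x) = x"
  by (simp add: wz_wp wp_wp)

lemma wz_commute: "x \<in> carrier (G n) \<Longrightarrow> gm n x (wz n) = gm n (wz n) x"
  by (simp add: wz_wp wp_commute)

lemma wz_left: "x \<in> carrier (G n) \<Longrightarrow> y \<in> carrier (G n) \<Longrightarrow>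
    gm n x (gm n (wz n) y) = gm n (wz n) (gm n x y)"
  by (simp add: wz_wp wp_left)

lemma wz_neq_one: "wz n \<noteq> \<one>\<^bsub>G n\<^esub>"
  using zz_neq_one by (simp add: wreath_z_def one_G)

lemma wz_mult_neq: "x \<in> carrier (G n) \<Longrightarrow> gm n (wz n) x \<noteq> x"
  using wz_neq_one by (metis W.r_cancel_one' wz_closed)

lemma par_range: "x \<in> carrier (G n) \<Longrightarrow> par x = 0 \<or> par x = 1"
  using spin_parity_range[of "snd x" n] by (auto simp: carrier_G wreath_parity_def)

lemma par_mult: "x \<in> carrier (G n) \<Longrightarrow> y \<in> carrier (G n) \<Longrightarrow> par (gm n x y) = (par x + par y) mod 2"
  by (cases x; cases y) (auto simp: carrier_G mult_G wreath_parity_def spin_parity_mult)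

lemma par_wz [simp]: "par (wz n) = 0"
  by (simp add: wreath_z_def wreath_parity_def)

lemma par_one [simp]: "par \<one>\<^bsub>G n\<^esub> = 0"
  by (simp add: one_G wreath_parity_def)

lemma par_wp [simp]: "par (wp n e) = 0"
  by (simp add: wpow_def)

lemma par_inv: "x \<in> carrier (G n) \<Longrightarrow> par (inv\<^bsub>G n\<^esub> x) = par x"
  using par_mult[of "inv\<^bsub>G n\<^esub> x" n x] par_range[of x n] par_range[of "inv\<^bsub>G n\<^esub> x" n] by auto

lemma par_conj: "x \<in> carrier (G n) \<Longrightarrow> s \<in> carrier (G n) \<Longrightarrow>
    par (gm n (gm n (inv\<^bsub>G n\<^esub> s) x) s) = par x"
  using par_range[of x n] par_range[of s n] by (auto simp: par_mult par_inv)

lemma wperm_permutes: "x \<in> carrier (G n) \<Longrightarrow> wperm n x permutes {1..n}"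
  using spin_perm_permutes[of "snd x" n] by (auto simp: carrier_G wperm_def)

lemma wperm_mult: "x \<in> carrier (G n) \<Longrightarrow> y \<in> carrier (G n) \<Longrightarrow>
    wperm n (gm n x y) = wperm n x \<circ> wperm n y"
  by (cases x; cases y) (auto simp: carrier_G mult_G wperm_def spin_perm_mult)

lemma wperm_one [simp]: "wperm n \<one>\<^bsub>G n\<^esub> = id"
  by (simp add: wperm_def one_G)

lemma wperm_wz [simp]: "wperm n (wz n) = id"
  by (simp add: wperm_def wreath_z_def)

lemma wperm_inv: "x \<in> carrier (G n) \<Longrightarrow> wperm n (inv\<^bsub>G n\<^esub> x) = inv' (wperm n x)"
  using wperm_mult[of "inv\<^bsub>G n\<^esub> x" n x] wperm_mult[of x n "inv\<^bsub>G n\<^esub> x"]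
  by (intro inv_unique_comp[symmetric]) simp_all

lemma wperm_surj: "p permutes {1..n} \<Longrightarrow> \<exists>x\<in>carrier (G n). wperm n x = p"
proof -
  assume "p permutes {1..n}"
  then obtain t where "t \<in> carrier (spin_sym n)" "spin_perm n t = p" using spin_perm_surj by blast
  then show ?thesis
    by (intro bexI[of _ "(\<lambda>i\<in>{1..n}. \<one>, t)"]) (auto simp: carrier_G wperm_def)
qed

lemma carrier_G_0: "carrier (G 0) = {\<one>\<^bsub>G 0\<^esub>, wz 0}"
proof -
  have "t = \<one>\<^bsub>spin_sym 0\<^esub> \<or> t = zz 0" if "t \<in> carrier (spin_sym 0)" for t
    using spin_perm_permutes[OF that] by (intro spin_perm_kernel[OF that]) simp
  then have "carrier (spin_sym 0) = {\<one>\<^bsub>spin_sym 0\<^esub>, zz 0}" by auto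
  then show ?thesis by (auto simp: carrier_G one_G wreath_z_def restrict_def)
qed


subsection \<open>Juxtaposition\<close>

lemma jx_closed [simp]:
  assumes "x \<in> carrier (G n)" "y \<in> carrier (G m)"
  shows "jx n m x y \<in> carrier (G (n + m))"
proof -
  obtain g t h s where x: "x = (g, t)" "y = (h, s)" by (cases x; cases y)
  have "i - n \<in> {1..m}" if "i \<in> {1..n+m}" "\<not> i \<le> n" for i using that by auto
  then show ?thesis using assms
    by (auto simp: x jx_def carrier_G PiE_iff intro!: spin.m_closed)
qed

lemma wperm_jx:
  assumes "x \<in> carrier (G n)" "y \<in> carrier (G m)"
  shows "wperm (n + m) (jx n m x y) i = (if i \<le> n then wperm n x i else n + wperm m y (i - n))"
proof -
  obtain g t h s where x: "x = (g, t)" "y = (h, s)" by (cases x; cases y)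
  have t: "t \<in> carrier (spin_sym n)" "s \<in> carrier (spin_sym m)" using assms x by (auto simp: carrier_G)
  have *: "spin_perm n t i = i" if "\<not> i \<le> n" for i
    using permutes_not_in[OF spin_perm_permutes[OF t(1)]] that by auto
  have **: "\<not> n + spin_perm m s (i - n) \<le> n" if "\<not> i \<le> n" for i
  proof (cases "i \<le> n + m")
    case True
    then show ?thesis using spin_perm_range[OF t(2), of "i - n"] that by auto
  next
    case False
    then have "spin_perm m s (i - n) = i - n"
      by (intro permutes_not_in[OF spin_perm_permutes[OF t(2)]]) auto
    then show ?thesis using that by simp
  qed
  have z: "spin_perm n t 0 = 0" using permutes_not_in[OF spin_perm_permutes[OF t(1)], of 0] by simp
  show ?thesis using t * ** z
    by (auto simp: wperm_def jx_def x spin_perm_mult spin_shift_perm)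
qed

lemma inv_wperm_jx:
  assumes "x \<in> carrier (G n)" "y \<in> carrier (G m)" "i \<in> {1..n+m}"
  shows "inv' (wperm (n + m) (jx n m x y)) i =
    (if i \<le> n then inv' (wperm n x) i else n + inv' (wperm m y) (i - n))"
proof -
  have p: "wperm (n + m) (jx n m x y) permutes {1..n+m}" using assms wperm_permutes by simp
  note px = wperm_permutes[OF assms(1)] and py = wperm_permutes[OF assms(2)]
  show ?thesis
  proof (cases "i \<le> n")
    case True
    then have "inv' (wperm n x) i \<in> {1..n}"
      using permutes_in_image[OF permutes_inv[OF px], of i] assms(3) by auto
    then show ?thesis using True permutes_inverses(1)[OF px]
      by (simp add: permutes_inv_eq[OF p] wperm_jx[OF assms(1,2)])
  next
    case False
    then have "inv' (wperm m y) (i - n) \<in> {1..m}"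
      using permutes_in_image[OF permutes_inv[OF py], of "i - n"] assms(3) by auto
    then show ?thesis using False permutes_inverses(1)[OF py]
      by (simp add: permutes_inv_eq[OF p] wperm_jx[OF assms(1,2)])
  qed
qed

lemma par_jx [simp]:
  assumes "x \<in> carrier (G n)" "y \<in> carrier (G m)"
  shows "par (jx n m x y) = (par x + par y) mod 2"
  using assms by (cases x; cases y) (auto simp: jx_def wreath_parity_def carrier_G spin_parity_mult)

text \<open>The second block of the left factor has to pass the first block of the right factor,
  which it fixes pointwise; \<open>spin_conj_shift\<close> with both offsets zero gives the
  exponent. This is the twist in the multiplication of \<open>tilde_prod\<close>.\<close>

lemma jx_mult:
  assumes "x \<in> carrier (G n)" "y \<in> carrier (G m)" "x' \<in> carrier (G n)" "y' \<in> carrier (G m)"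
  shows "gm (n + m) (jx n m x y) (jx n m x' y') =
    gm (n + m) (wp (n + m) (par y * par x')) (jx n m (gm n x x') (gm m y y'))"
proof -
  obtain g t h s where x: "x = (g, t)" "y = (h, s)" by (cases x; cases y)
  obtain g' t' h' s' where x': "x' = (g', t')" "y' = (h', s')" by (cases x'; cases y')
  let ?m = "monoid.mult (spin_sym (n + m))" and ?N = "n + m"
  have c: "t \<in> carrier (spin_sym n)" "t' \<in> carrier (spin_sym n)"
    "s \<in> carrier (spin_sym m)" "s' \<in> carrier (spin_sym m)" using assms x x' by (auto simp: carrier_G)
  define a b a' b' where ab: "a = spin_shift 0 ?N t" "b = spin_shift n ?N s"
    "a' = spin_shift 0 ?N t'" "b' = spin_shift n ?N s'"
  have cc: "a \<in> carrier (spin_sym ?N)" "b \<in> carrier (spin_sym ?N)"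
    "a' \<in> carrier (spin_sym ?N)" "b' \<in> carrier (spin_sym ?N)" using c by (auto simp: ab)
  let ?z = "zpow ?N (par y * par x')"
  have "?m b a' = ?m ?z (?m a' b)"
    using spin_conj_shift[of b ?N t' n 0 0] c cc by (simp add: ab spin_shift_perm x x' wreath_parity_def)
  then have "?m (?m a b) (?m a' b') = ?m a (?m (?m ?z (?m a' b)) b')"
    using cc by (metis spin.m_assoc spin.m_closed)
  also have "\<dots> = ?m ?z (?m (?m a a') (?m b b'))"
    using cc by (simp add: spin.m_assoc zpow_lcomm)
  finally have 1: "?m (?m a b) (?m a' b') = ?m ?z (?m (spin_shift 0 ?N (t \<otimes>\<^bsub>spin_sym n\<^esub> t'))
      (spin_shift n ?N (s \<otimes>\<^bsub>spin_sym m\<^esub> s')))"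
    using c by (simp add: ab spin_shift_mult)
  have i: "inv' (spin_perm ?N (?m a b)) i =
    (if i \<le> n then inv' (spin_perm n t) i else n + inv' (spin_perm m s) (i - n))" if "i \<in> {1..?N}" for i
    using inv_wperm_jx[OF assms(1,2) that] by (simp add: wperm_def jx_def x ab)
  have r: "inv' (spin_perm n t) i \<in> {1..n}" if "i \<in> {1..n}" for i using spin_perm_inv_range c that by blast
  have r': "inv' (spin_perm m s) i \<in> {1..m}" if "i \<in> {1..m}" for i using spin_perm_inv_range c that by blast
  have 2: "(\<lambda>i\<in>{1..?N}. (\<lambda>i\<in>{1..?N}. if i \<le> n then g i else h (i - n)) i \<otimes>
      (\<lambda>i\<in>{1..?N}. if i \<le> n then g' i else h' (i - n)) (inv' (spin_perm ?N (?m a b)) i)) =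
      (\<lambda>i\<in>{1..?N}. if i \<le> n then (\<lambda>i\<in>{1..n}. g i \<otimes> g' (inv' (spin_perm n t) i)) i
        else (\<lambda>i\<in>{1..m}. h i \<otimes> h' (inv' (spin_perm m s) i)) (i - n))"
  proof (rule restrict_ext)
    fix k assume k: "k \<in> {1..?N}"
    show "(\<lambda>i\<in>{1..?N}. if i \<le> n then g i else h (i - n)) k \<otimes>
      (\<lambda>i\<in>{1..?N}. if i \<le> n then g' i else h' (i - n)) (inv' (spin_perm ?N (?m a b)) k) =
      (if k \<le> n then (\<lambda>i\<in>{1..n}. g i \<otimes> g' (inv' (spin_perm n t) i)) k
        else (\<lambda>i\<in>{1..m}. h i \<otimes> h' (inv' (spin_perm m s) i)) (k - n))"
      using k r[of k] r'[of "k - n"] unfolding i[OF k] by (cases "k \<le> n") auto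
  qed
  let ?J = "jx n m (gm n x x') (gm m y y')"
  have J: "?J \<in> carrier (G ?N)" using assms by simp
  have Jeq: "?J = (\<lambda>i\<in>{1..?N}. if i \<le> n then (\<lambda>i\<in>{1..n}. g i \<otimes> g' (inv' (spin_perm n t) i)) i
        else (\<lambda>i\<in>{1..m}. h i \<otimes> h' (inv' (spin_perm m s) i)) (i - n),
        ?m (spin_shift 0 ?N (t \<otimes>\<^bsub>spin_sym n\<^esub> t')) (spin_shift n ?N (s \<otimes>\<^bsub>spin_sym m\<^esub> s')))"
    unfolding x x' mult_G jx_def fst_conv snd_conv ..
  have "gm ?N (wp ?N (par y * par x')) ?J = (fst ?J, ?m ?z (snd ?J))"
    using wp_mult_pair(1)[of "fst ?J" "snd ?J"] J by simp
  also have "\<dots> = gm ?N (jx n m x y) (jx n m x' y')"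
    unfolding Jeq fst_conv snd_conv 1[symmetric] 2[symmetric]
    unfolding x x' jx_def fst_conv snd_conv ab[symmetric] mult_G ..
  finally show ?thesis ..
qed

lemma jx_one: "jx n m \<one>\<^bsub>G n\<^esub> \<one>\<^bsub>G m\<^esub> = \<one>\<^bsub>G (n + m)\<^esub>"
  by (auto simp: jx_def one_G intro!: restrict_ext)

lemma jx_wp:
  assumes "x \<in> carrier (G n)" "y \<in> carrier (G m)"
  shows "jx n m (gm n (wp n e) x) y = gm (n + m) (wp (n + m) e) (jx n m x y)"
    "jx n m x (gm m (wp m e) y) = gm (n + m) (wp (n + m) e) (jx n m x y)"
proof -
  have "jx n m (wp n e) \<one>\<^bsub>G m\<^esub> = wp (n + m) e"
    by (auto simp: jx_def wp_eq one_G zpow_def intro!: restrict_ext)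
  then show "jx n m (gm n (wp n e) x) y = gm (n + m) (wp (n + m) e) (jx n m x y)"
    using jx_mult[of "wp n e" n "\<one>\<^bsub>G m\<^esub>" m x y] assms by simp
  have "jx n m \<one>\<^bsub>G n\<^esub> (wp m e) = wp (n + m) e"
    by (auto simp: jx_def wp_eq one_G zpow_def intro!: restrict_ext)
  then show "jx n m x (gm m (wp m e) y) = gm (n + m) (wp (n + m) e) (jx n m x y)"
    using jx_mult[of "\<one>\<^bsub>G n\<^esub>" n "wp m e" m x y] assms by simp
qed

lemma jx_wz:
  assumes "x \<in> carrier (G n)" "y \<in> carrier (G m)"
  shows "jx n m (gm n (wz n) x) y = gm (n + m) (wz (n + m)) (jx n m x y)"
    "jx n m x (gm m (wz m) y) = gm (n + m) (wz (n + m)) (jx n m x y)"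
  unfolding wz_wp using jx_wp[OF assms] by auto

text \<open>The parities of \<open>x\<close> and \<open>y\<close> occur in every exponent that
  arises, so evenness removes all signs. The identity is verified after multiplication by
  \<open>jx n m s t\<close> from the left, since the inverse of a juxtaposition carries a sign of
  its own.\<close>

lemma jx_conj:
  assumes "x \<in> carrier (G n)" "y \<in> carrier (G m)" "s \<in> carrier (G n)" "t \<in> carrier (G m)"
    "par x = 0" "par y = 0"
  shows "gm (n + m) (inv\<^bsub>G (n+m)\<^esub> (jx n m s t)) (gm (n + m) (jx n m x y) (jx n m s t)) =
    jx n m (gm n (inv\<^bsub>G n\<^esub> s) (gm n x s)) (gm m (inv\<^bsub>G m\<^esub> t) (gm m y t))"
proof -
  let ?x = "gm n (inv\<^bsub>G n\<^esub> s) (gm n x s)" and ?y = "gm m (inv\<^bsub>G m\<^esub> t) (gm m y t)"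
  have s: "gm n s ?x = gm n x s" "gm m t ?y = gm m y t"
    using assms by (simp_all add: W.m_assoc[symmetric])
  have p: "par ?x = 0" using assms par_range[of s n] by (auto simp: par_mult par_inv)
  have "gm (n + m) (jx n m s t) (jx n m ?x ?y) = jx n m (gm n x s) (gm m y t)"
    using jx_mult[of s n t m ?x ?y] assms p s by simp
  also have "\<dots> = gm (n + m) (jx n m x y) (jx n m s t)"
    using jx_mult[of x n y m s t] assms by simp
  finally show ?thesis using assms by (metis W.inv_solve_left W.inv_closed W.m_closed jx_closed)
qed

lemma jx_assoc:
  assumes "x \<in> carrier (G n)" "y \<in> carrier (G m)" "w \<in> carrier (G l)"
  shows "jx (n + m) l (jx n m x y) w = jx n (m + l) x (jx m l y w)"
proof -
  obtain g t h s k r where x: "x = (g, t)" "y = (h, s)" "w = (k, r)" by (cases x; cases y; cases w)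
  have c: "t \<in> carrier (spin_sym n)" "s \<in> carrier (spin_sym m)" "r \<in> carrier (spin_sym l)"
    using assms x by (auto simp: carrier_G)
  show ?thesis
    using c by (auto simp: jx_def x spin_shift_mult[of _ "n + m"] spin_shift_mult[of _ "m + l"]
      spin_shift_shift[where k = n] spin_shift_shift[where k = m] spin_shift_shift[where k = l]
      spin.m_assoc add.assoc intro!: restrict_ext)
qed

lemma jx_0_left: "x \<in> carrier (G n) \<Longrightarrow> jx 0 n \<one>\<^bsub>G 0\<^esub> x = x"
  by (cases x) (auto simp: jx_def carrier_G one_G spin_shift_id PiE_iff extensional_def fun_eq_iff)

lemma jx_0_right: "x \<in> carrier (G n) \<Longrightarrow> jx n 0 x \<one>\<^bsub>G 0\<^esub> = x"
  by (cases x) (auto simp: jx_def carrier_G one_G spin_shift_id PiE_iff extensional_def fun_eq_iff)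

section \<open>Injectivity, image and block exchange for juxtaposition\<close>

lemma wreath_eqI:
  assumes "x \<in> carrier (G n)" "y \<in> carrier (G n)" "fst x = fst y" "wperm n x = wperm n y"
  shows "y = x \<or> y = gm n (wz n) x"
proof -
  obtain g t s where x: "x = (g, t)" "y = (g, s)" using assms by (cases x; cases y) auto
  have "eqz n t s" using assms x by (intro spin_perm_eq) (auto simp: carrier_G wperm_def)
  then have "s = t \<or> s = zz n \<otimes>\<^bsub>spin_sym n\<^esub> t" by (simp add: eqz_def)
  then show ?thesis using wp_mult_pair(1)[of g t n 1] assms x by (auto simp: wz_wp zpow_def)
qed

text \<open>Base components and permutations of both parts can be read off, which determines each
  part up to \<open>z\<close>. Changing only one part by \<open>z\<close> would change the
  juxtaposition by \<open>z\<close>, so the two changes occur together.\<close>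

lemma jx_inj:
  assumes "x \<in> carrier (G n)" "y \<in> carrier (G m)" "x' \<in> carrier (G n)" "y' \<in> carrier (G m)"
    and e: "jx n m x y = jx n m x' y'"
  shows "x' = x \<and> y' = y \<or> x' = gm n (wz n) x \<and> y' = gm m (wz m) y"
proof -
  have fx: "fst x \<in> extensional {1..n}" "fst x' \<in> extensional {1..n}" 
    "fst y \<in> extensional {1..m}" "fst y' \<in> extensional {1..m}"
    using assms by (auto simp: carrier_G PiE_iff)
  have f: "fst (jx n m x y) i = fst (jx n m x' y') i" for i using e by simp
  have "fst x = fst x'"
    by (rule extensionalityI[OF fx(1,2)]) (use f in \<open>auto simp: jx_def split: if_splits dest!: meta_spec\<close>)
  moreover have "fst y = fst y'"
  proof (rule extensionalityI[OF fx(3,4)])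
    fix i assume "i \<in> {1..m}"
    then show "fst y i = fst y' i" using f[of "n + i"] by (auto simp: jx_def)
  qed
  moreover have p: "wperm (n + m) (jx n m x y) = wperm (n + m) (jx n m x' y')" using e by simp
  have "wperm n x i = wperm n x' i" for i
  proof (cases "i \<le> n")
    case True then show ?thesis using fun_cong[OF p, of i] assms(1-4) by (simp add: wperm_jx)
  next
    case False then show ?thesis using assms wperm_permutes[of x n] wperm_permutes[of x' n]
      permutes_not_in[of "wperm n x" "{1..n}" i] permutes_not_in[of "wperm n x'" "{1..n}" i] by auto
  qed
  moreover have "wperm m y i = wperm m y' i" for i
  proof (cases "i = 0")
    case True then show ?thesis using assms wperm_permutes[of y m] wperm_permutes[of y' m]
      permutes_not_in[of "wperm m y" "{1..m}" i] permutes_not_in[of "wperm m y'" "{1..m}" i] by auto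
  next
    case False then show ?thesis using fun_cong[OF p, of "n + i"] assms(1-4) by (simp add: wperm_jx)
  qed
  ultimately have "x' = x \<or> x' = gm n (wz n) x" "y' = y \<or> y' = gm m (wz m) y"
    using assms wreath_eqI[of x n x'] wreath_eqI[of y m y'] by (simp_all add: fun_eq_iff)
  moreover have "gm (n + m) (wz (n + m)) (jx n m x y) \<noteq> jx n m x y"
    using assms by (intro wz_mult_neq) simp
  ultimately show ?thesis using e jx_wz[OF assms(1,2)] by metis
qed

text \<open>The image of juxtaposition is the stabiliser of the first block. A preimage is assembled
  from the base components and arbitrary lifts of the two restricted permutations; a wrong factor
  \<open>z\<close> can be absorbed into the first part.\<close>

lemma jx_image:
  assumes w: "w \<in> carrier (G (n + m))" and p: "wperm (n + m) w ` {1..n} = {1..n}"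
  shows "\<exists>x\<in>carrier (G n). \<exists>y\<in>carrier (G m). w = jx n m x y"
proof -
  let ?p = "wperm (n + m) w"
  have pp: "?p permutes {1..n+m}" using wperm_permutes[OF w] .
  have inj: "inj ?p" using permutes_inj[OF pp] .
  define p1 where "p1 i = (if i \<in> {1..n} then ?p i else i)" for i
  define p2 where "p2 i = (if i \<in> {1..m} then ?p (n + i) - n else i)" for i
  have p1: "p1 permutes {1..n}"
  proof (rule bij_imp_permutes)
    show "bij_betw p1 {1..n} {1..n}"
      using p inj by (auto simp: bij_betw_def p1_def inj_on_def image_def)
  qed (auto simp: p1_def)
  have im: "?p (n + i) \<in> {n+1..n+m}" if "i \<in> {1..m}" for i
  proof -
    have "?p (n + i) \<in> {1..n+m}" using permutes_in_image[OF pp, of "n + i"] that by simp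
    moreover have "?p (n + i) \<notin> ?p ` {1..n}" using inj that by (auto simp: inj_eq)
    ultimately show ?thesis unfolding p by auto
  qed
  have p2: "p2 permutes {1..m}"
  proof (rule bij_imp_permutes)
    have "inj_on p2 {1..m}"
    proof (rule inj_onI)
      fix i j assume i: "i \<in> {1..m}" and j: "j \<in> {1..m}" and e: "p2 i = p2 j"
      have "?p (n + i) - n = ?p (n + j) - n" using e i j by (simp add: p2_def)
      moreover have "n \<le> ?p (n + i)" "n \<le> ?p (n + j)" using im[OF i] im[OF j] by simp_all
      ultimately have "?p (n + i) = ?p (n + j)" by linarith
      then show "i = j" using inj by (simp add: inj_eq)
    qed
    moreover have "p2 ` {1..m} \<subseteq> {1..m}" using im by (force simp: p2_def)
    ultimately show "bij_betw p2 {1..m} {1..m}"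
      by (simp add: bij_betw_def endo_inj_surj)
  qed (auto simp: p2_def)
  obtain x y where xy: "x \<in> carrier (G n)" "wperm n x = p1" "y \<in> carrier (G m)" "wperm m y = p2"
    using wperm_surj[OF p1] wperm_surj[OF p2] by blast
  define x1 where "x1 = ((\<lambda>i\<in>{1..n}. fst w i), snd x)"
  define y1 where "y1 = ((\<lambda>i\<in>{1..m}. fst w (n + i)), snd y)"
  have fw: "fst w \<in> {1..n+m} \<rightarrow>\<^sub>E carrier \<Gamma>" using w by (auto simp: carrier_G)
  have c: "x1 \<in> carrier (G n)" "y1 \<in> carrier (G m)"
    using xy fw by (auto simp: x1_def y1_def carrier_G PiE_iff)
  have wx: "wperm n x1 = p1" "wperm m y1 = p2" using xy by (auto simp: wperm_def x1_def y1_def)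
  have "wperm (n + m) (jx n m x1 y1) i = ?p i" for i
    unfolding wperm_jx[OF c] wx using im[of "i - n"] permutes_not_in[OF pp, of i]
    by (auto simp: p1_def p2_def)
  moreover have "fst (jx n m x1 y1) = fst w"
    using fw by (auto simp: jx_def x1_def y1_def fun_eq_iff PiE_iff extensional_def)
  ultimately have "w = jx n m x1 y1 \<or> w = gm (n + m) (wz (n + m)) (jx n m x1 y1)"
    using w c by (intro wreath_eqI) auto
  then show ?thesis using c jx_wz(1)[OF c] by (metis W.m_closed wz_closed)
qed

lemma jx_stable:
  assumes "x \<in> carrier (G n)" "y \<in> carrier (G m)"
  shows "wperm (n + m) (jx n m x y) ` {1..n} = {1..n}"
proof -
  have "wperm (n + m) (jx n m x y) ` {1..n} = wperm n x ` {1..n}"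
    using assms by (intro image_cong) (auto simp: wperm_jx)
  then show ?thesis using permutes_image[OF wperm_permutes[OF assms(1)]] by simp
qed

text \<open>Conjugation by a lift of the block exchange reverses a juxtaposition. The exponent
  \<open>e\<close> depends on the parities and is exactly \<open>0\<close> for even parts, so that
  exchanging blocks costs no sign where class functions do not vanish.\<close>

lemma jx_swap:
  obtains \<tau> where "\<tau> \<in> carrier (G (n + m))"
    "\<And>i. i \<in> {1..m} \<Longrightarrow> wperm (n + m) \<tau> i = n + i"
    "\<And>i. i \<in> {1..n} \<Longrightarrow> wperm (n + m) \<tau> (m + i) = i"
    "\<And>x y. x \<in> carrier (G n) \<Longrightarrow> y \<in> carrier (G m) \<Longrightarrow>
      \<exists>e. gm (n + m) (jx n m x y) \<tau> = gm (n + m) \<tau> (gm (n + m) (wp (n + m) e) (jx m n y x))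
        \<and> (par x = 0 \<longrightarrow> par y = 0 \<longrightarrow> e = 0)"
proof -
  let ?N = "n + m"
  define p where "p i = (if i \<in> {1..m} then n + i else if i \<in> {m+1..m+n} then i - m else i)" for i
  have "p permutes {1..?N}"
  proof (rule bij_imp_permutes)
    have "inj_on p {1..?N}" by (auto simp: inj_on_def p_def split: if_splits)
    moreover have "p ` {1..?N} \<subseteq> {1..?N}" by (auto simp: p_def)
    ultimately show "bij_betw p {1..?N} {1..?N}" by (simp add: bij_betw_def endo_inj_surj)
  qed (auto simp: p_def)
  then obtain t where t: "t \<in> carrier (spin_sym ?N)" "spin_perm ?N t = p" using spin_perm_surj by blast
  define \<tau> where "\<tau> = (\<lambda>i\<in>{1..?N}. \<one>, t)"
  have tau: "\<tau> \<in> carrier (G ?N)" using t by (simp add: \<tau>_def carrier_G)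
  have ex: "\<exists>e. gm ?N (jx n m x y) \<tau> = gm ?N \<tau> (gm ?N (wp ?N e) (jx m n y x))
        \<and> (par x = 0 \<longrightarrow> par y = 0 \<longrightarrow> e = 0)" if xy: "x \<in> carrier (G n)" "y \<in> carrier (G m)" for x y
  proof -
    obtain g r h s where x: "x = (g, r)" "y = (h, s)" by (cases x; cases y)
    have c: "r \<in> carrier (spin_sym n)" "s \<in> carrier (spin_sym m)"
      and gh: "g \<in> {1..n} \<rightarrow>\<^sub>E carrier \<Gamma>" "h \<in> {1..m} \<rightarrow>\<^sub>E carrier \<Gamma>" using xy x by (auto simp: carrier_G)
    let ?m = "monoid.mult (spin_sym ?N)"
    define R R' S S' where R: "R = spin_shift 0 ?N r" "R' = spin_shift m ?N r"
      "S = spin_shift n ?N s" "S' = spin_shift 0 ?N s"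
    have cc: "R \<in> carrier (spin_sym ?N)" "R' \<in> carrier (spin_sym ?N)"
      "S \<in> carrier (spin_sym ?N)" "S' \<in> carrier (spin_sym ?N)" using c by (auto simp: R)
    \<comment> \<open>\<open>e1\<close> and \<open>e2\<close> come from moving the exchanging
      element past either block, and \<open>e3\<close> below from moving the two blocks past each
      other.\<close>
    define e1 e2 where e: "e1 = spin_parity t * spin_parity r" "e2 = spin_parity t * spin_parity s"
    define e3 where "e3 = spin_parity r * spin_parity s"
    have 1: "?m t R' = ?m (zpow ?N e1) (?m R t)"
      using spin_conj_shift[of t ?N r n m 0] t c by (auto simp: R e p_def)
    have 2: "?m t S' = ?m (zpow ?N e2) (?m S t)"
      using spin_conj_shift[of t ?N s m 0 n] t c by (auto simp: R e p_def)
    have 3: "?m R S = ?m (zpow ?N e3) (?m S R)"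
      using spin_conj_shift[of R ?N s m n n] c cc
        permutes_not_in[OF spin_perm_permutes[OF c(1)]]
      by (auto simp: R e3_def spin_shift_perm)
    let ?e = "e1 + e2 + e3"
    have "?m t (?m S' R') = ?m (?m t S') R'" using t cc by (simp add: spin.m_assoc)
    also have "\<dots> = ?m (zpow ?N e2) (?m S (?m t R'))" unfolding 2 using t cc by (simp add: spin.m_assoc)
    also have "\<dots> = ?m (zpow ?N e2) (?m (zpow ?N e1) (?m S (?m R t)))"
      unfolding 1 using zpow_lcomm[of S ?N "?m R t" e1] t cc by simp
    also have "\<dots> = ?m (zpow ?N (e2 + e1)) (?m (?m S R) t)"
      using t cc by (simp add: spin.m_assoc zpow_add)
    finally have 4: "?m t (?m S' R') = ?m (zpow ?N (e2 + e1)) (?m (?m S R) t)" .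
    have "?m (zpow ?N ?e) (?m t (?m S' R')) = ?m (zpow ?N (?e + (e2 + e1))) (?m (?m S R) t)"
      unfolding 4 using t cc zpow_zpow[of "?m (?m S R) t" ?N ?e "e2 + e1"] by simp
    also have "zpow ?N (?e + (e2 + e1)) = zpow ?N e3" by (rule zpow_cong) simp
    also have "?m (zpow ?N e3) (?m (?m S R) t) = ?m (?m R S) t"
      unfolding 3 using t cc by (simp add: spin.m_assoc)
    finally have 5: "?m (?m R S) t = ?m t (?m (zpow ?N ?e) (?m S' R'))"
      using zpow_lcomm[of t ?N "?m S' R'" ?e] t cc by simp
    have J: "jx m n y x \<in> carrier (G ?N)" using jx_closed[OF xy(2,1)] by (simp add: add.commute)
    have Jeq: "jx m n y x = (\<lambda>i\<in>{1..?N}. if i \<le> m then h i else g (i - m), ?m S' R')"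
      unfolding jx_def x fst_conv snd_conv R add.commute[of m n] ..
    have tp: "spin_perm ?N t permutes {1..?N}" using spin_perm_permutes t by blast
    have it: "inv' (spin_perm ?N t) i = (if i \<le> n then m + i else i - n)" if "i \<in> {1..?N}" for i
      using that unfolding permutes_inv_eq[OF tp] by (auto simp: t(2) p_def)
    have rng: "inv' (spin_perm ?N (?m R S)) i \<in> {1..?N}" if "i \<in> {1..?N}" for i
      using spin_perm_inv_range[of "?m R S" ?N i] cc that by simp
    have "gm ?N (jx n m x y) \<tau> = gm ?N \<tau> (gm ?N (wp ?N ?e) (jx m n y x))"
    proof -
      have a: "gm ?N (wp ?N ?e) (jx m n y x) =
          (\<lambda>i\<in>{1..?N}. if i \<le> m then h i else g (i - m), ?m (zpow ?N ?e) (?m S' R'))"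
        using wp_mult_pair(1) J unfolding Jeq by blast
      have b: "jx n m x y = (\<lambda>i\<in>{1..?N}. if i \<le> n then g i else h (i - n), ?m R S)"
        unfolding jx_def x fst_conv snd_conv R ..
      show ?thesis unfolding a b \<tau>_def mult_G 5
        using rng it gh by (auto simp: PiE_iff intro!: restrict_ext)
    qed
    moreover have "par x = 0 \<longrightarrow> par y = 0 \<longrightarrow> ?e = 0" by (auto simp: wreath_parity_def x e e3_def)
    ultimately show ?thesis by blast
  qed
  show thesis
    by (rule that[OF tau _ _ ex]) (auto simp: wperm_def \<tau>_def t p_def)
qed

end

section \<open>The twisted product\<close>

declare split_paired_All [simp del] split_paired_Ex [simp del]

text \<open>The coset of \<open>(x, y)\<close> modulo \<open>(z, z)\<close> as an explicit
  two-element set; a \<open>the_elem\<close> over it only requires that its two elements give the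
  same value.\<close>

definition hat_class :: "('a, 'b) monoid_scheme \<Rightarrow> nat \<Rightarrow> nat \<Rightarrow> 'a wr \<Rightarrow> 'a wr \<Rightarrow> 'a hat" where
  "hat_class \<Gamma> n m x y = {(x, y),
    (wreath_z \<Gamma> n \<otimes>\<^bsub>spin_wreath \<Gamma> n\<^esub> x, wreath_z \<Gamma> m \<otimes>\<^bsub>spin_wreath \<Gamma> m\<^esub> y)}"

context finite_base
begin

abbreviation TP where "TP n m \<equiv> tilde_prod \<Gamma> n m"
abbreviation HP where "HP n m \<equiv> hat_prod \<Gamma> n m"
abbreviation hcls where "hcls n m x y \<equiv> hat_class \<Gamma> n m x y"

lemma carrier_TP: "carrier (TP n m) = carrier (G n) \<times> carrier (G m)"
  by (simp add: tilde_prod_def)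

lemma one_TP: "\<one>\<^bsub>TP n m\<^esub> = (\<one>\<^bsub>G n\<^esub>, \<one>\<^bsub>G m\<^esub>)"
  by (simp add: tilde_prod_def)

lemma wz_int_pow: "e = 0 \<or> e = 1 \<Longrightarrow> wz n [^]\<^bsub>G n\<^esub> (e::int) = wp n e"
  using W.int_pow_1[of "wz n" n] by (auto simp: wz_wp)

lemma mult_TP:
  assumes "t \<in> carrier (G n)" "s \<in> carrier (G n)" "t' \<in> carrier (G m)" "s' \<in> carrier (G m)"
  shows "(t, t') \<otimes>\<^bsub>TP n m\<^esub> (s, s') = (gm n (wp n (par t' * par s)) (gm n t s), gm m t' s')"
proof -
  have "par t' * par s = 0 \<or> par t' * par s = 1"
    using par_range[OF assms(2)] par_range[OF assms(3)] by auto
  then show ?thesis using assms by (simp add: tilde_prod_def wz_int_pow wp_commute)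
qed

lemma group_TP: "group (TP n m)"
proof (rule groupI)
  fix x y assume "x \<in> carrier (TP n m)" "y \<in> carrier (TP n m)"
  then show "x \<otimes>\<^bsub>TP n m\<^esub> y \<in> carrier (TP n m)" by (auto simp: carrier_TP mult_TP)
next
  show "\<one>\<^bsub>TP n m\<^esub> \<in> carrier (TP n m)" by (simp add: carrier_TP one_TP)
next
  fix x y w assume "x \<in> carrier (TP n m)" "y \<in> carrier (TP n m)" "w \<in> carrier (TP n m)"
  then obtain a a' b b' c c' where x: "x = (a, a')" "y = (b, b')" "w = (c, c')"
    "a \<in> carrier (G n)" "b \<in> carrier (G n)" "c \<in> carrier (G n)"
    "a' \<in> carrier (G m)" "b' \<in> carrier (G m)" "c' \<in> carrier (G m)"
    by (auto simp: carrier_TP)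
  have "gm n (wp n (par (gm m a' b') * par c)) (gm n (gm n (wp n (par a' * par b)) (gm n a b)) c) =
      gm n (wp n (par (gm m a' b') * par c + par a' * par b)) (gm n a (gm n b c))"
    using x by (simp add: W.m_assoc wp_add)
  \<comment> \<open>The cocycle condition behind associativity of the twisted product: the exponent
    is biadditive modulo 2.\<close>
  also have "wp n (par (gm m a' b') * par c + par a' * par b) =
      wp n (par a' * par (gm n (wp n (par b' * par c)) (gm n b c)) + par b' * par c)"
    using x par_range[of b n] par_range[of c n] par_range[of a' m] par_range[of b' m]
    by (intro wp_cong) (auto simp: par_mult)
  also have "gm n \<dots> (gm n a (gm n b c)) =
      gm n (wp n (par a' * par (gm n (wp n (par b' * par c)) (gm n b c))))
        (gm n a (gm n (wp n (par b' * par c)) (gm n b c)))"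
    using x wp_left[of a n "gm n b c" "par b' * par c"] wp_wp[of "gm n a (gm n b c)" n] by simp
  finally show "x \<otimes>\<^bsub>TP n m\<^esub> y \<otimes>\<^bsub>TP n m\<^esub> w = x \<otimes>\<^bsub>TP n m\<^esub> (y \<otimes>\<^bsub>TP n m\<^esub> w)"
    using x by (simp add: mult_TP W.m_assoc)
next
  fix x assume "x \<in> carrier (TP n m)"
  then obtain a a' where x: "x = (a, a')" "a \<in> carrier (G n)" "a' \<in> carrier (G m)"
    by (auto simp: carrier_TP)
  show "\<one>\<^bsub>TP n m\<^esub> \<otimes>\<^bsub>TP n m\<^esub> x = x" using x by (simp add: one_TP mult_TP)
  let ?e = "par (inv\<^bsub>G m\<^esub> a') * par a"
  have "gm n (wp n ?e) (gm n (gm n (wp n ?e) (inv\<^bsub>G n\<^esub> a)) a) = gm n (wp n (?e + ?e)) (gm n (inv\<^bsub>G n\<^esub> a) a)"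
    unfolding wp_add using x by (simp add: W.m_assoc)
  also have "\<dots> = \<one>\<^bsub>G n\<^esub>" using x by simp
  finally show "\<exists>y\<in>carrier (TP n m). y \<otimes>\<^bsub>TP n m\<^esub> x = \<one>\<^bsub>TP n m\<^esub>"
    using x by (intro bexI[of _ "(gm n (wp n ?e) (inv\<^bsub>G n\<^esub> a), inv\<^bsub>G m\<^esub> a')"])
      (auto simp: carrier_TP mult_TP one_TP)
qed

lemma jx_hom: "(\<lambda>(x, y). jx n m x y) \<in> hom (TP n m) (G (n + m))"
  by (rule homI) (auto simp: carrier_TP mult_TP jx_mult jx_wp)

lemma group_hom_jx: "group_hom (TP n m) (G (n + m)) (\<lambda>(x, y). jx n m x y)"
  by (simp add: group_hom_def group_hom_axioms_def group_TP jx_hom W.is_group)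

lemma kernel_jx: "kernel (TP n m) (G (n + m)) (\<lambda>(x, y). jx n m x y) =
    {\<one>\<^bsub>TP n m\<^esub>, (wz n, wz m)}"
proof -
  have "x = \<one>\<^bsub>G n\<^esub> \<and> y = \<one>\<^bsub>G m\<^esub> \<or> x = wz n \<and> y = wz m"
    if "x \<in> carrier (G n)" "y \<in> carrier (G m)" "jx n m x y = \<one>\<^bsub>G (n + m)\<^esub>" for x y
    using jx_inj[of "\<one>\<^bsub>G n\<^esub>" n "\<one>\<^bsub>G m\<^esub>" m x y] that by (simp add: jx_one)
  moreover have "jx n m (wz n) (wz m) = \<one>\<^bsub>G (n + m)\<^esub>"
    using jx_wz[of "\<one>\<^bsub>G n\<^esub>" n "wz m" m] jx_wz[of "\<one>\<^bsub>G n\<^esub>" n "\<one>\<^bsub>G m\<^esub>" m]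
    by (simp add: jx_one wz_wz)
  ultimately have "p \<in> carrier (TP n m) \<and> (case p of (x, y) \<Rightarrow> jx n m x y) = \<one>\<^bsub>G (n + m)\<^esub>
      \<longleftrightarrow> p = (\<one>\<^bsub>G n\<^esub>, \<one>\<^bsub>G m\<^esub>) \<or> p = (wz n, wz m)" for p
    by (cases p) (auto simp only: carrier_TP mem_Times_iff jx_one fst_conv snd_conv prod.case
        prod.inject W.one_closed wz_closed)
  then show ?thesis unfolding kernel_def one_TP by blast
qed

text \<open>Being the kernel of juxtaposition, the subgroup is normal without any computation of
  conjugates in the twisted product.\<close>

lemma normal_hat: "{\<one>\<^bsub>TP n m\<^esub>, (wz n, wz m)} \<lhd> TP n m"
  using group_hom.normal_kernel[OF group_hom_jx] by (simp add: kernel_jx)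

lemma hat_coset:
  assumes "x \<in> carrier (G n)" "y \<in> carrier (G m)"
  shows "{\<one>\<^bsub>TP n m\<^esub>, (wz n, wz m)} #>\<^bsub>TP n m\<^esub> (x, y) = hcls n m x y"
  using assms unfolding r_coset_def hat_class_def by (simp add: one_TP mult_TP insert_commute)

lemma carrier_HP: "carrier (HP n m) = (\<lambda>p. hcls n m (fst p) (snd p)) ` (carrier (G n) \<times> carrier (G m))"
  unfolding hat_prod_def carrier_FactGroup carrier_TP
proof (rule image_cong)
  fix p assume "p \<in> carrier (G n) \<times> carrier (G m)"
  then show "{\<one>\<^bsub>TP n m\<^esub>, (wz n, wz m)} #>\<^bsub>TP n m\<^esub> p = hcls n m (fst p) (snd p)"
    using hat_coset[of "fst p" n "snd p" m] by (simp add: mem_Times_iff)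
qed simp

lemma HP_cases:
  assumes "C \<in> carrier (HP n m)"
  obtains x y where "C = hcls n m x y" "x \<in> carrier (G n)" "y \<in> carrier (G m)"
  using assms unfolding carrier_HP by (elim imageE) (simp add: mem_Times_iff)

lemma hcls_closed [simp]: "x \<in> carrier (G n) \<Longrightarrow> y \<in> carrier (G m) \<Longrightarrow> hcls n m x y \<in> carrier (HP n m)"
  unfolding carrier_HP by (rule image_eqI[of _ _ "(x, y)"]) simp_all

lemma group_HP: "group (HP n m)"
  unfolding hat_prod_def by (rule normal.factorgroup_is_group[OF normal_hat])

lemma hat_mult:
  assumes "x \<in> carrier (G n)" "y \<in> carrier (G m)" "x' \<in> carrier (G n)" "y' \<in> carrier (G m)"
  shows "hcls n m x y \<otimes>\<^bsub>HP n m\<^esub> hcls n m x' y' =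
    hcls n m (gm n (wp n (par y * par x')) (gm n x x')) (gm m y y')"
  using normal.rcos_sum[OF normal_hat, of "(x, y)" n m "(x', y')"] assms
  by (simp add: hat_prod_def carrier_TP mult_TP hat_coset)

lemma hat_z_eq: "hat_z \<Gamma> n m = hcls n m (wz n) \<one>\<^bsub>G m\<^esub>"
  by (simp add: hat_z_def hat_coset)

lemma the_elem_hcls:
  "f (x, y) = f (gm n (wz n) x, gm m (wz m) y) \<Longrightarrow> the_elem (f ` hcls n m x y) = f (x, y)"
  by (simp add: hat_class_def)

lemma hat_embed_hcls:
  assumes "x \<in> carrier (G n)" "y \<in> carrier (G m)"
  shows "hat_embed \<Gamma> n m (hcls n m x y) = jx n m x y"
proof -
  have *: "(\<lambda>((g, t), (h, s)). (\<lambda>i\<in>{1..n+m}. if i \<le> n then g i else h (i - n),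
         spin_shift 0 (n+m) t \<otimes>\<^bsub>spin_sym (n+m)\<^esub> spin_shift n (n+m) s)) = (\<lambda>(x, y). jx n m x y)"
    by (auto simp: fun_eq_iff jx_def)
  have "jx n m x y = jx n m (gm n (wz n) x) (gm m (wz m) y)"
    using assms by (simp add: jx_wz wz_wz_mult)
  then show ?thesis unfolding hat_embed_def *
    using the_elem_hcls[of "\<lambda>(x, y). jx n m x y" x y n m] by simp
qed

lemma hat_embed_hom: "hat_embed \<Gamma> n m \<in> hom (HP n m) (G (n + m))"
proof (rule homI)
  fix C assume "C \<in> carrier (HP n m)"
  then show "hat_embed \<Gamma> n m C \<in> carrier (G (n + m))"
    by (elim HP_cases) (simp add: hat_embed_hcls)
next
  fix C D assume "C \<in> carrier (HP n m)" "D \<in> carrier (HP n m)"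
  then show "hat_embed \<Gamma> n m (C \<otimes>\<^bsub>HP n m\<^esub> D) =
      hat_embed \<Gamma> n m C \<otimes>\<^bsub>G (n + m)\<^esub> hat_embed \<Gamma> n m D"
    by (elim HP_cases) (simp add: hat_embed_hcls hat_mult jx_mult jx_wp)
qed

lemma inj_hat_embed: "inj_on (hat_embed \<Gamma> n m) (carrier (HP n m))"
proof (rule inj_onI)
  fix C D assume CD: "C \<in> carrier (HP n m)" "D \<in> carrier (HP n m)"
    and e: "hat_embed \<Gamma> n m C = hat_embed \<Gamma> n m D"
  obtain x y where x: "C = hcls n m x y" "x \<in> carrier (G n)" "y \<in> carrier (G m)"
    using CD(1) by (rule HP_cases)
  obtain x' y' where x': "D = hcls n m x' y'" "x' \<in> carrier (G n)" "y' \<in> carrier (G m)"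
    using CD(2) by (rule HP_cases)
  have "jx n m x y = jx n m x' y'" using e x x' by (simp add: hat_embed_hcls)
  from jx_inj[OF x(2,3) x'(2,3) this] show "C = D"
    unfolding x(1) x'(1) hat_class_def using x by (elim disjE conjE) (simp_all add: wz_wz_mult insert_commute)
qed

lemma order_HP: "2 * order (HP n m) = order (G n) * order (G m)"
proof -
  interpret T: group "TP n m" by (rule group_TP)
  let ?N = "{\<one>\<^bsub>TP n m\<^esub>, (wz n, wz m)}"
  have "card (rcosets\<^bsub>TP n m\<^esub> ?N) * card ?N = order (TP n m)"
    by (rule T.lagrange) (rule normal_imp_subgroup[OF normal_hat])
  moreover have "card ?N = 2" using wz_neq_one[of n] by (auto simp: one_TP card_insert_if)
  moreover have "order (TP n m) = order (G n) * order (G m)"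
    by (simp add: order_def carrier_TP card_cartesian_product)
  ultimately show ?thesis by (simp add: order_def hat_prod_def FactGroup_def)
qed

lemma hat_parity_hcls:
  assumes "x \<in> carrier (G n)" "y \<in> carrier (G m)"
  shows "hat_parity (hcls n m x y) = (par x + par y) mod 2"
  using assms the_elem_hcls[of "\<lambda>(x, y). (par x + par y) mod 2" x y n m] unfolding hat_parity_def
  by (auto simp: par_mult mod_simps)

lemma outer_prod_hcls:
  assumes "x \<in> carrier (G n)" "y \<in> carrier (G m)"
    and "f (gm n (wz n) x) = - f x" "g (gm m (wz m) y) = - g y"
  shows "outer_prod \<Gamma> n m f g (hcls n m x y) = (if par x = 0 \<and> par y = 0 then f x * g y else 0)"
  using assms par_range[of x n] par_range[of y m]
    the_elem_hcls[of "\<lambda>(x, y). if par x = 0 \<and> par y = 0 then f x * g y else 0" x y n m]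
  by (auto simp: outer_prod_def par_mult)

lemma hat_inverse:
  assumes "x \<in> carrier (G n)" "y \<in> carrier (G m)"
  obtains x' y' where "x' \<in> carrier (G n)" "y' \<in> carrier (G m)"
    "inv\<^bsub>HP n m\<^esub> (hcls n m x y) = hcls n m x' y'"
  using group.inv_closed[OF group_HP hcls_closed[OF assms]] by (elim HP_cases) (rule that)

subsection \<open>Spin super class functions\<close>

abbreviation RS where "RS n \<equiv> carrier (R_spin \<Gamma> n)"
abbreviation E where "E n \<equiv> {x \<in> carrier (G n). par x = 0}"

lemma finite_E [simp]: "finite (E n)"
  using finite_G by simp

text \<open>Conjugation and multiplication by \<open>z\<close> preserve parity, so all conditions
  can be tested on even elements. The conjugation is written in the form in which induction sums
  produce it.\<close>

lemma RS_iff: "f \<in> RS n \<longleftrightarrow> (\<forall>x. x \<notin> E n \<longrightarrow> f x = 0)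
    \<and> (\<forall>x\<in>E n. \<forall>s\<in>carrier (G n). f (gm n (inv\<^bsub>G n\<^esub> s) (gm n x s)) = f x)
    \<and> (\<forall>x\<in>E n. f (gm n (wz n) x) = - f x)"
proof -
  let ?A = "\<forall>x\<in>carrier (G n). \<forall>s\<in>carrier (G n). f (gm n (gm n s x) (inv\<^bsub>G n\<^esub> s)) = f x"
  let ?B = "\<forall>x\<in>E n. \<forall>s\<in>carrier (G n). f (gm n (inv\<^bsub>G n\<^esub> s) (gm n x s)) = f x"
  have 1: "?B" if ?A
  proof (intro ballI)
    fix x s assume "x \<in> E n" "s \<in> carrier (G n)"
    then show "f (gm n (inv\<^bsub>G n\<^esub> s) (gm n x s)) = f x"
      using that[rule_format, of x "inv\<^bsub>G n\<^esub> s"] by (simp add: W.m_assoc)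
  qed
  have 2: "?A" if v: "\<forall>x. x \<notin> E n \<longrightarrow> f x = 0" and B: ?B
  proof (intro ballI)
    fix x s assume x: "x \<in> carrier (G n)" "s \<in> carrier (G n)"
    show "f (gm n (gm n s x) (inv\<^bsub>G n\<^esub> s)) = f x"
    proof (cases "par x = 0")
      case True
      then show ?thesis using B[rule_format, of x "inv\<^bsub>G n\<^esub> s"] x by (simp add: W.m_assoc)
    next
      case False
      then have "par (gm n (gm n s x) (inv\<^bsub>G n\<^esub> s)) \<noteq> 0"
        using par_conj[of x n "inv\<^bsub>G n\<^esub> s"] x by simp
      then show ?thesis using v False by simp
    qed
  qed
  have 3: "(\<forall>x. x \<notin> carrier (G n) \<longrightarrow> f x = 0) \<and> (\<forall>x\<in>carrier (G n). par x = 1 \<longrightarrow> f x = 0)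
    \<longleftrightarrow> (\<forall>x. x \<notin> E n \<longrightarrow> f x = 0)" using par_range[of _ n] by force
  have 4: "\<forall>x\<in>carrier (G n). f (gm n (wz n) x) = - f x"
    if v: "\<forall>x. x \<notin> E n \<longrightarrow> f x = 0" and "\<forall>x\<in>E n. f (gm n (wz n) x) = - f x"
    using that par_range[of _ n] by (force simp: par_mult)
  show ?thesis
    unfolding R_spin_def super_cf_def using 1 2 3 4 by auto
qed

lemma RS_zero: "f \<in> RS n \<Longrightarrow> x \<notin> E n \<Longrightarrow> f x = 0"
  by (simp add: RS_iff)

lemma RS_conj: "f \<in> RS n \<Longrightarrow> x \<in> carrier (G n) \<Longrightarrow> s \<in> carrier (G n) \<Longrightarrow>
    f (gm n (inv\<^bsub>G n\<^esub> s) (gm n x s)) = f x"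
  using par_conj[of x n s] unfolding RS_iff by (cases "x \<in> E n") (auto simp: W.m_assoc)

lemma RS_wz: "f \<in> RS n \<Longrightarrow> x \<in> carrier (G n) \<Longrightarrow> f (gm n (wz n) x) = - f x"
  using par_range[of x n] unfolding RS_iff by (cases "x \<in> E n") (auto simp: par_mult)

lemma RS_wp: "f \<in> RS n \<Longrightarrow> x \<in> carrier (G n) \<Longrightarrow> f (gm n (wp n e) x) = (if even e then 1 else -1) * f x"
  by (simp add: wpow_def RS_wz)

lemma RS_sum: "(\<And>i. i \<in> I \<Longrightarrow> f i \<in> RS n) \<Longrightarrow> (\<lambda>x. \<Sum>i\<in>I. c i * f i x) \<in> RS n"
  by (simp add: RS_iff sum_negf)

text \<open>If \<open>y\<close> is odd too, conjugating by the first part alone multiplies the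
  juxtaposition by \<open>z\<close>, because the odd \<open>y\<close> passes the odd
  \<open>x\<close>; a class function that changes sign under \<open>z\<close> then equals its own
  negative. If \<open>y\<close> is even, the juxtaposition is odd.\<close>

lemma RS_jx_odd:
  assumes f: "f \<in> RS (n + m)" and x: "x \<in> carrier (G n)" "y \<in> carrier (G m)" "par x = 1"
  shows "f (jx n m x y) = 0"
proof (cases "par y = 1")
  case True
  let ?s = "jx n m x \<one>\<^bsub>G m\<^esub>" and ?J = "jx n m x y"
  have "gm (n + m) ?J ?s = gm (n + m) (wz (n + m)) (jx n m (gm n x x) y)"
    using jx_mult[of x n y m x "\<one>\<^bsub>G m\<^esub>"] x True by (simp add: wz_wp)
  also have "jx n m (gm n x x) y = gm (n + m) ?s ?J"
    using jx_mult[of x n "\<one>\<^bsub>G m\<^esub>" m x y] x by simp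
  finally have "gm (n + m) (inv\<^bsub>G (n+m)\<^esub> ?s) (gm (n + m) ?J ?s) = gm (n + m) (wz (n + m)) ?J"
    using x W.m_assoc[of "inv\<^bsub>G (n+m)\<^esub> ?s" "n + m" ?s ?J]
      wz_left[of "inv\<^bsub>G (n+m)\<^esub> ?s" "n + m" "gm (n + m) ?s ?J"] by simp
  then have "f ?J = - f ?J" using RS_conj[OF f, of ?J ?s] RS_wz[OF f, of ?J] x by simp
  then show ?thesis by simp
next
  case False
  then have "?thesis \<longleftrightarrow> True" using RS_zero[OF f] x par_range[OF x(2)] by simp
  then show ?thesis by simp
qed

end

section \<open>Products of class functions\<close>

lemma bij_extension:
  fixes A :: "nat set"
  assumes "A \<subseteq> {1..k}"
  obtains p where "p permutes {1..k}" "p ` {1..card A} = A"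
proof -
  have fA: "finite A" using assms finite_subset by blast
  have c: "card A \<le> k" using card_mono[OF _ assms] by simp
  obtain f where f: "bij_betw f {1..card A} A"
    using finite_same_card_bij[of "{1..card A}" A] fA by auto
  have "card ({1..k} - A) = k - card A" using card_Diff_subset[OF fA assms] by simp
  then obtain g where g: "bij_betw g {card A + 1..k} ({1..k} - A)"
    using finite_same_card_bij[of "{card A + 1..k}" "{1..k} - A"] by auto
  define p where "p i = (if i \<in> {1..card A} then f i else if i \<in> {card A + 1..k} then g i else i)" for i
  have "bij_betw p {1..card A} A" using f by (rule bij_betw_cong[THEN iffD1, rotated]) (simp add: p_def)
  moreover have "bij_betw p {card A + 1..k} ({1..k} - A)"
    using g by (rule bij_betw_cong[THEN iffD1, rotated]) (simp add: p_def)
  ultimately have "bij_betw p ({1..card A} \<union> {card A + 1..k}) (A \<union> ({1..k} - A))"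
    by (rule bij_betw_combine) auto
  moreover have "{1..card A} \<union> {card A + 1..k} = {1..k}" "A \<union> ({1..k} - A) = {1..k}" using c assms by auto
  ultimately have "bij_betw p {1..k} {1..k}" by simp
  then have "p permutes {1..k}"
    by (rule bij_imp_permutes) (use c in \<open>auto simp: p_def\<close>)
  moreover have "p ` {1..card A} = A" using \<open>bij_betw p {1..card A} A\<close> by (simp add: bij_betw_def)
  ultimately show thesis by (rule that)
qed

context finite_base
begin

text \<open>The order of the centraliser if \<open>w\<close> and \<open>v\<close> are conjugate, and
  zero otherwise. It serves as the integral kernel of induction.\<close>

definition conj_count :: "nat \<Rightarrow> 'a wr \<Rightarrow> 'a wr \<Rightarrow> complex" where
  "conj_count n w v = of_nat (card {s \<in> carrier (G n). gm n (inv\<^bsub>G n\<^esub> s) (gm n w s) = v})"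

text \<open>The factor \<open>1/2\<close> accounts for the two preimages \<open>(x, y)\<close> and \<open>(z x, z y)\<close>.\<close>

definition outer_ext :: "nat \<Rightarrow> nat \<Rightarrow> ('a wr \<Rightarrow> complex) \<Rightarrow> ('a wr \<Rightarrow> complex) \<Rightarrow> 'a wr \<Rightarrow> complex" where
  "outer_ext n m f g v = (\<Sum>x\<in>E n. \<Sum>y\<in>E m. if jx n m x y = v then f x * g y else 0) / 2"

definition ind_prod :: "nat \<Rightarrow> nat \<Rightarrow> ('a wr \<Rightarrow> complex) \<Rightarrow> ('a wr \<Rightarrow> complex) \<Rightarrow> 'a wr \<Rightarrow> complex" where
  "ind_prod n m f g w = (if w \<in> carrier (G (n + m)) then
     (\<Sum>s\<in>carrier (G (n + m)). outer_ext n m f g (gm (n + m) (inv\<^bsub>G (n+m)\<^esub> s) (gm (n + m) w s)))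
       / of_nat (order (HP n m)) else 0)"

lemma jx_even_unique:
  assumes "jx n m x y = jx n m x' y'" "x \<in> carrier (G n)" "y \<in> carrier (G m)"
    "x' \<in> carrier (G n)" "y' \<in> carrier (G m)"
  shows "par x = par x'" "par y = par y'"
proof -
  have "par x = par x' \<and> par y = par y'"
    using jx_inj[OF assms(2-5,1)]
  proof (elim disjE conjE)
    assume "x' = gm n (wz n) x" "y' = gm m (wz m) y"
    then show ?thesis using assms(2,3) par_range[of x n] par_range[of y m] by (auto simp: par_mult)
  qed simp
  then show "par x = par x'" "par y = par y'" by auto
qed

lemma outer_ext_jx:
  assumes "f \<in> RS n" "g \<in> RS m" and x: "x \<in> E n" and y: "y \<in> E m"
  shows "outer_ext n m f g (jx n m x y) = f x * g y"
proof -
  let ?x = "gm n (wz n) x" and ?y = "gm m (wz m) y"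
  have c: "x \<in> carrier (G n)" "y \<in> carrier (G m)" using x y by auto
  have E: "?x \<in> E n" "?y \<in> E m" using x y by (auto simp: par_mult)
  have e: "jx n m ?x ?y = jx n m x y" using c by (simp add: jx_wz wz_wz_mult)
  have u: "jx n m x' y' = jx n m x y \<longleftrightarrow> (x', y') = (x, y) \<or> (x', y') = (?x, ?y)"
    if "x' \<in> E n" "y' \<in> E m" for x' y'
    using jx_inj[of x n y m x' y'] that c e by auto
  have ne: "(x, y) \<noteq> (?x, ?y)" using wz_mult_neq[OF c(1)] by auto
  have "(\<Sum>x'\<in>E n. \<Sum>y'\<in>E m. if jx n m x' y' = jx n m x y then f x' * g y' else 0) =
     (\<Sum>p\<in>E n \<times> E m. if p = (x, y) \<or> p = (?x, ?y) then f (fst p) * g (snd p) else 0)"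
    unfolding sum.cartesian_product by (rule sum.cong) (use u in \<open>auto split: prod.splits\<close>)
  also have "\<dots> = (\<Sum>p\<in>{(x, y), (?x, ?y)}. f (fst p) * g (snd p))"
    by (rule sum.mono_neutral_cong_right) (use x y E in auto)
  also have "\<dots> = 2 * (f x * g y)"
    using ne RS_wz[OF assms(1) c(1)] RS_wz[OF assms(2) c(2)] by simp
  finally show ?thesis by (simp add: outer_ext_def)
qed

lemma outer_ext_zero:
  assumes "\<And>x y. x \<in> E n \<Longrightarrow> y \<in> E m \<Longrightarrow> v \<noteq> jx n m x y"
  shows "outer_ext n m f g v = 0"
proof -
  have "(if jx n m x y = v then f x * g y else 0) = 0" if "x \<in> E n" "y \<in> E m" for x y
    using assms[OF that] by simp
  then show ?thesis unfolding outer_ext_def by (simp add: sum.neutral)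
qed

lemma outer_ext_odd:
  assumes "x \<in> carrier (G n)" "y \<in> carrier (G m)" "par x \<noteq> 0 \<or> par y \<noteq> 0"
  shows "outer_ext n m f g (jx n m x y) = 0"
  using assms jx_even_unique[of n m x y] by (intro outer_ext_zero) force

lemma outer_ext_wp:
  assumes fg: "f \<in> RS n" "g \<in> RS m" and v: "v \<in> carrier (G (n + m))"
  shows "outer_ext n m f g (gm (n + m) (wp (n + m) e) v) = (if even e then 1 else -1) * outer_ext n m f g v"
proof (cases "\<exists>x\<in>E n. \<exists>y\<in>E m. v = jx n m x y")
  case True
  then obtain x y where x: "x \<in> E n" "y \<in> E m" "v = jx n m x y" by blast
  have "gm (n + m) (wp (n + m) e) v = jx n m (gm n (wp n e) x) y" using x by (simp add: jx_wp)
  moreover have "gm n (wp n e) x \<in> E n" using x by (simp add: par_mult)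
  ultimately show ?thesis using x by (simp add: outer_ext_jx[OF fg] RS_wp[OF fg(1)])
next
  case False
  have "gm (n + m) (wp (n + m) e) v \<noteq> jx n m x y" if "x \<in> E n" "y \<in> E m" for x y
  proof
    assume a: "gm (n + m) (wp (n + m) e) v = jx n m x y"
    have "v = gm (n + m) (wp (n + m) (e + e)) v" using v by simp
    also have "\<dots> = gm (n + m) (wp (n + m) e) (gm (n + m) (wp (n + m) e) v)" using wp_wp[OF v] by simp
    also have "\<dots> = jx n m (gm n (wp n e) x) y" using that by (simp add: a jx_wp)
    finally have "v = jx n m (gm n (wp n e) x) y" .
    moreover have "gm n (wp n e) x \<in> E n" using that by (simp add: par_mult)
    ultimately show False using False that by blast
  qed
  then have "outer_ext n m f g (gm (n + m) (wp (n + m) e) v) = 0"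
    by (rule outer_ext_zero)
  moreover have "outer_ext n m f g v = 0" by (rule outer_ext_zero) (use False in blast)
  ultimately show ?thesis by (simp only: mult_zero_right)
qed

lemma conj_conj:
  assumes "v \<in> carrier (G n)" "s \<in> carrier (G n)" "t \<in> carrier (G n)"
  shows "gm n (inv\<^bsub>G n\<^esub> t) (gm n (gm n (inv\<^bsub>G n\<^esub> s) (gm n v s)) t) =
    gm n (inv\<^bsub>G n\<^esub> (gm n s t)) (gm n v (gm n s t))"
  using assms by (simp add: W.inv_mult_group W.m_assoc)

lemma conj_inv_conj:
  assumes "v \<in> carrier (G n)" "s \<in> carrier (G n)"
  shows "gm n s (gm n (gm n (inv\<^bsub>G n\<^esub> s) (gm n v s)) (inv\<^bsub>G n\<^esub> s)) = v"
  using conj_conj[of v n s "inv\<^bsub>G n\<^esub> s"] assms by simp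

lemma outer_ext_conj:
  assumes fg: "f \<in> RS n" "g \<in> RS m" and v: "v \<in> carrier (G (n + m))"
    and st: "s \<in> carrier (G n)" "t \<in> carrier (G m)"
  shows "outer_ext n m f g (gm (n + m) (inv\<^bsub>G (n+m)\<^esub> (jx n m s t)) (gm (n + m) v (jx n m s t)))
    = outer_ext n m f g v"
proof (cases "\<exists>x\<in>E n. \<exists>y\<in>E m. v = jx n m x y")
  case True
  then obtain x y where x: "x \<in> E n" "y \<in> E m" "v = jx n m x y" by blast
  let ?x = "gm n (inv\<^bsub>G n\<^esub> s) (gm n x s)" and ?y = "gm m (inv\<^bsub>G m\<^esub> t) (gm m y t)"
  have "gm (n + m) (inv\<^bsub>G (n+m)\<^esub> (jx n m s t)) (gm (n + m) v (jx n m s t)) = jx n m ?x ?y"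
    using jx_conj[of x n y m s t] x st by simp
  moreover have "?x \<in> E n" "?y \<in> E m" using x st par_conj[of x n s] par_conj[of y m t] by (auto simp: W.m_assoc)
  ultimately show ?thesis using x st fg by (simp add: outer_ext_jx[OF fg] RS_conj)
next
  case False
  let ?J = "jx n m s t"
  have "gm (n + m) (inv\<^bsub>G (n+m)\<^esub> ?J) (gm (n + m) v ?J) \<noteq> jx n m x y" if "x \<in> E n" "y \<in> E m" for x y
  proof
    assume a: "gm (n + m) (inv\<^bsub>G (n+m)\<^esub> ?J) (gm (n + m) v ?J) = jx n m x y"
    let ?s = "inv\<^bsub>G n\<^esub> s" and ?t = "inv\<^bsub>G m\<^esub> t"
    let ?J' = "jx n m ?s ?t"
    \<comment> \<open>The juxtaposition of the inverses inverts \<open>?J\<close> only up to a power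
      of \<open>z\<close>; this power is central and drops out of conjugations.\<close>
    have "gm (n + m) ?J ?J' = wp (n + m) (par t * par s)"
      using jx_mult[of s n t m ?s ?t] st by (simp add: par_inv jx_one)
    then have i: "gm (n + m) (inv\<^bsub>G (n+m)\<^esub> (gm (n + m) ?J ?J')) (gm (n + m) v (gm (n + m) ?J ?J')) = v"
      using v by (simp add: wp_commute W.m_assoc[symmetric])
    have "v = gm (n + m) (inv\<^bsub>G (n+m)\<^esub> ?J') (gm (n + m) (jx n m x y) ?J')"
      unfolding a[symmetric] using conj_conj[of v "n + m" ?J ?J'] i v st by simp
    also have "\<dots> = jx n m (gm n (inv\<^bsub>G n\<^esub> ?s) (gm n x ?s)) (gm m (inv\<^bsub>G m\<^esub> ?t) (gm m y ?t))"
      using that st by (intro jx_conj) auto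
    finally have "v = jx n m (gm n (inv\<^bsub>G n\<^esub> ?s) (gm n x ?s)) (gm m (inv\<^bsub>G m\<^esub> ?t) (gm m y ?t))" .
    moreover have "gm n (inv\<^bsub>G n\<^esub> ?s) (gm n x ?s) \<in> E n" "gm m (inv\<^bsub>G m\<^esub> ?t) (gm m y ?t) \<in> E m"
      using that st par_conj[of x n ?s] par_conj[of y m ?t] by (auto simp: W.m_assoc)
    ultimately show False using False by blast
  qed
  then have "outer_ext n m f g (gm (n + m) (inv\<^bsub>G (n+m)\<^esub> ?J) (gm (n + m) v ?J)) = 0"
    by (rule outer_ext_zero)
  moreover have "outer_ext n m f g v = 0" by (rule outer_ext_zero) (use False in blast)
  ultimately show ?thesis by (simp only: mult_zero_right)
qed

text \<open>Extending the outer product by zero to the whole group absorbs the summation condition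
  in \<open>cf_ind\<close> and hides the choice made by \<open>inv_into\<close>.\<close>

lemma cf_ind_outer_prod:
  assumes fg: "f \<in> RS n" "g \<in> RS m"
  shows "cf_ind (HP n m) (G (n + m)) (hat_embed \<Gamma> n m) (outer_prod \<Gamma> n m f g) = ind_prod n m f g"
proof
  fix w
  let ?i = "hat_embed \<Gamma> n m" and ?H = "carrier (HP n m)" and ?F = "outer_prod \<Gamma> n m f g"
  have 1: "?F (inv_into ?H ?i v) = outer_ext n m f g v" if v: "v \<in> ?i ` ?H" for v
  proof -
    obtain C where C: "C \<in> ?H" "v = ?i C" using v by blast
    then obtain x y where x: "C = hcls n m x y" "x \<in> carrier (G n)" "y \<in> carrier (G m)"
      by (elim HP_cases)
    have v: "v = jx n m x y" using C x by (simp add: hat_embed_hcls)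
    have "inv_into ?H ?i v = C" using C inv_into_f_f[OF inj_hat_embed] by simp
    moreover have "?F C = (if par x = 0 \<and> par y = 0 then f x * g y else 0)"
      unfolding x(1) using x fg by (intro outer_prod_hcls) (auto simp: RS_wz)
    moreover have "outer_ext n m f g v = (if par x = 0 \<and> par y = 0 then f x * g y else 0)"
      unfolding v using x outer_ext_jx[OF fg] outer_ext_odd[of x n y m f g] by auto
    ultimately show ?thesis by simp
  qed
  have 2: "outer_ext n m f g v = 0" if v: "v \<notin> ?i ` ?H" for v
  proof (rule outer_ext_zero)
    fix x y assume "x \<in> E n" "y \<in> E m"
    then have "jx n m x y = ?i (hcls n m x y)" "hcls n m x y \<in> ?H" by (simp_all add: hat_embed_hcls)
    then show "v \<noteq> jx n m x y" using v by auto
  qed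
  show "cf_ind (HP n m) (G (n + m)) ?i ?F w = ind_prod n m f g w"
  proof (cases "w \<in> carrier (G (n + m))")
    case True
    let ?c = "\<lambda>s. gm (n + m) (gm (n + m) (inv\<^bsub>G (n+m)\<^esub> s) w) s"
    have "(\<Sum>s | s \<in> carrier (G (n + m)) \<and> ?c s \<in> ?i ` ?H. ?F (inv_into ?H ?i (?c s))) =
       (\<Sum>s\<in>carrier (G (n + m)). outer_ext n m f g (?c s))"
      by (rule sum.mono_neutral_cong_left) (auto simp: finite_G 1 2)
    also have "\<dots> = (\<Sum>s\<in>carrier (G (n + m)). outer_ext n m f g (gm (n + m) (inv\<^bsub>G (n+m)\<^esub> s) (gm (n + m) w s)))"
      using True by (intro sum.cong) (auto simp: W.m_assoc)
    finally show ?thesis using True by (simp add: cf_ind_def ind_prod_def)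
  next
    case False then show ?thesis by (simp add: cf_ind_def ind_prod_def)
  qed
qed

lemma sum_translate:
  assumes "r \<in> carrier (G n)"
  shows "(\<Sum>s\<in>carrier (G n). h (gm n r s)) = (\<Sum>s\<in>carrier (G n). h s :: complex)"
  by (rule sum.reindex_bij_witness[of _ "\<lambda>s. gm n (inv\<^bsub>G n\<^esub> r) s" "\<lambda>s. gm n r s"])
    (use assms in \<open>auto simp: W.m_assoc[symmetric]\<close>)

lemma ind_prod_closed:
  assumes fg: "f \<in> RS n" "g \<in> RS m"
  shows "ind_prod n m f g \<in> RS (n + m)"
  unfolding RS_iff
proof (intro conjI allI impI ballI)
  let ?N = "n + m"
  fix x assume x: "x \<notin> E ?N"
  show "ind_prod n m f g x = 0"
  proof (cases "x \<in> carrier (G ?N)")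
    case True
    have "outer_ext n m f g (gm ?N (inv\<^bsub>G ?N\<^esub> s) (gm ?N x s)) = 0" if s: "s \<in> carrier (G ?N)" for s
    proof (rule outer_ext_zero)
      fix a b assume ab: "a \<in> E n" "b \<in> E m"
      have "par (gm ?N (inv\<^bsub>G ?N\<^esub> s) (gm ?N x s)) \<noteq> 0"
        using par_conj[of x ?N s] True x s by (simp add: W.m_assoc)
      moreover have "par (jx n m a b) = 0" using ab by simp
      ultimately show "gm ?N (inv\<^bsub>G ?N\<^esub> s) (gm ?N x s) \<noteq> jx n m a b" by metis
    qed
    then show ?thesis by (simp add: ind_prod_def)
  qed (simp add: ind_prod_def)
next
  let ?N = "n + m"
  fix x r assume x: "x \<in> E ?N" and r: "r \<in> carrier (G ?N)"
  have "(\<Sum>s\<in>carrier (G ?N). outer_ext n m f g (gm ?N (inv\<^bsub>G ?N\<^esub> s) (gm ?N (gm ?N (inv\<^bsub>G ?N\<^esub> r) (gm ?N x r)) s)))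
      = (\<Sum>s\<in>carrier (G ?N). outer_ext n m f g (gm ?N (inv\<^bsub>G ?N\<^esub> (gm ?N r s)) (gm ?N x (gm ?N r s))))"
    using x r by (intro sum.cong) (auto simp: conj_conj)
  also have "\<dots> = (\<Sum>s\<in>carrier (G ?N). outer_ext n m f g (gm ?N (inv\<^bsub>G ?N\<^esub> s) (gm ?N x s)))"
    by (rule sum_translate[OF r])
  finally show "ind_prod n m f g (gm ?N (inv\<^bsub>G ?N\<^esub> r) (gm ?N x r)) = ind_prod n m f g x"
    using x r by (simp add: ind_prod_def)
next
  let ?N = "n + m"
  fix x assume x: "x \<in> E ?N"
  have "outer_ext n m f g (gm ?N (inv\<^bsub>G ?N\<^esub> s) (gm ?N (gm ?N (wz ?N) x) s)) =
      - outer_ext n m f g (gm ?N (inv\<^bsub>G ?N\<^esub> s) (gm ?N x s))" if s: "s \<in> carrier (G ?N)" for s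
  proof -
    have "gm ?N (inv\<^bsub>G ?N\<^esub> s) (gm ?N (gm ?N (wz ?N) x) s) = gm ?N (wp ?N 1) (gm ?N (inv\<^bsub>G ?N\<^esub> s) (gm ?N x s))"
      using x s wz_left[of "inv\<^bsub>G ?N\<^esub> s" ?N "gm ?N x s"] by (simp add: W.m_assoc wz_wp)
    then show ?thesis using outer_ext_wp[OF fg, of "gm ?N (inv\<^bsub>G ?N\<^esub> s) (gm ?N x s)" 1] x s by simp
  qed
  then show "ind_prod n m f g (gm ?N (wz ?N) x) = - ind_prod n m f g x"
    using x by (simp add: ind_prod_def sum_negf)
qed

subsection \<open>Associativity\<close>

text \<open>A form that is visibly bilinear and symmetric in its treatment of the two factors. Since
  \<open>order_HP\<close> counts each class of the twisted product as two pairs, the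
  \<open>1/2\<close> of \<open>outer_ext\<close> turns the denominator into the product of the two
  orders.\<close>

lemma ind_prod_conj_count:
  assumes "w \<in> carrier (G (n + m))"
  shows "ind_prod n m f g w = (\<Sum>x\<in>E n. \<Sum>y\<in>E m. f x * g y * conj_count (n + m) w (jx n m x y))
    / (of_nat (order (G n)) * of_nat (order (G m)))"
proof -
  let ?N = "n + m" and ?c = "\<lambda>s. gm (n + m) (inv\<^bsub>G (n+m)\<^esub> s) (gm (n + m) w s)"
  have "(\<Sum>s\<in>carrier (G ?N). outer_ext n m f g (?c s)) =
      (\<Sum>s\<in>carrier (G ?N). \<Sum>x\<in>E n. \<Sum>y\<in>E m. if jx n m x y = ?c s then f x * g y else 0) / 2"
    by (simp add: outer_ext_def sum_divide_distrib)
  also have "(\<Sum>s\<in>carrier (G ?N). \<Sum>x\<in>E n. \<Sum>y\<in>E m. if jx n m x y = ?c s then f x * g y else 0) =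
      (\<Sum>x\<in>E n. \<Sum>y\<in>E m. \<Sum>s\<in>carrier (G ?N). if jx n m x y = ?c s then f x * g y else 0)"
    by (subst sum.swap, rule sum.cong[OF HOL.refl], subst sum.swap) simp
  also have "\<dots> = (\<Sum>x\<in>E n. \<Sum>y\<in>E m. f x * g y * conj_count ?N w (jx n m x y))"
  proof (intro sum.cong HOL.refl)
    fix x y
    have "(\<Sum>s\<in>carrier (G ?N). if jx n m x y = ?c s then f x * g y else 0) =
        (\<Sum>s | s \<in> carrier (G ?N) \<and> ?c s = jx n m x y. f x * g y)"
      by (rule sum.mono_neutral_cong_right) (auto simp: finite_G)
    then show "(\<Sum>s\<in>carrier (G ?N). if jx n m x y = ?c s then f x * g y else 0) =
        f x * g y * conj_count ?N w (jx n m x y)"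
      by (simp add: conj_count_def mult.commute)
  qed
  finally have *: "(\<Sum>s\<in>carrier (G ?N). outer_ext n m f g (?c s)) =
    (\<Sum>x\<in>E n. \<Sum>y\<in>E m. f x * g y * conj_count ?N w (jx n m x y)) / 2" .
  have "of_nat (order (G n)) * of_nat (order (G m)) = (2 * of_nat (order (HP n m)) :: complex)"
    using order_HP[of n m] by (metis of_nat_mult of_nat_numeral)
  then show ?thesis using assms unfolding ind_prod_def * by simp
qed

text \<open>Every \<open>s\<close> contributes exactly one \<open>u\<close>, the conjugate of
  \<open>v\<close> by the inverse of \<open>s\<close>, and \<open>K\<close> takes the same value
  there. This formula eliminates the intermediate group in an iterated induction.\<close>

lemma sum_conj_count:
  assumes v: "v \<in> E n" and K: "\<And>u s. u \<in> E n \<Longrightarrow> s \<in> carrier (G n) \<Longrightarrow> K (gm n (inv\<^bsub>G n\<^esub> s) (gm n u s)) = K u"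
  shows "(\<Sum>u\<in>E n. conj_count n u v * K u) = of_nat (order (G n)) * K v"
proof -
  have "(\<Sum>u\<in>E n. conj_count n u v * K u) =
      (\<Sum>u\<in>E n. \<Sum>s\<in>carrier (G n). if gm n (inv\<^bsub>G n\<^esub> s) (gm n u s) = v then K u else 0)"
  proof (rule sum.cong[OF HOL.refl])
    fix u
    have "(\<Sum>s\<in>carrier (G n). if gm n (inv\<^bsub>G n\<^esub> s) (gm n u s) = v then K u else 0) =
        (\<Sum>s | s \<in> carrier (G n) \<and> gm n (inv\<^bsub>G n\<^esub> s) (gm n u s) = v. K u)"
      by (rule sum.mono_neutral_cong_right) (auto simp: finite_G)
    then show "conj_count n u v * K u =
        (\<Sum>s\<in>carrier (G n). if gm n (inv\<^bsub>G n\<^esub> s) (gm n u s) = v then K u else 0)"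
      by (simp add: conj_count_def)
  qed
  also have "\<dots> = (\<Sum>s\<in>carrier (G n). \<Sum>u\<in>E n. if gm n (inv\<^bsub>G n\<^esub> s) (gm n u s) = v then K u else 0)"
    by (rule sum.swap)
  also have "\<dots> = (\<Sum>s\<in>carrier (G n). K v)"
  proof (rule sum.cong[OF HOL.refl])
    fix s assume s: "s \<in> carrier (G n)"
    let ?u = "gm n s (gm n v (inv\<^bsub>G n\<^esub> s))"
    have vc: "v \<in> carrier (G n)" using v by simp
    have u: "?u \<in> E n" using v s par_conj[of v n "inv\<^bsub>G n\<^esub> s"] by (simp add: W.m_assoc)
    have uv: "gm n (inv\<^bsub>G n\<^esub> s) (gm n ?u s) = v" using vc s by (simp add: W.m_assoc) (simp add: W.m_assoc[symmetric])
    have "gm n (inv\<^bsub>G n\<^esub> s) (gm n u s) = v \<longleftrightarrow> u = ?u" if "u \<in> E n" for u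
      using that s uv conj_inv_conj[of u n s] vc by (auto simp: W.m_assoc)
    then have "(\<Sum>u\<in>E n. if gm n (inv\<^bsub>G n\<^esub> s) (gm n u s) = v then K u else 0) =
        (\<Sum>u\<in>E n. if u = ?u then K u else 0)" by (intro sum.cong) auto
    also have "\<dots> = K ?u" using u by simp
    also have "\<dots> = K v" using K[OF u s] uv by simp
    finally show "(\<Sum>u\<in>E n. if gm n (inv\<^bsub>G n\<^esub> s) (gm n u s) = v then K u else 0) = K v" .
  qed
  also have "\<dots> = of_nat (order (G n)) * K v" by (simp add: order_def)
  finally show ?thesis .
qed

lemma conj_count_conj:
  assumes w: "w \<in> carrier (G n)" and v: "v \<in> carrier (G n)" and r: "r \<in> carrier (G n)"
  shows "conj_count n w (gm n (inv\<^bsub>G n\<^esub> r) (gm n v r)) = conj_count n w v"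
proof -
  have "bij_betw (\<lambda>s. gm n s r) {s \<in> carrier (G n). gm n (inv\<^bsub>G n\<^esub> s) (gm n w s) = v}
    {s \<in> carrier (G n). gm n (inv\<^bsub>G n\<^esub> s) (gm n w s) = gm n (inv\<^bsub>G n\<^esub> r) (gm n v r)}"
  proof (rule bij_betwI[where g = "\<lambda>s. gm n s (inv\<^bsub>G n\<^esub> r)"])
    show "(\<lambda>s. gm n s r) \<in> {s \<in> carrier (G n). gm n (inv\<^bsub>G n\<^esub> s) (gm n w s) = v} \<rightarrow>
      {s \<in> carrier (G n). gm n (inv\<^bsub>G n\<^esub> s) (gm n w s) = gm n (inv\<^bsub>G n\<^esub> r) (gm n v r)}"
      using w r by (auto simp: conj_conj[symmetric])
    show "(\<lambda>s. gm n s (inv\<^bsub>G n\<^esub> r)) \<in>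
      {s \<in> carrier (G n). gm n (inv\<^bsub>G n\<^esub> s) (gm n w s) = gm n (inv\<^bsub>G n\<^esub> r) (gm n v r)} \<rightarrow>
      {s \<in> carrier (G n). gm n (inv\<^bsub>G n\<^esub> s) (gm n w s) = v}"
    proof
      fix s assume "s \<in> {s \<in> carrier (G n). gm n (inv\<^bsub>G n\<^esub> s) (gm n w s) = gm n (inv\<^bsub>G n\<^esub> r) (gm n v r)}"
      then have s: "s \<in> carrier (G n)" "gm n (inv\<^bsub>G n\<^esub> s) (gm n w s) = gm n (inv\<^bsub>G n\<^esub> r) (gm n v r)" by auto
      have "gm n (inv\<^bsub>G n\<^esub> (gm n s (inv\<^bsub>G n\<^esub> r))) (gm n w (gm n s (inv\<^bsub>G n\<^esub> r))) = v"
        using conj_conj[of w n s "inv\<^bsub>G n\<^esub> r"] conj_inv_conj[of v n r] w v r s by simp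
      then show "gm n s (inv\<^bsub>G n\<^esub> r) \<in> {s \<in> carrier (G n). gm n (inv\<^bsub>G n\<^esub> s) (gm n w s) = v}"
        using s r by simp
    qed
  qed (use r in \<open>auto simp: W.m_assoc\<close>)
  from bij_betw_same_card[OF this] show ?thesis unfolding conj_count_def by (simp only:)
qed

lemma order_G_neq_0 [simp]: "order (G n) \<noteq> 0"
  using W.order_gt_0_iff_finite[of n] finite_G[of n] by simp

text \<open>Transitivity of induction. Both sides reduce to one sum over triples of even elements
  weighted by \<open>conj_count\<close> at the triple juxtaposition, once
  \<open>sum_conj_count\<close> has removed the inner induction together with the order of the
  intermediate group.\<close>

lemma ind_prod_assoc:
  assumes f: "f \<in> RS n" and g: "g \<in> RS m" and h: "h \<in> RS l"
  shows "ind_prod (n + m) l (ind_prod n m f g) h = ind_prod n (m + l) f (ind_prod m l g h)"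
proof
  fix w
  let ?N = "n + m + l"
  let ?o = "\<lambda>n. of_nat (order (G n)) :: complex"
  show "ind_prod (n + m) l (ind_prod n m f g) h w = ind_prod n (m + l) f (ind_prod m l g h) w"
  proof (cases "w \<in> carrier (G ?N)")
    case True
    then have w': "w \<in> carrier (G (n + (m + l)))" by (simp add: add.assoc)
    define c where "c a b y = conj_count ?N w (jx (n + m) l (jx n m a b) y)" for a b y
    have L: "(\<Sum>u\<in>E (n + m). ind_prod n m f g u * h y * conj_count ?N w (jx (n + m) l u y)) =
       h y * (\<Sum>a\<in>E n. \<Sum>b\<in>E m. f a * g b * c a b y) * ?o (n + m) / (?o n * ?o m)" if y: "y \<in> E l" for y
    proof -
      \<comment> \<open>Conjugating \<open>u\<close> amounts to conjugating the juxtaposition by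
        \<open>s\<close> next to the identity, so the weight is a class function of
        \<open>u\<close>, as \<open>sum_conj_count\<close> requires.\<close>
      have K: "conj_count ?N w (jx (n + m) l (gm (n + m) (inv\<^bsub>G (n+m)\<^esub> s) (gm (n + m) u s)) y) =
          conj_count ?N w (jx (n + m) l u y)" if "u \<in> E (n + m)" "s \<in> carrier (G (n + m))" for u s
        using conj_count_conj[OF True, of "jx (n + m) l u y" "jx (n + m) l s \<one>\<^bsub>G l\<^esub>"]
          jx_conj[of u "n + m" y l s "\<one>\<^bsub>G l\<^esub>"] that y by simp
      have "(\<Sum>u\<in>E (n + m). ind_prod n m f g u * h y * conj_count ?N w (jx (n + m) l u y)) =
        (\<Sum>u\<in>E (n + m). (\<Sum>a\<in>E n. \<Sum>b\<in>E m. h y * (f a * g b) * (conj_count (n + m) u (jx n m a b) *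
           conj_count ?N w (jx (n + m) l u y)))) / (?o n * ?o m)"
        unfolding sum_divide_distrib[symmetric]
        by (subst sum_divide_distrib, intro sum.cong HOL.refl)
          (simp add: ind_prod_conj_count sum_distrib_left sum_distrib_right mult_ac)
      also have "(\<Sum>u\<in>E (n + m). (\<Sum>a\<in>E n. \<Sum>b\<in>E m. h y * (f a * g b) * (conj_count (n + m) u (jx n m a b) *
           conj_count ?N w (jx (n + m) l u y)))) =
         (\<Sum>a\<in>E n. \<Sum>b\<in>E m. \<Sum>u\<in>E (n + m). h y * (f a * g b) * (conj_count (n + m) u (jx n m a b) *
           conj_count ?N w (jx (n + m) l u y)))"
        by (subst sum.swap, rule sum.cong[OF HOL.refl], subst sum.swap) simp
      also have "\<dots> = (\<Sum>a\<in>E n. \<Sum>b\<in>E m. h y * (f a * g b) * (?o (n + m) * c a b y))"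
      proof (intro sum.cong HOL.refl)
        fix a b assume "a \<in> E n" "b \<in> E m"
        then have "jx n m a b \<in> E (n + m)" by simp
        from sum_conj_count[OF this, of "\<lambda>u. conj_count ?N w (jx (n + m) l u y)", OF K]
        show "(\<Sum>u\<in>E (n + m). h y * (f a * g b) * (conj_count (n + m) u (jx n m a b) *
           conj_count ?N w (jx (n + m) l u y))) = h y * (f a * g b) * (?o (n + m) * c a b y)"
          by (simp add: sum_distrib_left[symmetric] c_def)
      qed
      finally show ?thesis by (simp add: sum_distrib_left sum_distrib_right mult_ac)
    qed
    have R: "(\<Sum>u\<in>E (m + l). f a * ind_prod m l g h u * conj_count ?N w (jx n (m + l) a u)) =
       f a * (\<Sum>b\<in>E m. \<Sum>y\<in>E l. g b * h y * c a b y) * ?o (m + l) / (?o m * ?o l)" if a: "a \<in> E n" for a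
    proof -
      have K: "conj_count ?N w (jx n (m + l) a (gm (m + l) (inv\<^bsub>G (m+l)\<^esub> s) (gm (m + l) u s))) =
          conj_count ?N w (jx n (m + l) a u)" if "u \<in> E (m + l)" "s \<in> carrier (G (m + l))" for u s
        using conj_count_conj[OF w', of "jx n (m + l) a u" "jx n (m + l) \<one>\<^bsub>G n\<^esub> s"]
          jx_conj[of a n u "m + l" "\<one>\<^bsub>G n\<^esub>" s] that a by (simp add: add.assoc)
      have "(\<Sum>u\<in>E (m + l). f a * ind_prod m l g h u * conj_count ?N w (jx n (m + l) a u)) =
        (\<Sum>u\<in>E (m + l). (\<Sum>b\<in>E m. \<Sum>y\<in>E l. f a * (g b * h y) * (conj_count (m + l) u (jx m l b y) *
           conj_count ?N w (jx n (m + l) a u)))) / (?o m * ?o l)"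
        unfolding sum_divide_distrib[symmetric]
        by (subst sum_divide_distrib, intro sum.cong HOL.refl)
          (simp add: ind_prod_conj_count sum_distrib_left sum_distrib_right mult_ac)
      also have "(\<Sum>u\<in>E (m + l). (\<Sum>b\<in>E m. \<Sum>y\<in>E l. f a * (g b * h y) * (conj_count (m + l) u (jx m l b y) *
           conj_count ?N w (jx n (m + l) a u)))) =
         (\<Sum>b\<in>E m. \<Sum>y\<in>E l. \<Sum>u\<in>E (m + l). f a * (g b * h y) * (conj_count (m + l) u (jx m l b y) *
           conj_count ?N w (jx n (m + l) a u)))"
        by (subst sum.swap, rule sum.cong[OF HOL.refl], subst sum.swap) simp
      also have "\<dots> = (\<Sum>b\<in>E m. \<Sum>y\<in>E l. f a * (g b * h y) * (?o (m + l) * c a b y))"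
      proof (intro sum.cong HOL.refl)
        fix b y assume by': "b \<in> E m" "y \<in> E l"
        then have "jx m l b y \<in> E (m + l)" by simp
        from sum_conj_count[OF this, of "\<lambda>u. conj_count ?N w (jx n (m + l) a u)", OF K]
        show "(\<Sum>u\<in>E (m + l). f a * (g b * h y) * (conj_count (m + l) u (jx m l b y) *
           conj_count ?N w (jx n (m + l) a u))) = f a * (g b * h y) * (?o (m + l) * c a b y)"
          using jx_assoc[of a n b m y l] a by' by (simp add: sum_distrib_left[symmetric] c_def)
      qed
      finally show ?thesis by (simp add: sum_distrib_left sum_distrib_right mult_ac)
    qed
    have "ind_prod (n + m) l (ind_prod n m f g) h w =
      (\<Sum>y\<in>E l. \<Sum>u\<in>E (n + m). ind_prod n m f g u * h y * conj_count ?N w (jx (n + m) l u y)) / (?o (n + m) * ?o l)"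
      unfolding ind_prod_conj_count[OF True] by (subst sum.swap) simp
    also have "\<dots> = (\<Sum>y\<in>E l. h y * (\<Sum>a\<in>E n. \<Sum>b\<in>E m. f a * g b * c a b y)) / (?o n * ?o m * ?o l)"
    proof -
      define k where "k = ?o (n + m) / (?o n * ?o m)"
      have "(\<Sum>y\<in>E l. \<Sum>u\<in>E (n + m). ind_prod n m f g u * h y * conj_count ?N w (jx (n + m) l u y)) =
        (\<Sum>y\<in>E l. h y * (\<Sum>a\<in>E n. \<Sum>b\<in>E m. f a * g b * c a b y)) * k"
        unfolding sum_distrib_right[of _ _ k]
        by (intro sum.cong HOL.refl) (simp only: L k_def times_divide_eq_right)
      moreover have "S * k / (?o (n + m) * ?o l) = S / (?o n * ?o m * ?o l)" for S
        by (simp add: k_def)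
      ultimately show ?thesis by (simp only:)
    qed
    also have "(\<Sum>y\<in>E l. h y * (\<Sum>a\<in>E n. \<Sum>b\<in>E m. f a * g b * c a b y)) =
        (\<Sum>a\<in>E n. f a * (\<Sum>b\<in>E m. \<Sum>y\<in>E l. g b * h y * c a b y))"
      unfolding sum_distrib_left
      by (subst sum.swap, rule sum.cong[OF HOL.refl], subst sum.swap) (simp add: mult_ac)
    also have "\<dots> / (?o n * ?o m * ?o l) = (\<Sum>a\<in>E n. \<Sum>u\<in>E (m + l). f a * ind_prod m l g h u * conj_count ?N w (jx n (m + l) a u))
        / (?o n * ?o (m + l))"
    proof -
      define k where "k = ?o (m + l) / (?o m * ?o l)"
      have "(\<Sum>a\<in>E n. \<Sum>u\<in>E (m + l). f a * ind_prod m l g h u * conj_count ?N w (jx n (m + l) a u)) =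
        (\<Sum>a\<in>E n. f a * (\<Sum>b\<in>E m. \<Sum>y\<in>E l. g b * h y * c a b y)) * k"
        unfolding sum_distrib_right[of _ _ k]
        by (intro sum.cong HOL.refl) (simp only: R k_def times_divide_eq_right)
      moreover have "S * k / (?o n * ?o (m + l)) = S / (?o n * ?o m * ?o l)" for S
        by (simp add: k_def)
      ultimately show ?thesis by (simp only:)
    qed
    also have "\<dots> = ind_prod n (m + l) f (ind_prod m l g h) w"
      unfolding ind_prod_conj_count[OF w'] by (simp add: add.assoc)
    finally show ?thesis .
  next
    case False
    then show ?thesis by (simp add: ind_prod_def add.assoc)
  qed
qed

end

section \<open>Products as sums over subsets\<close>

context finite_base
begin

text \<open>The subsets of size \<open>n\<close> index the cosets of the stabiliser of
  \<open>{1..n}\<close>; this chooses a representative of each coset.\<close>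

definition set_rep :: "nat \<Rightarrow> nat set \<Rightarrow> 'a wr" where
  "set_rep k A = (SOME s. s \<in> carrier (G k) \<and> wperm k s ` {1..card A} = A)"

lemma set_rep:
  assumes "A \<subseteq> {1..k}"
  shows "set_rep k A \<in> carrier (G k)" "wperm k (set_rep k A) ` {1..card A} = A"
proof -
  obtain p where "p permutes {1..k}" "p ` {1..card A} = A" using bij_extension[OF assms] .
  then have "\<exists>s. s \<in> carrier (G k) \<and> wperm k s ` {1..card A} = A" using wperm_surj by metis
  from someI_ex[OF this] show "set_rep k A \<in> carrier (G k)" "wperm k (set_rep k A) ` {1..card A} = A"
    by (auto simp: set_rep_def)
qed

lemma same_image_jx:
  assumes s: "s \<in> carrier (G (n + m))" "s' \<in> carrier (G (n + m))"
    and e: "wperm (n + m) s ` {1..n} = wperm (n + m) s' ` {1..n}"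
  obtains a b where "a \<in> carrier (G n)" "b \<in> carrier (G m)" "s' = gm (n + m) s (jx n m a b)"
proof -
  let ?h = "gm (n + m) (inv\<^bsub>G (n+m)\<^esub> s) s'"
  have h: "?h \<in> carrier (G (n + m))" using s by simp
  have "wperm (n + m) ?h ` {1..n} = inv' (wperm (n + m) s) ` wperm (n + m) s' ` {1..n}"
    using s by (simp add: wperm_mult wperm_inv image_comp)
  also have "\<dots> = {1..n}"
    unfolding e[symmetric] using permutes_inj[OF wperm_permutes[OF s(1)]]
    by (simp add: image_comp inv_o_cancel)
  finally obtain a b where ab: "a \<in> carrier (G n)" "b \<in> carrier (G m)" "?h = jx n m a b"
    using jx_image[OF h] by blast
  have "s' = gm (n + m) s ?h" using s by (simp add: W.m_assoc[symmetric])
  then show thesis using that ab by simp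
qed

lemma outer_ext_same_image:
  assumes "f \<in> RS n" "g \<in> RS m" and w: "w \<in> carrier (G (n + m))"
    and s: "s \<in> carrier (G (n + m))" "s' \<in> carrier (G (n + m))"
    and e: "wperm (n + m) s ` {1..n} = wperm (n + m) s' ` {1..n}"
  shows "outer_ext n m f g (gm (n + m) (inv\<^bsub>G (n+m)\<^esub> s') (gm (n + m) w s')) =
    outer_ext n m f g (gm (n + m) (inv\<^bsub>G (n+m)\<^esub> s) (gm (n + m) w s))"
proof -
  obtain a b where ab: "a \<in> carrier (G n)" "b \<in> carrier (G m)" "s' = gm (n + m) s (jx n m a b)"
    using same_image_jx[OF s e] .
  show ?thesis unfolding ab(3)
    using conj_conj[of w "n + m" s "jx n m a b"] w s ab
      outer_ext_conj[OF assms(1,2), of "gm (n + m) (inv\<^bsub>G (n+m)\<^esub> s) (gm (n + m) w s)" a b]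
    by simp
qed

text \<open>Two elements with the same image of \<open>{1..n}\<close> differ by a juxtaposition, by
  \<open>jx_image\<close>. The fibre is thus a left coset of the embedded
  \<open>HP n m\<close>.\<close>

lemma card_same_image:
  assumes s: "s \<in> carrier (G (n + m))" and A: "wperm (n + m) s ` {1..n} = A"
  shows "card {s' \<in> carrier (G (n + m)). wperm (n + m) s' ` {1..n} = A} = order (HP n m)"
proof -
  let ?f = "\<lambda>C. gm (n + m) s (hat_embed \<Gamma> n m C)"
  have cl: "hat_embed \<Gamma> n m C \<in> carrier (G (n + m))" if "C \<in> carrier (HP n m)" for C
    using hom_in_carrier[OF hat_embed_hom that] .
  have inj: "inj_on ?f (carrier (HP n m))"
  proof (rule inj_onI)
    fix C D assume CD: "C \<in> carrier (HP n m)" "D \<in> carrier (HP n m)" and "?f C = ?f D"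
    then have "hat_embed \<Gamma> n m C = hat_embed \<Gamma> n m D" using s cl by (metis W.Units_eq W.Units_l_cancel)
    then show "C = D" using CD inj_hat_embed by (metis inj_onD)
  qed
  have "?f ` carrier (HP n m) = {s' \<in> carrier (G (n + m)). wperm (n + m) s' ` {1..n} = A}"
  proof (intro Set.equalityI subsetI)
    fix s' assume "s' \<in> ?f ` carrier (HP n m)"
    then obtain x y where xy: "x \<in> carrier (G n)" "y \<in> carrier (G m)" "s' = gm (n + m) s (jx n m x y)"
      by (elim imageE HP_cases) (simp add: hat_embed_hcls)
    have "wperm (n + m) s' ` {1..n} = wperm (n + m) s ` wperm (n + m) (jx n m x y) ` {1..n}"
      using xy s by (simp add: wperm_mult image_comp)
    also have "\<dots> = A" unfolding jx_stable[OF xy(1,2)] by (rule A)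
    finally show "s' \<in> {s' \<in> carrier (G (n + m)). wperm (n + m) s' ` {1..n} = A}" using xy s by simp
  next
    fix s' assume "s' \<in> {s' \<in> carrier (G (n + m)). wperm (n + m) s' ` {1..n} = A}"
    then have s': "s' \<in> carrier (G (n + m))" "wperm (n + m) s ` {1..n} = wperm (n + m) s' ` {1..n}"
      using A by auto
    obtain a b where ab: "a \<in> carrier (G n)" "b \<in> carrier (G m)" "s' = gm (n + m) s (jx n m a b)"
      using same_image_jx[OF s s'] .
    show "s' \<in> ?f ` carrier (HP n m)"
      using ab by (intro image_eqI[of _ _ "hcls n m a b"]) (simp_all add: hat_embed_hcls)
  qed
  with card_image[OF inj] show ?thesis by (simp only: order_def)
qed

text \<open>The sum over the group is grouped by the image of \<open>{1..n}\<close>. On a fibre the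
  summand is constant, and the size of the fibre cancels the denominator of the induction
  formula.\<close>

lemma ind_prod_subset:
  assumes fg: "f \<in> RS n" "g \<in> RS m" and w: "w \<in> carrier (G (n + m))"
  shows "ind_prod n m f g w = (\<Sum>A | A \<subseteq> {1..n+m} \<and> card A = n.
    outer_ext n m f g (gm (n + m) (inv\<^bsub>G (n+m)\<^esub> (set_rep (n + m) A)) (gm (n + m) w (set_rep (n + m) A))))"
proof -
  let ?S = "carrier (G (n + m))" and ?T = "{A. A \<subseteq> {1..n+m} \<and> card A = n}"
  let ?g = "\<lambda>s. wperm (n + m) s ` {1..n}"
  let ?h = "\<lambda>s. outer_ext n m f g (gm (n + m) (inv\<^bsub>G (n+m)\<^esub> s) (gm (n + m) w s))"
  have T: "?g ` ?S \<subseteq> ?T"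
  proof safe
    fix s i assume s: "s \<in> ?S" and i: "i \<in> {1..n}"
    show "wperm (n + m) s i \<in> {1..n+m}" using permutes_in_image[OF wperm_permutes[OF s], of i] i by simp
  next
    fix s assume s: "s \<in> ?S"
    show "card (?g s) = n" using card_image[OF inj_on_subset[OF permutes_inj[OF wperm_permutes[OF s]]]] by simp
  qed
  have "(\<Sum>s\<in>?S. ?h s) = (\<Sum>A\<in>?T. \<Sum>s\<in>{s \<in> ?S. ?g s = A}. ?h s)"
    by (rule sum.group[symmetric]) (use T in \<open>auto simp: finite_G\<close>)
  also have "\<dots> = (\<Sum>A\<in>?T. of_nat (order (HP n m)) * ?h (set_rep (n + m) A))"
  proof (rule sum.cong[OF HOL.refl])
    fix A assume A: "A \<in> ?T"
    then have r: "set_rep (n + m) A \<in> ?S" "?g (set_rep (n + m) A) = A"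
      using set_rep[of A "n + m"] by auto
    have "(\<Sum>s\<in>{s \<in> ?S. ?g s = A}. ?h s) = (\<Sum>s\<in>{s \<in> ?S. ?g s = A}. ?h (set_rep (n + m) A))"
      by (rule sum.cong[OF HOL.refl], rule outer_ext_same_image[OF fg w]) (use r in auto)
    then show "(\<Sum>s\<in>{s \<in> ?S. ?g s = A}. ?h s) = of_nat (order (HP n m)) * ?h (set_rep (n + m) A)"
      by (simp only: sum_constant card_same_image[OF r])
  qed
  finally have *: "(\<Sum>s\<in>?S. ?h s) = of_nat (order (HP n m)) * (\<Sum>A\<in>?T. ?h (set_rep (n + m) A))"
    by (simp add: sum_distrib_left)
  have "order (HP n m) \<noteq> 0" using order_HP[of n m] by (metis mult_0_right mult_eq_0_iff order_G_neq_0)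
  then show ?thesis unfolding ind_prod_def * using w by simp
qed

definition tot_prod :: "'a spin_seq \<Rightarrow> 'a spin_seq \<Rightarrow> 'a spin_seq" where
  "tot_prod F H k w = (\<Sum>n\<le>k. ind_prod n (k - n) (F n) (H (k - n)) w)"

definition subset_term :: "'a spin_seq \<Rightarrow> 'a spin_seq \<Rightarrow> nat \<Rightarrow> 'a wr \<Rightarrow> nat set \<Rightarrow> complex" where
  "subset_term F H k w A = outer_ext (card A) (k - card A) (F (card A)) (H (k - card A))
     (gm k (inv\<^bsub>G k\<^esub> (set_rep k A)) (gm k w (set_rep k A)))"

lemma tot_prod_subset:
  assumes F: "\<And>n. F n \<in> RS n" and H: "\<And>n. H n \<in> RS n" and w: "w \<in> carrier (G k)"
  shows "tot_prod F H k w = (\<Sum>A\<in>Pow {1..k}. subset_term F H k w A)"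
proof -
  have "ind_prod n (k - n) (F n) (H (k - n)) w = (\<Sum>A | A \<in> Pow {1..k} \<and> card A = n. subset_term F H k w A)"
    if "n \<le> k" for n
    using ind_prod_subset[OF F H, of w n "k - n"] w that by (simp add: subset_term_def cong: conj_cong)
  then have "tot_prod F H k w = (\<Sum>n\<le>k. \<Sum>A | A \<in> Pow {1..k} \<and> card A = n. subset_term F H k w A)"
    by (simp add: tot_prod_def)
  also have "\<dots> = (\<Sum>A\<in>Pow {1..k}. subset_term F H k w A)"
  proof (rule sum.group)
    show "card ` Pow {1..k} \<subseteq> {..k}"
    proof safe
      fix A :: "nat set" assume "A \<subseteq> {1..k}"
      then show "card A \<le> k" using card_mono[of "{1..k}" A] by simp
    qed
  qed auto
  finally show ?thesis .
qed

lemma card_le: "A \<subseteq> {1..k} \<Longrightarrow> card A \<le> k"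
  using card_mono[of "{1..k}" A] by simp

text \<open>Frees the summand from the choice in \<open>set_rep\<close>, so that for a juxtaposed
  element a representative adapted to the two blocks may be used.\<close>

lemma subset_term_rep:
  assumes F: "\<And>n. F n \<in> RS n" and H: "\<And>n. H n \<in> RS n" and w: "w \<in> carrier (G k)"
    and A: "A \<subseteq> {1..k}" and s: "s \<in> carrier (G k)" "wperm k s ` {1..card A} = A"
  shows "subset_term F H k w A = outer_ext (card A) (k - card A) (F (card A)) (H (k - card A))
     (gm k (inv\<^bsub>G k\<^esub> s) (gm k w s))"
  using outer_ext_same_image[OF F H, of w "card A" "k - card A" s "set_rep k A"]
    w s set_rep[OF A] card_le[OF A]
  by (simp add: subset_term_def)

text \<open>\<open>split_sets k w\<close> consists of the subsets \<open>A\<close> stable under \<open>w\<close> on which, and on whose complement,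
  \<open>w\<close> induces even elements; these are \<open>left_part k w A\<close> and \<open>right_part k w A\<close>.\<close>

definition split_sets :: "nat \<Rightarrow> 'a wr \<Rightarrow> nat set set" where
  "split_sets k w = {A \<in> Pow {1..k}. \<exists>p \<in> E (card A) \<times> E (k - card A).
     gm k (inv\<^bsub>G k\<^esub> (set_rep k A)) (gm k w (set_rep k A)) = jx (card A) (k - card A) (fst p) (snd p)}"

definition split_pair :: "nat \<Rightarrow> 'a wr \<Rightarrow> nat set \<Rightarrow> 'a wr \<times> 'a wr" where
  "split_pair k w A = (SOME p. p \<in> E (card A) \<times> E (k - card A) \<and>
     gm k (inv\<^bsub>G k\<^esub> (set_rep k A)) (gm k w (set_rep k A)) = jx (card A) (k - card A) (fst p) (snd p))"

definition left_part where "left_part k w A = fst (split_pair k w A)"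
definition right_part where "right_part k w A = snd (split_pair k w A)"

lemma split_sets_subset: "A \<in> split_sets k w \<Longrightarrow> A \<subseteq> {1..k}"
  by (simp add: split_sets_def)

lemma split_parts:
  assumes "A \<in> split_sets k w"
  shows "left_part k w A \<in> E (card A)" "right_part k w A \<in> E (k - card A)"
    "gm k (inv\<^bsub>G k\<^esub> (set_rep k A)) (gm k w (set_rep k A)) =
      jx (card A) (k - card A) (left_part k w A) (right_part k w A)"
proof -
  have "\<exists>p. p \<in> E (card A) \<times> E (k - card A) \<and>
     gm k (inv\<^bsub>G k\<^esub> (set_rep k A)) (gm k w (set_rep k A)) = jx (card A) (k - card A) (fst p) (snd p)"
    using assms unfolding split_sets_def by blast
  from someI_ex[OF this, folded split_pair_def]
  show "left_part k w A \<in> E (card A)" "right_part k w A \<in> E (k - card A)"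
    "gm k (inv\<^bsub>G k\<^esub> (set_rep k A)) (gm k w (set_rep k A)) =
      jx (card A) (k - card A) (left_part k w A) (right_part k w A)"
    unfolding left_part_def right_part_def by (simp_all add: mem_Times_iff)
qed

lemma not_split_sets:
  assumes "A \<subseteq> {1..k}" "A \<notin> split_sets k w" "l \<in> E (card A)" "r \<in> E (k - card A)"
  shows "gm k (inv\<^bsub>G k\<^esub> (set_rep k A)) (gm k w (set_rep k A)) \<noteq> jx (card A) (k - card A) l r"
proof
  assume e: "gm k (inv\<^bsub>G k\<^esub> (set_rep k A)) (gm k w (set_rep k A)) = jx (card A) (k - card A) l r"
  have "(l, r) \<in> E (card A) \<times> E (k - card A)" using assms by (simp add: mem_Times_iff)
  then have "A \<in> split_sets k w"
    unfolding split_sets_def using e assms(1) by (auto intro!: bexI[of _ "(l, r)"])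
  then show False using assms by simp
qed

lemma subset_term_split:
  assumes F: "\<And>n. F n \<in> RS n" and H: "\<And>n. H n \<in> RS n" and A: "A \<subseteq> {1..k}"
  shows "subset_term F H k w A = (if A \<in> split_sets k w
    then F (card A) (left_part k w A) * H (k - card A) (right_part k w A) else 0)"
proof (cases "A \<in> split_sets k w")
  case True
  then show ?thesis unfolding subset_term_def split_parts(3)[OF True]
    using split_parts[OF True] by (simp only: outer_ext_jx[OF F H] if_True)
next
  case False
  have "subset_term F H k w A = 0"
    unfolding subset_term_def by (rule outer_ext_zero) (rule not_split_sets[OF A False])
  then show ?thesis using False by simp
qed

lemma tot_prod_split:
  assumes F: "\<And>n. F n \<in> RS n" and H: "\<And>n. H n \<in> RS n" and w: "w \<in> carrier (G k)"
  shows "tot_prod F H k w = (\<Sum>A\<in>split_sets k w. F (card A) (left_part k w A) * H (k - card A) (right_part k w A))"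
proof -
  have "tot_prod F H k w = (\<Sum>A\<in>Pow {1..k}. subset_term F H k w A)" by (rule tot_prod_subset[OF F H w])
  also have "\<dots> = (\<Sum>A\<in>split_sets k w. F (card A) (left_part k w A) * H (k - card A) (right_part k w A))"
  proof (rule sum.mono_neutral_cong_right)
    show "split_sets k w \<subseteq> Pow {1..k}" using split_sets_subset by blast
    show "\<forall>A\<in>Pow {1..k} - split_sets k w. subset_term F H k w A = 0"
      using subset_term_split[OF F H] by simp
  qed (simp_all add: subset_term_split[OF F H split_sets_subset])
  finally show ?thesis .
qed

subsection \<open>Compatibility with restriction\<close>

text \<open>The block exchange of \<open>jx_swap\<close>, applied to the two middle blocks and
  continued by the identity on the outer ones. It compares the order of blocks in a product of
  coproducts with that in a coproduct of products.\<close>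

lemma jx_four_swap:
  fixes n1 m1 n2 m2 :: nat
  defines "N \<equiv> n1 + m1 + (n2 + m2)"
  obtains \<sigma> where "\<sigma> \<in> carrier (G N)"
    "\<And>i. i \<in> {1..n1} \<Longrightarrow> wperm N \<sigma> i = i"
    "\<And>i. i \<in> {1..n2} \<Longrightarrow> wperm N \<sigma> (n1 + i) = n1 + m1 + i"
    "\<And>a1 b1 a2 b2. a1 \<in> carrier (G n1) \<Longrightarrow> b1 \<in> carrier (G m1) \<Longrightarrow>
      a2 \<in> carrier (G n2) \<Longrightarrow> b2 \<in> carrier (G m2) \<Longrightarrow>
      \<exists>e. gm N (jx (n1 + m1) (n2 + m2) (jx n1 m1 a1 b1) (jx n2 m2 a2 b2)) \<sigma> =
        gm N \<sigma> (gm N (wp N e) (jx (n1 + n2) (m1 + m2) (jx n1 n2 a1 a2) (jx m1 m2 b1 b2))) \<and>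
       (par a1 = 0 \<longrightarrow> par b1 = 0 \<longrightarrow> par a2 = 0 \<longrightarrow> par b2 = 0 \<longrightarrow> e = 0)"
proof -
  let ?P = "m1 + n2"
  let ?Q = "?P + m2"
  have NQ: "n1 + ?Q = N" by (simp add: N_def)
  obtain \<tau> where t: "\<tau> \<in> carrier (G ?P)"
    and tp: "\<And>i. i \<in> {1..n2} \<Longrightarrow> wperm ?P \<tau> i = m1 + i"
    and te: "\<And>x y. x \<in> carrier (G m1) \<Longrightarrow> y \<in> carrier (G n2) \<Longrightarrow>
      \<exists>e. gm ?P (jx m1 n2 x y) \<tau> = gm ?P \<tau> (gm ?P (wp ?P e) (jx n2 m1 y x))
        \<and> (par x = 0 \<longrightarrow> par y = 0 \<longrightarrow> e = 0)"
    using jx_swap[of m1 n2] by metis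
  define T1 where "T1 = jx ?P m2 \<tau> \<one>\<^bsub>G m2\<^esub>"
  have T1: "T1 \<in> carrier (G ?Q)" using t by (simp add: T1_def)
  define \<sigma> where "\<sigma> = jx n1 ?Q \<one>\<^bsub>G n1\<^esub> T1"
  have \<sigma>: "\<sigma> \<in> carrier (G N)" using T1 jx_closed[of "\<one>\<^bsub>G n1\<^esub>" n1 T1 ?Q] unfolding \<sigma>_def NQ by simp
  have ws: "wperm N \<sigma> i = (if i \<le> n1 then i else n1 + wperm ?Q T1 (i - n1))" for i
    using wperm_jx[of "\<one>\<^bsub>G n1\<^esub>" n1 T1 ?Q i] T1 unfolding \<sigma>_def NQ by simp
  have wt: "wperm ?Q T1 i = m1 + i" if "i \<in> {1..n2}" for i
    using wperm_jx[of \<tau> ?P "\<one>\<^bsub>G m2\<^esub>" m2 i] t tp[OF that] that unfolding T1_def by simp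
  have ex: "\<exists>e. gm N (jx (n1 + m1) (n2 + m2) (jx n1 m1 a1 b1) (jx n2 m2 a2 b2)) \<sigma> =
        gm N \<sigma> (gm N (wp N e) (jx (n1 + n2) (m1 + m2) (jx n1 n2 a1 a2) (jx m1 m2 b1 b2))) \<and>
       (par a1 = 0 \<longrightarrow> par b1 = 0 \<longrightarrow> par a2 = 0 \<longrightarrow> par b2 = 0 \<longrightarrow> e = 0)"
    if c: "a1 \<in> carrier (G n1)" "b1 \<in> carrier (G m1)" "a2 \<in> carrier (G n2)" "b2 \<in> carrier (G m2)"
    for a1 b1 a2 b2
  proof -
    let ?X = "jx m1 n2 b1 a2" and ?X' = "jx n2 m1 a2 b1"
    let ?Y = "jx ?P m2 ?X b2" and ?Y' = "jx ?P m2 ?X' b2"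
    have X: "?X \<in> carrier (G ?P)" "?X' \<in> carrier (G ?P)"
      using c jx_closed[OF c(3,2)] by (simp_all add: add.commute)
    then have Y: "?Y \<in> carrier (G ?Q)" "?Y' \<in> carrier (G ?Q)" using c by simp_all
    obtain e where e: "gm ?P ?X \<tau> = gm ?P \<tau> (gm ?P (wp ?P e) ?X')" "par b1 = 0 \<longrightarrow> par a2 = 0 \<longrightarrow> e = 0"
      using te[OF c(2,3)] by blast
    have e': "gm ?P ?X \<tau> = gm ?P (wp ?P e) (gm ?P \<tau> ?X')" unfolding e using wp_left t X by simp
    have B: "gm ?Q T1 ?Y' = jx ?P m2 (gm ?P \<tau> ?X') b2"
      using jx_mult[of \<tau> ?P "\<one>\<^bsub>G m2\<^esub>" m2 ?X' b2] t X c Y by (simp add: T1_def)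
    \<comment> \<open>The first summand arises from moving the exchange past the last block, the
      second from the exchange itself.\<close>
    let ?f = "par b2 * par \<tau> + e"
    have "gm ?Q ?Y T1 = gm ?Q (wp ?Q (par b2 * par \<tau>)) (jx ?P m2 (gm ?P ?X \<tau>) b2)"
      using jx_mult[of ?X ?P b2 m2 \<tau> "\<one>\<^bsub>G m2\<^esub>"] t X c by (simp add: T1_def)
    also have "\<dots> = gm ?Q (wp ?Q (par b2 * par \<tau>)) (gm ?Q (wp ?Q e) (gm ?Q T1 ?Y'))"
      unfolding e' B using jx_wp(1)[of "gm ?P \<tau> ?X'" ?P b2 m2 e] t X c by simp
    also have "\<dots> = gm ?Q (wp ?Q ?f) (gm ?Q T1 ?Y')"
      using T1 Y by (intro wp_wp) simp
    finally have A: "gm ?Q ?Y T1 = gm ?Q (wp ?Q ?f) (gm ?Q T1 ?Y')" .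
    let ?Z = "jx n1 ?Q a1 (gm ?Q T1 ?Y')" and ?J' = "jx n1 ?Q a1 ?Y'"
    have ZJ: "?Z \<in> carrier (G N)" "?J' \<in> carrier (G N)"
      using jx_closed[OF c(1), of "gm ?Q T1 ?Y'" ?Q] jx_closed[OF c(1) Y(2)] T1 Y unfolding NQ by simp_all
    have "gm N (jx n1 ?Q a1 ?Y) \<sigma> = jx n1 ?Q a1 (gm ?Q ?Y T1)"
      using jx_mult[of a1 n1 ?Y ?Q "\<one>\<^bsub>G n1\<^esub>" T1] c Y T1 jx_closed[of a1 n1 "gm ?Q ?Y T1" ?Q]
      unfolding \<sigma>_def NQ by simp
    also have "\<dots> = gm N (wp N ?f) ?Z"
      unfolding A using jx_wp(2)[of a1 n1 "gm ?Q T1 ?Y'" ?Q ?f] c T1 Y unfolding NQ by simp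
    finally have C: "gm N (jx n1 ?Q a1 ?Y) \<sigma> = gm N (wp N ?f) ?Z" .
    \<comment> \<open>The price of moving the exchange past the first block. It reappears when
      \<open>?J'\<close> is multiplied by \<open>\<sigma>\<close> from the left, hence the doubled
      \<open>?g\<close> below that cancels modulo 2.\<close>
    let ?g = "par T1 * par a1"
    have D: "gm N \<sigma> ?J' = gm N (wp N ?g) ?Z"
      using jx_mult[of "\<one>\<^bsub>G n1\<^esub>" n1 T1 ?Q a1 ?Y'] c Y T1 unfolding \<sigma>_def NQ by simp
    have "gm N \<sigma> (gm N (wp N (?f + ?g)) ?J') = gm N (wp N (?f + ?g)) (gm N \<sigma> ?J')"
      using wp_left[OF \<sigma> ZJ(2)] .
    also have "\<dots> = gm N (wp N (?f + ?g + ?g)) ?Z" unfolding D using wp_wp[OF ZJ(1)] .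
    also have "wp N (?f + ?g + ?g) = wp N ?f" by (rule wp_cong) simp
    finally have main: "gm N (jx n1 ?Q a1 ?Y) \<sigma> = gm N \<sigma> (gm N (wp N (?f + ?g)) ?J')" unfolding C by simp
    have J: "jx n1 ?Q a1 ?Y = jx (n1 + m1) (n2 + m2) (jx n1 m1 a1 b1) (jx n2 m2 a2 b2)"
      using jx_assoc[OF c(2,3,4)] jx_assoc[OF c(1,2) jx_closed[OF c(3,4)]] by (simp add: add.assoc)
    have J': "?J' = jx (n1 + n2) (m1 + m2) (jx n1 n2 a1 a2) (jx m1 m2 b1 b2)"
      using jx_assoc[OF c(3,2,4)] jx_assoc[OF c(1,3) jx_closed[OF c(2,4)]]
      by (simp add: add.assoc add.left_commute add.commute[of n2 m1])
    have "par a1 = 0 \<longrightarrow> par b1 = 0 \<longrightarrow> par a2 = 0 \<longrightarrow> par b2 = 0 \<longrightarrow> ?f + ?g = 0" using e(2) by simp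
    then show ?thesis using main unfolding J J' by blast
  qed
  show thesis by (rule that[OF \<sigma> _ _ ex]) (simp_all add: ws wt)
qed

text \<open>Conjugating by the juxtaposed representatives followed by the middle exchange splits the
  element into the four parts. The delicate point is the zero case: stable subsets with odd parts
  may still give an even left and an even right side, and then it is \<open>RS_jx_odd\<close> that
  makes the term vanish.\<close>

lemma subset_term_jx:
  fixes F H :: "'a spin_seq"
  assumes F: "\<And>n. F n \<in> RS n" and H: "\<And>n. H n \<in> RS n"
    and x: "x \<in> E p" and y: "y \<in> E q" and A1: "A1 \<subseteq> {1..p}" and A2: "A2 \<subseteq> {1..q}"
  shows "subset_term F H (p + q) (jx p q x y) (A1 \<union> (+) p ` A2) =
    (if A1 \<in> split_sets p x \<and> A2 \<in> split_sets q y then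
      F (card A1 + card A2) (jx (card A1) (card A2) (left_part p x A1) (left_part q y A2)) *
      H (p - card A1 + (q - card A2))
        (jx (p - card A1) (q - card A2) (right_part p x A1) (right_part q y A2)) else 0)"
proof -
  define n1 where "n1 = card A1"
  define n2 where "n2 = card A2"
  define m1 where "m1 = p - n1"
  define m2 where "m2 = q - n2"
  have p: "n1 + m1 = p" and q: "n2 + m2 = q"
    using card_le[OF A1] card_le[OF A2] by (simp_all add: n1_def n2_def m1_def m2_def)
  define N where "N = p + q"
  have N: "n1 + n2 + (m1 + m2) = N" "n1 + m1 + (n2 + m2) = N" using p q by (simp_all add: N_def)
  let ?A = "A1 \<union> (+) p ` A2"
  have fin: "finite A1" "finite A2" using A1 A2 finite_subset by blast+
  have A: "?A \<subseteq> {1..N}" using A1 A2 by (force simp: N_def)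
  have cA: "card ?A = n1 + n2"
  proof -
    have "A1 \<inter> (+) p ` A2 = {}" using A1 A2 by force
    then show ?thesis using fin by (simp add: card_Un_disjoint card_image n1_def n2_def)
  qed
  have NA: "N - card ?A = m1 + m2" using cA N by simp
  obtain \<sigma> where s: "\<sigma> \<in> carrier (G N)" "\<And>i. i \<in> {1..n1} \<Longrightarrow> wperm N \<sigma> i = i"
    "\<And>i. i \<in> {1..n2} \<Longrightarrow> wperm N \<sigma> (n1 + i) = p + i"
    and ex: "\<And>a1 b1 a2 b2. a1 \<in> carrier (G n1) \<Longrightarrow> b1 \<in> carrier (G m1) \<Longrightarrow>
      a2 \<in> carrier (G n2) \<Longrightarrow> b2 \<in> carrier (G m2) \<Longrightarrow>
      \<exists>e. gm N (jx p q (jx n1 m1 a1 b1) (jx n2 m2 a2 b2)) \<sigma> =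
        gm N \<sigma> (gm N (wp N e) (jx (n1 + n2) (m1 + m2) (jx n1 n2 a1 a2) (jx m1 m2 b1 b2))) \<and>
       (par a1 = 0 \<longrightarrow> par b1 = 0 \<longrightarrow> par a2 = 0 \<longrightarrow> par b2 = 0 \<longrightarrow> e = 0)"
    by (rule jx_four_swap[of n1 m1 n2 m2, unfolded p q, folded N_def]) blast
  define s1 where "s1 = set_rep p A1"
  define s2 where "s2 = set_rep q A2"
  have s12: "s1 \<in> carrier (G p)" "wperm p s1 ` {1..n1} = A1" "s2 \<in> carrier (G q)" "wperm q s2 ` {1..n2} = A2"
    using set_rep[OF A1] set_rep[OF A2] by (simp_all add: s1_def s2_def n1_def n2_def)
  define S where "S = jx p q s1 s2"
  have S: "S \<in> carrier (G N)" using s12 by (simp add: S_def N_def)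
  define J where "J = jx p q x y"
  have xy: "x \<in> carrier (G p)" "y \<in> carrier (G q)" "par x = 0" "par y = 0" using x y by auto
  have J: "J \<in> carrier (G N)" using xy by (simp add: J_def N_def)
  define v1 where "v1 = gm p (inv\<^bsub>G p\<^esub> s1) (gm p x s1)"
  define v2 where "v2 = gm q (inv\<^bsub>G q\<^esub> s2) (gm q y s2)"
  have v: "v1 \<in> E p" "v2 \<in> E q"
    using xy s12 par_conj[of x p s1] par_conj[of y q s2] by (auto simp: v1_def v2_def W.m_assoc)
  have vJ: "gm N (inv\<^bsub>G N\<^esub> S) (gm N J S) = jx p q v1 v2"
    unfolding S_def J_def v1_def v2_def N_def using xy s12 by (intro jx_conj)
  let ?V = "jx p q v1 v2"
  have V: "?V \<in> carrier (G N)" using v by (simp add: N_def)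
  have img: "wperm N \<sigma> ` {1..n1 + n2} = {1..n1} \<union> (+) p ` {1..n2}"
  proof -
    have "{1..n1 + n2} = {1..n1} \<union> (+) n1 ` {1..n2}"
    proof -
      have "(+) n1 ` {1..n2} = {n1 + 1..n1 + n2}" by (simp add: image_add_atLeastAtMost add.commute)
      then show ?thesis by auto
    qed
    then have "wperm N \<sigma> ` {1..n1 + n2} = wperm N \<sigma> ` {1..n1} \<union> (\<lambda>i. wperm N \<sigma> (n1 + i)) ` {1..n2}"
      by (simp only: image_Un image_image)
    also have "wperm N \<sigma> ` {1..n1} = {1..n1}" using s(2) by simp
    also have "(\<lambda>i. wperm N \<sigma> (n1 + i)) ` {1..n2} = (+) p ` {1..n2}" using s(3) by (rule image_cong[OF HOL.refl])
    finally show ?thesis .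
  qed
  have wS: "wperm N S ` ({1..n1} \<union> (+) p ` {1..n2}) = ?A"
  proof -
    have "wperm N S i = wperm p s1 i" if "i \<in> {1..n1}" for i
      using that wperm_jx[OF s12(1,3), of i] p by (simp add: S_def N_def)
    moreover have "wperm N S (p + i) = p + wperm q s2 i" if "i \<in> {1..n2}" for i
      using that wperm_jx[OF s12(1,3), of "p + i"] by (simp add: S_def N_def)
    ultimately show ?thesis
      unfolding image_Un image_image s12(2,4)[symmetric] by (intro arg_cong2[where f = "(\<union>)"] image_cong) auto
  qed
  \<comment> \<open>\<open>\<sigma>\<close> spreads \<open>{1..n1+n2}\<close> over the beginnings of
    the two blocks, and \<open>S\<close> then carries these to \<open>A1\<close> and to the shifted
    \<open>A2\<close>.\<close>
  let ?s = "gm N S \<sigma>"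
  have "wperm N ?s ` {1..card ?A} = wperm N S ` wperm N \<sigma> ` {1..n1 + n2}"
    unfolding cA wperm_mult[OF S s(1)] by (rule image_comp[symmetric])
  then have sA: "?s \<in> carrier (G N)" "wperm N ?s ` {1..card ?A} = ?A"
    unfolding img wS using S s(1) by simp_all
  have "subset_term F H N J ?A = outer_ext (n1 + n2) (m1 + m2) (F (n1 + n2)) (H (m1 + m2))
      (gm N (inv\<^bsub>G N\<^esub> ?s) (gm N J ?s))"
    using subset_term_rep[OF F H J A sA] unfolding cA NA unfolding N[symmetric] by simp
  also have "gm N (inv\<^bsub>G N\<^esub> ?s) (gm N J ?s) = gm N (inv\<^bsub>G N\<^esub> \<sigma>) (gm N ?V \<sigma>)"
    using conj_conj[OF J S s(1)] unfolding vJ by simp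
  finally have main: "subset_term F H N J ?A = outer_ext (n1 + n2) (m1 + m2) (F (n1 + n2)) (H (m1 + m2))
      (gm N (inv\<^bsub>G N\<^esub> \<sigma>) (gm N ?V \<sigma>))" .
  let ?O = "outer_ext (n1 + n2) (m1 + m2) (F (n1 + n2)) (H (m1 + m2))"
  have conj: "?O (gm N (inv\<^bsub>G N\<^esub> \<sigma>) (gm N ?V \<sigma>)) = ?O (gm N (wp N e) (jx (n1 + n2) (m1 + m2) (jx n1 n2 a1 a2) (jx m1 m2 b1 b2)))"
    if "gm N ?V \<sigma> = gm N \<sigma> (gm N (wp N e) (jx (n1 + n2) (m1 + m2) (jx n1 n2 a1 a2) (jx m1 m2 b1 b2)))"
      "a1 \<in> carrier (G n1)" "b1 \<in> carrier (G m1)" "a2 \<in> carrier (G n2)" "b2 \<in> carrier (G m2)" for a1 b1 a2 b2 e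
  proof -
    let ?R = "jx (n1 + n2) (m1 + m2) (jx n1 n2 a1 a2) (jx m1 m2 b1 b2)"
    have "?R \<in> carrier (G (n1 + n2 + (m1 + m2)))" using that by (intro jx_closed)
    then have "?R \<in> carrier (G N)" unfolding N .
    then show ?thesis using that(1) s(1) W.m_assoc[of "inv\<^bsub>G N\<^esub> \<sigma>" N \<sigma> "gm N (wp N e) ?R"] by simp
  qed
  have D1: "A1 \<in> split_sets p x \<Longrightarrow> left_part p x A1 \<in> E n1 \<and> right_part p x A1 \<in> E m1 \<and>
      v1 = jx n1 m1 (left_part p x A1) (right_part p x A1)"
    using split_parts[of A1 p x] by (simp add: v1_def s1_def n1_def m1_def)
  have D2: "A2 \<in> split_sets q y \<Longrightarrow> left_part q y A2 \<in> E n2 \<and> right_part q y A2 \<in> E m2 \<and>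
      v2 = jx n2 m2 (left_part q y A2) (right_part q y A2)"
    using split_parts[of A2 q y] by (simp add: v2_def s2_def n2_def m2_def)
  have ND1: "A1 \<in> split_sets p x" if "v1 = jx n1 m1 l r" "l \<in> E n1" "r \<in> E m1" for l r
    using not_split_sets[OF A1, of x l r] that by (auto simp: v1_def s1_def n1_def m1_def)
  have ND2: "A2 \<in> split_sets q y" if "v2 = jx n2 m2 l r" "l \<in> E n2" "r \<in> E m2" for l r
    using not_split_sets[OF A2, of y l r] that by (auto simp: v2_def s2_def n2_def m2_def)
  have "subset_term F H N J ?A = (if A1 \<in> split_sets p x \<and> A2 \<in> split_sets q y then
      F (n1 + n2) (jx n1 n2 (left_part p x A1) (left_part q y A2)) *
      H (m1 + m2) (jx m1 m2 (right_part p x A1) (right_part q y A2)) else 0)"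
  proof (cases "A1 \<in> split_sets p x \<and> A2 \<in> split_sets q y")
    case True
    let ?l1 = "left_part p x A1" and ?r1 = "right_part p x A1"
    let ?l2 = "left_part q y A2" and ?r2 = "right_part q y A2"
    have c: "?l1 \<in> E n1" "?r1 \<in> E m1" "?l2 \<in> E n2" "?r2 \<in> E m2" 
      "v1 = jx n1 m1 ?l1 ?r1" "v2 = jx n2 m2 ?l2 ?r2" using D1 D2 True by auto
    have cc: "?l1 \<in> carrier (G n1)" "?r1 \<in> carrier (G m1)" "?l2 \<in> carrier (G n2)" "?r2 \<in> carrier (G m2)"
      using c by auto
    obtain e where e: "gm N ?V \<sigma> = gm N \<sigma> (gm N (wp N e) (jx (n1 + n2) (m1 + m2) (jx n1 n2 ?l1 ?l2) (jx m1 m2 ?r1 ?r2)))"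
      "e = 0" using ex[OF cc] c(1-4) unfolding c(5,6)[symmetric] by auto
    have R: "jx (n1 + n2) (m1 + m2) (jx n1 n2 ?l1 ?l2) (jx m1 m2 ?r1 ?r2) \<in> carrier (G N)"
      using jx_closed[OF jx_closed[OF cc(1,3)] jx_closed[OF cc(2,4)]] unfolding N .
    have "?O (jx (n1 + n2) (m1 + m2) (jx n1 n2 ?l1 ?l2) (jx m1 m2 ?r1 ?r2)) =
        F (n1 + n2) (jx n1 n2 ?l1 ?l2) * H (m1 + m2) (jx m1 m2 ?r1 ?r2)"
      using c(1-4) by (intro outer_ext_jx[OF F H]) auto
    then show ?thesis using True main conj[OF e(1) cc] e(2) R by simp
  next
    case False
    have "?O (gm N (inv\<^bsub>G N\<^esub> \<sigma>) (gm N ?V \<sigma>)) = 0"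
    proof (cases "wperm p v1 ` {1..n1} = {1..n1} \<and> wperm q v2 ` {1..n2} = {1..n2}")
      case True
      have v': "v1 \<in> carrier (G (n1 + m1))" "v2 \<in> carrier (G (n2 + m2))" using v p q by auto
      obtain a1 b1 where 1: "a1 \<in> carrier (G n1)" "b1 \<in> carrier (G m1)" "v1 = jx n1 m1 a1 b1"
        using jx_image[OF v'(1)] True p by auto
      obtain a2 b2 where 2: "a2 \<in> carrier (G n2)" "b2 \<in> carrier (G m2)" "v2 = jx n2 m2 a2 b2"
        using jx_image[OF v'(2)] True q by auto
      obtain e where e: "gm N ?V \<sigma> = gm N \<sigma> (gm N (wp N e) (jx (n1 + n2) (m1 + m2) (jx n1 n2 a1 a2) (jx m1 m2 b1 b2)))"
        using ex[OF 1(1,2) 2(1,2)] unfolding 1(3)[symmetric] 2(3)[symmetric] by blast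
      let ?R = "jx (n1 + n2) (m1 + m2) (jx n1 n2 a1 a2) (jx m1 m2 b1 b2)"
      \<comment> \<open>\<open>v1\<close> and \<open>v2\<close> are even, so within either of them
        the two parts have equal parity.\<close>
      have par12: "par a1 = par b1" "par a2 = par b2"
        using v par_jx[OF 1(1,2)] par_jx[OF 2(1,2)] 1 2 p q
          par_range[OF 1(1)] par_range[OF 1(2)] par_range[OF 2(1)] par_range[OF 2(2)] by auto
      have odd: "par a1 = 1 \<or> par a2 = 1"
      proof (rule ccontr)
        assume "\<not> ?thesis"
        then have "par a1 = 0" "par a2 = 0" using par_range[OF 1(1)] par_range[OF 2(1)] by auto
        then have "A1 \<in> split_sets p x" "A2 \<in> split_sets q y"
          using ND1[OF 1(3)] ND2[OF 2(3)] 1 2 par12 by auto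
        then show False using False by blast
      qed
      \<comment> \<open>At least one of \<open>a1\<close>, \<open>a2\<close> is odd. If exactly one
        is, the combined left side is odd and \<open>outer_ext\<close> vanishes; if both are, the
        left side is an even juxtaposition of odd parts, where \<open>F\<close> vanishes.\<close>
      have R0: "?O ?R = 0"
      proof (cases "par (jx n1 n2 a1 a2) = 0")
        case True
        then have o: "par a1 = 1" "par a2 = 1"
          using odd 1 2 par_range[OF 1(1)] par_range[OF 2(1)] by auto
        have "jx n1 n2 a1 a2 \<in> E (n1 + n2)" "jx m1 m2 b1 b2 \<in> E (m1 + m2)"
          using True 1 2 o par12 by simp_all
        then have "?O ?R = F (n1 + n2) (jx n1 n2 a1 a2) * H (m1 + m2) (jx m1 m2 b1 b2)"
          by (rule outer_ext_jx[OF F H])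
        also have "F (n1 + n2) (jx n1 n2 a1 a2) = 0"
          using RS_jx_odd[OF F 1(1) 2(1) o(1)] .
        finally show ?thesis by simp
      next
        case False
        then show ?thesis using 1 2 by (intro outer_ext_odd) auto
      qed
      have "?R \<in> carrier (G (n1 + n2 + (m1 + m2)))" using 1 2 by (intro jx_closed)
      from outer_ext_wp[OF F H this, of e] have "?O (gm N (wp N e) ?R) = 0" unfolding N R0 by simp
      then show ?thesis using conj[OF e 1(1,2) 2(1,2)] by simp
    next
      \<comment> \<open>If the conjugated element were a juxtaposition, \<open>?V\<close> would
        stabilise the union of the two beginnings; as it also respects the blocks, each beginning
        would be stable.\<close>
      case nstab: False
      show ?thesis
      proof (rule outer_ext_zero)
        fix a b assume ab: "a \<in> E (n1 + n2)" "b \<in> E (m1 + m2)"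
        let ?B = "{1..n1} \<union> (+) p ` {1..n2}"
        show "gm N (inv\<^bsub>G N\<^esub> \<sigma>) (gm N ?V \<sigma>) \<noteq> jx (n1 + n2) (m1 + m2) a b"
        proof
          assume eq: "gm N (inv\<^bsub>G N\<^esub> \<sigma>) (gm N ?V \<sigma>) = jx (n1 + n2) (m1 + m2) a b"
          have "wperm N (jx (n1 + n2) (m1 + m2) a b) ` {1..n1 + n2} = {1..n1 + n2}"
            using jx_stable[of a "n1 + n2" b "m1 + m2"] ab unfolding N by auto
          then have "wperm N \<sigma> ` wperm N (gm N (inv\<^bsub>G N\<^esub> \<sigma>) (gm N ?V \<sigma>)) ` {1..n1 + n2} = ?B"
            unfolding eq using img by simp
          moreover have "wperm N \<sigma> ` wperm N (gm N (inv\<^bsub>G N\<^esub> \<sigma>) (gm N ?V \<sigma>)) ` {1..n1 + n2} =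
              wperm N (gm N \<sigma> (gm N (inv\<^bsub>G N\<^esub> \<sigma>) (gm N ?V \<sigma>))) ` {1..n1 + n2}"
            by (subst wperm_mult) (use s(1) V in \<open>simp_all only: image_comp W.m_closed W.inv_closed\<close>)
          moreover have "gm N \<sigma> (gm N (inv\<^bsub>G N\<^esub> \<sigma>) (gm N ?V \<sigma>)) = gm N ?V \<sigma>"
            using s(1) V by (simp add: W.m_assoc[symmetric])
          moreover have "wperm N (gm N ?V \<sigma>) ` {1..n1 + n2} = wperm N ?V ` ?B"
            unfolding wperm_mult[OF V s(1)] img[symmetric] by (rule image_comp[symmetric])
          ultimately have VB: "wperm N ?V ` ?B = ?B" by simp
          have vc: "v1 \<in> carrier (G p)" "v2 \<in> carrier (G q)" using v by auto
          have w: "wperm N ?V i = (if i \<le> p then wperm p v1 i else p + wperm q v2 (i - p))" for i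
            using wperm_jx[OF vc] by (simp add: N_def)
          have r1: "wperm p v1 i \<in> {1..n1}" if i: "i \<in> {1..n1}" for i
          proof -
            have "wperm N ?V i \<in> ?B" using VB i by blast
            moreover have "wperm N ?V i = wperm p v1 i" using i p w by simp
            moreover have "wperm p v1 i \<le> p"
              using permutes_in_image[OF wperm_permutes[OF vc(1)], of i] i p by auto
            ultimately show ?thesis by auto
          qed
          have r2: "wperm q v2 i \<in> {1..n2}" if i: "i \<in> {1..n2}" for i
          proof -
            have "wperm N ?V (p + i) \<in> ?B" using VB i by blast
            moreover have "wperm N ?V (p + i) = p + wperm q v2 i" using i w by simp
            moreover have "1 \<le> wperm q v2 i"
              using permutes_in_image[OF wperm_permutes[OF vc(2)], of i] i q by auto
            ultimately show ?thesis using p by auto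
          qed
          have "wperm p v1 ` {1..n1} = {1..n1}"
            using r1 permutes_inj[OF wperm_permutes[OF vc(1)]]
            by (intro endo_inj_surj) (auto intro: inj_on_subset)
          moreover have "wperm q v2 ` {1..n2} = {1..n2}"
            using r2 permutes_inj[OF wperm_permutes[OF vc(2)]]
            by (intro endo_inj_surj) (auto intro: inj_on_subset)
          ultimately show False using nstab by blast
        qed
      qed
    qed
    then show ?thesis unfolding main if_not_P[OF False] .
  qed
  then show ?thesis unfolding N_def J_def n1_def n2_def m1_def m2_def .
qed

text \<open>Compatibility of product and coproduct at the level of evaluations: a subset of
  \<open>{1..p+q}\<close> is a pair of subsets of the two blocks, and \<open>subset_term_jx\<close>
  evaluates the term of such a pair.\<close>

lemma tot_prod_jx:
  assumes F: "\<And>n. F n \<in> RS n" and H: "\<And>n. H n \<in> RS n" and x: "x \<in> E p" and y: "y \<in> E q"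
  shows "tot_prod F H (p + q) (jx p q x y) = (\<Sum>A1\<in>split_sets p x. \<Sum>A2\<in>split_sets q y.
      F (card A1 + card A2) (jx (card A1) (card A2) (left_part p x A1) (left_part q y A2)) *
      H (p - card A1 + (q - card A2))
        (jx (p - card A1) (q - card A2) (right_part p x A1) (right_part q y A2)))"
proof -
  let ?J = "jx p q x y"
  define t where "t A1 A2 = F (card A1 + card A2) (jx (card A1) (card A2) (left_part p x A1) (left_part q y A2)) *
      H (p - card A1 + (q - card A2))
        (jx (p - card A1) (q - card A2) (right_part p x A1) (right_part q y A2))" for A1 A2
  have J: "?J \<in> carrier (G (p + q))" using x y by auto
  have "tot_prod F H (p + q) ?J = (\<Sum>A\<in>Pow {1..p+q}. subset_term F H (p + q) ?J A)"
    by (rule tot_prod_subset[OF F H J])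
  also have "\<dots> = (\<Sum>(A1, A2)\<in>Pow {1..p} \<times> Pow {1..q}. subset_term F H (p + q) ?J (A1 \<union> (+) p ` A2))"
  proof (rule sum.reindex_bij_witness[of _ "\<lambda>(A1, A2). A1 \<union> (+) p ` A2"
        "\<lambda>A. (A \<inter> {1..p}, {i \<in> {1..q}. p + i \<in> A})"])
    fix A assume A: "A \<in> Pow {1..p + q}"
    have "(+) p ` {i \<in> {1..q}. p + i \<in> A} = A \<inter> {p+1..p+q}"
    proof (intro Set.equalityI subsetI)
      fix j assume "j \<in> A \<inter> {p+1..p+q}"
      then show "j \<in> (+) p ` {i \<in> {1..q}. p + i \<in> A}" by (intro image_eqI[of _ _ "j - p"]) auto
    qed auto
    then have *: "A \<inter> {1..p} \<union> (+) p ` {i \<in> {1..q}. p + i \<in> A} = A" using A by force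
    then show "(case (A \<inter> {1..p}, {i \<in> {1..q}. p + i \<in> A}) of (A1, A2) \<Rightarrow> A1 \<union> (+) p ` A2) = A" by simp
    show "(case (A \<inter> {1..p}, {i \<in> {1..q}. p + i \<in> A}) of (A1, A2) \<Rightarrow>
      subset_term F H (p + q) ?J (A1 \<union> (+) p ` A2)) = subset_term F H (p + q) ?J A"
      unfolding prod.case * ..
    show "(A \<inter> {1..p}, {i \<in> {1..q}. p + i \<in> A}) \<in> Pow {1..p} \<times> Pow {1..q}" by auto
  next
    fix B assume B: "B \<in> Pow {1..p} \<times> Pow {1..q}"
    then show "((case B of (A1, A2) \<Rightarrow> A1 \<union> (+) p ` A2) \<inter> {1..p},
        {i \<in> {1..q}. p + i \<in> (case B of (A1, A2) \<Rightarrow> A1 \<union> (+) p ` A2)}) = B"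
      by (cases B) (force simp: subset_iff)
    show "(case B of (A1, A2) \<Rightarrow> A1 \<union> (+) p ` A2) \<in> Pow {1..p + q}"
      using B by (cases B) (force simp: subset_iff)
  qed
  also have "\<dots> = (\<Sum>A1\<in>Pow {1..p}. \<Sum>A2\<in>Pow {1..q}. subset_term F H (p + q) ?J (A1 \<union> (+) p ` A2))"
    by (simp add: sum.cartesian_product)
  also have "\<dots> = (\<Sum>A1\<in>Pow {1..p}. \<Sum>A2\<in>Pow {1..q}. if A1 \<in> split_sets p x \<and> A2 \<in> split_sets q y then t A1 A2 else 0)"
    unfolding t_def by (intro sum.cong HOL.refl subset_term_jx[OF F H x y]) auto
  also have "\<dots> = (\<Sum>A1\<in>split_sets p x. \<Sum>A2\<in>Pow {1..q}. if A2 \<in> split_sets q y then t A1 A2 else 0)"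
    by (rule sum.mono_neutral_cong_right) (use split_sets_subset in \<open>auto simp: subset_iff\<close>)
  also have "\<dots> = (\<Sum>A1\<in>split_sets p x. \<Sum>A2\<in>split_sets q y. t A1 A2)"
    by (intro sum.cong[OF HOL.refl] sum.mono_neutral_cong_right) (use split_sets_subset in \<open>auto simp: subset_iff\<close>)
  finally show ?thesis unfolding t_def .
qed

end

section \<open>Orbits and signs\<close>

text \<open>Only iterates in one direction are taken; for an injective map with finite forward
  orbits they make up the whole cycle, by \<open>forward_orbit_eq\<close>.\<close>

definition forward_orbit :: "('x \<Rightarrow> 'x) \<Rightarrow> 'x \<Rightarrow> 'x set" where
  "forward_orbit p i = range (\<lambda>t. (p ^^ t) i)"

lemma forward_orbit_self [simp]: "i \<in> forward_orbit p i"
  unfolding forward_orbit_def by (rule range_eqI[of _ _ 0]) simp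

lemma forward_orbit_step: "j \<in> forward_orbit p i \<Longrightarrow> p j \<in> forward_orbit p i"
  unfolding forward_orbit_def by (auto simp: image_iff intro: exI[of _ "Suc _"])

lemma forward_orbit_subset: "(\<And>j. j \<in> A \<Longrightarrow> p j \<in> A) \<Longrightarrow> i \<in> A \<Longrightarrow> forward_orbit p i \<subseteq> A"
proof -
  assume c: "\<And>j. j \<in> A \<Longrightarrow> p j \<in> A" and i: "i \<in> A"
  have "(p ^^ t) i \<in> A" for t by (induction t) (use c i in auto)
  then show ?thesis by (auto simp: forward_orbit_def)
qed

lemma forward_orbit_semiconj:
  assumes "\<And>i. i \<in> S \<Longrightarrow> p i \<in> S" "\<And>i. i \<in> S \<Longrightarrow> s (p i) = q (s i)" "i \<in> S"
  shows "forward_orbit q (s i) = s ` forward_orbit p i"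
proof -
  have "s ((p ^^ t) i) = (q ^^ t) (s i) \<and> (p ^^ t) i \<in> S" for t
    by (induction t) (use assms in auto)
  then show ?thesis by (simp add: forward_orbit_def image_image)
qed

lemma forward_orbit_stable:
  assumes p: "inj p" and A: "p ` A = A"
  shows "i \<in> A \<Longrightarrow> forward_orbit p i \<subseteq> A" "i \<notin> A \<Longrightarrow> forward_orbit p i \<inter> A = {}"
proof -
  show "i \<in> A \<Longrightarrow> forward_orbit p i \<subseteq> A" using A by (intro forward_orbit_subset) auto
  have "p j \<notin> A" if "j \<notin> A" for j
    using that A p by (metis imageE inj_eq)
  then show "i \<notin> A \<Longrightarrow> forward_orbit p i \<inter> A = {}"
    using forward_orbit_subset[of "- A" p i] by auto
qed

lemma image_forward_orbit:
  assumes "finite (forward_orbit p i)" "inj p"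
  shows "p ` forward_orbit p i = forward_orbit p i"
  using assms forward_orbit_step[of _ p i] by (intro endo_inj_surj) (auto intro: inj_on_subset)

text \<open>A finite forward orbit is mapped onto itself, so any other orbit lies inside it or
  misses it. The orbit of \<open>i\<close> meets that of \<open>j\<close> in
  \<open>j\<close>.\<close>

lemma forward_orbit_eq:
  assumes fin: "\<And>i. finite (forward_orbit p i)" and p: "inj p" and j: "j \<in> forward_orbit p i"
  shows "forward_orbit p j = forward_orbit p i"
proof
  show "forward_orbit p j \<subseteq> forward_orbit p i"
    using forward_orbit_stable(1)[OF p image_forward_orbit[OF fin p] j] .
  have "i \<in> forward_orbit p j"
  proof (rule ccontr)
    assume "i \<notin> forward_orbit p j"
    from forward_orbit_stable(2)[OF p image_forward_orbit[OF fin p] this] j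
    show False using forward_orbit_self[of j p]
      forward_orbit_stable(2)[OF p image_forward_orbit[OF fin p], of i j] by blast
  qed
  then show "forward_orbit p i \<subseteq> forward_orbit p j"
    using forward_orbit_stable(1)[OF p image_forward_orbit[OF fin p]] by blast
qed

text \<open>Adding or removing the orbit of \<open>1\<close> is a sign-reversing involution on the stable sets.\<close>

lemma sum_stable_sets_sign:
  fixes k :: nat
  assumes p: "p permutes {1..k}" and k: "k > 0"
  shows "(\<Sum>A | A \<subseteq> {1..k} \<and> p ` A = A. (-1) ^ card (forward_orbit p ` A)) = (0 :: complex)"
proof -
  note inj = permutes_inj[OF p]
  have fin: "finite (forward_orbit p i)" for i
  proof (cases "i \<in> {1..k}")
    case True
    have "forward_orbit p i \<subseteq> {1..k}"
      using forward_orbit_stable(1)[OF inj permutes_image[OF p] True] .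
    then show ?thesis by (rule finite_subset) simp
  next
    case False
    have "forward_orbit p i \<subseteq> {i}"
      using permutes_not_in[OF p False] by (intro forward_orbit_subset) auto
    then show ?thesis by (rule finite_subset) simp
  qed
  define O1 where "O1 = forward_orbit p 1"
  have O1: "1 \<in> O1" "O1 \<subseteq> {1..k}" "p ` O1 = O1"
    using forward_orbit_stable(1)[OF inj permutes_image[OF p], of 1] image_forward_orbit[OF fin inj] k
    by (auto simp: O1_def)
  define S where "S = {A. A \<subseteq> {1..k} \<and> p ` A = A}"
  have finS: "finite S" unfolding S_def by (rule finite_subset[of _ "Pow {1..k}"]) auto
  have disj: "A \<inter> O1 = {}" if "A \<in> S" "1 \<notin> A" for A
    using forward_orbit_stable(2)[OF inj, of A 1] that by (auto simp: S_def O1_def)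
  have sub: "O1 \<subseteq> A" if "A \<in> S" "1 \<in> A" for A
    using forward_orbit_stable(1)[OF inj, of A 1] that by (simp add: S_def O1_def)
  have card: "card (forward_orbit p ` (A \<union> O1)) = Suc (card (forward_orbit p ` A))"
    if A: "A \<in> S" "1 \<notin> A" for A
  proof -
    have "forward_orbit p j = O1" if "j \<in> O1" for j
      using forward_orbit_eq[OF fin inj] that unfolding O1_def .
    then have "forward_orbit p ` O1 = {O1}" using O1(1) by blast
    then have "forward_orbit p ` (A \<union> O1) = insert O1 (forward_orbit p ` A)" by (simp add: image_Un)
    moreover have "O1 \<notin> forward_orbit p ` A"
    proof
      assume "O1 \<in> forward_orbit p ` A"
      then obtain i where "i \<in> A" "O1 = forward_orbit p i" by blast
      then have "i \<in> A \<inter> O1" by simp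
      then show False using disj[OF A] by blast
    qed
    moreover have "finite A" using A finite_subset by (auto simp: S_def)
    ultimately show ?thesis by simp
  qed
  let ?f = "\<lambda>A. (-1) ^ card (forward_orbit p ` A) :: complex"
  have "(\<Sum>A\<in>{A \<in> S. 1 \<in> A}. ?f A) = (\<Sum>A\<in>{A \<in> S. 1 \<notin> A}. - ?f A)"
  proof (rule sum.reindex_bij_witness[of _ "\<lambda>A. A \<union> O1" "\<lambda>A. A - O1"])
    fix A assume A: "A \<in> {A \<in> S. 1 \<in> A}"
    then show u: "A - O1 \<union> O1 = A" using sub by blast
    show m: "A - O1 \<in> {A \<in> S. 1 \<notin> A}"
      using A O1 image_set_diff[OF inj, of A O1] by (auto simp: S_def)
    have "?f (A - O1 \<union> O1) = - ?f (A - O1)" using card[of "A - O1"] m by simp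
    then show "- ?f (A - O1) = ?f A" unfolding u by simp
  next
    fix A assume A: "A \<in> {A \<in> S. 1 \<notin> A}"
    then show "A \<union> O1 - O1 = A" using disj by blast
    show "A \<union> O1 \<in> {A \<in> S. 1 \<in> A}" using A O1 by (auto simp: S_def image_Un)
  qed
  moreover have "S = {A \<in> S. 1 \<in> A} \<union> {A \<in> S. 1 \<notin> A}" by blast
  then have "(\<Sum>A\<in>S. ?f A) = (\<Sum>A\<in>{A \<in> S. 1 \<in> A}. ?f A) + (\<Sum>A\<in>{A \<in> S. 1 \<notin> A}. ?f A)"
    using finS by (metis (no_types, lifting) sum.union_disjoint finite_Un disjoint_iff mem_Collect_eq)
  ultimately show ?thesis by (simp add: S_def sum_negf)
qed

section \<open>Orbit signs, stable subsets and the antipode sums\<close>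

context finite_base
begin

definition orbit_sign :: "nat \<Rightarrow> 'a wr \<Rightarrow> complex" where
  "orbit_sign n x = (-1) ^ card (forward_orbit (wperm n x) ` {1..n})"

text \<open>The usual antipode of symmetric functions negates every power sum. In terms of class
  functions this is the sign given by the number of cycles.\<close>

definition antipode :: "'a spin_seq \<Rightarrow> 'a spin_seq" where
  "antipode F n x = orbit_sign n x * F n x"

text \<open>An injective intertwining map sends orbits to orbits and distinct ones to distinct ones.
  It is applied to conjugations and to the inclusions of the two blocks.\<close>

lemma orbit_sign_transport:
  assumes s: "inj s" and l: "p permutes {1..n}" and e: "\<And>i. i \<in> {1..n} \<Longrightarrow> s (p i) = q (s i)"
  shows "card (forward_orbit p ` {1..n}) = card (forward_orbit q ` s ` {1..n})"
proof -
  have "forward_orbit q (s i) = s ` forward_orbit p i" if "i \<in> {1..n}" for i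
    using permutes_in_image[OF l] e that by (intro forward_orbit_semiconj[of "{1..n}"]) auto
  then have "forward_orbit q ` s ` {1..n} = (`) s ` forward_orbit p ` {1..n}"
    by (simp add: image_image)
  moreover have "inj_on ((`) s) (forward_orbit p ` {1..n})"
    using s by (meson inj_image_eq_iff inj_onI)
  ultimately show ?thesis by (simp add: card_image)
qed

lemma orbit_sign_conj:
  assumes x: "x \<in> carrier (G n)" and s: "s \<in> carrier (G n)"
  shows "orbit_sign n (gm n (inv\<^bsub>G n\<^esub> s) (gm n x s)) = orbit_sign n x"
proof -
  let ?v = "gm n (inv\<^bsub>G n\<^esub> s) (gm n x s)"
  have v: "?v \<in> carrier (G n)" using x s by simp
  have "gm n s ?v = gm n x s" using x s by (simp add: W.m_assoc[symmetric])
  then have "wperm n s \<circ> wperm n ?v = wperm n x \<circ> wperm n s"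
    using wperm_mult[OF s v] wperm_mult[OF x s] by (simp only:)
  then have "wperm n s (wperm n ?v i) = wperm n x (wperm n s i)" for i by (metis comp_apply)
  from orbit_sign_transport[OF permutes_inj[OF wperm_permutes[OF s]] wperm_permutes[OF v] this]
  show ?thesis unfolding orbit_sign_def permutes_image[OF wperm_permutes[OF s]] by simp
qed

lemma antipode_closed: "F n \<in> RS n \<Longrightarrow> antipode F n \<in> RS n"
  unfolding RS_iff antipode_def
  by (auto simp: orbit_sign_conj) (simp add: orbit_sign_def wperm_mult)

text \<open>\<open>w\<close> acts on \<open>A\<close> as its left part does on \<open>{1..card A}\<close>, and on the complement as its right part.\<close>

lemma orbit_sign_parts:
  assumes w: "w \<in> carrier (G k)" and A: "A \<in> split_sets k w"
  shows "orbit_sign (card A) (left_part k w A) = (-1) ^ card (forward_orbit (wperm k w) ` A)"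
    and "orbit_sign (k - card A) (right_part k w A) = (-1) ^ card (forward_orbit (wperm k w) ` ({1..k} - A))"
proof -
  define n where "n = card A"
  define m where "m = k - n"
  define s where "s = set_rep k A"
  define l where "l = left_part k w A"
  define r where "r = right_part k w A"
  have Ak: "A \<subseteq> {1..k}" by (rule split_sets_subset[OF A])
  have k: "n + m = k" using card_le[OF Ak] by (simp add: n_def m_def)
  have s: "s \<in> carrier (G k)" "wperm k s ` {1..n} = A" using set_rep[OF Ak] by (simp_all add: s_def n_def)
  have lr: "l \<in> carrier (G n)" "r \<in> carrier (G m)"
    "gm k (inv\<^bsub>G k\<^esub> s) (gm k w s) = jx n m l r"
    using split_parts[OF A] by (auto simp: l_def r_def n_def m_def s_def)
  let ?v = "jx n m l r"
  have v: "?v \<in> carrier (G k)" using lr k jx_closed[OF lr(1,2)] by simp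
  have "gm k s ?v = gm k w s" unfolding lr(3)[symmetric] using w s by (simp add: W.m_assoc[symmetric])
  then have "wperm k s \<circ> wperm k ?v = wperm k w \<circ> wperm k s"
    using wperm_mult[OF s(1) v] wperm_mult[OF w s(1)] by (simp only:)
  then have c: "wperm k s (wperm k ?v i) = wperm k w (wperm k s i)" for i by (metis comp_apply)
  have vi: "wperm k ?v i = (if i \<le> n then wperm n l i else n + wperm m r (i - n))" for i
    using wperm_jx[OF lr(1,2), of i] unfolding k .
  note injs = permutes_inj[OF wperm_permutes[OF s(1)]]
  have "wperm k s (wperm n l i) = wperm k w (wperm k s i)" if "i \<in> {1..n}" for i
    using c[of i] vi[of i] that by simp
  from orbit_sign_transport[OF injs wperm_permutes[OF lr(1)] this]
  show "orbit_sign (card A) (left_part k w A) = (-1) ^ card (forward_orbit (wperm k w) ` A)"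
    unfolding orbit_sign_def s(2) l_def[symmetric] n_def[symmetric] by simp
  let ?t = "\<lambda>j. wperm k s (n + j)"
  have injt: "inj ?t" by (rule injI) (simp add: inj_eq[OF injs])
  have "?t (wperm m r i) = wperm k w (?t i)" if "i \<in> {1..m}" for i
    using c[of "n + i"] vi[of "n + i"] that by simp
  from orbit_sign_transport[OF injt wperm_permutes[OF lr(2)] this]
  have 1: "card (forward_orbit (wperm m r) ` {1..m}) = card (forward_orbit (wperm k w) ` ?t ` {1..m})" .
  have "?t ` {1..m} = wperm k s ` {n+1..k}"
  proof -
    have "{n+1..k} = (+) n ` {1..m}" unfolding k[symmetric] by (simp add: image_add_atLeastAtMost add.commute)
    then show ?thesis by (simp only: image_image)
  qed
  also have "{n+1..k} = {1..k} - {1..n}" by auto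
  also have "wperm k s ` ({1..k} - {1..n}) = {1..k} - A"
    unfolding image_set_diff[OF injs] permutes_image[OF wperm_permutes[OF s(1)]] s(2) ..
  finally show "orbit_sign (k - card A) (right_part k w A) = (-1) ^ card (forward_orbit (wperm k w) ` ({1..k} - A))"
    using 1 unfolding orbit_sign_def r_def[symmetric] n_def[symmetric] m_def[symmetric] by simp
qed

lemma split_parts_value:
  assumes F: "\<And>n. F n \<in> RS n" and w: "w \<in> carrier (G k)" and A: "A \<in> split_sets k w"
  shows "F (card A + (k - card A)) (jx (card A) (k - card A) (left_part k w A) (right_part k w A)) = F k w"
proof -
  have Ak: "A \<subseteq> {1..k}" by (rule split_sets_subset[OF A])
  show ?thesis unfolding split_parts(3)[OF A, symmetric]
    using card_le[OF Ak] RS_conj[OF F w set_rep(1)[OF Ak]] by simp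
qed

text \<open>A stable subset fails to be a split set only if its parts are odd, and then
  \<open>RS_jx_odd\<close> forces \<open>F k w\<close> to vanish. Where \<open>F\<close> is nonzero,
  the sum over split sets thus becomes the sum over all stable sets, whose signs cancel.\<close>

lemma split_sets_stable:
  assumes F: "\<And>n. F n \<in> RS n" and w: "w \<in> E k" and nz: "F k w \<noteq> 0"
  shows "split_sets k w = {A. A \<subseteq> {1..k} \<and> wperm k w ` A = A}"
proof (intro Set.equalityI subsetI)
  have wc: "w \<in> carrier (G k)" using w by simp
  have img: "wperm k s ` wperm k v ` B = wperm k w ` wperm k s ` B"
    if "s \<in> carrier (G k)" "v \<in> carrier (G k)" "gm k (inv\<^bsub>G k\<^esub> s) (gm k w s) = v" for s v B
  proof -
    have "gm k s v = gm k w s" unfolding that(3)[symmetric] using wc that(1) by (simp add: W.m_assoc[symmetric])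
    then have "wperm k s \<circ> wperm k v = wperm k w \<circ> wperm k s"
      using wperm_mult[OF that(1,2)] wperm_mult[OF wc that(1)] by (simp only:)
    then show ?thesis by (metis image_comp)
  qed
  fix A
  {
    assume A: "A \<in> split_sets k w"
    then have Ak: "A \<subseteq> {1..k}" by (rule split_sets_subset)
    let ?n = "card A" and ?m = "k - card A"
    have k: "?n + ?m = k" using card_le[OF Ak] by simp
    let ?J = "jx ?n ?m (left_part k w A) (right_part k w A)"
    have lr: "left_part k w A \<in> carrier (G ?n)" "right_part k w A \<in> carrier (G ?m)"
      using split_parts[OF A] by auto
    have J: "?J \<in> carrier (G k)" using jx_closed[OF lr] unfolding k .
    have st: "wperm k ?J ` {1..?n} = {1..?n}" using jx_stable[OF lr] unfolding k .
    from img[OF set_rep(1)[OF Ak] J split_parts(3)[OF A], of "{1..?n}"]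
    show "A \<in> {A. A \<subseteq> {1..k} \<and> wperm k w ` A = A}"
      unfolding st set_rep(2)[OF Ak] using Ak by simp
  next
    assume "A \<in> {A. A \<subseteq> {1..k} \<and> wperm k w ` A = A}"
    then have Ak: "A \<subseteq> {1..k}" and Aw: "wperm k w ` A = A" by auto
    let ?n = "card A" and ?m = "k - card A"
    have k: "?n + ?m = k" using card_le[OF Ak] by simp
    define s where "s = set_rep k A"
    have s: "s \<in> carrier (G k)" "wperm k s ` {1..?n} = A" using set_rep[OF Ak] by (simp_all add: s_def)
    define v where "v = gm k (inv\<^bsub>G k\<^esub> s) (gm k w s)"
    have v: "v \<in> carrier (G k)" "v \<in> carrier (G (?n + ?m))" using s wc k by (simp_all add: v_def)
    have "wperm k s ` wperm k v ` {1..?n} = wperm k w ` wperm k s ` {1..?n}"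
      by (rule img[OF s(1) v(1) v_def[symmetric]])
    also have "\<dots> = wperm k s ` {1..?n}" unfolding s(2) by (rule Aw)
    finally have "wperm k v ` {1..?n} = {1..?n}"
      by (rule inj_image_eq_iff[OF permutes_inj[OF wperm_permutes[OF s(1)]], THEN iffD1])
    then have st: "wperm (?n + ?m) v ` {1..?n} = {1..?n}" unfolding k .
    obtain a b where ab: "a \<in> carrier (G ?n)" "b \<in> carrier (G ?m)" "v = jx ?n ?m a b"
      using jx_image[OF v(2) st] by (elim bexE) (rule that)
    have pv: "par v = 0" using par_conj[of w k s] w s by (simp add: v_def W.m_assoc)
    have "par a = 0"
    proof (rule ccontr)
      assume "par a \<noteq> 0"
      then have "par a = 1" using par_range[OF ab(1)] by simp
      then have "F k v = 0" using RS_jx_odd[OF F ab(1,2)] k ab(3) by metis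
      moreover have "F k v = F k w" unfolding v_def by (rule RS_conj[OF F wc s(1)])
      ultimately show False using nz by simp
    qed
    moreover have "par b = 0" using calculation pv par_range[OF ab(2)] ab by auto
    ultimately have "a \<in> E ?n" "b \<in> E ?m" using ab by auto
    then show "A \<in> split_sets k w"
      using not_split_sets[OF Ak] ab(3) unfolding v_def s_def by blast
  }
qed

text \<open>The juxtaposed parts are conjugate to \<open>w\<close>, so \<open>F k w\<close> factors
  out and the alternating sum over the stable sets remains. The second sum turns into the first by
  passing to complements. If \<open>F k w = 0\<close>, the split sets need not be known.\<close>

lemma antipode_sums:
  assumes F: "\<And>n. F n \<in> RS n" and w: "w \<in> E k" and k: "k > 0"
  shows "(\<Sum>A\<in>split_sets k w. orbit_sign (card A) (left_part k w A) *
      F (card A + (k - card A)) (jx (card A) (k - card A) (left_part k w A) (right_part k w A))) = 0"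
    and "(\<Sum>A\<in>split_sets k w. orbit_sign (k - card A) (right_part k w A) *
      F (card A + (k - card A)) (jx (card A) (k - card A) (left_part k w A) (right_part k w A))) = 0"
proof -
  have wc: "w \<in> carrier (G k)" using w by simp
  let ?p = "wperm k w"
  have p: "?p permutes {1..k}" by (rule wperm_permutes[OF wc])
  let ?S = "{A. A \<subseteq> {1..k} \<and> ?p ` A = A}"
  let ?c = "\<lambda>A. (-1) ^ card (forward_orbit ?p ` A) :: complex"
  have L: "(\<Sum>A\<in>split_sets k w. orbit_sign (card A) (left_part k w A) *
      F (card A + (k - card A)) (jx (card A) (k - card A) (left_part k w A) (right_part k w A)))
     = (\<Sum>A\<in>split_sets k w. ?c A) * F k w"
    unfolding sum_distrib_right
    by (intro sum.cong HOL.refl) (simp only: orbit_sign_parts[OF wc] split_parts_value[OF F wc])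
  have R: "(\<Sum>A\<in>split_sets k w. orbit_sign (k - card A) (right_part k w A) *
      F (card A + (k - card A)) (jx (card A) (k - card A) (left_part k w A) (right_part k w A)))
     = (\<Sum>A\<in>split_sets k w. ?c ({1..k} - A)) * F k w"
    unfolding sum_distrib_right
    by (intro sum.cong HOL.refl) (simp only: orbit_sign_parts[OF wc] split_parts_value[OF F wc])
  have z: "(\<Sum>A\<in>?S. ?c A) = 0" by (rule sum_stable_sets_sign[OF p k])
  have "(\<Sum>A\<in>?S. ?c ({1..k} - A)) = (\<Sum>A\<in>?S. ?c A)"
  proof (rule sum.reindex_bij_witness[of _ "\<lambda>A. {1..k} - A" "\<lambda>A. {1..k} - A"])
    fix A assume A: "A \<in> ?S"
    show "{1..k} - A \<in> ?S" using A image_set_diff[OF permutes_inj[OF p], of "{1..k}" A] permutes_image[OF p] by auto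
    show "{1..k} - ({1..k} - A) = A" using A by auto
    show "{1..k} - A \<in> ?S" by fact
  qed auto
  then have z': "(\<Sum>A\<in>?S. ?c ({1..k} - A)) = 0" using z by simp
  show "(\<Sum>A\<in>split_sets k w. orbit_sign (card A) (left_part k w A) *
      F (card A + (k - card A)) (jx (card A) (k - card A) (left_part k w A) (right_part k w A))) = 0"
    unfolding L using z split_sets_stable[OF F w] by (cases "F k w = 0") simp_all
  show "(\<Sum>A\<in>split_sets k w. orbit_sign (k - card A) (right_part k w A) *
      F (card A + (k - card A)) (jx (card A) (k - card A) (left_part k w A) (right_part k w A))) = 0"
    unfolding R using z' split_sets_stable[OF F w] by (cases "F k w = 0") simp_all
qed

section \<open>The algebra of sequences\<close>

text \<open>In degree zero the group is \<open>{1, z}\<close> and the spin functions form a line;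
  this is its element with value \<open>1\<close> at the identity.\<close>

definition unit_seq :: "'a spin_seq" where
  "unit_seq n x = (if n = 0 \<and> x = \<one>\<^bsub>G 0\<^esub> then 1 else if n = 0 \<and> x = wz 0 then -1 else 0)"

lemma unit_seq_closed: "unit_seq n \<in> RS n"
proof (cases "n = 0")
  case True
  have c: "x = \<one>\<^bsub>G 0\<^esub> \<or> x = wz 0" if "x \<in> carrier (G 0)" for x using that carrier_G_0 by blast
  have d: "wz 0 \<noteq> \<one>\<^bsub>G 0\<^esub>" by (rule wz_neq_one)
  have conj: "gm 0 (inv\<^bsub>G 0\<^esub> s) (gm 0 x s) = x" if "x \<in> carrier (G 0)" "s \<in> carrier (G 0)" for x s
    using c[OF that(1)] that by (elim disjE) (simp_all add: wz_commute[symmetric] W.m_assoc[symmetric])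
  show ?thesis unfolding True RS_iff
  proof (intro conjI allI impI ballI)
    fix x assume "x \<notin> E 0"
    then show "unit_seq 0 x = 0" by (auto simp: unit_seq_def)
  next
    fix x s assume "x \<in> E 0" "s \<in> carrier (G 0)"
    then show "unit_seq 0 (gm 0 (inv\<^bsub>G 0\<^esub> s) (gm 0 x s)) = unit_seq 0 x" using conj by simp
  next
    fix x assume "x \<in> E 0"
    then have "x = \<one>\<^bsub>G 0\<^esub> \<or> x = wz 0" using c by simp
    then show "unit_seq 0 (gm 0 (wz 0) x) = - unit_seq 0 x"
      using d by (elim disjE) (simp_all add: unit_seq_def wz_wz)
  qed
next
  case False
  then have "unit_seq n = (\<lambda>_. 0)" by (simp add: unit_seq_def fun_eq_iff)
  then show ?thesis by (simp add: RS_iff)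
qed

lemma unit_seq_pos: "n > 0 \<Longrightarrow> unit_seq n = (\<lambda>_. 0)"
  by (simp add: unit_seq_def fun_eq_iff)

lemma unit_seq_one: "unit_seq 0 \<one>\<^bsub>G 0\<^esub> = 1"
  by (simp add: unit_seq_def)

lemma tot_prod_closed:
  assumes F: "\<And>n. F n \<in> RS n" and H: "\<And>n. H n \<in> RS n"
  shows "tot_prod F H k \<in> RS k"
proof -
  have "(\<lambda>w. \<Sum>n\<in>{..k}. 1 * ind_prod n (k - n) (F n) (H (k - n)) w) \<in> RS k"
  proof (rule RS_sum)
    fix n assume "n \<in> {..k}"
    then show "ind_prod n (k - n) (F n) (H (k - n)) \<in> RS k" using ind_prod_closed[OF F H, of n "k - n"] by simp
  qed
  then show ?thesis by (simp add: tot_prod_def[abs_def])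
qed

lemma RS_eqI: "f \<in> RS n \<Longrightarrow> g \<in> RS n \<Longrightarrow> (\<And>x. x \<in> E n \<Longrightarrow> f x = g x) \<Longrightarrow> f = g"
proof
  fix x assume fg: "f \<in> RS n" "g \<in> RS n" and e: "\<And>x. x \<in> E n \<Longrightarrow> f x = g x"
  show "f x = g x"
    using RS_zero[OF fg(1), of x] RS_zero[OF fg(2), of x] e[of x] by (cases "x \<in> E n") simp_all
qed

text \<open>\<open>unit_seq\<close> vanishes in positive degree, so only the empty subset
  contributes, and the identity may represent it.\<close>

lemma tot_prod_unit_left:
  assumes F: "\<And>n. F n \<in> RS n"
  shows "tot_prod unit_seq F k = F k"
proof (rule RS_eqI[OF tot_prod_closed[OF unit_seq_closed F] F])
  fix w assume w: "w \<in> E k"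
  then have wc: "w \<in> carrier (G k)" by simp
  have 0: "subset_term unit_seq F k w A = 0" if "A \<in> Pow {1..k} - {{}}" for A
  proof -
    have "finite A" using that finite_subset by auto
    then have "card A > 0" using that by (simp add: card_gt_0_iff)
    then show ?thesis by (simp add: subset_term_def unit_seq_pos outer_ext_def cong: if_cong)
  qed
  have "tot_prod unit_seq F k w = (\<Sum>A\<in>Pow {1..k}. subset_term unit_seq F k w A)"
    by (rule tot_prod_subset[OF unit_seq_closed F wc])
  also have "\<dots> = (\<Sum>A\<in>{{}}. subset_term unit_seq F k w A)"
    by (rule sum.mono_neutral_right) (use 0 in auto)
  also have "\<dots> = subset_term unit_seq F k w {}" by simp
  also have "\<dots> = outer_ext 0 k (unit_seq 0) (F k) w"
    using subset_term_rep[OF unit_seq_closed F wc, of "{}" "\<one>\<^bsub>G k\<^esub>"] wc by simp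
  also have "\<dots> = outer_ext 0 k (unit_seq 0) (F k) (jx 0 k \<one>\<^bsub>G 0\<^esub> w)" by (simp add: jx_0_left wc)
  also have "\<dots> = unit_seq 0 \<one>\<^bsub>G 0\<^esub> * F k w"
    using w by (intro outer_ext_jx[OF unit_seq_closed F]) auto
  finally show "tot_prod unit_seq F k w = F k w" by (simp add: unit_seq_one)
qed

lemma tot_prod_unit_right:
  assumes F: "\<And>n. F n \<in> RS n"
  shows "tot_prod F unit_seq k = F k"
proof (rule RS_eqI[OF tot_prod_closed[OF F unit_seq_closed] F])
  fix w assume w: "w \<in> E k"
  then have wc: "w \<in> carrier (G k)" by simp
  have 0: "subset_term F unit_seq k w A = 0" if "A \<in> Pow {1..k} - {{1..k}}" for A
  proof -
    have "card A < card {1..k}" using that by (intro psubset_card_mono) auto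
    then have "k - card A > 0" by simp
    then show ?thesis by (simp add: subset_term_def unit_seq_pos outer_ext_def cong: if_cong)
  qed
  have "tot_prod F unit_seq k w = (\<Sum>A\<in>Pow {1..k}. subset_term F unit_seq k w A)"
    by (rule tot_prod_subset[OF F unit_seq_closed wc])
  also have "\<dots> = (\<Sum>A\<in>{{1..k}}. subset_term F unit_seq k w A)"
    by (rule sum.mono_neutral_right) (use 0 in auto)
  also have "\<dots> = subset_term F unit_seq k w {1..k}" by simp
  also have "\<dots> = outer_ext k 0 (F k) (unit_seq 0) w"
    using subset_term_rep[OF F unit_seq_closed wc, of "{1..k}" "\<one>\<^bsub>G k\<^esub>"] wc by simp
  also have "\<dots> = outer_ext k 0 (F k) (unit_seq 0) (jx k 0 w \<one>\<^bsub>G 0\<^esub>)" by (simp add: jx_0_right wc)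
  also have "\<dots> = F k w * unit_seq 0 \<one>\<^bsub>G 0\<^esub>"
    using w by (intro outer_ext_jx[OF F unit_seq_closed]) auto
  finally show "tot_prod F unit_seq k w = F k w" by (simp add: unit_seq_one)
qed

section \<open>Additivity and associativity of the total product\<close>

lemma ind_prod_sum_left:
  "ind_prod n m (\<lambda>x. \<Sum>i\<in>I. f i x) g w = (\<Sum>i\<in>I. ind_prod n m (f i) g w)"
proof (cases "w \<in> carrier (G (n + m))")
  case True
  have "(\<Sum>x\<in>E n. \<Sum>y\<in>E m. (\<Sum>i\<in>I. f i x) * g y * conj_count (n + m) w (jx n m x y)) =
      (\<Sum>i\<in>I. \<Sum>x\<in>E n. \<Sum>y\<in>E m. f i x * g y * conj_count (n + m) w (jx n m x y))"
    by (simp add: sum_distrib_right)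
      (subst sum.swap[of _ _ "E m"], subst sum.swap[of _ _ "E n"], rule HOL.refl)
  then show ?thesis using True by (simp add: ind_prod_conj_count sum_divide_distrib)
qed (simp add: ind_prod_def)

lemma ind_prod_sum_right:
  "ind_prod n m g (\<lambda>x. \<Sum>i\<in>I. f i x) w = (\<Sum>i\<in>I. ind_prod n m g (f i) w)"
proof (cases "w \<in> carrier (G (n + m))")
  case True
  have "(\<Sum>x\<in>E n. \<Sum>y\<in>E m. g x * (\<Sum>i\<in>I. f i y) * conj_count (n + m) w (jx n m x y)) =
      (\<Sum>i\<in>I. \<Sum>x\<in>E n. \<Sum>y\<in>E m. g x * f i y * conj_count (n + m) w (jx n m x y))"
    by (simp add: sum_distrib_right sum_distrib_left)
      (subst sum.swap[of _ _ "E m"], subst sum.swap[of _ _ "E n"], rule HOL.refl)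
  then show ?thesis using True by (simp add: ind_prod_conj_count sum_divide_distrib)
qed (simp add: ind_prod_def)

lemma sum_triple_reindex:
  fixes f :: "nat \<Rightarrow> nat \<Rightarrow> nat \<Rightarrow> complex"
  shows "(\<Sum>N\<le>k. \<Sum>n\<le>N. f n (N - n) (k - N)) = (\<Sum>n\<le>k. \<Sum>m\<le>k - n. f n m (k - n - m))"
proof -
  have "(\<Sum>N\<le>k. \<Sum>n\<le>N. f n (N - n) (k - N)) = (\<Sum>(N, n)\<in>(SIGMA N:{..k}. {..N}). f n (N - n) (k - N))"
    by (rule sum.Sigma) auto
  also have "\<dots> = (\<Sum>(n, m)\<in>(SIGMA n:{..k}. {..k - n}). f n m (k - n - m))"
    by (rule sum.reindex_bij_witness[of _ "\<lambda>(n, m). (n + m, n)" "\<lambda>(N, n). (n, N - n)"]) auto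
  also have "\<dots> = (\<Sum>n\<le>k. \<Sum>m\<le>k - n. f n m (k - n - m))" by (rule sum.Sigma[symmetric]) auto
  finally show ?thesis .
qed

lemma tot_prod_assoc:
  assumes F: "\<And>n. F n \<in> RS n" and H: "\<And>n. H n \<in> RS n" and K: "\<And>n. K n \<in> RS n"
  shows "tot_prod (tot_prod F H) K = tot_prod F (tot_prod H K)"
proof (intro ext)
  fix k w
  have "tot_prod (tot_prod F H) K k w =
      (\<Sum>N\<le>k. \<Sum>n\<le>N. ind_prod N (k - N) (ind_prod n (N - n) (F n) (H (N - n))) (K (k - N)) w)"
    unfolding tot_prod_def[of "tot_prod F H"] by (simp add: tot_prod_def[abs_def] ind_prod_sum_left)
  \<comment> \<open>Writing \<open>N\<close> as \<open>n + (N - n)\<close> makes the summand a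
    function of the three degrees, the shape that \<open>sum_triple_reindex\<close> expects.\<close>
  also have "\<dots> = (\<Sum>N\<le>k. \<Sum>n\<le>N. ind_prod (n + (N - n)) (k - N) (ind_prod n (N - n) (F n) (H (N - n))) (K (k - N)) w)"
    by (intro sum.cong HOL.refl) simp
  also have "\<dots> = (\<Sum>n\<le>k. \<Sum>m\<le>k - n. ind_prod (n + m) (k - n - m) (ind_prod n m (F n) (H m)) (K (k - n - m)) w)"
    by (rule sum_triple_reindex[of "\<lambda>n m l. ind_prod (n + m) l (ind_prod n m (F n) (H m)) (K l) w"])
  also have "\<dots> = (\<Sum>n\<le>k. \<Sum>m\<le>k - n. ind_prod n (k - n) (F n) (ind_prod m (k - n - m) (H m) (K (k - n - m))) w)"
    by (intro sum.cong HOL.refl) (simp add: ind_prod_assoc[OF F H K])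
  also have "\<dots> = tot_prod F (tot_prod H K) k w"
    unfolding tot_prod_def[of F "tot_prod H K"] by (simp add: tot_prod_def[abs_def] ind_prod_sum_right)
  finally show "tot_prod (tot_prod F H) K k w = tot_prod F (tot_prod H K) k w" .
qed

end

section \<open>Complex vector spaces and their tensor products\<close>

lemma complex_ring_simps [simp]:
  "carrier complex_ring = UNIV" "a \<oplus>\<^bsub>complex_ring\<^esub> b = a + b" "a \<otimes>\<^bsub>complex_ring\<^esub> b = a * b"
  "\<zero>\<^bsub>complex_ring\<^esub> = 0" "\<one>\<^bsub>complex_ring\<^esub> = 1"
  by (simp_all add: complex_ring_def)

lemma cring_complex: "cring complex_ring"
proof (rule cringI)
  show "abelian_group complex_ring"
    by (rule abelian_groupI) (auto intro: exI[of _ "- _"])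
  show "comm_monoid complex_ring" by unfold_locales (auto simp: mult.assoc mult.commute)
qed (auto simp: algebra_simps)

lemma a_inv_complex [simp]: "\<ominus>\<^bsub>complex_ring\<^esub> a = - a"
proof -
  interpret cring complex_ring by (rule cring_complex)
  show ?thesis using minus_equality[of "- a" a] by simp
qed

abbreviation vspace :: "(complex, 'm) module \<Rightarrow> bool" where
  "vspace M \<equiv> module complex_ring M"

abbreviation lin :: "(complex, 'm) module \<Rightarrow> (complex, 'n) module \<Rightarrow> ('m \<Rightarrow> 'n) set" where
  "lin M N \<equiv> mod_hom complex_ring M N"

abbreviation scalars :: "(complex, complex) module" where
  "scalars \<equiv> self_module complex_ring"

lemma scalars_simps [simp]:
  "carrier scalars = UNIV" "a \<oplus>\<^bsub>scalars\<^esub> b = a + b" "r \<odot>\<^bsub>scalars\<^esub> a = r * a" "\<zero>\<^bsub>scalars\<^esub> = 0"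
  by (simp_all add: self_module_def)

lemma vspace_scalars: "vspace scalars"
proof (rule moduleI)
  show "abelian_group scalars" by (rule abelian_groupI) (auto intro: exI[of _ "- _"])
qed (auto simp: cring_complex algebra_simps)

text \<open>The additive inverse of \<open>x\<close> is \<open>(-1) x\<close>, by the hypotheses on
  \<open>0 x\<close> and on sums of scalars.\<close>

lemma vspaceI:
  assumes "\<And>x y. x \<in> carrier M \<Longrightarrow> y \<in> carrier M \<Longrightarrow> x \<oplus>\<^bsub>M\<^esub> y \<in> carrier M" "\<zero>\<^bsub>M\<^esub> \<in> carrier M"
    "\<And>x y z. x \<in> carrier M \<Longrightarrow> y \<in> carrier M \<Longrightarrow> z \<in> carrier M \<Longrightarrow>
       (x \<oplus>\<^bsub>M\<^esub> y) \<oplus>\<^bsub>M\<^esub> z = x \<oplus>\<^bsub>M\<^esub> (y \<oplus>\<^bsub>M\<^esub> z)"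
    "\<And>x y. x \<in> carrier M \<Longrightarrow> y \<in> carrier M \<Longrightarrow> x \<oplus>\<^bsub>M\<^esub> y = y \<oplus>\<^bsub>M\<^esub> x"
    "\<And>x. x \<in> carrier M \<Longrightarrow> \<zero>\<^bsub>M\<^esub> \<oplus>\<^bsub>M\<^esub> x = x"
    "\<And>r x. x \<in> carrier M \<Longrightarrow> r \<odot>\<^bsub>M\<^esub> x \<in> carrier M"
    "\<And>r s x. x \<in> carrier M \<Longrightarrow> (r + s) \<odot>\<^bsub>M\<^esub> x = r \<odot>\<^bsub>M\<^esub> x \<oplus>\<^bsub>M\<^esub> s \<odot>\<^bsub>M\<^esub> x"
    "\<And>r x y. x \<in> carrier M \<Longrightarrow> y \<in> carrier M \<Longrightarrow> r \<odot>\<^bsub>M\<^esub> (x \<oplus>\<^bsub>M\<^esub> y) = r \<odot>\<^bsub>M\<^esub> x \<oplus>\<^bsub>M\<^esub> r \<odot>\<^bsub>M\<^esub> y"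
    "\<And>r s x. x \<in> carrier M \<Longrightarrow> (r * s) \<odot>\<^bsub>M\<^esub> x = r \<odot>\<^bsub>M\<^esub> (s \<odot>\<^bsub>M\<^esub> x)"
    "\<And>x. x \<in> carrier M \<Longrightarrow> 1 \<odot>\<^bsub>M\<^esub> x = x" "\<And>x. x \<in> carrier M \<Longrightarrow> 0 \<odot>\<^bsub>M\<^esub> x = \<zero>\<^bsub>M\<^esub>"
  shows "vspace M"
proof (rule moduleI)
  show "abelian_group M"
  proof (rule abelian_groupI)
    fix x assume x: "x \<in> carrier M"
    have "(-1 + 1) \<odot>\<^bsub>M\<^esub> x = (-1) \<odot>\<^bsub>M\<^esub> x \<oplus>\<^bsub>M\<^esub> x" using assms(7)[OF x, of "-1" 1] assms(10)[OF x] by simp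
    then show "\<exists>y\<in>carrier M. y \<oplus>\<^bsub>M\<^esub> x = \<zero>\<^bsub>M\<^esub>"
      using assms(6)[OF x, of "-1"] assms(11)[OF x] by auto
  qed (use assms in auto)
qed (use assms in \<open>auto simp: cring_complex\<close>)

lemma linI:
  assumes "\<And>x. x \<in> carrier M \<Longrightarrow> f x \<in> carrier N"
    "\<And>x y. x \<in> carrier M \<Longrightarrow> y \<in> carrier M \<Longrightarrow> f (x \<oplus>\<^bsub>M\<^esub> y) = f x \<oplus>\<^bsub>N\<^esub> f y"
    "\<And>r x. x \<in> carrier M \<Longrightarrow> f (r \<odot>\<^bsub>M\<^esub> x) = r \<odot>\<^bsub>N\<^esub> f x"
  shows "f \<in> lin M N"
  using assms by (auto simp: mod_hom_def)

lemma lin_closed: "f \<in> lin M N \<Longrightarrow> x \<in> carrier M \<Longrightarrow> f x \<in> carrier N"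
  and lin_add: "f \<in> lin M N \<Longrightarrow> x \<in> carrier M \<Longrightarrow> y \<in> carrier M \<Longrightarrow> f (x \<oplus>\<^bsub>M\<^esub> y) = f x \<oplus>\<^bsub>N\<^esub> f y"
  and lin_smult: "f \<in> lin M N \<Longrightarrow> x \<in> carrier M \<Longrightarrow> f (r \<odot>\<^bsub>M\<^esub> x) = r \<odot>\<^bsub>N\<^esub> f x"
  by (auto simp: mod_hom_def)

lemma vspace_add [simp]: "vspace M \<Longrightarrow> x \<in> carrier M \<Longrightarrow> y \<in> carrier M \<Longrightarrow> x \<oplus>\<^bsub>M\<^esub> y \<in> carrier M"
  and vspace_smult [simp]: "vspace M \<Longrightarrow> x \<in> carrier M \<Longrightarrow> r \<odot>\<^bsub>M\<^esub> x \<in> carrier M"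
  and vspace_zero [simp]: "vspace M \<Longrightarrow> \<zero>\<^bsub>M\<^esub> \<in> carrier M"
  and vspace_zero_smult [simp]: "vspace M \<Longrightarrow> x \<in> carrier M \<Longrightarrow> 0 \<odot>\<^bsub>M\<^esub> x = \<zero>\<^bsub>M\<^esub>"
  and vspace_smult_add: "vspace M \<Longrightarrow> x \<in> carrier M \<Longrightarrow> y \<in> carrier M \<Longrightarrow>
    r \<odot>\<^bsub>M\<^esub> (x \<oplus>\<^bsub>M\<^esub> y) = r \<odot>\<^bsub>M\<^esub> x \<oplus>\<^bsub>M\<^esub> r \<odot>\<^bsub>M\<^esub> y"
  and vspace_add_smult: "vspace M \<Longrightarrow> x \<in> carrier M \<Longrightarrow> (r + s) \<odot>\<^bsub>M\<^esub> x = r \<odot>\<^bsub>M\<^esub> x \<oplus>\<^bsub>M\<^esub> s \<odot>\<^bsub>M\<^esub> x"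
  and vspace_mult_smult: "vspace M \<Longrightarrow> x \<in> carrier M \<Longrightarrow> (r * s) \<odot>\<^bsub>M\<^esub> x = r \<odot>\<^bsub>M\<^esub> (s \<odot>\<^bsub>M\<^esub> x)"
  and vspace_zero_add [simp]: "vspace M \<Longrightarrow> x \<in> carrier M \<Longrightarrow> \<zero>\<^bsub>M\<^esub> \<oplus>\<^bsub>M\<^esub> x = x"
  and vspace_add_zero [simp]: "vspace M \<Longrightarrow> x \<in> carrier M \<Longrightarrow> x \<oplus>\<^bsub>M\<^esub> \<zero>\<^bsub>M\<^esub> = x"
  and vspace_assoc: "vspace M \<Longrightarrow> x \<in> carrier M \<Longrightarrow> y \<in> carrier M \<Longrightarrow> z \<in> carrier M \<Longrightarrow>
    (x \<oplus>\<^bsub>M\<^esub> y) \<oplus>\<^bsub>M\<^esub> z = x \<oplus>\<^bsub>M\<^esub> (y \<oplus>\<^bsub>M\<^esub> z)"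
  and vspace_commute: "vspace M \<Longrightarrow> x \<in> carrier M \<Longrightarrow> y \<in> carrier M \<Longrightarrow> x \<oplus>\<^bsub>M\<^esub> y = y \<oplus>\<^bsub>M\<^esub> x"
  and vspace_one_smult [simp]: "vspace M \<Longrightarrow> x \<in> carrier M \<Longrightarrow> 1 \<odot>\<^bsub>M\<^esub> x = x"
  and vspace_smult_zero [simp]: "vspace M \<Longrightarrow> r \<odot>\<^bsub>M\<^esub> \<zero>\<^bsub>M\<^esub> = \<zero>\<^bsub>M\<^esub>"
proof -
  assume M: "vspace M"
  interpret module complex_ring M by (rule M)
  show "x \<in> carrier M \<Longrightarrow> y \<in> carrier M \<Longrightarrow> x \<oplus>\<^bsub>M\<^esub> y \<in> carrier M"
    "x \<in> carrier M \<Longrightarrow> r \<odot>\<^bsub>M\<^esub> x \<in> carrier M" "\<zero>\<^bsub>M\<^esub> \<in> carrier M"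
    "x \<in> carrier M \<Longrightarrow> 0 \<odot>\<^bsub>M\<^esub> x = \<zero>\<^bsub>M\<^esub>"
    "x \<in> carrier M \<Longrightarrow> y \<in> carrier M \<Longrightarrow> r \<odot>\<^bsub>M\<^esub> (x \<oplus>\<^bsub>M\<^esub> y) = r \<odot>\<^bsub>M\<^esub> x \<oplus>\<^bsub>M\<^esub> r \<odot>\<^bsub>M\<^esub> y"
    "x \<in> carrier M \<Longrightarrow> (r + s) \<odot>\<^bsub>M\<^esub> x = r \<odot>\<^bsub>M\<^esub> x \<oplus>\<^bsub>M\<^esub> s \<odot>\<^bsub>M\<^esub> x"
    "x \<in> carrier M \<Longrightarrow> (r * s) \<odot>\<^bsub>M\<^esub> x = r \<odot>\<^bsub>M\<^esub> (s \<odot>\<^bsub>M\<^esub> x)"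
    "x \<in> carrier M \<Longrightarrow> \<zero>\<^bsub>M\<^esub> \<oplus>\<^bsub>M\<^esub> x = x" "x \<in> carrier M \<Longrightarrow> x \<oplus>\<^bsub>M\<^esub> \<zero>\<^bsub>M\<^esub> = x"
    "x \<in> carrier M \<Longrightarrow> y \<in> carrier M \<Longrightarrow> z \<in> carrier M \<Longrightarrow>
      (x \<oplus>\<^bsub>M\<^esub> y) \<oplus>\<^bsub>M\<^esub> z = x \<oplus>\<^bsub>M\<^esub> (y \<oplus>\<^bsub>M\<^esub> z)"
    "x \<in> carrier M \<Longrightarrow> y \<in> carrier M \<Longrightarrow> x \<oplus>\<^bsub>M\<^esub> y = y \<oplus>\<^bsub>M\<^esub> x"
    "x \<in> carrier M \<Longrightarrow> 1 \<odot>\<^bsub>M\<^esub> x = x" "r \<odot>\<^bsub>M\<^esub> \<zero>\<^bsub>M\<^esub> = \<zero>\<^bsub>M\<^esub>"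
    using smult_l_null[of x] smult_r_distr[of r x y] smult_l_distr[of r s x] smult_assoc1[of r s x]
      smult_one[of x] smult_r_null[of r] M.a_assoc[of x y z] M.a_comm[of x y]
    by simp_all
qed

lemma vspace_uminus: "vspace M \<Longrightarrow> x \<in> carrier M \<Longrightarrow> \<ominus>\<^bsub>M\<^esub> x = (-1) \<odot>\<^bsub>M\<^esub> x"
  using module.smult_l_minus[of complex_ring M 1 x] vspace_one_smult[of M x] by simp

lemma vspace_minus: "vspace M \<Longrightarrow> y \<in> carrier M \<Longrightarrow> x \<ominus>\<^bsub>M\<^esub> y = x \<oplus>\<^bsub>M\<^esub> (-1) \<odot>\<^bsub>M\<^esub> y"
  by (simp add: a_minus_def vspace_uminus)

lemma lin_zero:
  assumes "vspace M" "vspace N" "f \<in> lin M N"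
  shows "f \<zero>\<^bsub>M\<^esub> = \<zero>\<^bsub>N\<^esub>"
  using lin_smult[OF assms(3), of "\<zero>\<^bsub>M\<^esub>" 0] lin_closed[OF assms(3), of "\<zero>\<^bsub>M\<^esub>"] assms by simp

lemma lin_comp: "f \<in> lin M N \<Longrightarrow> g \<in> lin N P \<Longrightarrow> (\<lambda>x. g (f x)) \<in> lin M P"
  by (auto simp: mod_hom_def Pi_iff)

lemma lin_id: "(\<lambda>x. x) \<in> lin M M"
  by (auto simp: mod_hom_def)

lemma vspace_sub_eq:
  assumes M: "vspace M" and x: "x \<in> carrier M" "y \<in> carrier M" and e: "x \<oplus>\<^bsub>M\<^esub> (-1) \<odot>\<^bsub>M\<^esub> y = \<zero>\<^bsub>M\<^esub>"
  shows "x = y"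
proof -
  have "(-1) \<odot>\<^bsub>M\<^esub> y \<oplus>\<^bsub>M\<^esub> y = (-1 + 1) \<odot>\<^bsub>M\<^esub> y" using vspace_add_smult[OF M x(2), of "-1" 1] M x by simp
  then have "(-1) \<odot>\<^bsub>M\<^esub> y \<oplus>\<^bsub>M\<^esub> y = \<zero>\<^bsub>M\<^esub>" using M x by simp
  then have "(x \<oplus>\<^bsub>M\<^esub> (-1) \<odot>\<^bsub>M\<^esub> y) \<oplus>\<^bsub>M\<^esub> y = x" using M x by (simp add: vspace_assoc)
  then show ?thesis using e M x by simp
qed

subsection \<open>Free modules and quotients\<close>

abbreviation FM :: "'x set \<Rightarrow> (complex, 'x \<Rightarrow> complex) module" where
  "FM X \<equiv> free_module complex_ring X"

lemma FM_simps:
  "carrier (FM X) = {c. (\<forall>x. x \<notin> X \<longrightarrow> c x = 0) \<and> finite {x. c x \<noteq> 0}}"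
  "c \<oplus>\<^bsub>FM X\<^esub> d = (\<lambda>x. c x + d x)" "r \<odot>\<^bsub>FM X\<^esub> c = (\<lambda>x. r * c x)" "\<zero>\<^bsub>FM X\<^esub> = (\<lambda>x. 0)"
  by (simp_all add: free_module_def)

lemma vspace_FM: "vspace (FM X)"
proof (rule vspaceI)
  fix c d assume cd: "c \<in> carrier (FM X)" "d \<in> carrier (FM X)"
  have "finite {x. c x + d x \<noteq> 0}"
    by (rule finite_subset[of _ "{x. c x \<noteq> 0} \<union> {x. d x \<noteq> 0}"]) (use cd in \<open>auto simp: FM_simps\<close>)
  then show "c \<oplus>\<^bsub>FM X\<^esub> d \<in> carrier (FM X)" using cd by (auto simp: FM_simps)
next
  fix r c assume c: "c \<in> carrier (FM X)"
  have "finite {x. r * c x \<noteq> 0}"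
    by (rule finite_subset[of _ "{x. c x \<noteq> 0}"]) (use c in \<open>auto simp: FM_simps\<close>)
  then show "r \<odot>\<^bsub>FM X\<^esub> c \<in> carrier (FM X)" using c by (auto simp: FM_simps)
qed (auto simp: FM_simps algebra_simps)

abbreviation fb :: "'x \<Rightarrow> 'x \<Rightarrow> complex" where "fb \<equiv> free_basis complex_ring"

lemma fb_eq: "fb x = (\<lambda>y. if y = x then 1 else 0)"
  by (simp add: free_basis_def cong: if_cong)

lemma fb_closed: "x \<in> X \<Longrightarrow> fb x \<in> carrier (FM X)"
  by (auto simp: FM_simps fb_eq)

lemma submodule_vspace_iff:
  assumes M: "vspace M"
  shows "submodule N complex_ring M \<longleftrightarrow> N \<subseteq> carrier M \<and> \<zero>\<^bsub>M\<^esub> \<in> N \<and>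
    (\<forall>x\<in>N. \<forall>y\<in>N. x \<oplus>\<^bsub>M\<^esub> y \<in> N) \<and> (\<forall>r. \<forall>x\<in>N. r \<odot>\<^bsub>M\<^esub> x \<in> N)" (is "_ \<longleftrightarrow> ?R")
proof
  interpret module complex_ring M by (rule M)
  assume s: "submodule N complex_ring M"
  then interpret submodule N complex_ring M .
  show ?R using submoduleE[OF s] subgroup.one_closed[OF subgroup_axioms] by auto
next
  interpret module complex_ring M by (rule M)
  assume R: ?R
  show "submodule N complex_ring M"
  proof (rule submoduleI)
    fix a assume "a \<in> N"
    then show "\<ominus>\<^bsub>M\<^esub> a \<in> N" using R vspace_uminus[OF M, of a] by auto
  qed (use R in auto)
qed

lemma submodule_span_submodule:
  assumes M: "vspace M" and S: "S \<subseteq> carrier M"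
  shows "submodule (submodule_span complex_ring M S) complex_ring M"
    and "S \<subseteq> submodule_span complex_ring M S"
proof -
  let ?I = "{N. submodule N complex_ring M \<and> S \<subseteq> N}"
  have "carrier M \<in> ?I" using S M by (simp add: submodule_vspace_iff)
  then show "submodule (submodule_span complex_ring M S) complex_ring M"
    unfolding submodule_span_def submodule_vspace_iff[OF M] by (auto simp: submodule_vspace_iff[OF M])
  show "S \<subseteq> submodule_span complex_ring M S" unfolding submodule_span_def by blast
qed

locale vquotient =
  fixes M :: "(complex, 'm) module" and N :: "'m set"
  assumes M: "vspace M" and N: "submodule N complex_ring M"
begin

abbreviation Q where "Q \<equiv> quotient_module M N"
abbreviation co where "co x \<equiv> N +>\<^bsub>M\<^esub> x"

sublocale M: module complex_ring M by (rule M)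

sublocale A: abelian_subgroup N M
proof (rule abelian_subgroupI3)
  show "additive_subgroup N M"
    using N by (simp add: additive_subgroup_def submodule_def)
qed (rule M.abelian_group_axioms)

lemma carrier_Q: "carrier Q = co ` carrier M"
  by (auto simp: quotient_module_def A_RCOSETS_def' a_r_coset_def')

lemma co_closed: "x \<in> carrier M \<Longrightarrow> co x \<in> carrier Q"
  by (simp add: carrier_Q)

lemma co_eq_iff:
  assumes x: "x \<in> carrier M" "y \<in> carrier M"
  shows "co x = co y \<longleftrightarrow> x \<oplus>\<^bsub>M\<^esub> (-1) \<odot>\<^bsub>M\<^esub> y \<in> N"
proof -
  have "co x = co y \<longleftrightarrow> x \<in> co y"
    using A.a_repr_independence'[of x y] A.a_repr_independenceD[of x y] x by metis
  then show ?thesis using A.a_rcos_module[of y x] x vspace_uminus[OF M x(2)] by simp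
qed

lemma add_co: "x \<in> carrier M \<Longrightarrow> y \<in> carrier M \<Longrightarrow> co x \<oplus>\<^bsub>Q\<^esub> co y = co (x \<oplus>\<^bsub>M\<^esub> y)"
  using A.a_rcos_sum by (simp add: quotient_module_def)

lemma zero_co: "\<zero>\<^bsub>Q\<^esub> = co \<zero>\<^bsub>M\<^esub>"
  using M.a_coset_add_zero[OF A.a_subset] by (simp add: quotient_module_def)

lemma smult_co:
  assumes x: "x \<in> carrier M" shows "r \<odot>\<^bsub>Q\<^esub> co x = co (r \<odot>\<^bsub>M\<^esub> x)"
proof -
  have "co (r \<odot>\<^bsub>M\<^esub> y) = co (r \<odot>\<^bsub>M\<^esub> x)" if "y \<in> co x" for y
  proof -
    have y: "y \<in> carrier M" using that x A.a_elemrcos_carrier[of x y] M.is_abelian_group by blast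
    have "co y = co x" using A.a_repr_independence'[OF that x] by simp
    then have "y \<oplus>\<^bsub>M\<^esub> (-1) \<odot>\<^bsub>M\<^esub> x \<in> N" using co_eq_iff x y by simp
    then have "r \<odot>\<^bsub>M\<^esub> (y \<oplus>\<^bsub>M\<^esub> (-1) \<odot>\<^bsub>M\<^esub> x) \<in> N"
      using N unfolding submodule_vspace_iff[OF M] by (elim conjE) simp
    moreover have "r \<odot>\<^bsub>M\<^esub> (y \<oplus>\<^bsub>M\<^esub> (-1) \<odot>\<^bsub>M\<^esub> x) = r \<odot>\<^bsub>M\<^esub> y \<oplus>\<^bsub>M\<^esub> (-1) \<odot>\<^bsub>M\<^esub> (r \<odot>\<^bsub>M\<^esub> x)"
      using x y M vspace_mult_smult[OF M x, of r "-1"] vspace_mult_smult[OF M x, of "-1" r]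
      by (simp add: vspace_smult_add)
    ultimately show ?thesis using co_eq_iff x y M by simp
  qed
  moreover have "x \<in> co x" using A.a_rcos_self x by simp
  ultimately have "(\<Union>y\<in>co x. co (r \<odot>\<^bsub>M\<^esub> y)) = co (r \<odot>\<^bsub>M\<^esub> x)" by blast
  then show ?thesis by (simp add: quotient_module_def)
qed

lemma vspace_Q: "vspace Q"
proof (rule vspaceI)
  show "\<zero>\<^bsub>Q\<^esub> \<in> carrier Q" using co_closed M by (simp add: zero_co)
next
  fix x y z assume "x \<in> carrier Q" "y \<in> carrier Q" "z \<in> carrier Q"
  then show "(x \<oplus>\<^bsub>Q\<^esub> y) \<oplus>\<^bsub>Q\<^esub> z = x \<oplus>\<^bsub>Q\<^esub> (y \<oplus>\<^bsub>Q\<^esub> z)"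
    unfolding carrier_Q by (elim imageE) (simp add: add_co M vspace_assoc)
next
  fix x y assume "x \<in> carrier Q" "y \<in> carrier Q"
  then show "x \<oplus>\<^bsub>Q\<^esub> y \<in> carrier Q" "x \<oplus>\<^bsub>Q\<^esub> y = y \<oplus>\<^bsub>Q\<^esub> x"
    "r \<odot>\<^bsub>Q\<^esub> (x \<oplus>\<^bsub>Q\<^esub> y) = r \<odot>\<^bsub>Q\<^esub> x \<oplus>\<^bsub>Q\<^esub> r \<odot>\<^bsub>Q\<^esub> y" for r
    unfolding carrier_Q by (elim imageE; simp add: add_co smult_co M vspace_smult_add vspace_commute[OF M])+
next
  fix x assume "x \<in> carrier Q"
  then show "\<zero>\<^bsub>Q\<^esub> \<oplus>\<^bsub>Q\<^esub> x = x" "r \<odot>\<^bsub>Q\<^esub> x \<in> carrier Q" "1 \<odot>\<^bsub>Q\<^esub> x = x" "0 \<odot>\<^bsub>Q\<^esub> x = \<zero>\<^bsub>Q\<^esub>"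
    "(r + s) \<odot>\<^bsub>Q\<^esub> x = r \<odot>\<^bsub>Q\<^esub> x \<oplus>\<^bsub>Q\<^esub> s \<odot>\<^bsub>Q\<^esub> x" "(r * s) \<odot>\<^bsub>Q\<^esub> x = r \<odot>\<^bsub>Q\<^esub> (s \<odot>\<^bsub>Q\<^esub> x)" for r s
    unfolding carrier_Q zero_co
    by (elim imageE; simp add: add_co smult_co M vspace_add_smult vspace_mult_smult)+
qed

end

subsection \<open>The tensor product\<close>

abbreviation ten :: "(complex, 'm) module \<Rightarrow> (complex, 'n) module \<Rightarrow> (complex, ('m \<times> 'n \<Rightarrow> complex) set) module"
  where "ten M N \<equiv> tensor complex_ring M N"

abbreviation pt where "pt M N x y \<equiv> pure_tensor complex_ring M N x y"

abbreviation tlift where "tlift M N P f \<equiv> tensor_lift complex_ring M N P f"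

definition bilin :: "(complex, 'm) module \<Rightarrow> (complex, 'n) module \<Rightarrow> (complex, 'p) module \<Rightarrow> ('m \<Rightarrow> 'n \<Rightarrow> 'p) \<Rightarrow> bool" where
  "bilin M N P f \<longleftrightarrow> (\<forall>x\<in>carrier M. f x \<in> lin N P) \<and> (\<forall>y\<in>carrier N. (\<lambda>x. f x y) \<in> lin M P)"

lemma bilinD:
  assumes "bilin M N P f" "x \<in> carrier M" "y \<in> carrier N"
  shows "f x y \<in> carrier P" "f x \<in> lin N P" "(\<lambda>x. f x y) \<in> lin M P"
  using assms lin_closed[of "f x" N P y] by (simp_all add: bilin_def)

locale vpair =
  fixes M :: "(complex, 'm) module" and N :: "(complex, 'n) module"
  assumes M: "vspace M" and N: "vspace N"
begin

abbreviation X where "X \<equiv> carrier M \<times> carrier N"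
abbreviation rels where "rels \<equiv> bilinear_rels complex_ring M N"

lemma rels_cases:
  assumes "c \<in> rels"
  obtains (add_left) x x' y where "x \<in> carrier M" "x' \<in> carrier M" "y \<in> carrier N"
      "c = fb (x \<oplus>\<^bsub>M\<^esub> x', y) \<ominus>\<^bsub>FM X\<^esub> (fb (x, y) \<oplus>\<^bsub>FM X\<^esub> fb (x', y))"
    | (add_right) x y y' where "x \<in> carrier M" "y \<in> carrier N" "y' \<in> carrier N"
      "c = fb (x, y \<oplus>\<^bsub>N\<^esub> y') \<ominus>\<^bsub>FM X\<^esub> (fb (x, y) \<oplus>\<^bsub>FM X\<^esub> fb (x, y'))"
    | (smult_left) r x y where "x \<in> carrier M" "y \<in> carrier N"
      "c = fb (r \<odot>\<^bsub>M\<^esub> x, y) \<ominus>\<^bsub>FM X\<^esub> (r \<odot>\<^bsub>FM X\<^esub> fb (x, y))"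
    | (smult_right) r x y where "x \<in> carrier M" "y \<in> carrier N"
      "c = fb (x, r \<odot>\<^bsub>N\<^esub> y) \<ominus>\<^bsub>FM X\<^esub> (r \<odot>\<^bsub>FM X\<^esub> fb (x, y))"
  using assms unfolding bilinear_rels_def Let_def by blast

lemma rels_intros:
  "x \<in> carrier M \<Longrightarrow> x' \<in> carrier M \<Longrightarrow> y \<in> carrier N \<Longrightarrow>
    fb (x \<oplus>\<^bsub>M\<^esub> x', y) \<ominus>\<^bsub>FM X\<^esub> (fb (x, y) \<oplus>\<^bsub>FM X\<^esub> fb (x', y)) \<in> rels"
  "x \<in> carrier M \<Longrightarrow> y \<in> carrier N \<Longrightarrow> y' \<in> carrier N \<Longrightarrow>
    fb (x, y \<oplus>\<^bsub>N\<^esub> y') \<ominus>\<^bsub>FM X\<^esub> (fb (x, y) \<oplus>\<^bsub>FM X\<^esub> fb (x, y')) \<in> rels"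
  "x \<in> carrier M \<Longrightarrow> y \<in> carrier N \<Longrightarrow>
    fb (r \<odot>\<^bsub>M\<^esub> x, y) \<ominus>\<^bsub>FM X\<^esub> (r \<odot>\<^bsub>FM X\<^esub> fb (x, y)) \<in> rels"
  "x \<in> carrier M \<Longrightarrow> y \<in> carrier N \<Longrightarrow>
    fb (x, r \<odot>\<^bsub>N\<^esub> y) \<ominus>\<^bsub>FM X\<^esub> (r \<odot>\<^bsub>FM X\<^esub> fb (x, y)) \<in> rels"
  unfolding bilinear_rels_def Let_def complex_ring_simps by blast+

lemma fb_X: "x \<in> carrier M \<Longrightarrow> y \<in> carrier N \<Longrightarrow> fb (x, y) \<in> carrier (FM X)"
  by (rule fb_closed) simp

lemma rels_closed: "rels \<subseteq> carrier (FM X)"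
proof
  fix c assume "c \<in> rels"
  then show "c \<in> carrier (FM X)"
    by (cases rule: rels_cases) (simp_all add: vspace_minus vspace_FM fb_X M N)
qed

abbreviation null where "null \<equiv> tensor_null complex_ring M N"

lemma null_submodule: "submodule null complex_ring (FM X)"
  and rels_null: "rels \<subseteq> null"
  unfolding tensor_null_def using submodule_span_submodule[OF vspace_FM rels_closed] by auto

sublocale Q: vquotient "FM X" null
  by (rule vquotient.intro[OF vspace_FM null_submodule])

lemma ten_eq: "ten M N = Q.Q"
  by (simp add: tensor_def)

lemma pt_eq: "pt M N x y = Q.co (fb (x, y))"
  by (simp add: pure_tensor_def)

lemma vspace_ten: "vspace (ten M N)"
  unfolding ten_eq by (rule Q.vspace_Q)

lemma pt_closed: "x \<in> carrier M \<Longrightarrow> y \<in> carrier N \<Longrightarrow> pt M N x y \<in> carrier (ten M N)"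
  unfolding ten_eq pt_eq by (intro Q.co_closed fb_X)

lemma co_minus:
  assumes "a \<in> carrier (FM X)" "b \<in> carrier (FM X)" "a \<ominus>\<^bsub>FM X\<^esub> b \<in> rels"
  shows "Q.co a = Q.co b"
  using assms rels_null by (subst Q.co_eq_iff) (auto simp: vspace_minus vspace_FM)

lemma pt_bilin: "bilin M N (ten M N) (pt M N)"
  unfolding bilin_def
proof (intro conjI ballI linI)
  fix x y y' assume c: "x \<in> carrier M" "y \<in> carrier N" "y' \<in> carrier N"
  have "Q.co (fb (x, y \<oplus>\<^bsub>N\<^esub> y')) = Q.co (fb (x, y) \<oplus>\<^bsub>FM X\<^esub> fb (x, y'))"
    by (rule co_minus) (use c M N in \<open>simp_all add: fb_X vspace_FM rels_intros\<close>)
  then show "pt M N x (y \<oplus>\<^bsub>N\<^esub> y') = pt M N x y \<oplus>\<^bsub>ten M N\<^esub> pt M N x y'"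
    unfolding pt_eq ten_eq using c by (simp add: Q.add_co fb_X)
next
  fix x r y assume c: "x \<in> carrier M" "y \<in> carrier N"
  have "Q.co (fb (x, r \<odot>\<^bsub>N\<^esub> y)) = Q.co (r \<odot>\<^bsub>FM X\<^esub> fb (x, y))"
    by (rule co_minus) (use c M N in \<open>simp_all add: fb_X vspace_FM rels_intros\<close>)
  then show "pt M N x (r \<odot>\<^bsub>N\<^esub> y) = r \<odot>\<^bsub>ten M N\<^esub> pt M N x y"
    unfolding pt_eq ten_eq using c by (simp add: Q.smult_co fb_X)
next
  fix x x' y assume c: "y \<in> carrier N" "x \<in> carrier M" "x' \<in> carrier M"
  have "Q.co (fb (x \<oplus>\<^bsub>M\<^esub> x', y)) = Q.co (fb (x, y) \<oplus>\<^bsub>FM X\<^esub> fb (x', y))"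
    by (rule co_minus) (use c M N in \<open>simp_all add: fb_X vspace_FM rels_intros\<close>)
  then show "pt M N (x \<oplus>\<^bsub>M\<^esub> x') y = pt M N x y \<oplus>\<^bsub>ten M N\<^esub> pt M N x' y"
    unfolding pt_eq ten_eq using c by (simp add: Q.add_co fb_X)
next
  fix r x y assume c: "y \<in> carrier N" "x \<in> carrier M"
  have "Q.co (fb (r \<odot>\<^bsub>M\<^esub> x, y)) = Q.co (r \<odot>\<^bsub>FM X\<^esub> fb (x, y))"
    by (rule co_minus) (use c M N in \<open>simp_all add: fb_X vspace_FM rels_intros\<close>)
  then show "pt M N (r \<odot>\<^bsub>M\<^esub> x) y = r \<odot>\<^bsub>ten M N\<^esub> pt M N x y"
    unfolding pt_eq ten_eq using c by (simp add: Q.smult_co fb_X)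
qed (auto intro: pt_closed)

text \<open>Scalars can be absorbed into the first factor of a pure tensor, so every element is a
  sum of pure tensors. The induction runs over the support of a representative in the free
  module.\<close>

lemma ten_induct [consumes 1, case_names pure add]:
  assumes U: "U \<in> carrier (ten M N)"
    and pure: "\<And>x y. x \<in> carrier M \<Longrightarrow> y \<in> carrier N \<Longrightarrow> P (pt M N x y)"
    and add: "\<And>U W. U \<in> carrier (ten M N) \<Longrightarrow> W \<in> carrier (ten M N) \<Longrightarrow> P U \<Longrightarrow> P W \<Longrightarrow> P (U \<oplus>\<^bsub>ten M N\<^esub> W)"
  shows "P U"
proof -
  have *: "P (Q.co c)" if "finite A" "A \<subseteq> X" "\<And>p. p \<notin> A \<Longrightarrow> c p = 0" for A c
    using that
  proof (induction A arbitrary: c)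
    case empty
    then have c: "c = \<zero>\<^bsub>FM X\<^esub>" by (auto simp: FM_simps)
    \<comment> \<open>The empty support gives the zero tensor, which is itself pure, so the
      induction principle requires no separate case for zero.\<close>
    have "pt M N \<zero>\<^bsub>M\<^esub> \<zero>\<^bsub>N\<^esub> = pt M N (0 \<odot>\<^bsub>M\<^esub> \<zero>\<^bsub>M\<^esub>) \<zero>\<^bsub>N\<^esub>" using M by simp
    also have "\<dots> = 0 \<odot>\<^bsub>ten M N\<^esub> pt M N \<zero>\<^bsub>M\<^esub> \<zero>\<^bsub>N\<^esub>"
      by (rule lin_smult[OF bilinD(3)[OF pt_bilin vspace_zero[OF M] vspace_zero[OF N]] vspace_zero[OF M]])
    also have "\<dots> = Q.co c"
      using vspace_zero_smult[OF vspace_ten] pt_closed M N by (simp add: ten_eq Q.zero_co c)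
    finally have "pt M N \<zero>\<^bsub>M\<^esub> \<zero>\<^bsub>N\<^esub> = Q.co c" .
    then show ?case using pure[of "\<zero>\<^bsub>M\<^esub>" "\<zero>\<^bsub>N\<^esub>"] M N by simp
  next
    case (insert p A)
    obtain x y where p: "p = (x, y)" "x \<in> carrier M" "y \<in> carrier N" using insert.prems(1) by auto
    define d where "d = c(p := 0)"
    have d: "P (Q.co d)" by (rule insert.IH) (use insert in \<open>auto simp: d_def\<close>)
    have sd: "{q. d q \<noteq> 0} \<subseteq> A" using insert.prems by (auto simp: d_def)
    have dF: "d \<in> carrier (FM X)"
      using finite_subset[OF sd insert.hyps(1)] sd insert.prems(1) by (auto simp: FM_simps)
    have "c = d \<oplus>\<^bsub>FM X\<^esub> c p \<odot>\<^bsub>FM X\<^esub> fb (x, y)" by (auto simp: FM_simps d_def fb_eq p)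
    then have "Q.co c = Q.co d \<oplus>\<^bsub>Q.Q\<^esub> c p \<odot>\<^bsub>Q.Q\<^esub> Q.co (fb (x, y))"
      using dF p by (simp add: Q.add_co Q.smult_co fb_X vspace_FM)
    also have "c p \<odot>\<^bsub>Q.Q\<^esub> Q.co (fb (x, y)) = pt M N (c p \<odot>\<^bsub>M\<^esub> x) y"
      using lin_smult[OF bilinD(3)[OF pt_bilin p(2,3)] p(2)] by (simp add: pt_eq ten_eq)
    finally have e: "Q.co c = Q.co d \<oplus>\<^bsub>ten M N\<^esub> pt M N (c p \<odot>\<^bsub>M\<^esub> x) y" by (simp add: ten_eq)
    show ?case unfolding e
      by (rule add) (use d dF p M in \<open>auto simp: ten_eq Q.co_closed intro: pure pt_closed[unfolded ten_eq]\<close>)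
  qed
  obtain c where c: "c \<in> carrier (FM X)" "U = Q.co c" using U unfolding ten_eq Q.carrier_Q by blast
  show ?thesis unfolding c(2)
    by (rule *[of "{p. c p \<noteq> 0}"]) (use c(1) in \<open>auto simp: FM_simps\<close>)
qed

lemma ten_ext:
  assumes "f \<in> lin (ten M N) P" "g \<in> lin (ten M N) P"
    and "\<And>x y. x \<in> carrier M \<Longrightarrow> y \<in> carrier N \<Longrightarrow> f (pt M N x y) = g (pt M N x y)"
    and "U \<in> carrier (ten M N)"
  shows "f U = g U"
  using assms(4)
proof (induction rule: ten_induct)
  case (add U W)
  then show ?case using lin_add[OF assms(1)] lin_add[OF assms(2)] by simp
qed (rule assms(3))

end

section \<open>The universal property of the tensor product\<close>

locale vpair_lift = vpair M N
  for M :: "(complex, 'm) module" and N :: "(complex, 'n) module" +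
  fixes P :: "(complex, 'p) module" and f :: "'m \<Rightarrow> 'n \<Rightarrow> 'p"
  assumes P: "vspace P" and f: "bilin M N P f"
begin

sublocale P: module complex_ring P by (rule P)

definition ext :: "('m \<times> 'n \<Rightarrow> complex) \<Rightarrow> 'p" where
  "ext c = (\<Oplus>\<^bsub>P\<^esub>p\<in>{p \<in> X. c p \<noteq> 0}. c p \<odot>\<^bsub>P\<^esub> f (fst p) (snd p))"

lemma term_closed: "p \<in> X \<Longrightarrow> r \<odot>\<^bsub>P\<^esub> f (fst p) (snd p) \<in> carrier P"
  using bilinD(1)[OF f, of "fst p" "snd p"] P by auto

text \<open>The support of a sum can be smaller than the union of the supports; extending all sums
  to a common finite range makes them comparable.\<close>

lemma ext_superset:
  assumes "finite A" "A \<subseteq> X" "\<And>p. p \<in> X \<Longrightarrow> p \<notin> A \<Longrightarrow> c p = 0"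
  shows "ext c = (\<Oplus>\<^bsub>P\<^esub>p\<in>A. c p \<odot>\<^bsub>P\<^esub> f (fst p) (snd p))"
  unfolding ext_def
proof (rule P.add.finprod_mono_neutral_cong_left)
  fix p assume "p \<in> A - {p \<in> X. c p \<noteq> 0}"
  then have "c p = 0" "p \<in> X" using assms by auto
  then show "c p \<odot>\<^bsub>P\<^esub> f (fst p) (snd p) = \<zero>\<^bsub>P\<^esub>"
    using bilinD(1)[OF f, of "fst p" "snd p"] P by auto
qed (use assms term_closed in auto)

lemma ext_lin: "ext \<in> lin (FM X) P"
proof (rule linI)
  fix c assume "c \<in> carrier (FM X)"
  show "ext c \<in> carrier P" unfolding ext_def using term_closed by (intro P.finsum_closed) auto
next
  fix c d assume cd: "c \<in> carrier (FM X)" "d \<in> carrier (FM X)"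
  let ?A = "{p. c p \<noteq> 0} \<union> {p. d p \<noteq> 0}"
  have A: "finite ?A" "?A \<subseteq> X" using cd by (auto simp: FM_simps)
  have "ext (c \<oplus>\<^bsub>FM X\<^esub> d) = (\<Oplus>\<^bsub>P\<^esub>p\<in>?A. (c p + d p) \<odot>\<^bsub>P\<^esub> f (fst p) (snd p))"
    unfolding FM_simps by (rule ext_superset[OF A]) auto
  also have "\<dots> = (\<Oplus>\<^bsub>P\<^esub>p\<in>?A. c p \<odot>\<^bsub>P\<^esub> f (fst p) (snd p) \<oplus>\<^bsub>P\<^esub> d p \<odot>\<^bsub>P\<^esub> f (fst p) (snd p))"
  proof (rule P.finsum_cong')
    show "(\<lambda>p. c p \<odot>\<^bsub>P\<^esub> f (fst p) (snd p) \<oplus>\<^bsub>P\<^esub> d p \<odot>\<^bsub>P\<^esub> f (fst p) (snd p)) \<in> ?A \<rightarrow> carrier P"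
      using term_closed A P by (intro Pi_I vspace_add) auto
    fix p assume "p \<in> ?A"
    then have "p \<in> X" using A by blast
    then show "(c p + d p) \<odot>\<^bsub>P\<^esub> f (fst p) (snd p) = c p \<odot>\<^bsub>P\<^esub> f (fst p) (snd p) \<oplus>\<^bsub>P\<^esub> d p \<odot>\<^bsub>P\<^esub> f (fst p) (snd p)"
      using bilinD(1)[OF f, of "fst p" "snd p"] by (auto intro!: vspace_add_smult[OF P])
  qed simp
  also have "\<dots> = (\<Oplus>\<^bsub>P\<^esub>p\<in>?A. c p \<odot>\<^bsub>P\<^esub> f (fst p) (snd p)) \<oplus>\<^bsub>P\<^esub> (\<Oplus>\<^bsub>P\<^esub>p\<in>?A. d p \<odot>\<^bsub>P\<^esub> f (fst p) (snd p))"
    by (rule P.finsum_addf) (use term_closed A in auto)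
  also have "\<dots> = ext c \<oplus>\<^bsub>P\<^esub> ext d"
    using ext_superset[OF A, of c] ext_superset[OF A, of d] by auto
  finally show "ext (c \<oplus>\<^bsub>FM X\<^esub> d) = ext c \<oplus>\<^bsub>P\<^esub> ext d" .
next
  fix r c assume c: "c \<in> carrier (FM X)"
  let ?A = "{p. c p \<noteq> 0}"
  have A: "finite ?A" "?A \<subseteq> X" using c by (auto simp: FM_simps)
  have "ext (r \<odot>\<^bsub>FM X\<^esub> c) = (\<Oplus>\<^bsub>P\<^esub>p\<in>?A. (r * c p) \<odot>\<^bsub>P\<^esub> f (fst p) (snd p))"
    unfolding FM_simps by (rule ext_superset[OF A]) auto
  also have "\<dots> = (\<Oplus>\<^bsub>P\<^esub>p\<in>?A. r \<odot>\<^bsub>P\<^esub> (c p \<odot>\<^bsub>P\<^esub> f (fst p) (snd p)))"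
  proof (rule P.finsum_cong')
    show "(\<lambda>p. r \<odot>\<^bsub>P\<^esub> (c p \<odot>\<^bsub>P\<^esub> f (fst p) (snd p))) \<in> ?A \<rightarrow> carrier P"
      by (rule Pi_I, rule vspace_smult[OF P term_closed]) (use A(2) in blast)
    fix p assume "p \<in> ?A"
    then have "p \<in> X" using A by blast
    then show "(r * c p) \<odot>\<^bsub>P\<^esub> f (fst p) (snd p) = r \<odot>\<^bsub>P\<^esub> (c p \<odot>\<^bsub>P\<^esub> f (fst p) (snd p))"
      using bilinD(1)[OF f, of "fst p" "snd p"] by (auto intro!: vspace_mult_smult[OF P])
  qed simp
  also have "\<dots> = r \<odot>\<^bsub>P\<^esub> (\<Oplus>\<^bsub>P\<^esub>p\<in>?A. c p \<odot>\<^bsub>P\<^esub> f (fst p) (snd p))"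
  proof (rule P.finsum_smult_ldistr[symmetric, OF A(1)])
    show "(\<lambda>p. c p \<odot>\<^bsub>P\<^esub> f (fst p) (snd p)) \<in> ?A \<rightarrow> carrier P"
      by (rule Pi_I, rule term_closed) (use A(2) in blast)
  qed simp
  also have "\<dots> = r \<odot>\<^bsub>P\<^esub> ext c" using ext_superset[OF A, of c] by auto
  finally show "ext (r \<odot>\<^bsub>FM X\<^esub> c) = r \<odot>\<^bsub>P\<^esub> ext c" .
qed

lemma ext_fb:
  assumes "x \<in> carrier M" "y \<in> carrier N"
  shows "ext (fb (x, y)) = f x y"
proof -
  have "ext (fb (x, y)) = (\<Oplus>\<^bsub>P\<^esub>p\<in>{(x, y)}. fb (x, y) p \<odot>\<^bsub>P\<^esub> f (fst p) (snd p))"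
    by (rule ext_superset) (use assms in \<open>auto simp: fb_eq\<close>)
  then show ?thesis using bilinD(1)[OF f assms] P by (simp add: fb_eq)
qed

text \<open>The kernel of the linear map \<open>ext\<close> is a submodule, and bilinearity of
  \<open>f\<close> puts every generating relation into it. Hence it contains their span.\<close>

lemma ext_null: "null \<subseteq> {c \<in> carrier (FM X). ext c = \<zero>\<^bsub>P\<^esub>}"
proof -
  let ?K = "{c \<in> carrier (FM X). ext c = \<zero>\<^bsub>P\<^esub>}"
  have K: "submodule ?K complex_ring (FM X)"
    unfolding submodule_vspace_iff[OF vspace_FM]
    using lin_add[OF ext_lin] lin_smult[OF ext_lin] lin_zero[OF vspace_FM P ext_lin] P
    by (auto simp: vspace_FM)
  have m: "ext (a \<ominus>\<^bsub>FM X\<^esub> b) = \<zero>\<^bsub>P\<^esub>"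
    if "a \<in> carrier (FM X)" "b \<in> carrier (FM X)" "ext a = ext b" for a b
  proof -
    have "ext (a \<ominus>\<^bsub>FM X\<^esub> b) = ext b \<oplus>\<^bsub>P\<^esub> (-1) \<odot>\<^bsub>P\<^esub> ext b"
      using that lin_add[OF ext_lin] lin_smult[OF ext_lin] by (simp add: vspace_minus vspace_FM)
    also have "\<dots> = (1 + -1) \<odot>\<^bsub>P\<^esub> ext b"
      using vspace_add_smult[OF P, of "ext b" 1 "-1"] lin_closed[OF ext_lin that(2)] P by simp
    finally show ?thesis using lin_closed[OF ext_lin that(2)] P by simp
  qed
  note a = lin_add[OF ext_lin] lin_smult[OF ext_lin]
  have "rels \<subseteq> ?K"
  proof
    fix c assume cr: "c \<in> rels"
    then have "ext c = \<zero>\<^bsub>P\<^esub>"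
    proof (cases rule: rels_cases)
      case (add_left x x' y)
      then show ?thesis using lin_add[OF bilinD(3)[OF f]] M N
        by (auto simp: a ext_fb fb_X vspace_FM intro!: m)
    next
      case (add_right x y y')
      then show ?thesis using lin_add[OF bilinD(2)[OF f]] M N
        by (auto simp: a ext_fb fb_X vspace_FM intro!: m)
    next
      case (smult_left r x y)
      then show ?thesis using lin_smult[OF bilinD(3)[OF f]] M N
        by (auto simp: a ext_fb fb_X vspace_FM intro!: m)
    next
      case (smult_right r x y)
      then show ?thesis using lin_smult[OF bilinD(2)[OF f]] M N
        by (auto simp: a ext_fb fb_X vspace_FM intro!: m)
    qed
    then show "c \<in> ?K" using cr rels_closed by blast
  qed
  then show ?thesis unfolding tensor_null_def submodule_span_def using K by blast
qed

text \<open>Two representatives of a coset differ by an element of \<open>null\<close>, which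
  \<open>ext\<close> kills; so the set of values in \<open>tensor_lift\<close> is a
  singleton.\<close>

lemma tlift_co:
  assumes c: "c \<in> carrier (FM X)"
  shows "tlift M N P f (Q.co c) = ext c"
proof -
  have *: "ext d = ext c" if d: "d \<in> Q.co c" for d
  proof -
    have dF: "d \<in> carrier (FM X)" using Q.A.a_elemrcos_carrier[OF c d] .
    have "Q.co d = Q.co c" using Q.A.a_repr_independence'[OF d c] by simp
    then have "d \<oplus>\<^bsub>FM X\<^esub> (-1) \<odot>\<^bsub>FM X\<^esub> c \<in> null" using Q.co_eq_iff[OF dF c] by simp
    then have "ext (d \<oplus>\<^bsub>FM X\<^esub> (-1) \<odot>\<^bsub>FM X\<^esub> c) = \<zero>\<^bsub>P\<^esub>" using ext_null by blast
    then have "ext d \<oplus>\<^bsub>P\<^esub> (-1) \<odot>\<^bsub>P\<^esub> ext c = \<zero>\<^bsub>P\<^esub>"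
      using lin_add[OF ext_lin dF] lin_smult[OF ext_lin c] c by (simp add: vspace_FM)
    then show ?thesis using vspace_sub_eq[OF P] lin_closed[OF ext_lin] c dF by blast
  qed
  have e: "ext ` Q.co c = {ext c}"
  proof (rule Set.equalityI; rule subsetI)
    fix y assume "y \<in> ext ` Q.co c"
    then show "y \<in> {ext c}" by (elim imageE) (simp only: * singletonI)
  next
    fix y assume "y \<in> {ext c}"
    then show "y \<in> ext ` Q.co c" using Q.A.a_rcos_self[OF c] by (simp only: singleton_iff) (rule imageI)
  qed
  have "tlift M N P f (Q.co c) = the_elem (ext ` Q.co c)"
    unfolding tensor_lift_def ext_def[abs_def] complex_ring_simps ..
  then show ?thesis unfolding e by simp
qed

lemma tlift_lin: "tlift M N P f \<in> lin (ten M N) P"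
proof (rule linI)
  fix U assume "U \<in> carrier (ten M N)"
  then show "tlift M N P f U \<in> carrier P"
    unfolding ten_eq Q.carrier_Q by (elim imageE) (simp add: tlift_co lin_closed[OF ext_lin])
next
  fix U W assume "U \<in> carrier (ten M N)" "W \<in> carrier (ten M N)"
  then show "tlift M N P f (U \<oplus>\<^bsub>ten M N\<^esub> W) = tlift M N P f U \<oplus>\<^bsub>P\<^esub> tlift M N P f W"
    unfolding ten_eq Q.carrier_Q
    by (elim imageE) (simp add: tlift_co Q.add_co lin_add[OF ext_lin] vspace_FM)
next
  fix r U assume "U \<in> carrier (ten M N)"
  then show "tlift M N P f (r \<odot>\<^bsub>ten M N\<^esub> U) = r \<odot>\<^bsub>P\<^esub> tlift M N P f U"
    unfolding ten_eq Q.carrier_Q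
    by (elim imageE) (simp add: tlift_co Q.smult_co lin_smult[OF ext_lin] vspace_FM)
qed

lemma tlift_pt: "x \<in> carrier M \<Longrightarrow> y \<in> carrier N \<Longrightarrow> tlift M N P f (pt M N x y) = f x y"
  unfolding pt_eq using fb_X by (simp add: tlift_co ext_fb)

end

subsection \<open>Functoriality and functionals\<close>

lemmas vspace_ten = vpair.vspace_ten[OF vpair.intro]
lemmas pt_closed = vpair.pt_closed[OF vpair.intro]
lemmas pt_bilin = vpair.pt_bilin[OF vpair.intro]
lemmas ten_induct = vpair.ten_induct[OF vpair.intro, consumes 3, case_names pure add]
lemmas ten_ext = vpair.ten_ext[OF vpair.intro]

lemma tlift_lin: "vspace M \<Longrightarrow> vspace N \<Longrightarrow> vspace P \<Longrightarrow> bilin M N P f \<Longrightarrow> tlift M N P f \<in> lin (ten M N) P"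
  by (rule vpair_lift.tlift_lin) (simp add: vpair_lift_def vpair_lift_axioms_def vpair_def)

lemma tlift_pt: "vspace M \<Longrightarrow> vspace N \<Longrightarrow> vspace P \<Longrightarrow> bilin M N P f \<Longrightarrow>
    x \<in> carrier M \<Longrightarrow> y \<in> carrier N \<Longrightarrow> tlift M N P f (pt M N x y) = f x y"
  by (rule vpair_lift.tlift_pt) (simp add: vpair_lift_def vpair_lift_axioms_def vpair_def)

lemma pt_lin_left: "vspace M \<Longrightarrow> vspace N \<Longrightarrow> y \<in> carrier N \<Longrightarrow> (\<lambda>x. pt M N x y) \<in> lin M (ten M N)"
  and pt_lin_right: "vspace M \<Longrightarrow> vspace N \<Longrightarrow> x \<in> carrier M \<Longrightarrow> pt M N x \<in> lin N (ten M N)"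
  using pt_bilin[of M N] by (auto simp: bilin_def)

lemma lin_cong:
  assumes M: "vspace M" and f: "f \<in> lin M N" and e: "\<And>x. x \<in> carrier M \<Longrightarrow> g x = f x"
  shows "g \<in> lin M N"
  by (rule linI) (use M e lin_closed[OF f] lin_add[OF f] lin_smult[OF f] in auto)

lemma lin_plus:
  assumes M: "vspace M" and N: "vspace N" and f: "f \<in> lin M N" and g: "g \<in> lin M N"
  shows "(\<lambda>x. f x \<oplus>\<^bsub>N\<^esub> g x) \<in> lin M N"
proof (rule linI)
  fix x y assume c: "x \<in> carrier M" "y \<in> carrier M"
  note cl = lin_closed[OF f c(1)] lin_closed[OF f c(2)] lin_closed[OF g c(1)] lin_closed[OF g c(2)]
  interpret module complex_ring N by (rule N)
  show "f (x \<oplus>\<^bsub>M\<^esub> y) \<oplus>\<^bsub>N\<^esub> g (x \<oplus>\<^bsub>M\<^esub> y) = f x \<oplus>\<^bsub>N\<^esub> g x \<oplus>\<^bsub>N\<^esub> (f y \<oplus>\<^bsub>N\<^esub> g y)"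
    using cl lin_add[OF f c] lin_add[OF g c] by (simp add: M.a_ac)
next
  fix x assume c: "x \<in> carrier M"
  show "f x \<oplus>\<^bsub>N\<^esub> g x \<in> carrier N" using lin_closed[OF f c] lin_closed[OF g c] N by simp
  show "f (r \<odot>\<^bsub>M\<^esub> x) \<oplus>\<^bsub>N\<^esub> g (r \<odot>\<^bsub>M\<^esub> x) = r \<odot>\<^bsub>N\<^esub> (f x \<oplus>\<^bsub>N\<^esub> g x)" for r
    using lin_closed[OF f c] lin_closed[OF g c] lin_smult[OF f c] lin_smult[OF g c] N
    by (simp add: vspace_smult_add)
qed

lemma bilin_comp:
  assumes f: "f \<in> lin M M'" and g: "g \<in> lin N N'" and h: "bilin M' N' P h"
  shows "bilin M N P (\<lambda>x y. h (f x) (g y))"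
  unfolding bilin_def
proof (intro conjI ballI)
  fix x assume "x \<in> carrier M"
  then have "h (f x) \<in> lin N' P" using h lin_closed[OF f] by (simp add: bilin_def)
  then show "(\<lambda>y. h (f x) (g y)) \<in> lin N P" by (rule lin_comp[OF g])
next
  fix y assume "y \<in> carrier N"
  then have "(\<lambda>x. h x (g y)) \<in> lin M' P" using h lin_closed[OF g] by (simp add: bilin_def)
  then show "(\<lambda>x. h (f x) (g y)) \<in> lin M P" by (rule lin_comp[OF f])
qed

lemma bilin_lin: "bilin M N P h \<Longrightarrow> f \<in> lin P Q \<Longrightarrow> bilin M N Q (\<lambda>x y. f (h x y))"
  by (auto simp: bilin_def intro: lin_comp)

text \<open>Linear dependence on a parameter survives the lift, by induction over sums of pure
  tensors. The nested lifts in \<open>tensor_assoc\<close> and \<open>tensor_swap\<close> are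
  bilinear for this reason.\<close>

lemma tlift_param:
  assumes M: "vspace M" and N: "vspace N" and C: "vspace C" and Q: "vspace Q"
    and b: "\<And>c. c \<in> carrier C \<Longrightarrow> bilin M N Q (f c)"
    and l: "\<And>x y. x \<in> carrier M \<Longrightarrow> y \<in> carrier N \<Longrightarrow> (\<lambda>c. f c x y) \<in> lin C Q"
    and U: "U \<in> carrier (ten M N)"
  shows "(\<lambda>c. tlift M N Q (f c) U) \<in> lin C Q"
  using M N U
proof (induction rule: ten_induct)
  case (pure x y)
  show ?case
    by (rule lin_cong[OF C l[OF pure]]) (rule tlift_pt[OF M N Q b pure])
next
  case (add U W)
  show ?case
    by (rule lin_cong[OF C lin_plus[OF C Q add(3,4)]]) (rule lin_add[OF tlift_lin[OF M N Q b] add(1,2)])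
qed

lemma lin_tlift:
  assumes M: "vspace M" and N: "vspace N" and P: "vspace P" and Q: "vspace Q"
    and b: "bilin M N P h" and f: "f \<in> lin P Q" and U: "U \<in> carrier (ten M N)"
  shows "f (tlift M N P h U) = tlift M N Q (\<lambda>x y. f (h x y)) U"
  by (rule ten_ext[OF M N lin_comp[OF tlift_lin[OF M N P b] f] tlift_lin[OF M N Q bilin_lin[OF b f]] _ U])
    (simp add: tlift_pt[OF M N P b] tlift_pt[OF M N Q bilin_lin[OF b f]])

abbreviation tmap where "tmap M N M' N' f g \<equiv> tensor_map complex_ring M N M' N' f g"

lemma
  assumes M: "vspace M" and N: "vspace N" and M': "vspace M'" and N': "vspace N'"
    and f: "f \<in> lin M M'" and g: "g \<in> lin N N'"
  shows tmap_lin: "tmap M N M' N' f g \<in> lin (ten M N) (ten M' N')"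
    and tmap_pt: "x \<in> carrier M \<Longrightarrow> y \<in> carrier N \<Longrightarrow> tmap M N M' N' f g (pt M N x y) = pt M' N' (f x) (g y)"
  unfolding tensor_map_def
  using tlift_lin[OF M N vspace_ten[OF M' N'] bilin_comp[OF f g pt_bilin[OF M' N']]]
    tlift_pt[OF M N vspace_ten[OF M' N'] bilin_comp[OF f g pt_bilin[OF M' N']]] by auto

abbreviation tassoc where "tassoc M N P \<equiv> tensor_assoc complex_ring M N P"

lemma
  assumes M: "vspace M" and N: "vspace N" and P: "vspace P"
  shows tassoc_lin: "tassoc M N P \<in> lin (ten (ten M N) P) (ten M (ten N P))"
    and tassoc_pt: "x \<in> carrier M \<Longrightarrow> y \<in> carrier N \<Longrightarrow> w \<in> carrier P \<Longrightarrow>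
      tassoc M N P (pt (ten M N) P (pt M N x y) w) = pt M (ten N P) x (pt N P y w)"
proof -
  let ?NP = "ten N P" and ?Q = "ten M (ten N P)"
  note NP = vspace_ten[OF N P] and MN = vspace_ten[OF M N]
  note Q = vspace_ten[OF M NP]
  let ?f = "\<lambda>w x y. pt M ?NP x (pt N P y w)"
  have b: "bilin M N ?Q (?f w)" if "w \<in> carrier P" for w
    using bilin_comp[OF lin_id pt_lin_left[OF N P that] pt_bilin[OF M NP]] .
  have l: "(\<lambda>w. ?f w x y) \<in> lin P ?Q" if "x \<in> carrier M" "y \<in> carrier N" for x y
    using lin_comp[OF pt_lin_right[OF N P that(2)] pt_lin_right[OF M NP that(1)]] .
  have B: "bilin (ten M N) P ?Q (\<lambda>U w. tlift M N ?Q (?f w) U)"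
    unfolding bilin_def using tlift_param[OF M N P Q b l] tlift_lin[OF M N Q b] by blast
  have e: "tassoc M N P = tlift (ten M N) P ?Q (\<lambda>U w. tlift M N ?Q (?f w) U)"
    by (simp add: tensor_assoc_def Let_def)
  show "tassoc M N P \<in> lin (ten (ten M N) P) ?Q" unfolding e by (rule tlift_lin[OF MN P Q B])
  show "x \<in> carrier M \<Longrightarrow> y \<in> carrier N \<Longrightarrow> w \<in> carrier P \<Longrightarrow>
      tassoc M N P (pt (ten M N) P (pt M N x y) w) = ?f w x y"
    unfolding e by (simp add: tlift_pt[OF MN P Q B] tlift_pt[OF M N Q b] pt_closed[OF M N])
qed

abbreviation tswap where "tswap K L M N \<equiv> tensor_swap complex_ring K L M N"

lemma
  assumes K: "vspace K" and L: "vspace L" and M: "vspace M" and N: "vspace N"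
  shows tswap_lin: "tswap K L M N \<in> lin (ten (ten K L) (ten M N)) (ten (ten K M) (ten L N))"
    and tswap_pt: "a \<in> carrier K \<Longrightarrow> b \<in> carrier L \<Longrightarrow> c \<in> carrier M \<Longrightarrow> d \<in> carrier N \<Longrightarrow>
      tswap K L M N (pt (ten K L) (ten M N) (pt K L a b) (pt M N c d)) =
      pt (ten K M) (ten L N) (pt K M a c) (pt L N b d)"
proof -
  let ?KM = "ten K M" and ?LN = "ten L N" and ?Q = "ten (ten K M) (ten L N)"
  note KL = vspace_ten[OF K L] and MN = vspace_ten[OF M N]
  note KM = vspace_ten[OF K M] and LN = vspace_ten[OF L N]
  note Q = vspace_ten[OF KM LN]
  let ?f = "\<lambda>a b c d. pt ?KM ?LN (pt K M a c) (pt L N b d)"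
  have b1: "bilin M N ?Q (?f a b)" if "a \<in> carrier K" "b \<in> carrier L" for a b
    using bilin_comp[OF pt_lin_right[OF K M that(1)] pt_lin_right[OF L N that(2)] pt_bilin[OF KM LN]] .
  have la: "(\<lambda>a. ?f a b c d) \<in> lin K ?Q" if "b \<in> carrier L" "c \<in> carrier M" "d \<in> carrier N" for b c d
    using lin_comp[OF pt_lin_left[OF K M that(2)] pt_lin_left[OF KM LN pt_closed[OF L N that(1,3)]]] .
  have lb: "(\<lambda>b. ?f a b c d) \<in> lin L ?Q" if "a \<in> carrier K" "c \<in> carrier M" "d \<in> carrier N" for a c d
    using lin_comp[OF pt_lin_left[OF L N that(3)] pt_lin_right[OF KM LN pt_closed[OF K M that(1,2)]]] .
  let ?g = "\<lambda>Y a b. tlift M N ?Q (?f a b) Y"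
  have b2: "bilin K L ?Q (?g Y)" if Y: "Y \<in> carrier (ten M N)" for Y
    unfolding bilin_def
  proof (intro conjI ballI)
    fix a assume a: "a \<in> carrier K"
    show "?g Y a \<in> lin L ?Q" by (rule tlift_param[OF M N L Q b1[OF a] lb[OF a] Y])
  next
    fix b assume b: "b \<in> carrier L"
    show "(\<lambda>a. ?g Y a b) \<in> lin K ?Q" by (rule tlift_param[OF M N K Q b1[OF _ b] la[OF b] Y])
  qed
  have l2: "(\<lambda>Y. ?g Y a b) \<in> lin (ten M N) ?Q" if "a \<in> carrier K" "b \<in> carrier L" for a b
    by (rule tlift_lin[OF M N Q b1[OF that]])
  let ?h = "\<lambda>X Y. tlift K L ?Q (?g Y) X"
  have B: "bilin (ten K L) (ten M N) ?Q ?h"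
    unfolding bilin_def using tlift_param[OF K L MN Q b2 l2] tlift_lin[OF K L Q b2] by blast
  have e: "tswap K L M N = tlift (ten K L) (ten M N) ?Q ?h"
    by (simp add: tensor_swap_def Let_def)
  show "tswap K L M N \<in> lin (ten (ten K L) (ten M N)) ?Q" unfolding e by (rule tlift_lin[OF KL MN Q B])
  assume c: "a \<in> carrier K" "b \<in> carrier L" "c \<in> carrier M" "d \<in> carrier N"
  have "tswap K L M N (pt (ten K L) (ten M N) (pt K L a b) (pt M N c d)) = ?h (pt K L a b) (pt M N c d)"
    unfolding e by (rule tlift_pt[OF KL MN Q B pt_closed[OF K L c(1,2)] pt_closed[OF M N c(3,4)]])
  also have "\<dots> = ?g (pt M N c d) a b" by (rule tlift_pt[OF K L Q b2[OF pt_closed[OF M N c(3,4)]] c(1,2)])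
  also have "\<dots> = ?f a b c d" by (rule tlift_pt[OF M N Q b1[OF c(1,2)] c(3,4)])
  finally show "tswap K L M N (pt (ten K L) (ten M N) (pt K L a b) (pt M N c d)) = ?f a b c d" .
qed

lemma ten_ext3:
  assumes M: "vspace M" and N: "vspace N" and P: "vspace P"
    and f: "f \<in> lin (ten (ten M N) P) Q" and g: "g \<in> lin (ten (ten M N) P) Q"
    and e: "\<And>x y w. x \<in> carrier M \<Longrightarrow> y \<in> carrier N \<Longrightarrow> w \<in> carrier P \<Longrightarrow>
      f (pt (ten M N) P (pt M N x y) w) = g (pt (ten M N) P (pt M N x y) w)"
    and U: "U \<in> carrier (ten (ten M N) P)"
  shows "f U = g U"
proof (rule ten_ext[OF vspace_ten[OF M N] P f g _ U])
  fix X w assume X: "X \<in> carrier (ten M N)" and w: "w \<in> carrier P"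
  note l = pt_lin_left[OF vspace_ten[OF M N] P w]
  show "f (pt (ten M N) P X w) = g (pt (ten M N) P X w)"
    by (rule ten_ext[OF M N lin_comp[OF l f] lin_comp[OF l g] _ X]) (rule e[OF _ _ w])
qed

lemma ten_ext4:
  assumes K: "vspace K" and L: "vspace L" and M: "vspace M" and N: "vspace N"
    and f: "f \<in> lin (ten (ten K L) (ten M N)) Q" and g: "g \<in> lin (ten (ten K L) (ten M N)) Q"
    and e: "\<And>a b c d. a \<in> carrier K \<Longrightarrow> b \<in> carrier L \<Longrightarrow> c \<in> carrier M \<Longrightarrow> d \<in> carrier N \<Longrightarrow>
      f (pt (ten K L) (ten M N) (pt K L a b) (pt M N c d)) = g (pt (ten K L) (ten M N) (pt K L a b) (pt M N c d))"
    and U: "U \<in> carrier (ten (ten K L) (ten M N))"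
  shows "f U = g U"
proof (rule ten_ext3[OF K L vspace_ten[OF M N] f g _ U])
  fix a b Y assume ab: "a \<in> carrier K" "b \<in> carrier L" and Y: "Y \<in> carrier (ten M N)"
  note l = pt_lin_right[OF vspace_ten[OF K L] vspace_ten[OF M N] pt_closed[OF K L ab]]
  show "f (pt (ten K L) (ten M N) (pt K L a b) Y) = g (pt (ten K L) (ten M N) (pt K L a b) Y)"
    by (rule ten_ext[OF M N lin_comp[OF l f] lin_comp[OF l g] _ Y]) (rule e[OF ab])
qed

text \<open>The tensor product of two linear functionals. All identities between tensors in the Hopf
  algebra axioms are reduced to values of such functionals or to pure tensors.\<close>

definition tfun :: "(complex, 'm) module \<Rightarrow> (complex, 'n) module \<Rightarrow> ('m \<Rightarrow> complex) \<Rightarrow> ('n \<Rightarrow> complex) \<Rightarrow>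
    ('m \<times> 'n \<Rightarrow> complex) set \<Rightarrow> complex" where
  "tfun M N \<alpha> \<beta> = tlift M N scalars (\<lambda>x y. \<alpha> x * \<beta> y)"

lemma bilin_times: "bilin scalars scalars scalars (*)"
  by (auto simp: bilin_def mod_hom_def algebra_simps)

lemma
  assumes M: "vspace M" and N: "vspace N" and a: "\<alpha> \<in> lin M scalars" and b: "\<beta> \<in> lin N scalars"
  shows tfun_lin: "tfun M N \<alpha> \<beta> \<in> lin (ten M N) scalars"
    and tfun_pt: "x \<in> carrier M \<Longrightarrow> y \<in> carrier N \<Longrightarrow> tfun M N \<alpha> \<beta> (pt M N x y) = \<alpha> x * \<beta> y"
  unfolding tfun_def using tlift_lin[OF M N vspace_scalars bilin_comp[OF a b bilin_times]]
    tlift_pt[OF M N vspace_scalars bilin_comp[OF a b bilin_times]] by auto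

lemma tfun_cong:
  assumes M: "vspace M" and N: "vspace N" and a: "\<alpha> \<in> lin M scalars" and b: "\<beta> \<in> lin N scalars"
    and a': "\<And>x. x \<in> carrier M \<Longrightarrow> \<alpha>' x = \<alpha> x" and b': "\<And>y. y \<in> carrier N \<Longrightarrow> \<beta>' y = \<beta> y"
    and U: "U \<in> carrier (ten M N)"
  shows "tfun M N \<alpha>' \<beta>' U = tfun M N \<alpha> \<beta> U"
proof -
  have l: "\<alpha>' \<in> lin M scalars" "\<beta>' \<in> lin N scalars"
    using lin_cong[OF M a a'] lin_cong[OF N b b'] by auto
  show ?thesis
    by (rule ten_ext[OF M N tfun_lin[OF M N l] tfun_lin[OF M N a b] _ U])
      (simp add: tfun_pt[OF M N l] tfun_pt[OF M N a b] a' b')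
qed

lemma tfun_tmap:
  assumes M: "vspace M" and N: "vspace N" and M': "vspace M'" and N': "vspace N'"
    and f: "f \<in> lin M M'" and g: "g \<in> lin N N'" and a: "\<alpha> \<in> lin M' scalars" and b: "\<beta> \<in> lin N' scalars"
    and U: "U \<in> carrier (ten M N)"
  shows "tfun M' N' \<alpha> \<beta> (tmap M N M' N' f g U) = tfun M N (\<lambda>x. \<alpha> (f x)) (\<lambda>y. \<beta> (g y)) U"
proof -
  note la = lin_comp[OF f a] and lb = lin_comp[OF g b]
  show ?thesis
    by (rule ten_ext[OF M N lin_comp[OF tmap_lin[OF M N M' N' f g] tfun_lin[OF M' N' a b]]
          tfun_lin[OF M N la lb] _ U])
      (simp add: tmap_pt[OF M N M' N' f g] tfun_pt[OF M' N' a b] tfun_pt[OF M N la lb]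
        lin_closed[OF f] lin_closed[OF g])
qed

lemma tfun_tassoc:
  assumes M: "vspace M" and N: "vspace N" and P: "vspace P"
    and a: "\<alpha> \<in> lin M scalars" and b: "\<beta> \<in> lin N scalars" and c: "\<gamma> \<in> lin P scalars"
    and U: "U \<in> carrier (ten (ten M N) P)"
  shows "tfun M (ten N P) \<alpha> (tfun N P \<beta> \<gamma>) (tassoc M N P U) = tfun (ten M N) P (tfun M N \<alpha> \<beta>) \<gamma> U"
proof -
  note NP = vspace_ten[OF N P] and MN = vspace_ten[OF M N]
  note bc = tfun_lin[OF N P b c] and ab = tfun_lin[OF M N a b]
  show ?thesis
    by (rule ten_ext3[OF M N P lin_comp[OF tassoc_lin[OF M N P] tfun_lin[OF M NP a bc]]
          tfun_lin[OF MN P ab c] _ U])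
      (simp add: tassoc_pt[OF M N P] tfun_pt[OF M NP a bc] tfun_pt[OF MN P ab c] tfun_pt[OF N P b c]
        tfun_pt[OF M N a b] pt_closed[OF M N] pt_closed[OF N P])
qed

lemma tfun_tswap:
  assumes K: "vspace K" and L: "vspace L" and M: "vspace M" and N: "vspace N"
    and a: "\<alpha> \<in> lin K scalars" and b: "\<beta> \<in> lin M scalars" and c: "\<gamma> \<in> lin L scalars" and d: "\<delta> \<in> lin N scalars"
    and U: "U \<in> carrier (ten (ten K L) (ten M N))"
  shows "tfun (ten K M) (ten L N) (tfun K M \<alpha> \<beta>) (tfun L N \<gamma> \<delta>) (tswap K L M N U) =
    tfun (ten K L) (ten M N) (tfun K L \<alpha> \<gamma>) (tfun M N \<beta> \<delta>) U"
proof -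
  note KL = vspace_ten[OF K L] and MN = vspace_ten[OF M N]
  note KM = vspace_ten[OF K M] and LN = vspace_ten[OF L N]
  note ab = tfun_lin[OF K M a b] and cd = tfun_lin[OF L N c d]
  note ac = tfun_lin[OF K L a c] and bd = tfun_lin[OF M N b d]
  show ?thesis
    by (rule ten_ext4[OF K L M N lin_comp[OF tswap_lin[OF K L M N] tfun_lin[OF KM LN ab cd]]
          tfun_lin[OF KL MN ac bd] _ U])
      (simp add: tswap_pt[OF K L M N] tfun_pt[OF KM LN ab cd] tfun_pt[OF KL MN ac bd]
        tfun_pt[OF K M a b] tfun_pt[OF L N c d] tfun_pt[OF K L a c] tfun_pt[OF M N b d]
        pt_closed[OF K L] pt_closed[OF M N] pt_closed[OF K M] pt_closed[OF L N])
qed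

lemma lin_sum_scalars:
  assumes "\<And>i. i \<in> I \<Longrightarrow> \<alpha> i \<in> lin M scalars"
  shows "(\<lambda>x. \<Sum>i\<in>I. \<alpha> i x) \<in> lin M scalars"
proof (rule linI)
  fix x y assume "x \<in> carrier M" "y \<in> carrier M"
  then show "(\<Sum>i\<in>I. \<alpha> i (x \<oplus>\<^bsub>M\<^esub> y)) = (\<Sum>i\<in>I. \<alpha> i x) \<oplus>\<^bsub>scalars\<^esub> (\<Sum>i\<in>I. \<alpha> i y)"
    using lin_add[OF assms] by (simp add: sum.distrib)
next
  fix r x assume "x \<in> carrier M"
  then show "(\<Sum>i\<in>I. \<alpha> i (r \<odot>\<^bsub>M\<^esub> x)) = r \<odot>\<^bsub>scalars\<^esub> (\<Sum>i\<in>I. \<alpha> i x)"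
    using lin_smult[OF assms] by (simp add: sum_distrib_left)
qed simp

lemma tfun_sum:
  assumes M: "vspace M" and N: "vspace N"
    and a: "\<And>i. i \<in> I \<Longrightarrow> \<alpha> i \<in> lin M scalars" and b: "\<And>j. j \<in> J \<Longrightarrow> \<beta> j \<in> lin N scalars"
    and U: "U \<in> carrier (ten M N)"
  shows "tfun M N (\<lambda>x. \<Sum>i\<in>I. \<alpha> i x) (\<lambda>y. \<Sum>j\<in>J. \<beta> j y) U = (\<Sum>i\<in>I. \<Sum>j\<in>J. tfun M N (\<alpha> i) (\<beta> j) U)"
proof -
  have l1: "(\<lambda>x. \<Sum>i\<in>I. \<alpha> i x) \<in> lin M scalars" "(\<lambda>y. \<Sum>j\<in>J. \<beta> j y) \<in> lin N scalars"
    using lin_sum_scalars[of I \<alpha> M] lin_sum_scalars[of J \<beta> N] a b by auto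
  have l2: "(\<lambda>U. \<Sum>i\<in>I. \<Sum>j\<in>J. tfun M N (\<alpha> i) (\<beta> j) U) \<in> lin (ten M N) scalars"
    by (intro lin_sum_scalars tfun_lin M N a b)
  show ?thesis
    by (rule ten_ext[OF M N tfun_lin[OF M N l1] l2 _ U])
      (simp add: tfun_pt[OF M N l1] tfun_pt[OF M N a b] sum_product)
qed

section \<open>Separating families of functionals on tensor products\<close>

definition separating :: "(complex, 'm) module \<Rightarrow> 'i set \<Rightarrow> ('i \<Rightarrow> 'm \<Rightarrow> complex) \<Rightarrow> bool" where
  "separating M I \<phi> \<longleftrightarrow> (\<forall>i\<in>I. \<phi> i \<in> lin M scalars) \<and> (\<forall>x\<in>carrier M. (\<forall>i\<in>I. \<phi> i x = 0) \<longrightarrow> x = \<zero>\<^bsub>M\<^esub>)"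

lemma separating_eqI:
  assumes M: "vspace M" and s: "separating M I \<phi>" and x: "x \<in> carrier M" "y \<in> carrier M"
    and e: "\<And>i. i \<in> I \<Longrightarrow> \<phi> i x = \<phi> i y"
  shows "x = y"
proof (rule vspace_sub_eq[OF M x])
  have "\<phi> i (x \<oplus>\<^bsub>M\<^esub> (-1) \<odot>\<^bsub>M\<^esub> y) = 0" if "i \<in> I" for i
    using s that e[OF that] x M lin_add[of "\<phi> i" M scalars x "(-1) \<odot>\<^bsub>M\<^esub> y"] lin_smult[of "\<phi> i" M scalars y "-1"]
    by (simp add: separating_def)
  then show "x \<oplus>\<^bsub>M\<^esub> (-1) \<odot>\<^bsub>M\<^esub> y = \<zero>\<^bsub>M\<^esub>" using s x M by (simp add: separating_def)
qed

text \<open>Induction on the number of pure tensors in a representation, without choosing bases. If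
  all the functionals vanish on a sum with first term \<open>a \<otimes> b\<close> and some
  \<open>\<psi> j\<close> does not kill \<open>b\<close>, then \<open>a\<close> is a combination of
  the other first factors, and the first term can be distributed over the remaining ones.\<close>

lemma separating_ten:
  fixes M :: "(complex, 'm) module" and N :: "(complex, 'n) module"
  assumes M: "vspace M" and N: "vspace N" and sM: "separating M I \<phi>" and sN: "separating N J \<psi>"
  shows "separating (ten M N) (I \<times> J) (\<lambda>p. tfun M N (\<phi> (fst p)) (\<psi> (snd p)))"
proof -
  let ?T = "ten M N"
  note T = vspace_ten[OF M N]
  have lM: "\<phi> i \<in> lin M scalars" if "i \<in> I" for i using sM that by (simp add: separating_def)
  have lN: "\<psi> j \<in> lin N scalars" if "j \<in> J" for j using sN that by (simp add: separating_def)
  \<comment> \<open>Tensors are represented by lists of pairs, so that the induction can be on the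
    length and pairs may be repeated.\<close>
  define ts where "ts = foldr (\<lambda>p U. pt M N (fst p) (snd p) \<oplus>\<^bsub>?T\<^esub> U)"
  have ts_closed: "ts xs \<zero>\<^bsub>?T\<^esub> \<in> carrier ?T" if "set xs \<subseteq> carrier M \<times> carrier N" for xs
    using that by (induction xs) (auto simp: ts_def T pt_closed[OF M N])
  have ts_append: "ts (xs @ ys) \<zero>\<^bsub>?T\<^esub> = ts xs \<zero>\<^bsub>?T\<^esub> \<oplus>\<^bsub>?T\<^esub> ts ys \<zero>\<^bsub>?T\<^esub>"
    if "set xs \<subseteq> carrier M \<times> carrier N" "set ys \<subseteq> carrier M \<times> carrier N" for xs ys
    using that(1)
  proof (induction xs)
    case Nil then show ?case using ts_closed[OF that(2)] T by (simp add: ts_def)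
  next
    case (Cons p xs)
    then show ?case using ts_closed[of xs] ts_closed[OF that(2)] pt_closed[OF M N, of "fst p" "snd p"]
      by (simp add: ts_def vspace_assoc[OF T] mem_Times_iff)
  qed
  have rep: "\<exists>xs. set xs \<subseteq> carrier M \<times> carrier N \<and> U = ts xs \<zero>\<^bsub>?T\<^esub>" if "U \<in> carrier ?T" for U
    using M N that
  proof (induction rule: ten_induct)
    case (pure x y)
    then show ?case using pt_closed[OF M N pure] T by (intro exI[of _ "[(x, y)]"]) (simp add: ts_def)
  next
    case (add U W)
    then obtain xs ys where "set xs \<subseteq> carrier M \<times> carrier N" "U = ts xs \<zero>\<^bsub>?T\<^esub>"
      "set ys \<subseteq> carrier M \<times> carrier N" "W = ts ys \<zero>\<^bsub>?T\<^esub>" by blast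
    then show ?case by (intro exI[of _ "xs @ ys"]) (simp add: ts_append)
  qed
  have tf: "tfun M N \<alpha> \<beta> (ts xs \<zero>\<^bsub>?T\<^esub>) = (\<Sum>p\<leftarrow>xs. \<alpha> (fst p) * \<beta> (snd p))"
    if "set xs \<subseteq> carrier M \<times> carrier N" "\<alpha> \<in> lin M scalars" "\<beta> \<in> lin N scalars" for xs \<alpha> \<beta>
    using that(1)
  proof (induction xs)
    case Nil
    then show ?case using lin_zero[OF T vspace_scalars tfun_lin[OF M N that(2,3)]] by (simp add: ts_def)
  next
    case (Cons p xs)
    have "ts (p # xs) \<zero>\<^bsub>?T\<^esub> = pt M N (fst p) (snd p) \<oplus>\<^bsub>?T\<^esub> ts xs \<zero>\<^bsub>?T\<^esub>" by (simp add: ts_def)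
    then show ?case using Cons ts_closed[of xs] pt_closed[OF M N, of "fst p" "snd p"]
        lin_add[OF tfun_lin[OF M N that(2,3)]] tfun_pt[OF M N that(2,3)]
      by (simp add: mem_Times_iff)
  qed
  have main: "ts xs \<zero>\<^bsub>?T\<^esub> = \<zero>\<^bsub>?T\<^esub>"
    if "set xs \<subseteq> carrier M \<times> carrier N"
      "\<And>i j. i \<in> I \<Longrightarrow> j \<in> J \<Longrightarrow> (\<Sum>p\<leftarrow>xs. \<phi> i (fst p) * \<psi> j (snd p)) = 0" for xs
    using that
  proof (induction "length xs" arbitrary: xs)
    case 0 then show ?case by (simp add: ts_def)
  next
    case (Suc n)
    obtain a b ys where xs: "xs = (a, b) # ys" using Suc.hyps(2) by (cases xs) auto
    have c: "a \<in> carrier M" "b \<in> carrier N" "set ys \<subseteq> carrier M \<times> carrier N" "length ys = n"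
      using Suc.prems(1) Suc.hyps(2) by (auto simp: xs)
    have tsx: "ts xs \<zero>\<^bsub>?T\<^esub> = pt M N a b \<oplus>\<^bsub>?T\<^esub> ts ys \<zero>\<^bsub>?T\<^esub>" by (simp add: ts_def xs)
    show ?case
    proof (cases "\<exists>j\<in>J. \<psi> j b \<noteq> 0")
      case False
      then have "b = \<zero>\<^bsub>N\<^esub>" using sN c(2) by (auto simp: separating_def)
      then have "pt M N a b = \<zero>\<^bsub>?T\<^esub>" using lin_zero[OF N T pt_lin_right[OF M N c(1)]] by simp
      moreover have "ts ys \<zero>\<^bsub>?T\<^esub> = \<zero>\<^bsub>?T\<^esub>"
      proof (rule Suc.hyps(1)[OF c(4)[symmetric] c(3)])
        fix i j assume "i \<in> I" "j \<in> J"
        then show "(\<Sum>p\<leftarrow>ys. \<phi> i (fst p) * \<psi> j (snd p)) = 0"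
          using Suc.prems(2)[of i j] False by (simp add: xs)
      qed
      ultimately show ?thesis using T by (simp add: tsx)
    next
      case True
      then obtain j where j: "j \<in> J" "\<psi> j b \<noteq> 0" by blast
      \<comment> \<open>These are the coefficients obtained by solving the vanishing condition at
        the fixed \<open>j\<close> for \<open>\<phi> i a\<close>. They do not involve
        \<open>i\<close>, so the family \<open>\<phi>\<close> identifies \<open>a\<close> with the
        corresponding combination.\<close>
      define k :: "'m \<times> 'n \<Rightarrow> complex" where "k p = - \<psi> j (snd p) / \<psi> j b" for p
      define comb where "comb = foldr (\<lambda>p x. k p \<odot>\<^bsub>M\<^esub> fst p \<oplus>\<^bsub>M\<^esub> x)"
      have comb_closed: "comb zs \<zero>\<^bsub>M\<^esub> \<in> carrier M" if "set zs \<subseteq> carrier M \<times> carrier N" for zs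
        using that by (induction zs) (auto simp: comb_def M)
      have comb_phi: "\<phi> i (comb zs \<zero>\<^bsub>M\<^esub>) = (\<Sum>p\<leftarrow>zs. k p * \<phi> i (fst p))"
        if "set zs \<subseteq> carrier M \<times> carrier N" "i \<in> I" for zs i
        using that(1)
      proof (induction zs)
        case Nil then show ?case using lin_zero[OF M vspace_scalars lM[OF that(2)]] by (simp add: comb_def)
      next
        case (Cons p zs)
        have "comb (p # zs) \<zero>\<^bsub>M\<^esub> = k p \<odot>\<^bsub>M\<^esub> fst p \<oplus>\<^bsub>M\<^esub> comb zs \<zero>\<^bsub>M\<^esub>" by (simp add: comb_def)
        then show ?case using Cons comb_closed[of zs] M lin_add[OF lM[OF that(2)]] lin_smult[OF lM[OF that(2)]]
          by (simp add: mem_Times_iff)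
      qed
      have "a = comb ys \<zero>\<^bsub>M\<^esub>"
      proof (rule separating_eqI[OF M sM c(1) comb_closed[OF c(3)]])
        fix i assume i: "i \<in> I"
        have "\<phi> i a * \<psi> j b + (\<Sum>p\<leftarrow>ys. \<phi> i (fst p) * \<psi> j (snd p)) = 0"
          using Suc.prems(2)[OF i j(1)] by (simp add: xs)
        moreover have "(\<Sum>p\<leftarrow>ys. k p * \<phi> i (fst p)) * \<psi> j b = - (\<Sum>p\<leftarrow>ys. \<phi> i (fst p) * \<psi> j (snd p))"
          using j(2) by (induction ys) (simp_all add: k_def field_simps)
        ultimately have "(\<phi> i a - (\<Sum>p\<leftarrow>ys. k p * \<phi> i (fst p))) * \<psi> j b = 0"
          by (simp add: left_diff_distrib)
        then show "\<phi> i a = \<phi> i (comb ys \<zero>\<^bsub>M\<^esub>)" using j(2) comb_phi[OF c(3) i] by simp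
      qed
      \<comment> \<open>After substituting the combination for \<open>a\<close>, each
        \<open>k p\<close> times the first factor, tensored with \<open>b\<close>, is merged into
        the pair \<open>p\<close> by adding a multiple of \<open>b\<close> to its second
        factor.\<close>
      define f :: "'m \<times> 'n \<Rightarrow> 'm \<times> 'n" where "f p = (fst p, snd p \<oplus>\<^bsub>N\<^esub> k p \<odot>\<^bsub>N\<^esub> b)" for p
      have fc: "set (map f zs) \<subseteq> carrier M \<times> carrier N" if "set zs \<subseteq> carrier M \<times> carrier N" for zs
        using that c(2) N by (auto simp: f_def)
      have "pt M N (comb zs \<zero>\<^bsub>M\<^esub>) b \<oplus>\<^bsub>?T\<^esub> ts zs \<zero>\<^bsub>?T\<^esub> = ts (map f zs) \<zero>\<^bsub>?T\<^esub>"
        if "set zs \<subseteq> carrier M \<times> carrier N" for zs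
        using that
      proof (induction zs)
        case Nil
        then show ?case using lin_zero[OF M T pt_lin_left[OF M N c(2)]] T by (simp add: comb_def ts_def)
      next
        case (Cons p zs)
        obtain x y where p: "p = (x, y)" "x \<in> carrier M" "y \<in> carrier N" using Cons.prems by (cases p) auto
        have zs: "set zs \<subseteq> carrier M \<times> carrier N" using Cons.prems by simp
        let ?C = "comb zs \<zero>\<^bsub>M\<^esub>" and ?S = "ts zs \<zero>\<^bsub>?T\<^esub>" and ?k = "k (x, y)"
        have e1: "comb (p # zs) \<zero>\<^bsub>M\<^esub> = ?k \<odot>\<^bsub>M\<^esub> x \<oplus>\<^bsub>M\<^esub> ?C" by (simp add: comb_def p)
        have e2: "ts (p # zs) \<zero>\<^bsub>?T\<^esub> = pt M N x y \<oplus>\<^bsub>?T\<^esub> ?S" by (simp add: ts_def p)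
        have e3: "ts (map f (p # zs)) \<zero>\<^bsub>?T\<^esub> = pt M N x (y \<oplus>\<^bsub>N\<^esub> ?k \<odot>\<^bsub>N\<^esub> b) \<oplus>\<^bsub>?T\<^esub> ts (map f zs) \<zero>\<^bsub>?T\<^esub>"
          by (simp add: ts_def p f_def)
        let ?A = "?k \<odot>\<^bsub>?T\<^esub> pt M N x b" and ?B = "pt M N ?C b" and ?D = "pt M N x y"
        have 1: "pt M N (?k \<odot>\<^bsub>M\<^esub> x \<oplus>\<^bsub>M\<^esub> ?C) b = ?A \<oplus>\<^bsub>?T\<^esub> ?B"
          using lin_add[OF pt_lin_left[OF M N c(2)]] lin_smult[OF pt_lin_left[OF M N c(2)]] p M comb_closed[OF zs]
          by simp
        have 2: "pt M N x (y \<oplus>\<^bsub>N\<^esub> ?k \<odot>\<^bsub>N\<^esub> b) = ?D \<oplus>\<^bsub>?T\<^esub> ?A"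
          using lin_add[OF pt_lin_right[OF M N p(2)]] lin_smult[OF pt_lin_right[OF M N p(2)]] p c(2) N
          by simp
        have cl: "?A \<in> carrier ?T" "?B \<in> carrier ?T" "?D \<in> carrier ?T" "?S \<in> carrier ?T"
          using pt_closed[OF M N] comb_closed[OF zs] ts_closed[OF zs] p c T by simp_all
        interpret T: module complex_ring ?T by (rule T)
        have "(?A \<oplus>\<^bsub>?T\<^esub> ?B) \<oplus>\<^bsub>?T\<^esub> (?D \<oplus>\<^bsub>?T\<^esub> ?S) = (?D \<oplus>\<^bsub>?T\<^esub> ?A) \<oplus>\<^bsub>?T\<^esub> (?B \<oplus>\<^bsub>?T\<^esub> ?S)"
          using cl by (simp add: T.M.a_ac)
        then show ?case unfolding e1 e2 e3 1 2 Cons.IH[OF zs, symmetric] .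
      qed
      from this[OF c(3)] have e: "ts xs \<zero>\<^bsub>?T\<^esub> = ts (map f ys) \<zero>\<^bsub>?T\<^esub>"
        unfolding tsx \<open>a = comb ys \<zero>\<^bsub>M\<^esub>\<close>[symmetric] .
      have "ts (map f ys) \<zero>\<^bsub>?T\<^esub> = \<zero>\<^bsub>?T\<^esub>"
      proof (rule Suc.hyps(1))
        show "n = length (map f ys)" using c(4) by simp
        show "set (map f ys) \<subseteq> carrier M \<times> carrier N" by (rule fc[OF c(3)])
        fix i j assume ij: "i \<in> I" "j \<in> J"
        \<comment> \<open>The shorter list represents the same tensor, so the functionals vanish on
          it as well.\<close>
        have "(\<Sum>p\<leftarrow>map f ys. \<phi> i (fst p) * \<psi> j (snd p)) = tfun M N (\<phi> i) (\<psi> j) (ts (map f ys) \<zero>\<^bsub>?T\<^esub>)"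
          by (rule tf[OF fc[OF c(3)] lM[OF ij(1)] lN[OF ij(2)], symmetric])
        also have "\<dots> = (\<Sum>p\<leftarrow>xs. \<phi> i (fst p) * \<psi> j (snd p))"
          unfolding e[symmetric] by (rule tf[OF Suc.prems(1) lM[OF ij(1)] lN[OF ij(2)]])
        also have "\<dots> = 0" by (rule Suc.prems(2)[OF ij])
        finally show "(\<Sum>p\<leftarrow>map f ys. \<phi> i (fst p) * \<psi> j (snd p)) = 0" .
      qed
      then show ?thesis unfolding e .
    qed
  qed
  show ?thesis unfolding separating_def
  proof (intro conjI ballI impI)
    fix p assume "p \<in> I \<times> J"
    then show "tfun M N (\<phi> (fst p)) (\<psi> (snd p)) \<in> lin ?T scalars"
      using tfun_lin[OF M N lM lN] by (simp add: mem_Times_iff)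
  next
    fix U assume U: "U \<in> carrier ?T" and z: "\<forall>p\<in>I \<times> J. tfun M N (\<phi> (fst p)) (\<psi> (snd p)) U = 0"
    obtain xs where xs: "set xs \<subseteq> carrier M \<times> carrier N" "U = ts xs \<zero>\<^bsub>?T\<^esub>" using rep[OF U] by blast
    have "(\<Sum>p\<leftarrow>xs. \<phi> i (fst p) * \<psi> j (snd p)) = 0" if "i \<in> I" "j \<in> J" for i j
      using tf[OF xs(1) lM[OF that(1)] lN[OF that(2)]] z that xs(2) by force
    then show "U = \<zero>\<^bsub>?T\<^esub>" using main[OF xs(1)] xs(2) by simp
  qed
qed

section \<open>The Hopf algebra\<close>

text \<open>Closure and value are proved together, because additivity of \<open>f\<close> in the
  induction step needs the partial sum to lie in the carrier.\<close>

lemma lin_finsum: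
  assumes M: "vspace M" and f: "f \<in> lin M scalars" and fin: "finite I" and g: "\<And>i. i \<in> I \<Longrightarrow> g i \<in> carrier M"
  shows "(\<Oplus>\<^bsub>M\<^esub>i\<in>I. g i) \<in> carrier M \<and> f (\<Oplus>\<^bsub>M\<^esub>i\<in>I. g i) = (\<Sum>i\<in>I. f (g i))"
  using fin g
proof (induction I)
  case empty
  interpret module complex_ring M by (rule M)
  show ?case using lin_zero[OF M vspace_scalars f] by simp
next
  case (insert i I)
  interpret module complex_ring M by (rule M)
  have "(\<Oplus>\<^bsub>M\<^esub>i\<in>insert i I. g i) = g i \<oplus>\<^bsub>M\<^esub> (\<Oplus>\<^bsub>M\<^esub>i\<in>I. g i)"
    using insert by (intro M.finsum_insert) auto
  then show ?case using insert lin_add[OF f] M by simp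
qed

lemma tfun_scale:
  assumes M: "vspace M" and N: "vspace N" and a: "\<alpha> \<in> lin M scalars" and b: "\<beta> \<in> lin N scalars"
    and U: "U \<in> carrier (ten M N)"
  shows "tfun M N (\<lambda>x. c * \<alpha> x) (\<lambda>y. d * \<beta> y) U = c * d * tfun M N \<alpha> \<beta> U"
proof -
  have l: "(\<lambda>x. c * \<alpha> x) \<in> lin M scalars" "(\<lambda>y. d * \<beta> y) \<in> lin N scalars"
    using lin_add[OF a] lin_smult[OF a] lin_add[OF b] lin_smult[OF b]
    by (auto intro!: linI simp: algebra_simps)
  have r: "(\<lambda>U. c * d * tfun M N \<alpha> \<beta> U) \<in> lin (ten M N) scalars"
    using lin_add[OF tfun_lin[OF M N a b]] lin_smult[OF tfun_lin[OF M N a b]]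
    by (auto intro!: linI simp: algebra_simps)
  show ?thesis
    by (rule ten_ext[OF M N tfun_lin[OF M N l] r _ U])
      (simp add: tfun_pt[OF M N l] tfun_pt[OF M N a b])
qed

lemma super_cf_simps:
  "f \<oplus>\<^bsub>super_cf H z d\<^esub> g = (\<lambda>x. f x + g x)" "r \<odot>\<^bsub>super_cf H z d\<^esub> f = (\<lambda>x. r * f x)"
  "\<zero>\<^bsub>super_cf H z d\<^esub> = (\<lambda>x. 0)"
  by (simp_all add: super_cf_def)

lemma vspace_super_cf: "vspace (super_cf H z d)"
  by (rule vspaceI) (auto simp: super_cf_def algebra_simps)

context finite_base
begin

abbreviation RM where "RM n \<equiv> R_spin \<Gamma> n"
abbreviation RH where "RH n m \<equiv> R_hat \<Gamma> n m"
abbreviation RT where "RT \<equiv> R_total \<Gamma>"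

lemma vspace_RM: "vspace (RM n)" and vspace_RH: "vspace (RH n m)"
  unfolding R_spin_def R_hat_def by (rule vspace_super_cf)+

lemma RM_simps: "f \<oplus>\<^bsub>RM n\<^esub> g = (\<lambda>x. f x + g x)" "r \<odot>\<^bsub>RM n\<^esub> f = (\<lambda>x. r * f x)" "\<zero>\<^bsub>RM n\<^esub> = (\<lambda>x. 0)"
  by (simp_all add: R_spin_def super_cf_simps)

lemma RH_simps: "f \<oplus>\<^bsub>RH n m\<^esub> g = (\<lambda>x. f x + g x)" "r \<odot>\<^bsub>RH n m\<^esub> f = (\<lambda>x. r * f x)" "\<zero>\<^bsub>RH n m\<^esub> = (\<lambda>x. 0)"
  by (simp_all add: R_hat_def super_cf_simps)

lemma eval_RM: "(\<lambda>f. f x) \<in> lin (RM n) scalars"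
  by (rule linI) (simp_all add: RM_simps)

lemma finsum_RM:
  assumes "finite I" "\<And>i. i \<in> I \<Longrightarrow> f i \<in> RS n"
  shows "(\<Oplus>\<^bsub>RM n\<^esub>i\<in>I. f i) = (\<lambda>x. \<Sum>i\<in>I. f i x)"
proof
  fix x
  show "(\<Oplus>\<^bsub>RM n\<^esub>i\<in>I. f i) x = (\<Sum>i\<in>I. f i x)"
    using lin_finsum[OF vspace_RM eval_RM[of x] assms] by simp
qed

subsection \<open>The outer product\<close>

text \<open>Conjugation in the quotient of the twisted product preserves the parities of both
  components, and for even components it is componentwise. These two facts give class invariance of
  the outer product, which is zero unless both components are even.\<close>

lemma hat_conj:
  assumes x: "x \<in> carrier (G n)" "y \<in> carrier (G m)" "s \<in> carrier (G n)" "t \<in> carrier (G m)"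
  obtains a b s' t' where "hcls n m s t \<otimes>\<^bsub>HP n m\<^esub> hcls n m x y \<otimes>\<^bsub>HP n m\<^esub> inv\<^bsub>HP n m\<^esub> (hcls n m s t) = hcls n m a b"
    "a \<in> carrier (G n)" "b \<in> carrier (G m)" "s' \<in> carrier (G n)" "t' \<in> carrier (G m)" "par a = par x" "par b = par y"
    "par x = 0 \<Longrightarrow> par y = 0 \<Longrightarrow> hcls n m a b =
      hcls n m (gm n (inv\<^bsub>G n\<^esub> s') (gm n x s')) (gm m (inv\<^bsub>G m\<^esub> t') (gm m y t'))"
proof -
  interpret HP: group "HP n m" by (rule group_HP)
  obtain s' t' where s': "s' \<in> carrier (G n)" "t' \<in> carrier (G m)"
    "inv\<^bsub>HP n m\<^esub> (hcls n m s t) = hcls n m s' t'" using hat_inverse[OF x(3,4)] .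
  have "hcls n m s t \<otimes>\<^bsub>HP n m\<^esub> hcls n m s' t' = \<one>\<^bsub>HP n m\<^esub>"
    unfolding s'(3)[symmetric] using x by (intro HP.r_inv) simp
  then have J1: "gm (n + m) (jx n m s t) (jx n m s' t') = \<one>\<^bsub>G (n + m)\<^esub>"
    using hom_mult[OF hat_embed_hom, of "hcls n m s t" n m "hcls n m s' t'"] x s'
      hom_one[OF hat_embed_hom group_HP W.is_group, of n m] by (simp add: hat_embed_hcls)
  \<comment> \<open>The inverse is known only as some class. That its juxtaposition is inverse to
    that of \<open>s\<close> and \<open>t\<close> yields the equality of the parities.\<close>
  then have "jx n m (gm n (wp n (par t * par s')) (gm n s s')) (gm m t t') = jx n m \<one>\<^bsub>G n\<^esub> \<one>\<^bsub>G m\<^esub>"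
    using jx_mult[of s n t m s' t'] jx_wp(1)[of "gm n s s'" n "gm m t t'" m] x s' by (simp add: jx_one)
  from jx_even_unique[OF this] have ps: "par (gm n (wp n (par t * par s')) (gm n s s')) = 0" "par (gm m t t') = 0"
    using x s' by simp_all
  define a where "a = gm n (wp n (par (gm m t y) * par s')) (gm n (gm n (wp n (par t * par x)) (gm n s x)) s')"
  define b where "b = gm m (gm m t y) t'"
  have e: "hcls n m s t \<otimes>\<^bsub>HP n m\<^esub> hcls n m x y \<otimes>\<^bsub>HP n m\<^esub> inv\<^bsub>HP n m\<^esub> (hcls n m s t) = hcls n m a b"
    using x s' by (simp add: hat_mult a_def b_def)
  have c: "a \<in> carrier (G n)" "b \<in> carrier (G m)" using x s' by (simp_all add: a_def b_def)
  have pa: "par a = par x" "par b = par y"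
    using ps x s' par_range[OF x(1)] par_range[OF x(2)] par_range[OF x(3)] par_range[OF x(4)]
      par_range[OF s'(1)] par_range[OF s'(2)]
    by (auto simp: a_def b_def par_mult)
  have "hcls n m a b = hcls n m (gm n (inv\<^bsub>G n\<^esub> s') (gm n x s')) (gm m (inv\<^bsub>G m\<^esub> t') (gm m y t'))"
    if "par x = 0" "par y = 0"
  proof (rule inj_onD[OF inj_hat_embed])
    have "jx n m a b = gm (n + m) (gm (n + m) (jx n m s t) (jx n m x y)) (jx n m s' t')"
      using arg_cong[OF e, of "hat_embed \<Gamma> n m"] x s' c
        hom_mult[OF hat_embed_hom, of "hcls n m s t \<otimes>\<^bsub>HP n m\<^esub> hcls n m x y" n m "hcls n m s' t'"]
        hom_mult[OF hat_embed_hom, of "hcls n m s t" n m "hcls n m x y"]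
      by (simp add: hat_embed_hcls)
    also have "jx n m s t = inv\<^bsub>G (n + m)\<^esub> (jx n m s' t')"
      using W.inv_equality[OF J1] x s' by simp
    finally have "jx n m a b = gm (n + m) (inv\<^bsub>G (n + m)\<^esub> (jx n m s' t')) (gm (n + m) (jx n m x y) (jx n m s' t'))"
      using x s' by (simp add: W.m_assoc)
    also have "\<dots> = jx n m (gm n (inv\<^bsub>G n\<^esub> s') (gm n x s')) (gm m (inv\<^bsub>G m\<^esub> t') (gm m y t'))"
      by (rule jx_conj[OF x(1,2) s'(1,2) that])
    finally show "hat_embed \<Gamma> n m (hcls n m a b) =
      hat_embed \<Gamma> n m (hcls n m (gm n (inv\<^bsub>G n\<^esub> s') (gm n x s')) (gm m (inv\<^bsub>G m\<^esub> t') (gm m y t')))"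
      using x s' c by (simp add: hat_embed_hcls)
  qed (use x s' c in auto)
  then show thesis using that e c s'(1,2) pa by metis
qed

lemma RS_outer:
  assumes "f \<in> RS n" "g \<in> RS m" "x \<in> carrier (G n)" "y \<in> carrier (G m)"
  shows "outer_prod \<Gamma> n m f g (hcls n m x y) = (if par x = 0 \<and> par y = 0 then f x * g y else 0)"
  using assms by (intro outer_prod_hcls) (simp_all add: RS_wz)

lemma outer_prod_closed:
  assumes fg: "f \<in> RS n" "g \<in> RS m"
  shows "outer_prod \<Gamma> n m f g \<in> carrier (RH n m)"
proof -
  let ?K = "outer_prod \<Gamma> n m f g"
  have "?K (S \<otimes>\<^bsub>HP n m\<^esub> C \<otimes>\<^bsub>HP n m\<^esub> inv\<^bsub>HP n m\<^esub> S) = ?K C"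
    if C: "C \<in> carrier (HP n m)" and S: "S \<in> carrier (HP n m)" for C S
  proof -
    obtain x y where x: "C = hcls n m x y" "x \<in> carrier (G n)" "y \<in> carrier (G m)" using C by (rule HP_cases)
    obtain s t where s: "S = hcls n m s t" "s \<in> carrier (G n)" "t \<in> carrier (G m)" using S by (rule HP_cases)
    obtain a b s' t' where ab: "S \<otimes>\<^bsub>HP n m\<^esub> C \<otimes>\<^bsub>HP n m\<^esub> inv\<^bsub>HP n m\<^esub> S = hcls n m a b"
      "a \<in> carrier (G n)" "b \<in> carrier (G m)" "s' \<in> carrier (G n)" "t' \<in> carrier (G m)" "par a = par x" "par b = par y"
      "par x = 0 \<Longrightarrow> par y = 0 \<Longrightarrow> hcls n m a b =
        hcls n m (gm n (inv\<^bsub>G n\<^esub> s') (gm n x s')) (gm m (inv\<^bsub>G m\<^esub> t') (gm m y t'))"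
      using hat_conj[OF x(2,3) s(2,3)] unfolding x(1)[symmetric] s(1)[symmetric] by metis
    show ?thesis
    proof (cases "par x = 0 \<and> par y = 0")
      case True
      then have p: "par (gm n (inv\<^bsub>G n\<^esub> s') (gm n x s')) = 0" "par (gm m (inv\<^bsub>G m\<^esub> t') (gm m y t')) = 0"
        using par_conj[OF x(2) ab(4)] par_conj[OF x(3) ab(5)] x ab by (simp_all add: W.m_assoc)
      show ?thesis unfolding ab(1) ab(8)[OF True[THEN conjunct1] True[THEN conjunct2]] x(1)
        using True p x ab fg by (simp add: RS_outer[OF fg] RS_conj)
    next
      case False
      then show ?thesis unfolding ab(1) x(1) using x ab by (auto simp: RS_outer[OF fg])
    qed
  qed
  moreover have "?K (hat_z \<Gamma> n m \<otimes>\<^bsub>HP n m\<^esub> C) = - ?K C" if C: "C \<in> carrier (HP n m)" for C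
  proof -
    obtain x y where x: "C = hcls n m x y" "x \<in> carrier (G n)" "y \<in> carrier (G m)" using C by (rule HP_cases)
    have "hat_z \<Gamma> n m \<otimes>\<^bsub>HP n m\<^esub> C = hcls n m (gm n (wz n) x) y"
      unfolding hat_z_eq x(1) using x by (simp add: hat_mult)
    then show ?thesis using x par_range[OF x(2)] fg by (auto simp: RS_outer[OF fg] par_mult RS_wz)
  qed
  moreover have "?K C = 0" if C: "C \<in> carrier (HP n m)" "hat_parity C = 1" for C
  proof -
    obtain x y where x: "C = hcls n m x y" "x \<in> carrier (G n)" "y \<in> carrier (G m)" using C(1) by (rule HP_cases)
    then show ?thesis using C(2) by (auto simp: RS_outer[OF fg] hat_parity_hcls)
  qed
  moreover have "?K C = 0" if "C \<notin> carrier (HP n m)" for C using that by (simp add: outer_prod_def)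
  ultimately show ?thesis unfolding R_hat_def super_cf_def by simp
qed

lemma hat_fun_eqI:
  assumes "\<And>C. C \<notin> carrier (HP n m) \<Longrightarrow> f C = g C"
    "\<And>x y. x \<in> carrier (G n) \<Longrightarrow> y \<in> carrier (G m) \<Longrightarrow> f (hcls n m x y) = g (hcls n m x y)"
  shows "f = g"
proof
  fix C show "f C = g C"
    by (cases "C \<in> carrier (HP n m)") (use assms in \<open>auto elim: HP_cases\<close>)
qed

lemma outer_prod_off: "C \<notin> carrier (HP n m) \<Longrightarrow> outer_prod \<Gamma> n m f g C = 0"
  by (simp add: outer_prod_def)

lemma bilin_outer_prod: "bilin (RM n) (RM m) (RH n m) (outer_prod \<Gamma> n m)"
  unfolding bilin_def
proof (intro conjI ballI linI)
  fix f g g' assume c: "f \<in> RS n" "g \<in> RS m" "g' \<in> RS m"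
  have "g \<oplus>\<^bsub>RM m\<^esub> g' \<in> RS m" using c vspace_RM by simp
  from this[unfolded RM_simps] show "outer_prod \<Gamma> n m f (g \<oplus>\<^bsub>RM m\<^esub> g') = outer_prod \<Gamma> n m f g \<oplus>\<^bsub>RH n m\<^esub> outer_prod \<Gamma> n m f g'"
    unfolding RM_simps RH_simps using c by (intro hat_fun_eqI[where n = n and m = m]) (simp_all add: RS_outer outer_prod_off algebra_simps)
next
  fix f g r assume c: "f \<in> RS n" "g \<in> RS m"
  have "r \<odot>\<^bsub>RM m\<^esub> g \<in> RS m" using c vspace_RM by simp
  from this[unfolded RM_simps] show "outer_prod \<Gamma> n m f (r \<odot>\<^bsub>RM m\<^esub> g) = r \<odot>\<^bsub>RH n m\<^esub> outer_prod \<Gamma> n m f g"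
    unfolding RM_simps RH_simps using c by (intro hat_fun_eqI[where n = n and m = m]) (simp_all add: RS_outer outer_prod_off)
next
  fix f f' g assume c: "g \<in> RS m" "f \<in> RS n" "f' \<in> RS n"
  have "f \<oplus>\<^bsub>RM n\<^esub> f' \<in> RS n" using c vspace_RM by simp
  from this[unfolded RM_simps] show "outer_prod \<Gamma> n m (f \<oplus>\<^bsub>RM n\<^esub> f') g = outer_prod \<Gamma> n m f g \<oplus>\<^bsub>RH n m\<^esub> outer_prod \<Gamma> n m f' g"
    unfolding RM_simps RH_simps using c by (intro hat_fun_eqI[where n = n and m = m]) (simp_all add: RS_outer outer_prod_off algebra_simps)
next
  fix f g r assume c: "g \<in> RS m" "f \<in> RS n"
  have "r \<odot>\<^bsub>RM n\<^esub> f \<in> RS n" using c vspace_RM by simp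
  from this[unfolded RM_simps] show "outer_prod \<Gamma> n m (r \<odot>\<^bsub>RM n\<^esub> f) g = r \<odot>\<^bsub>RH n m\<^esub> outer_prod \<Gamma> n m f g"
    unfolding RM_simps RH_simps using c by (intro hat_fun_eqI[where n = n and m = m]) (simp_all add: RS_outer outer_prod_off)
qed (auto intro: outer_prod_closed)

lemmas phi_lin = tlift_lin[OF vspace_RM vspace_RM vspace_RH bilin_outer_prod, folded phi_def]
lemmas phi_pt = tlift_pt[OF vspace_RM vspace_RM vspace_RH bilin_outer_prod, folded phi_def]

lemma mult_comp_pt: "f \<in> RS n \<Longrightarrow> g \<in> RS m \<Longrightarrow> mult_comp \<Gamma> n m (pt (RM n) (RM m) f g) = ind_prod n m f g"
  by (simp add: mult_comp_def phi_pt cf_ind_outer_prod)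

text \<open>Both sides are linear in \<open>U\<close> and agree on pure tensors. Thus values of
  \<open>phi\<close> at even pairs are the pairings with two evaluations.\<close>

lemma phi_eval:
  assumes U: "U \<in> carrier (ten (RM n) (RM m))" and x: "x \<in> E n" "y \<in> E m"
  shows "phi \<Gamma> n m U (hcls n m x y) = tfun (RM n) (RM m) (\<lambda>f. f x) (\<lambda>f. f y) U"
proof -
  have "(\<lambda>K. K (hcls n m x y)) \<in> lin (RH n m) scalars" by (rule linI) (simp_all add: RH_simps)
  note l = lin_comp[OF phi_lin this]
  show ?thesis
    by (rule ten_ext[OF vspace_RM vspace_RM l tfun_lin[OF vspace_RM vspace_RM eval_RM eval_RM] _ U])
      (use x in \<open>simp add: phi_pt RS_outer tfun_pt[OF vspace_RM vspace_RM eval_RM eval_RM]\<close>)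
qed

subsection \<open>Restriction lies in the image of the outer product\<close>

text \<open>\<open>spin_proj m v\<close> is the projection of the indicator function of \<open>v\<close> to the spin super class functions.\<close>

definition spin_proj :: "nat \<Rightarrow> 'a wr \<Rightarrow> 'a wr \<Rightarrow> complex" where
  "spin_proj m v y = (if y \<in> E m then
     (conj_count m y v - conj_count m y (gm m (wz m) v)) / (2 * of_nat (order (G m))) else 0)"

lemma conj_count_conj_left:
  assumes w: "w \<in> carrier (G n)" and r: "r \<in> carrier (G n)"
  shows "conj_count n (gm n (inv\<^bsub>G n\<^esub> r) (gm n w r)) v = conj_count n w v"
proof -
  have "bij_betw (\<lambda>s. gm n r s) {s \<in> carrier (G n). gm n (inv\<^bsub>G n\<^esub> s) (gm n (gm n (inv\<^bsub>G n\<^esub> r) (gm n w r)) s) = v}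
    {s \<in> carrier (G n). gm n (inv\<^bsub>G n\<^esub> s) (gm n w s) = v}"
  proof (rule bij_betwI[where g = "\<lambda>s. gm n (inv\<^bsub>G n\<^esub> r) s"])
    show "(\<lambda>s. gm n r s) \<in> {s \<in> carrier (G n). gm n (inv\<^bsub>G n\<^esub> s) (gm n (gm n (inv\<^bsub>G n\<^esub> r) (gm n w r)) s) = v} \<rightarrow>
      {s \<in> carrier (G n). gm n (inv\<^bsub>G n\<^esub> s) (gm n w s) = v}"
    proof
      fix s assume "s \<in> {s \<in> carrier (G n). gm n (inv\<^bsub>G n\<^esub> s) (gm n (gm n (inv\<^bsub>G n\<^esub> r) (gm n w r)) s) = v}"
      then have s: "s \<in> carrier (G n)" "gm n (inv\<^bsub>G n\<^esub> s) (gm n (gm n (inv\<^bsub>G n\<^esub> r) (gm n w r)) s) = v" by auto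
      then show "gm n r s \<in> {s \<in> carrier (G n). gm n (inv\<^bsub>G n\<^esub> s) (gm n w s) = v}"
        using conj_conj[OF w r s(1)] r by simp
    qed
    show "(\<lambda>s. gm n (inv\<^bsub>G n\<^esub> r) s) \<in> {s \<in> carrier (G n). gm n (inv\<^bsub>G n\<^esub> s) (gm n w s) = v} \<rightarrow>
      {s \<in> carrier (G n). gm n (inv\<^bsub>G n\<^esub> s) (gm n (gm n (inv\<^bsub>G n\<^esub> r) (gm n w r)) s) = v}"
    proof
      fix s assume "s \<in> {s \<in> carrier (G n). gm n (inv\<^bsub>G n\<^esub> s) (gm n w s) = v}"
      then have s: "s \<in> carrier (G n)" "gm n (inv\<^bsub>G n\<^esub> s) (gm n w s) = v" by auto
      have "gm n r (gm n (inv\<^bsub>G n\<^esub> r) s) = s" using r s by (simp add: W.m_assoc[symmetric])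
      then show "gm n (inv\<^bsub>G n\<^esub> r) s \<in> {s \<in> carrier (G n). gm n (inv\<^bsub>G n\<^esub> s) (gm n (gm n (inv\<^bsub>G n\<^esub> r) (gm n w r)) s) = v}"
        using conj_conj[OF w r, of "gm n (inv\<^bsub>G n\<^esub> r) s"] r s by simp
    qed
  next
    fix s assume "s \<in> {s \<in> carrier (G n). gm n (inv\<^bsub>G n\<^esub> s) (gm n (gm n (inv\<^bsub>G n\<^esub> r) (gm n w r)) s) = v}"
    then show "gm n (inv\<^bsub>G n\<^esub> r) (gm n r s) = s" using r by (simp add: W.m_assoc[symmetric])
  next
    fix s assume "s \<in> {s \<in> carrier (G n). gm n (inv\<^bsub>G n\<^esub> s) (gm n w s) = v}"
    then show "gm n r (gm n (inv\<^bsub>G n\<^esub> r) s) = s" using r by (simp add: W.m_assoc[symmetric])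
  qed
  from bij_betw_same_card[OF this] show ?thesis unfolding conj_count_def by (simp only:)
qed

lemma conj_count_wz:
  assumes w: "w \<in> carrier (G n)" and v: "v \<in> carrier (G n)"
  shows "conj_count n (gm n (wz n) w) v = conj_count n w (gm n (wz n) v)"
proof -
  have "gm n (inv\<^bsub>G n\<^esub> s) (gm n (gm n (wz n) w) s) = v \<longleftrightarrow> gm n (inv\<^bsub>G n\<^esub> s) (gm n w s) = gm n (wz n) v"
    if s: "s \<in> carrier (G n)" for s
  proof -
    let ?c = "gm n (inv\<^bsub>G n\<^esub> s) (gm n w s)"
    have "gm n (inv\<^bsub>G n\<^esub> s) (gm n (gm n (wz n) w) s) = gm n (wz n) ?c"
      using wz_left[of "inv\<^bsub>G n\<^esub> s" n "gm n w s"] s w by (simp add: W.m_assoc)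
    moreover have "gm n (wz n) ?c = v \<longleftrightarrow> ?c = gm n (wz n) v"
      using wz_wz_mult[of ?c n] wz_wz_mult[OF v] s w by auto
    ultimately show ?thesis by simp
  qed
  then show ?thesis unfolding conj_count_def by (simp cong: conj_cong)
qed

lemma spin_proj_closed:
  assumes v: "v \<in> E m" shows "spin_proj m v \<in> RS m"
  unfolding RS_iff
proof (intro conjI allI impI ballI)
  fix y s assume y: "y \<in> E m" and s: "s \<in> carrier (G m)"
  have "gm m (inv\<^bsub>G m\<^esub> s) (gm m y s) \<in> E m" using y s par_conj[of y m s] by (simp add: W.m_assoc)
  then show "spin_proj m v (gm m (inv\<^bsub>G m\<^esub> s) (gm m y s)) = spin_proj m v y"
    using y s unfolding spin_proj_def by (simp only: if_True) (simp add: conj_count_conj_left)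
next
  fix y assume y: "y \<in> E m"
  then have "gm m (wz m) y \<in> E m" by (simp add: par_mult)
  then show "spin_proj m v (gm m (wz m) y) = - spin_proj m v y"
    using y v unfolding spin_proj_def
    by (simp only: if_True) (simp add: conj_count_wz wz_wz_mult minus_divide_left)
next
  fix y assume "y \<notin> E m"
  then show "spin_proj m v y = 0" unfolding spin_proj_def by (simp only: if_False)
qed

text \<open>Spin super class functions are reproduced by the projected indicators: the two counts in
  \<open>spin_proj\<close> contribute the same amount, the second one because \<open>k\<close>
  changes sign under \<open>z\<close>, and this cancels the factor \<open>2\<close>.\<close>

lemma sum_spin_proj:
  assumes y: "y \<in> E m" and k: "\<And>v s. v \<in> E m \<Longrightarrow> s \<in> carrier (G m) \<Longrightarrow> k (gm m (inv\<^bsub>G m\<^esub> s) (gm m v s)) = k v"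
    and kz: "\<And>v. v \<in> E m \<Longrightarrow> k (gm m (wz m) v) = - k v"
  shows "(\<Sum>v\<in>E m. k v * spin_proj m v y) = k y"
proof -
  have yc: "y \<in> carrier (G m)" using y by simp
  have cc: "(\<Sum>v\<in>E m. k v * conj_count m y v) = of_nat (order (G m)) * k y"
  proof -
    have "(\<Sum>v\<in>E m. k v * conj_count m y v) =
        (\<Sum>v\<in>E m. \<Sum>s\<in>carrier (G m). if v = gm m (inv\<^bsub>G m\<^esub> s) (gm m y s) then k v else 0)"
    proof (rule sum.cong[OF HOL.refl])
      fix v
      have "(\<Sum>s\<in>carrier (G m). if v = gm m (inv\<^bsub>G m\<^esub> s) (gm m y s) then k v else 0) =
          (\<Sum>s | s \<in> carrier (G m) \<and> gm m (inv\<^bsub>G m\<^esub> s) (gm m y s) = v. k v)"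
        by (rule sum.mono_neutral_cong_right) (auto simp: finite_G)
      then show "k v * conj_count m y v =
          (\<Sum>s\<in>carrier (G m). if v = gm m (inv\<^bsub>G m\<^esub> s) (gm m y s) then k v else 0)"
        by (simp add: conj_count_def mult.commute)
    qed
    also have "\<dots> = (\<Sum>s\<in>carrier (G m). \<Sum>v\<in>E m. if v = gm m (inv\<^bsub>G m\<^esub> s) (gm m y s) then k v else 0)"
      by (rule sum.swap)
    also have "\<dots> = (\<Sum>s\<in>carrier (G m). k y)"
    proof (rule sum.cong[OF HOL.refl])
      fix s assume s: "s \<in> carrier (G m)"
      have "gm m (inv\<^bsub>G m\<^esub> s) (gm m y s) \<in> E m" using y s par_conj[of y m s] by (simp add: W.m_assoc)
      then show "(\<Sum>v\<in>E m. if v = gm m (inv\<^bsub>G m\<^esub> s) (gm m y s) then k v else 0) = k y"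
        using k[OF y s] by (subst sum.delta) simp_all
    qed
    finally show ?thesis by (simp add: order_def)
  qed
  have "(\<Sum>v\<in>E m. k v * conj_count m y (gm m (wz m) v)) = (\<Sum>v\<in>E m. k (gm m (wz m) v) * conj_count m y v)"
    by (rule sum.reindex_bij_witness[of _ "gm m (wz m)" "gm m (wz m)"]) (auto simp: wz_wz_mult par_mult)
  also have "\<dots> = (\<Sum>v\<in>E m. - (k v * conj_count m y v))" by (rule sum.cong) (simp_all add: kz)
  finally have z: "(\<Sum>v\<in>E m. k v * conj_count m y (gm m (wz m) v)) = - (of_nat (order (G m)) * k y)"
    by (simp only: sum_negf cc)
  have "(\<Sum>v\<in>E m. k v * spin_proj m v y) =
      ((\<Sum>v\<in>E m. k v * conj_count m y v) - (\<Sum>v\<in>E m. k v * conj_count m y (gm m (wz m) v))) / (2 * of_nat (order (G m)))"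
    using y unfolding spin_proj_def
    by (simp add: sum_divide_distrib[symmetric] sum_subtractf[symmetric] right_diff_distrib)
  then show ?thesis unfolding cc z by simp
qed

text \<open>For fixed even \<open>v\<close>, the function \<open>F (jx n m x v)\<close> of even
  \<open>x\<close> is a spin super class function. Expanding the dependence on the second argument
  by \<open>sum_spin_proj\<close> exhibits the restriction as the image of a finite sum of pure
  tensors, so that \<open>phi_inv\<close> is a true preimage.\<close>

lemma res_in_image:
  assumes F: "F \<in> RS (n + m)"
  shows "cf_res (HP n m) (hat_embed \<Gamma> n m) F \<in> phi \<Gamma> n m ` carrier (ten (RM n) (RM m))"
proof -
  define k where "k v x = (if x \<in> E n then F (jx n m x v) else 0)" for v x
  have conj: "F (jx n m (gm n (inv\<^bsub>G n\<^esub> s) (gm n x s)) (gm m (inv\<^bsub>G m\<^esub> t) (gm m v t))) = F (jx n m x v)"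
    if "x \<in> E n" "v \<in> E m" "s \<in> carrier (G n)" "t \<in> carrier (G m)" for x v s t
    using RS_conj[OF F, of "jx n m x v" "jx n m s t"] jx_conj[of x n v m s t] that by simp
  have kc: "k v \<in> RS n" if v: "v \<in> E m" for v
    unfolding RS_iff
  proof (intro conjI allI impI ballI)
    fix x s assume x: "x \<in> E n" and s: "s \<in> carrier (G n)"
    have "gm n (inv\<^bsub>G n\<^esub> s) (gm n x s) \<in> E n" using x s par_conj[of x n s] by (simp add: W.m_assoc)
    then show "k v (gm n (inv\<^bsub>G n\<^esub> s) (gm n x s)) = k v x"
      using conj[OF x v s, of "\<one>\<^bsub>G m\<^esub>"] x v by (simp add: k_def)
  next
    fix x assume x: "x \<in> E n"
    then have "gm n (wz n) x \<in> E n" by (simp add: par_mult)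
    then show "k v (gm n (wz n) x) = - k v x" using x v RS_wz[OF F] by (simp add: k_def jx_wz)
  next
    fix x assume "x \<notin> E n"
    then show "k v x = 0" unfolding k_def by (simp only: if_False)
  qed
  let ?u = "\<lambda>v. pt (RM n) (RM m) (k v) (spin_proj m v)"
  have uc: "?u v \<in> carrier (ten (RM n) (RM m))" if "v \<in> E m" for v
    using pt_closed[OF vspace_RM vspace_RM kc[OF that] spin_proj_closed[OF that]] .
  define U where "U = (\<Oplus>\<^bsub>ten (RM n) (RM m)\<^esub>v\<in>E m. ?u v)"
  have ev: "(\<lambda>U. phi \<Gamma> n m U C) \<in> lin (ten (RM n) (RM m)) scalars" for C
  proof -
    have "(\<lambda>K. K C) \<in> lin (RH n m) scalars" by (rule linI) (simp_all add: RH_simps)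
    from lin_comp[OF phi_lin this] show ?thesis .
  qed
  have U: "U \<in> carrier (ten (RM n) (RM m))" "phi \<Gamma> n m U C = (\<Sum>v\<in>E m. phi \<Gamma> n m (?u v) C)" for C
    using lin_finsum[OF vspace_ten[OF vspace_RM vspace_RM] ev finite_E uc] unfolding U_def by auto
  have "phi \<Gamma> n m U = cf_res (HP n m) (hat_embed \<Gamma> n m) F"
  proof (rule hat_fun_eqI)
    fix C assume "C \<notin> carrier (HP n m)"
    then show "phi \<Gamma> n m U C = cf_res (HP n m) (hat_embed \<Gamma> n m) F C"
      unfolding U(2) using kc spin_proj_closed by (simp add: phi_pt outer_prod_def cf_res_def)
  next
    fix x y assume x: "x \<in> carrier (G n)" "y \<in> carrier (G m)"
    have "phi \<Gamma> n m U (hcls n m x y) = (\<Sum>v\<in>E m. if par x = 0 \<and> par y = 0 then k v x * spin_proj m v y else 0)"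
      unfolding U(2) using x kc spin_proj_closed by (intro sum.cong) (simp_all add: phi_pt RS_outer)
    also have "\<dots> = F (jx n m x y)"
    proof (cases "par x = 0 \<and> par y = 0")
      case True
      then have xy: "x \<in> E n" "y \<in> E m" using x by auto
      have "(\<Sum>v\<in>E m. F (jx n m x v) * spin_proj m v y) = F (jx n m x y)"
      proof (rule sum_spin_proj[OF xy(2)])
        fix v s assume "v \<in> E m" "s \<in> carrier (G m)"
        then show "F (jx n m x (gm m (inv\<^bsub>G m\<^esub> s) (gm m v s))) = F (jx n m x v)"
          using conj[OF xy(1), of v "\<one>\<^bsub>G n\<^esub>" s] x by simp
      next
        fix v assume "v \<in> E m"
        then show "F (jx n m x (gm m (wz m) v)) = - F (jx n m x v)" using RS_wz[OF F] x by (simp add: jx_wz)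
      qed
      then show ?thesis using True xy by (simp add: k_def)
    next
      case False
      \<comment> \<open>If both parts are odd, the juxtaposition is even and
        \<open>RS_jx_odd\<close> is needed; for an odd second part alone, the juxtaposition is
        odd.\<close>
      have "F (jx n m x y) = 0"
      proof (cases "par x = 1")
        case True then show ?thesis using RS_jx_odd[OF F x] by simp
      next
        case False
        then have "par (jx n m x y) \<noteq> 0" using \<open>\<not> (par x = 0 \<and> par y = 0)\<close> x par_range[OF x(1)] par_range[OF x(2)] by auto
        then show ?thesis using RS_zero[OF F] by simp
      qed
      then show ?thesis unfolding if_not_P[OF False] by simp
    qed
    finally show "phi \<Gamma> n m U (hcls n m x y) = cf_res (HP n m) (hat_embed \<Gamma> n m) F (hcls n m x y)"
      using x by (simp add: cf_res_def hat_embed_hcls)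
  qed
  then show ?thesis using U(1) by (metis image_eqI)
qed

text \<open>Whatever preimage \<open>inv_into\<close> selects, \<open>phi_eval\<close> determines
  its evaluations from the restriction.\<close>

lemma comult_comp:
  assumes F: "F \<in> RS k" and m: "m \<le> k"
  shows "comult_comp \<Gamma> k m F \<in> carrier (ten (RM (k - m)) (RM m))"
    and "x \<in> E (k - m) \<Longrightarrow> y \<in> E m \<Longrightarrow>
      tfun (RM (k - m)) (RM m) (\<lambda>f. f x) (\<lambda>f. f y) (comult_comp \<Gamma> k m F) = F (jx (k - m) m x y)"
proof -
  let ?n = "k - m"
  have i: "cf_res (HP ?n m) (hat_embed \<Gamma> ?n m) F \<in> phi \<Gamma> ?n m ` carrier (ten (RM ?n) (RM m))"
    using res_in_image[of F ?n m] F m by simp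
  show c: "comult_comp \<Gamma> k m F \<in> carrier (ten (RM ?n) (RM m))"
    unfolding comult_comp_def phi_inv_def by (rule inv_into_into[OF i])
  have "phi \<Gamma> ?n m (comult_comp \<Gamma> k m F) = cf_res (HP ?n m) (hat_embed \<Gamma> ?n m) F"
    unfolding comult_comp_def phi_inv_def by (rule f_inv_into_f[OF i])
  then show "x \<in> E ?n \<Longrightarrow> y \<in> E m \<Longrightarrow>
      tfun (RM ?n) (RM m) (\<lambda>f. f x) (\<lambda>f. f y) (comult_comp \<Gamma> k m F) = F (jx ?n m x y)"
    using phi_eval[OF c, of x y] by (simp add: cf_res_def hat_embed_hcls)
qed


subsection \<open>Evaluations on the direct sum\<close>

lemma RT_simps:
  "F \<oplus>\<^bsub>RT\<^esub> H = (\<lambda>n x. F n x + H n x)" "r \<odot>\<^bsub>RT\<^esub> F = (\<lambda>n x. r * F n x)" "\<zero>\<^bsub>RT\<^esub> = (\<lambda>n x. 0)"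
  by (simp_all add: R_total_def RM_simps)

lemma RT_iff: "F \<in> carrier RT \<longleftrightarrow> (\<forall>n. F n \<in> RS n) \<and> finite {n. F n \<noteq> (\<lambda>x. 0)}"
  by (simp add: R_total_def RM_simps)

lemma RT_RS: "F \<in> carrier RT \<Longrightarrow> F n \<in> RS n"
  by (simp add: RT_iff)

lemma RT_support:
  assumes "\<And>n. F n \<in> RS n" "finite A" "\<And>n. n \<notin> A \<Longrightarrow> F n = (\<lambda>x. 0)"
  shows "F \<in> carrier RT"
proof -
  have "{n. F n \<noteq> (\<lambda>x. 0)} \<subseteq> A" using assms(3) by blast
  then show ?thesis unfolding RT_iff using assms(1,2) finite_subset by blast
qed

lemma vspace_RT: "vspace RT"
proof (rule vspaceI)
  fix F H assume c: "F \<in> carrier RT" "H \<in> carrier RT"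
  show "F \<oplus>\<^bsub>RT\<^esub> H \<in> carrier RT" unfolding RT_simps
  proof (rule RT_support)
    show "(\<lambda>x. F n x + H n x) \<in> RS n" for n using RT_RS[OF c(1), of n] RT_RS[OF c(2), of n] by (simp add: RS_iff)
    show "finite ({n. F n \<noteq> (\<lambda>x. 0)} \<union> {n. H n \<noteq> (\<lambda>x. 0)})" using c by (simp add: RT_iff)
  qed simp
next
  fix r F assume c: "F \<in> carrier RT"
  show "r \<odot>\<^bsub>RT\<^esub> F \<in> carrier RT" unfolding RT_simps
  proof (rule RT_support)
    show "(\<lambda>x. r * F n x) \<in> RS n" for n using RT_RS[OF c, of n] by (simp add: RS_iff)
    show "finite {n. F n \<noteq> (\<lambda>x. 0)}" using c by (simp add: RT_iff)
  qed simp
next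
  show "\<zero>\<^bsub>RT\<^esub> \<in> carrier RT" by (simp add: RT_iff RT_simps RS_iff)
qed (simp_all add: RT_simps algebra_simps)

lemma ev_lin: "(\<lambda>F. F n x) \<in> lin RT scalars"
  by (rule linI) (simp_all add: RT_simps)

lemma separating_RT: "separating RT (SIGMA n:UNIV. E n) (\<lambda>p F. F (fst p) (snd p))"
  unfolding separating_def
proof (intro conjI ballI impI)
  fix F assume F: "F \<in> carrier RT" and z: "\<forall>p\<in>(SIGMA n:UNIV. E n). F (fst p) (snd p) = 0"
  have "F n x = 0" for n x
  proof (cases "x \<in> E n")
    case True then show ?thesis using z[rule_format, of "(n, x)"] by simp
  next
    case False then show ?thesis by (rule RS_zero[OF RT_RS[OF F]])
  qed
  then show "F = \<zero>\<^bsub>RT\<^esub>" by (simp add: RT_simps fun_eq_iff)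
qed (rule ev_lin)

lemma RT_eqI:
  assumes "F \<in> carrier RT" "H \<in> carrier RT" "\<And>n x. x \<in> E n \<Longrightarrow> F n x = H n x"
  shows "F = H"
  using assms by (intro separating_eqI[OF vspace_RT separating_RT]) (auto simp: mem_Sigma_iff)

abbreviation T2 where "T2 i x j y \<equiv> tfun RT RT (\<lambda>F. F i x) (\<lambda>F. F j y)"
abbreviation RT2 where "RT2 \<equiv> ten RT RT"

lemmas vspace_RT2 = vspace_ten[OF vspace_RT vspace_RT]
lemmas T2_lin = tfun_lin[OF vspace_RT vspace_RT ev_lin ev_lin]
lemmas T2_pt = tfun_pt[OF vspace_RT vspace_RT ev_lin ev_lin]
lemmas RT_pt_closed = pt_closed[OF vspace_RT vspace_RT]

lemma RT2_eqI:
  assumes "U \<in> carrier RT2" "V \<in> carrier RT2"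
    and e: "\<And>i x j y. x \<in> E i \<Longrightarrow> y \<in> E j \<Longrightarrow> T2 i x j y U = T2 i x j y V"
  shows "U = V"
proof (rule separating_eqI[OF vspace_RT2 separating_ten[OF vspace_RT vspace_RT separating_RT separating_RT] assms(1,2)])
  fix q :: "(nat \<times> 'a wr) \<times> nat \<times> 'a wr" assume q: "q \<in> (SIGMA n:UNIV. E n) \<times> (SIGMA n:UNIV. E n)"
  then have "snd (fst q) \<in> E (fst (fst q))" "snd (snd q) \<in> E (fst (snd q))" by (simp_all only: mem_Times_iff) (auto simp: Sigma_def)
  from e[OF this] show "T2 (fst (fst q)) (snd (fst q)) (fst (snd q)) (snd (snd q)) U =
    T2 (fst (fst q)) (snd (fst q)) (fst (snd q)) (snd (snd q)) V" .
qed

lemma RT3_eqI: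
  assumes "U \<in> carrier (ten RT RT2)" "V \<in> carrier (ten RT RT2)"
    and e: "\<And>i x j y l w. x \<in> E i \<Longrightarrow> y \<in> E j \<Longrightarrow> w \<in> E l \<Longrightarrow>
      tfun RT RT2 (\<lambda>F. F i x) (T2 j y l w) U = tfun RT RT2 (\<lambda>F. F i x) (T2 j y l w) V"
  shows "U = V"
proof (rule separating_eqI[OF vspace_ten[OF vspace_RT vspace_RT2] separating_ten[OF vspace_RT vspace_RT2 separating_RT
      separating_ten[OF vspace_RT vspace_RT separating_RT separating_RT]] assms(1,2)])
  fix q :: "(nat \<times> 'a wr) \<times> (nat \<times> 'a wr) \<times> nat \<times> 'a wr"
  assume q: "q \<in> (SIGMA n:UNIV. E n) \<times> (SIGMA n:UNIV. E n) \<times> (SIGMA n:UNIV. E n)"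
  then have "snd (fst q) \<in> E (fst (fst q))" "snd (fst (snd q)) \<in> E (fst (fst (snd q)))"
    "snd (snd (snd q)) \<in> E (fst (snd (snd q)))" by (simp_all only: mem_Times_iff) (auto simp: Sigma_def)
  from e[OF this] show "tfun RT RT2 (\<lambda>F. F (fst (fst q)) (snd (fst q)))
      (T2 (fst (fst (snd q))) (snd (fst (snd q))) (fst (snd (snd q))) (snd (snd (snd q)))) U =
    tfun RT RT2 (\<lambda>F. F (fst (fst q)) (snd (fst q)))
      (T2 (fst (fst (snd q))) (snd (fst (snd q))) (fst (snd (snd q))) (snd (snd (snd q)))) V" .
qed

subsection \<open>The product\<close>

lemma ind_prod_add:
  "ind_prod n m (\<lambda>x. f x + f' x) g w = ind_prod n m f g w + ind_prod n m f' g w"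
  "ind_prod n m f (\<lambda>x. g x + g' x) w = ind_prod n m f g w + ind_prod n m f g' w"
  by (cases "w \<in> carrier (G (n + m))",
      simp add: ind_prod_conj_count distrib_right distrib_left sum.distrib add_divide_distrib,
      simp add: ind_prod_def)+

lemma ind_prod_smult:
  "ind_prod n m (\<lambda>x. r * f x) g w = r * ind_prod n m f g w"
  "ind_prod n m f (\<lambda>x. r * g x) w = r * ind_prod n m f g w"
  by (cases "w \<in> carrier (G (n + m))",
      simp add: ind_prod_conj_count sum_distrib_left mult_ac,
      simp add: ind_prod_def)+

lemma tot_prod_RT:
  assumes F: "F \<in> carrier RT" and H: "H \<in> carrier RT"
  shows "tot_prod F H \<in> carrier RT"
proof (rule RT_support)
  show "tot_prod F H n \<in> RS n" for n by (rule tot_prod_closed[OF RT_RS[OF F] RT_RS[OF H]])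
  let ?S = "\<lambda>F. {n. F n \<noteq> (\<lambda>x. 0)}"
  show "finite ((\<lambda>(n, m). n + m) ` (?S F \<times> ?S H))" using F H by (simp add: RT_iff)
  fix k assume k: "k \<notin> (\<lambda>(n, m). n + m) ` (?S F \<times> ?S H)"
  have "ind_prod n (k - n) (F n) (H (k - n)) w = 0" if n: "n \<le> k" for n w
  proof (cases "F n = (\<lambda>x. 0)")
    case True
    then show ?thesis using ind_prod_smult(1)[of n "k - n" 0] by simp
  next
    case False
    then have "k - n \<notin> ?S H" using k n image_eqI[of k "\<lambda>(n, m). n + m" "(n, k - n)" "?S F \<times> ?S H"] by auto
    then show ?thesis using ind_prod_smult(2)[of n "k - n" _ 0] by simp
  qed
  then show "tot_prod F H k = (\<lambda>x. 0)" by (simp add: tot_prod_def fun_eq_iff)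
qed

lemma mult_sum:
  assumes F: "F \<in> carrier RT" and H: "H \<in> carrier RT"
  shows "(\<Oplus>\<^bsub>RM k\<^esub>n\<in>{..k}. mult_comp \<Gamma> n (k - n) (pt (RM n) (RM (k - n)) (F n) (H (k - n)))) = tot_prod F H k"
proof -
  note e = mult_comp_pt[OF RT_RS[OF F] RT_RS[OF H]]
  have "mult_comp \<Gamma> n (k - n) (pt (RM n) (RM (k - n)) (F n) (H (k - n))) \<in> RS k" if "n \<in> {..k}" for n
    using ind_prod_closed[OF RT_RS[OF F] RT_RS[OF H], of n "k - n"] that by (simp add: e)
  then have "(\<Oplus>\<^bsub>RM k\<^esub>n\<in>{..k}. mult_comp \<Gamma> n (k - n) (pt (RM n) (RM (k - n)) (F n) (H (k - n)))) =
      (\<lambda>x. \<Sum>n\<le>k. mult_comp \<Gamma> n (k - n) (pt (RM n) (RM (k - n)) (F n) (H (k - n))) x)"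
    by (intro finsum_RM finite_atMost)
  then show ?thesis by (simp add: e tot_prod_def fun_eq_iff)
qed

text \<open>Stated for the literal body of \<open>R_mult\<close>, so that the universal property
  applies; on the carrier this body agrees with \<open>tot_prod\<close>, whose bilinearity is
  visible.\<close>

lemma bilin_mult: "bilin RT RT RT
  (\<lambda>F H k. \<Oplus>\<^bsub>RM k\<^esub>n\<in>{..k}. mult_comp \<Gamma> n (k - n) (pt (RM n) (RM (k - n)) (F n) (H (k - n))))"
  (is "bilin RT RT RT ?B")
proof -
  have e: "?B F H = tot_prod F H" if "F \<in> carrier RT" "H \<in> carrier RT" for F H
    using mult_sum[OF that] by (rule ext)
  note a = vspace_add[OF vspace_RT] and s = vspace_smult[OF vspace_RT]
  show ?thesis unfolding bilin_def
  proof (intro conjI ballI linI)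
    fix F H H' assume c: "F \<in> carrier RT" "H \<in> carrier RT" "H' \<in> carrier RT"
    show "?B F (H \<oplus>\<^bsub>RT\<^esub> H') = ?B F H \<oplus>\<^bsub>RT\<^esub> ?B F H'"
      unfolding e[OF c(1) a[OF c(2,3)]] e[OF c(1,2)] e[OF c(1,3)]
      by (simp add: RT_simps tot_prod_def fun_eq_iff ind_prod_add sum.distrib)
  next
    fix F H r assume c: "F \<in> carrier RT" "H \<in> carrier RT"
    show "?B F (r \<odot>\<^bsub>RT\<^esub> H) = r \<odot>\<^bsub>RT\<^esub> ?B F H"
      unfolding e[OF c(1) s[OF c(2)]] e[OF c]
      by (simp add: RT_simps tot_prod_def fun_eq_iff ind_prod_smult sum_distrib_left)
    show "?B F H \<in> carrier RT" unfolding e[OF c] by (rule tot_prod_RT[OF c])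
  next
    fix F H F' assume c: "H \<in> carrier RT" "F \<in> carrier RT" "F' \<in> carrier RT"
    show "?B (F \<oplus>\<^bsub>RT\<^esub> F') H = ?B F H \<oplus>\<^bsub>RT\<^esub> ?B F' H"
      unfolding e[OF a[OF c(2,3)] c(1)] e[OF c(2,1)] e[OF c(3,1)]
      by (simp add: RT_simps tot_prod_def fun_eq_iff ind_prod_add sum.distrib)
  next
    fix F H r assume c: "H \<in> carrier RT" "F \<in> carrier RT"
    show "?B (r \<odot>\<^bsub>RT\<^esub> F) H = r \<odot>\<^bsub>RT\<^esub> ?B F H"
      unfolding e[OF s[OF c(2)] c(1)] e[OF c(2,1)]
      by (simp add: RT_simps tot_prod_def fun_eq_iff ind_prod_smult sum_distrib_left)
    show "?B F H \<in> carrier RT" unfolding e[OF c(2,1)] by (rule tot_prod_RT[OF c(2,1)])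
  qed
qed

lemma R_mult_lin: "R_mult \<Gamma> \<in> lin RT2 RT"
  unfolding R_mult_def by (rule tlift_lin[OF vspace_RT vspace_RT vspace_RT bilin_mult])

lemma R_mult_pt:
  assumes "F \<in> carrier RT" "H \<in> carrier RT"
  shows "R_mult \<Gamma> (pt RT RT F H) = tot_prod F H"
  unfolding R_mult_def tlift_pt[OF vspace_RT vspace_RT vspace_RT bilin_mult assms]
  using mult_sum[OF assms] by (rule ext)

text \<open>The split sets and parts depend on \<open>w\<close> alone, so the formula for pure
  tensors is an equality of linear functionals and extends to every tensor, in particular to
  coproducts.\<close>

lemma R_mult_ev:
  assumes U: "U \<in> carrier RT2" and w: "w \<in> carrier (G k)"
  shows "R_mult \<Gamma> U k w = (\<Sum>A\<in>split_sets k w. T2 (card A) (left_part k w A) (k - card A) (right_part k w A) U)"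
  by (rule ten_ext[OF vspace_RT vspace_RT lin_comp[OF R_mult_lin ev_lin] lin_sum_scalars[OF T2_lin] _ U])
    (use w in \<open>simp add: R_mult_pt T2_pt tot_prod_split RT_RS\<close>)

subsection \<open>The coproduct\<close>

text \<open>In the form of a scalar factor, the degree condition can be pulled out of an evaluation
  by \<open>tfun_scale\<close>.\<close>

lemma R_incl_eq: "R_incl \<Gamma> n f i x = (if i = n then 1 else 0) * f x"
  by (simp add: R_incl_def RM_simps)

lemma R_incl_lin: "R_incl \<Gamma> n \<in> lin (RM n) RT"
proof (rule linI)
  fix f assume f: "f \<in> RS n"
  show "R_incl \<Gamma> n f \<in> carrier RT"
  proof (rule RT_support)
    show "R_incl \<Gamma> n f i \<in> RS i" for i using f by (simp add: R_incl_def RM_simps RS_iff)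
    show "finite {n}" by simp
    show "R_incl \<Gamma> n f i = (\<lambda>x. 0)" if "i \<notin> {n}" for i using that by (simp add: R_incl_def RM_simps)
  qed
qed (simp_all add: R_incl_eq RT_simps RM_simps fun_eq_iff algebra_simps)

text \<open>The conditionals are nested so that \<open>sum.delta\<close> can first collapse the sum
  over \<open>m\<close> and afterwards the one over the degrees.\<close>

lemma comult_summand:
  fixes k m
  assumes F: "F \<in> RS k" and m: "m \<le> k"
  defines "U \<equiv> tmap (RM (k - m)) (RM m) RT RT (R_incl \<Gamma> (k - m)) (R_incl \<Gamma> m) (comult_comp \<Gamma> k m F)"
  shows "U \<in> carrier RT2"
    and "x \<in> E i \<Longrightarrow> y \<in> E j \<Longrightarrow> T2 i x j y U = (if m = j then if k = i + j then F (jx i j x y) else 0 else 0)"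
proof -
  let ?c = "if i = k - m then 1 else 0 :: complex" and ?d = "if j = m then 1 else 0 :: complex"
  note C = comult_comp(1)[OF F m]
  show "U \<in> carrier RT2" unfolding U_def
    by (rule lin_closed[OF tmap_lin[OF vspace_RM vspace_RM vspace_RT vspace_RT R_incl_lin R_incl_lin] C])
  assume xy: "x \<in> E i" "y \<in> E j"
  have "T2 i x j y U = tfun (RM (k - m)) (RM m) (\<lambda>f. ?c * f x) (\<lambda>f. ?d * f y) (comult_comp \<Gamma> k m F)"
    unfolding U_def tfun_tmap[OF vspace_RM vspace_RM vspace_RT vspace_RT R_incl_lin R_incl_lin ev_lin ev_lin C]
    by (simp only: R_incl_eq)
  also have "\<dots> = ?c * ?d * tfun (RM (k - m)) (RM m) (\<lambda>f. f x) (\<lambda>f. f y) (comult_comp \<Gamma> k m F)"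
    by (rule tfun_scale[OF vspace_RM vspace_RM eval_RM eval_RM C])
  also have "\<dots> = (if m = j then if k = i + j then F (jx i j x y) else 0 else 0)"
  proof (cases "m = j \<and> k = i + j")
    case True
    then show ?thesis using comult_comp(2)[OF F m, of x y] xy by simp
  next
    case False
    then show ?thesis using m by auto
  qed
  finally show "T2 i x j y U = (if m = j then if k = i + j then F (jx i j x y) else 0 else 0)" .
qed

lemma
  assumes F: "F \<in> carrier RT"
  shows R_comult_closed: "R_comult \<Gamma> F \<in> carrier RT2"
    and R_comult_ev: "x \<in> E i \<Longrightarrow> y \<in> E j \<Longrightarrow> T2 i x j y (R_comult \<Gamma> F) = F (i + j) (jx i j x y)"
proof -
  let ?S = "{n. F n \<noteq> (\<lambda>x. 0)}"
  define u where "u n m = tmap (RM (n - m)) (RM m) RT RT (R_incl \<Gamma> (n - m)) (R_incl \<Gamma> m) (comult_comp \<Gamma> n m (F n))" for n m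
  define v where "v n = (\<Oplus>\<^bsub>RT2\<^esub>m\<in>{..n}. u n m)" for n
  have S: "finite ?S" using F by (simp add: RT_iff)
  have u: "u n m \<in> carrier RT2" if "m \<in> {..n}" for n m
    unfolding u_def using comult_summand(1)[OF RT_RS[OF F]] that by simp
  have v: "v n \<in> carrier RT2 \<and> T2 i x j y (v n) = (\<Sum>m\<le>n. T2 i x j y (u n m))" for n i x j y
    unfolding v_def by (rule lin_finsum[OF vspace_RT2 T2_lin finite_atMost u])
  have R: "R_comult \<Gamma> F = (\<Oplus>\<^bsub>RT2\<^esub>n\<in>?S. v n)"
    unfolding R_comult_def Let_def u_def v_def RM_simps by (rule HOL.refl)
  have r: "R_comult \<Gamma> F \<in> carrier RT2 \<and> T2 i x j y (R_comult \<Gamma> F) = (\<Sum>n\<in>?S. T2 i x j y (v n))" for i x j y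
    unfolding R by (rule lin_finsum[OF vspace_RT2 T2_lin S v[THEN conjunct1]])
  show "R_comult \<Gamma> F \<in> carrier RT2" using r by blast
  assume xy: "x \<in> E i" "y \<in> E j"
  have "T2 i x j y (v n) = (if n = i + j then F n (jx i j x y) else 0)" for n
  proof -
    have "T2 i x j y (v n) = (\<Sum>m\<le>n. T2 i x j y (u n m))" using v by blast
    also have "\<dots> = (\<Sum>m\<le>n. if m = j then if n = i + j then F n (jx i j x y) else 0 else 0)"
      unfolding u_def by (rule sum.cong[OF HOL.refl]) (rule comult_summand(2)[OF RT_RS[OF F] _ xy], simp)
    finally show ?thesis by (simp add: sum.delta)
  qed
  then have "T2 i x j y (R_comult \<Gamma> F) = (\<Sum>n\<in>?S. if n = i + j then F n (jx i j x y) else 0)"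
    using r by simp
  \<comment> \<open>If the degree \<open>i + j\<close> lies outside the support, the sum is empty of
    matching terms and \<open>F (i + j)\<close> is zero too.\<close>
  then show "T2 i x j y (R_comult \<Gamma> F) = F (i + j) (jx i j x y)" using S by (simp add: sum.delta)
qed

lemma R_comult_lin: "R_comult \<Gamma> \<in> lin RT RT2"
proof (rule linI)
  fix F H assume c: "F \<in> carrier RT" "H \<in> carrier RT"
  have s: "F \<oplus>\<^bsub>RT\<^esub> H \<in> carrier RT" using c vspace_RT by simp
  show "R_comult \<Gamma> (F \<oplus>\<^bsub>RT\<^esub> H) = R_comult \<Gamma> F \<oplus>\<^bsub>RT2\<^esub> R_comult \<Gamma> H"
  proof (rule RT2_eqI)
    fix i x j y assume xy: "x \<in> E i" "y \<in> E j"
    show "T2 i x j y (R_comult \<Gamma> (F \<oplus>\<^bsub>RT\<^esub> H)) = T2 i x j y (R_comult \<Gamma> F \<oplus>\<^bsub>RT2\<^esub> R_comult \<Gamma> H)"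
      unfolding lin_add[OF T2_lin R_comult_closed[OF c(1)] R_comult_closed[OF c(2)]]
      unfolding R_comult_ev[OF s xy] R_comult_ev[OF c(1) xy] R_comult_ev[OF c(2) xy] by (simp add: RT_simps)
  qed (use s c vspace_RT2 in \<open>simp_all add: R_comult_closed\<close>)
next
  fix r F assume c: "F \<in> carrier RT"
  have s: "r \<odot>\<^bsub>RT\<^esub> F \<in> carrier RT" using c vspace_RT by simp
  show "R_comult \<Gamma> (r \<odot>\<^bsub>RT\<^esub> F) = r \<odot>\<^bsub>RT2\<^esub> R_comult \<Gamma> F"
  proof (rule RT2_eqI)
    fix i x j y assume xy: "x \<in> E i" "y \<in> E j"
    show "T2 i x j y (R_comult \<Gamma> (r \<odot>\<^bsub>RT\<^esub> F)) = T2 i x j y (r \<odot>\<^bsub>RT2\<^esub> R_comult \<Gamma> F)"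
      unfolding lin_smult[OF T2_lin R_comult_closed[OF c]]
      unfolding R_comult_ev[OF s xy] R_comult_ev[OF c xy] by (simp add: RT_simps)
  qed (use s c vspace_RT2 in \<open>simp_all add: R_comult_closed\<close>)
qed (rule R_comult_closed)


subsection \<open>The Hopf algebra axioms\<close>

definition counit :: "'a spin_seq \<Rightarrow> complex" where
  "counit F = F 0 \<one>\<^bsub>G 0\<^esub>"

lemma counit_lin: "counit \<in> lin RT scalars"
  unfolding counit_def[abs_def] by (rule ev_lin)

lemma unit_seq_RT: "unit_seq \<in> carrier RT"
  by (rule RT_support[of _ "{0}"]) (simp_all add: unit_seq_closed unit_seq_pos)

text \<open>The degree zero part is the line spanned by the unit, because the two elements of the
  group are exchanged by \<open>z\<close>. It is used for the multiplicativity of the counit and for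
  the antipode in degree zero.\<close>

lemma RS_0_unit:
  assumes f: "f \<in> RS 0" shows "f x = f \<one>\<^bsub>G 0\<^esub> * unit_seq 0 x"
proof -
  have "f = (\<lambda>x. f \<one>\<^bsub>G 0\<^esub> * unit_seq 0 x)"
  proof (rule RS_eqI[OF f])
    show "(\<lambda>x. f \<one>\<^bsub>G 0\<^esub> * unit_seq 0 x) \<in> RS 0" using unit_seq_closed[of 0] by (simp add: RS_iff)
    fix x assume "x \<in> E 0"
    then have "x = \<one>\<^bsub>G 0\<^esub> \<or> x = gm 0 (wz 0) \<one>\<^bsub>G 0\<^esub>" using carrier_G_0 by auto
    then show "f x = f \<one>\<^bsub>G 0\<^esub> * unit_seq 0 x"
      by (elim disjE) (simp_all only: unit_seq_one RS_wz[OF f W.one_closed] RS_wz[OF unit_seq_closed W.one_closed], simp_all)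
  qed
  then show ?thesis by (rule fun_cong)
qed

lemma R_assoc_algebra: "assoc_algebra complex_ring RT (R_mult \<Gamma>) unit_seq"
proof (intro assoc_algebra.intro assoc_algebra_axioms.intro vspace_RT R_mult_lin unit_seq_RT)
  fix X assume X: "X \<in> carrier (ten RT2 RT)"
  note l1 = lin_comp[OF tmap_lin[OF vspace_RT2 vspace_RT vspace_RT vspace_RT R_mult_lin lin_id] R_mult_lin]
  note l2 = lin_comp[OF tassoc_lin[OF vspace_RT vspace_RT vspace_RT]
      lin_comp[OF tmap_lin[OF vspace_RT vspace_RT2 vspace_RT vspace_RT lin_id R_mult_lin] R_mult_lin]]
  show "R_mult \<Gamma> (tmap RT2 RT RT RT (R_mult \<Gamma>) (\<lambda>a. a) X) =
    R_mult \<Gamma> (tmap RT RT2 RT RT (\<lambda>a. a) (R_mult \<Gamma>) (tassoc RT RT RT X))"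
  proof (rule ten_ext3[OF vspace_RT vspace_RT vspace_RT l1 l2 _ X])
    fix F H K assume c: "F \<in> carrier RT" "H \<in> carrier RT" "K \<in> carrier RT"
    show "R_mult \<Gamma> (tmap RT2 RT RT RT (R_mult \<Gamma>) (\<lambda>a. a) (pt RT2 RT (pt RT RT F H) K)) =
      R_mult \<Gamma> (tmap RT RT2 RT RT (\<lambda>a. a) (R_mult \<Gamma>) (tassoc RT RT RT (pt RT2 RT (pt RT RT F H) K)))"
      unfolding tassoc_pt[OF vspace_RT vspace_RT vspace_RT c]
        tmap_pt[OF vspace_RT2 vspace_RT vspace_RT vspace_RT R_mult_lin lin_id RT_pt_closed[OF c(1,2)] c(3)]
        tmap_pt[OF vspace_RT vspace_RT2 vspace_RT vspace_RT lin_id R_mult_lin c(1) RT_pt_closed[OF c(2,3)]]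
        R_mult_pt[OF c(1,2)] R_mult_pt[OF c(2,3)]
        R_mult_pt[OF tot_prod_RT[OF c(1,2)] c(3)] R_mult_pt[OF c(1) tot_prod_RT[OF c(2,3)]]
      by (rule tot_prod_assoc[OF RT_RS[OF c(1)] RT_RS[OF c(2)] RT_RS[OF c(3)]])
  qed
next
  fix F assume F: "F \<in> carrier RT"
  show "R_mult \<Gamma> (pt RT RT unit_seq F) = F" unfolding R_mult_pt[OF unit_seq_RT F]
    by (rule ext) (rule tot_prod_unit_left[OF RT_RS[OF F]])
  show "R_mult \<Gamma> (pt RT RT F unit_seq) = F" unfolding R_mult_pt[OF F unit_seq_RT]
    by (rule ext) (rule tot_prod_unit_right[OF RT_RS[OF F]])
qed

lemma R_coassoc:
  assumes F: "F \<in> carrier RT"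
  shows "tassoc RT RT RT (tmap RT RT RT2 RT (R_comult \<Gamma>) (\<lambda>b. b) (R_comult \<Gamma> F)) =
    tmap RT RT RT RT2 (\<lambda>b. b) (R_comult \<Gamma>) (R_comult \<Gamma> F)" (is "?L = ?R")
proof (rule RT3_eqI)
  note D = R_comult_closed[OF F]
  note m1 = tmap_lin[OF vspace_RT vspace_RT vspace_RT2 vspace_RT R_comult_lin lin_id]
  note m2 = tmap_lin[OF vspace_RT vspace_RT vspace_RT vspace_RT2 lin_id R_comult_lin]
  show "?L \<in> carrier (ten RT RT2)"
    by (rule lin_closed[OF tassoc_lin[OF vspace_RT vspace_RT vspace_RT] lin_closed[OF m1 D]])
  show "?R \<in> carrier (ten RT RT2)" by (rule lin_closed[OF m2 D])
  fix i x j y l w assume e: "x \<in> E i" "y \<in> E j" "w \<in> E l"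
  have J: "jx i j x y \<in> E (i + j)" "jx j l y w \<in> E (j + l)" using e by simp_all
  have "tfun RT RT2 (\<lambda>F. F i x) (T2 j y l w) ?L =
      T2 (i + j) (jx i j x y) l w (R_comult \<Gamma> F)"
    unfolding tfun_tassoc[OF vspace_RT vspace_RT vspace_RT ev_lin ev_lin ev_lin lin_closed[OF m1 D]]
      tfun_tmap[OF vspace_RT vspace_RT vspace_RT2 vspace_RT R_comult_lin lin_id T2_lin ev_lin D]
    by (rule tfun_cong[OF vspace_RT vspace_RT ev_lin ev_lin _ _ D]) (simp_all only: R_comult_ev e)
  moreover have "tfun RT RT2 (\<lambda>F. F i x) (T2 j y l w) ?R =
      T2 i x (j + l) (jx j l y w) (R_comult \<Gamma> F)"
    unfolding tfun_tmap[OF vspace_RT vspace_RT vspace_RT vspace_RT2 lin_id R_comult_lin ev_lin T2_lin D]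
    by (rule tfun_cong[OF vspace_RT vspace_RT ev_lin ev_lin _ _ D]) (simp_all only: R_comult_ev e)
  ultimately show "tfun RT RT2 (\<lambda>F. F i x) (T2 j y l w) ?L = tfun RT RT2 (\<lambda>F. F i x) (T2 j y l w) ?R"
    using R_comult_ev[OF F J(1) e(3)] R_comult_ev[OF F e(1) J(2)] jx_assoc[of x i y j w l] e
    by (simp add: add.assoc)
qed

lemma bilin_smult:
  assumes f: "f \<in> lin RT scalars"
  shows "bilin RT RT RT (\<lambda>b c. f b \<odot>\<^bsub>RT\<^esub> c)" "bilin RT RT RT (\<lambda>b c. f c \<odot>\<^bsub>RT\<^esub> b)"
proof -
  have "(\<lambda>c. r \<odot>\<^bsub>RT\<^esub> c) \<in> lin RT RT" for r
    by (rule linI) (use vspace_RT in \<open>simp_all add: vspace_smult, simp_all add: RT_simps algebra_simps\<close>)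
  moreover have "(\<lambda>b. f b \<odot>\<^bsub>RT\<^esub> c) \<in> lin RT RT" if "c \<in> carrier RT" for c
  proof (rule linI)
    show "f b \<odot>\<^bsub>RT\<^esub> c \<in> carrier RT" for b using that vspace_RT by simp
  qed (simp_all add: lin_add[OF f] lin_smult[OF f], simp_all add: RT_simps algebra_simps)
  ultimately show "bilin RT RT RT (\<lambda>b c. f b \<odot>\<^bsub>RT\<^esub> c)" "bilin RT RT RT (\<lambda>b c. f c \<odot>\<^bsub>RT\<^esub> b)"
    by (simp_all add: bilin_def)
qed

lemma R_coalgebra: "coassoc_coalgebra complex_ring RT (R_comult \<Gamma>) counit"
proof (intro coassoc_coalgebra.intro coassoc_coalgebra_axioms.intro vspace_RT R_comult_lin counit_lin R_coassoc)
  fix F assume F: "F \<in> carrier RT"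
  note D = R_comult_closed[OF F]
  have one: "\<one>\<^bsub>G 0\<^esub> \<in> E 0" by simp
  show "tlift RT RT RT (\<lambda>b c. counit b \<odot>\<^bsub>RT\<^esub> c) (R_comult \<Gamma> F) = F"
  proof (rule RT_eqI[OF lin_closed[OF tlift_lin[OF vspace_RT vspace_RT vspace_RT bilin_smult(1)[OF counit_lin]] D] F])
    fix n x assume x: "x \<in> E n"
    have "tlift RT RT RT (\<lambda>b c. counit b \<odot>\<^bsub>RT\<^esub> c) (R_comult \<Gamma> F) n x =
        tlift RT RT scalars (\<lambda>b c. (counit b \<odot>\<^bsub>RT\<^esub> c) n x) (R_comult \<Gamma> F)"
      by (rule lin_tlift[OF vspace_RT vspace_RT vspace_RT vspace_scalars bilin_smult(1)[OF counit_lin] ev_lin D])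
    also have "\<dots> = T2 0 \<one>\<^bsub>G 0\<^esub> n x (R_comult \<Gamma> F)"
      by (simp add: tfun_def RT_simps counit_def)
    also have "\<dots> = F n x" using R_comult_ev[OF F one x] jx_0_left[of x n] x by simp
    finally show "tlift RT RT RT (\<lambda>b c. counit b \<odot>\<^bsub>RT\<^esub> c) (R_comult \<Gamma> F) n x = F n x" .
  qed
  show "tlift RT RT RT (\<lambda>b c. counit c \<odot>\<^bsub>RT\<^esub> b) (R_comult \<Gamma> F) = F"
  proof (rule RT_eqI[OF lin_closed[OF tlift_lin[OF vspace_RT vspace_RT vspace_RT bilin_smult(2)[OF counit_lin]] D] F])
    fix n x assume x: "x \<in> E n"
    have "tlift RT RT RT (\<lambda>b c. counit c \<odot>\<^bsub>RT\<^esub> b) (R_comult \<Gamma> F) n x =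
        tlift RT RT scalars (\<lambda>b c. (counit c \<odot>\<^bsub>RT\<^esub> b) n x) (R_comult \<Gamma> F)"
      by (rule lin_tlift[OF vspace_RT vspace_RT vspace_RT vspace_scalars bilin_smult(2)[OF counit_lin] ev_lin D])
    also have "\<dots> = T2 n x 0 \<one>\<^bsub>G 0\<^esub> (R_comult \<Gamma> F)"
      by (simp add: tfun_def RT_simps counit_def mult.commute)
    also have "\<dots> = F n x" using R_comult_ev[OF F x one] jx_0_right[of x n] x by simp
    finally show "tlift RT RT RT (\<lambda>b c. counit c \<odot>\<^bsub>RT\<^esub> b) (R_comult \<Gamma> F) n x = F n x" .
  qed
qed

text \<open>On a pure tensor, evaluating the right side at \<open>(x, y)\<close> sums over the
  splittings of \<open>x\<close> and of \<open>y\<close>; the swap regroups the four parts so that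
  one coproduct is evaluated at the two left parts and the other at the two right parts.
  \<open>tot_prod_jx\<close> gives the same sum for the left side.\<close>

lemma R_delta_mult:
  assumes X: "X \<in> carrier RT2"
  shows "R_comult \<Gamma> (R_mult \<Gamma> X) = tmap RT2 RT2 RT RT (R_mult \<Gamma>) (R_mult \<Gamma>)
    (tswap RT RT RT RT (tmap RT RT RT2 RT2 (R_comult \<Gamma>) (R_comult \<Gamma>) X))"
proof -
  note m1 = tmap_lin[OF vspace_RT vspace_RT vspace_RT2 vspace_RT2 R_comult_lin R_comult_lin]
  note m2 = tswap_lin[OF vspace_RT vspace_RT vspace_RT vspace_RT]
  note m3 = tmap_lin[OF vspace_RT2 vspace_RT2 vspace_RT vspace_RT R_mult_lin R_mult_lin]
  note r = lin_comp[OF m1 lin_comp[OF m2 m3]]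
  show ?thesis
  proof (rule ten_ext[OF vspace_RT vspace_RT lin_comp[OF R_mult_lin R_comult_lin] r _ X])
    fix F H assume c: "F \<in> carrier RT" "H \<in> carrier RT"
    note P = RT_pt_closed[OF c]
    let ?W = "tmap RT RT RT2 RT2 (R_comult \<Gamma>) (R_comult \<Gamma>) (pt RT RT F H)"
    note W = lin_closed[OF m1 P] and V = lin_closed[OF m2 lin_closed[OF m1 P]]
    have tp: "tot_prod F H \<in> carrier RT" by (rule tot_prod_RT[OF c])
    show "R_comult \<Gamma> (R_mult \<Gamma> (pt RT RT F H)) = tmap RT2 RT2 RT RT (R_mult \<Gamma>) (R_mult \<Gamma>) (tswap RT RT RT RT ?W)"
    proof (rule RT2_eqI)
      show "R_comult \<Gamma> (R_mult \<Gamma> (pt RT RT F H)) \<in> carrier RT2"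
        unfolding R_mult_pt[OF c] by (rule R_comult_closed[OF tp])
      show "tmap RT2 RT2 RT RT (R_mult \<Gamma>) (R_mult \<Gamma>) (tswap RT RT RT RT ?W) \<in> carrier RT2"
        by (rule lin_closed[OF m3 V])
      fix i x j y assume e: "x \<in> E i" "y \<in> E j"
      let ?a = "\<lambda>A. T2 (card A) (left_part i x A) (i - card A) (right_part i x A)"
      let ?b = "\<lambda>A. T2 (card A) (left_part j y A) (j - card A) (right_part j y A)"
      have "T2 i x j y (tmap RT2 RT2 RT RT (R_mult \<Gamma>) (R_mult \<Gamma>) (tswap RT RT RT RT ?W)) =
          tfun RT2 RT2 (\<lambda>U. R_mult \<Gamma> U i x) (\<lambda>U. R_mult \<Gamma> U j y) (tswap RT RT RT RT ?W)"
        by (rule tfun_tmap[OF vspace_RT2 vspace_RT2 vspace_RT vspace_RT R_mult_lin R_mult_lin ev_lin ev_lin V])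
      also have "\<dots> = tfun RT2 RT2 (\<lambda>U. \<Sum>A\<in>split_sets i x. ?a A U) (\<lambda>U. \<Sum>A\<in>split_sets j y. ?b A U) (tswap RT RT RT RT ?W)"
        by (rule tfun_cong[OF vspace_RT2 vspace_RT2 lin_sum_scalars[OF T2_lin] lin_sum_scalars[OF T2_lin] _ _ V])
          (rule R_mult_ev, assumption, use e in simp)+
      also have "\<dots> = (\<Sum>A\<in>split_sets i x. \<Sum>B\<in>split_sets j y. tfun RT2 RT2 (?a A) (?b B) (tswap RT RT RT RT ?W))"
        by (rule tfun_sum[OF vspace_RT2 vspace_RT2 T2_lin T2_lin V])
      also have "\<dots> = (\<Sum>A\<in>split_sets i x. \<Sum>B\<in>split_sets j y.
          F (card A + card B) (jx (card A) (card B) (left_part i x A) (left_part j y B)) *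
          H (i - card A + (j - card B)) (jx (i - card A) (j - card B) (right_part i x A) (right_part j y B)))"
      proof (intro sum.cong HOL.refl)
        fix A B assume AB: "A \<in> split_sets i x" "B \<in> split_sets j y"
        show "tfun RT2 RT2 (?a A) (?b B) (tswap RT RT RT RT ?W) =
          F (card A + card B) (jx (card A) (card B) (left_part i x A) (left_part j y B)) *
          H (i - card A + (j - card B)) (jx (i - card A) (j - card B) (right_part i x A) (right_part j y B))"
          unfolding tfun_tswap[OF vspace_RT vspace_RT vspace_RT vspace_RT ev_lin ev_lin ev_lin ev_lin W]
          unfolding tmap_pt[OF vspace_RT vspace_RT vspace_RT2 vspace_RT2 R_comult_lin R_comult_lin c]
            tfun_pt[OF vspace_RT2 vspace_RT2 T2_lin T2_lin R_comult_closed[OF c(1)] R_comult_closed[OF c(2)]]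
            R_comult_ev[OF c(1) split_parts(1)[OF AB(1)] split_parts(1)[OF AB(2)]]
            R_comult_ev[OF c(2) split_parts(2)[OF AB(1)] split_parts(2)[OF AB(2)]]
          by (rule HOL.refl)
      qed
      also have "\<dots> = T2 i x j y (R_comult \<Gamma> (R_mult \<Gamma> (pt RT RT F H)))"
        unfolding R_mult_pt[OF c] R_comult_ev[OF tp e]
        by (rule tot_prod_jx[OF RT_RS[OF c(1)] RT_RS[OF c(2)] e, symmetric])
      finally show "T2 i x j y (R_comult \<Gamma> (R_mult \<Gamma> (pt RT RT F H))) =
        T2 i x j y (tmap RT2 RT2 RT RT (R_mult \<Gamma>) (R_mult \<Gamma>) (tswap RT RT RT RT ?W))" by (rule HOL.sym)
    qed
  qed
qed

lemma R_delta_unit: "R_comult \<Gamma> unit_seq = pt RT RT unit_seq unit_seq"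
proof (rule RT2_eqI[OF R_comult_closed[OF unit_seq_RT] RT_pt_closed[OF unit_seq_RT unit_seq_RT]])
  fix i x j y assume e: "x \<in> E i" "y \<in> E j"
  have "unit_seq (i + j) (jx i j x y) = unit_seq i x * unit_seq j y"
  proof (cases "i = 0 \<and> j = 0")
    case False
    then show ?thesis by (auto simp: unit_seq_pos)
  next
    case True
    then have y: "y \<in> carrier (G 0)" and x: "x = \<one>\<^bsub>G 0\<^esub> \<or> x = gm 0 (wz 0) \<one>\<^bsub>G 0\<^esub>"
      using e carrier_G_0 by auto
    from x have "unit_seq 0 (jx 0 0 x y) = unit_seq 0 x * unit_seq 0 y"
    proof
      assume "x = \<one>\<^bsub>G 0\<^esub>"
      then show ?thesis using y by (simp add: jx_0_left unit_seq_one)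
    next
      assume x: "x = gm 0 (wz 0) \<one>\<^bsub>G 0\<^esub>"
      have "jx 0 0 x y = gm 0 (wz 0) y" unfolding x jx_wz(1)[OF W.one_closed y] jx_0_left[OF y] by simp
      then show ?thesis using RS_wz[OF unit_seq_closed y] RS_wz[OF unit_seq_closed[of 0] W.one_closed]
        unfolding x by (simp only: unit_seq_one) simp
    qed
    then show ?thesis using True by simp
  qed
  then show "T2 i x j y (R_comult \<Gamma> unit_seq) = T2 i x j y (pt RT RT unit_seq unit_seq)"
    unfolding R_comult_ev[OF unit_seq_RT e] T2_pt[OF unit_seq_RT unit_seq_RT] .
qed

text \<open>In degree zero \<open>F\<close> is a multiple of the unit, so the left unit law computes
  the product.\<close>

lemma counit_mult:
  assumes c: "F \<in> carrier RT" "H \<in> carrier RT"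
  shows "counit (R_mult \<Gamma> (pt RT RT F H)) = counit F * counit H"
proof -
  have "tot_prod F H 0 \<one>\<^bsub>G 0\<^esub> = ind_prod 0 0 (\<lambda>x. F 0 \<one>\<^bsub>G 0\<^esub> * unit_seq 0 x) (H 0) \<one>\<^bsub>G 0\<^esub>"
    unfolding tot_prod_def ext[OF RS_0_unit[OF RT_RS[OF c(1)]], symmetric] by simp
  also have "\<dots> = F 0 \<one>\<^bsub>G 0\<^esub> * tot_prod unit_seq H 0 \<one>\<^bsub>G 0\<^esub>" by (simp add: ind_prod_smult tot_prod_def)
  also have "\<dots> = F 0 \<one>\<^bsub>G 0\<^esub> * H 0 \<one>\<^bsub>G 0\<^esub>" by (simp only: tot_prod_unit_left[OF RT_RS[OF c(2)]])
  finally show ?thesis unfolding R_mult_pt[OF c] counit_def .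
qed

lemma R_bialgebra: "bialgebra complex_ring RT (R_mult \<Gamma>) unit_seq (R_comult \<Gamma>) counit"
  by (intro bialgebra.intro bialgebra_axioms.intro R_assoc_algebra R_coalgebra R_delta_mult R_delta_unit)
    (simp_all add: counit_mult, simp add: counit_def unit_seq_one)

lemma antipode_RT:
  assumes F: "F \<in> carrier RT" shows "antipode F \<in> carrier RT"
proof (rule RT_support)
  show "antipode F n \<in> RS n" for n by (rule antipode_closed[of F n, OF RT_RS[OF F]])
  show "finite {n. F n \<noteq> (\<lambda>x. 0)}" using F by (simp add: RT_iff)
qed (simp add: antipode_def fun_eq_iff)

lemma antipode_lin: "antipode \<in> lin RT RT"
  by (rule linI) (simp_all add: antipode_RT, simp_all add: RT_simps antipode_def fun_eq_iff algebra_simps)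

lemma antipode_sums_all:
  assumes F: "F \<in> carrier RT" and w: "w \<in> E k"
  shows "(\<Sum>A\<in>split_sets k w. orbit_sign (card A) (left_part k w A) *
      F (card A + (k - card A)) (jx (card A) (k - card A) (left_part k w A) (right_part k w A))) = counit F * unit_seq k w"
    and "(\<Sum>A\<in>split_sets k w. orbit_sign (k - card A) (right_part k w A) *
      F (card A + (k - card A)) (jx (card A) (k - card A) (left_part k w A) (right_part k w A))) = counit F * unit_seq k w"
proof -
  note R = RT_RS[OF F]
  let ?L = "\<Sum>A\<in>split_sets k w. orbit_sign (card A) (left_part k w A) *
      F (card A + (k - card A)) (jx (card A) (k - card A) (left_part k w A) (right_part k w A))"
  let ?R = "\<Sum>A\<in>split_sets k w. orbit_sign (k - card A) (right_part k w A) *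
      F (card A + (k - card A)) (jx (card A) (k - card A) (left_part k w A) (right_part k w A))"
  have "?L = counit F * unit_seq k w \<and> ?R = counit F * unit_seq k w"
  proof (cases "k > 0")
    case True
    then show ?thesis using antipode_sums[OF R w True] by (simp add: unit_seq_pos)
  next
    case False
    then have k: "k = 0" by simp
    have w0: "w \<in> carrier (G 0)" using w k by simp
    \<comment> \<open>\<open>split_sets_stable\<close> needs a function that is nonzero at
      \<open>w\<close>. The given \<open>F\<close> may vanish there, but the unit has no zero on the
      group of degree zero.\<close>
    then have "unit_seq 0 w \<noteq> 0" using carrier_G_0 by (auto simp: unit_seq_def)
    then have s: "split_sets k w = {{}}" using split_sets_stable[OF unit_seq_closed w] k by auto
    have "F (card A + (k - card A)) (jx (card A) (k - card A) (left_part k w A) (right_part k w A)) = F k w"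
      if "A \<in> split_sets k w" for A
      by (rule split_parts_value[OF R _ that]) (use w in simp)
    then have v: "F (card {} + (k - card {})) (jx (card {}) (k - card {}) (left_part k w {}) (right_part k w {})) = F k w"
      unfolding s by simp
    have o: "orbit_sign (card {}) v = 1" "orbit_sign (k - card {}) v = 1" for v by (simp_all add: orbit_sign_def k)
    have fw: "counit F * unit_seq k w = F k w" unfolding k counit_def by (rule RS_0_unit[OF R, symmetric])
    show ?thesis unfolding s fw by (simp only: o v sum.insert finite.emptyI empty_iff not_False_eq_True sum.empty) simp
  qed
  then show "?L = counit F * unit_seq k w" "?R = counit F * unit_seq k w" by auto
qed

text \<open>The antipode acts by pointwise multiplication, so on evaluations of the coproduct it is
  the orbit sign of one part; \<open>R_mult_ev\<close> then produces the sums of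
  \<open>antipode_sums_all\<close>.\<close>

lemma R_antipode:
  assumes F: "F \<in> carrier RT"
  shows "R_mult \<Gamma> (tmap RT RT RT RT antipode (\<lambda>b. b) (R_comult \<Gamma> F)) = counit F \<odot>\<^bsub>RT\<^esub> unit_seq"
    and "R_mult \<Gamma> (tmap RT RT RT RT (\<lambda>b. b) antipode (R_comult \<Gamma> F)) = counit F \<odot>\<^bsub>RT\<^esub> unit_seq"
proof -
  note D = R_comult_closed[OF F]
  note m1 = tmap_lin[OF vspace_RT vspace_RT vspace_RT vspace_RT antipode_lin lin_id]
  note m2 = tmap_lin[OF vspace_RT vspace_RT vspace_RT vspace_RT lin_id antipode_lin]
  have u: "counit F \<odot>\<^bsub>RT\<^esub> unit_seq \<in> carrier RT" using unit_seq_RT vspace_RT by simp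
  have t1: "T2 i x j y (tmap RT RT RT RT antipode (\<lambda>b. b) (R_comult \<Gamma> F)) = orbit_sign i x * F (i + j) (jx i j x y)"
    if "x \<in> E i" "y \<in> E j" for i x j y
    using tfun_scale[OF vspace_RT vspace_RT ev_lin ev_lin D, of "orbit_sign i x" i x 1 j y]
    unfolding tfun_tmap[OF vspace_RT vspace_RT vspace_RT vspace_RT antipode_lin lin_id ev_lin ev_lin D]
    by (simp add: antipode_def R_comult_ev[OF F that])
  have t2: "T2 i x j y (tmap RT RT RT RT (\<lambda>b. b) antipode (R_comult \<Gamma> F)) = orbit_sign j y * F (i + j) (jx i j x y)"
    if "x \<in> E i" "y \<in> E j" for i x j y
    using tfun_scale[OF vspace_RT vspace_RT ev_lin ev_lin D, of 1 i x "orbit_sign j y" j y]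
    unfolding tfun_tmap[OF vspace_RT vspace_RT vspace_RT vspace_RT lin_id antipode_lin ev_lin ev_lin D]
    by (simp add: antipode_def R_comult_ev[OF F that])
  show "R_mult \<Gamma> (tmap RT RT RT RT antipode (\<lambda>b. b) (R_comult \<Gamma> F)) = counit F \<odot>\<^bsub>RT\<^esub> unit_seq"
  proof (rule RT_eqI[OF lin_closed[OF R_mult_lin lin_closed[OF m1 D]] u])
    fix k w assume w: "w \<in> E k"
    then have wc: "w \<in> carrier (G k)" by simp
    show "R_mult \<Gamma> (tmap RT RT RT RT antipode (\<lambda>b. b) (R_comult \<Gamma> F)) k w = (counit F \<odot>\<^bsub>RT\<^esub> unit_seq) k w"
      unfolding R_mult_ev[OF lin_closed[OF m1 D] wc] RT_simps antipode_sums_all(1)[OF F w, symmetric]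
      by (rule sum.cong[OF HOL.refl]) (rule t1[OF split_parts(1,2)])
  qed
  show "R_mult \<Gamma> (tmap RT RT RT RT (\<lambda>b. b) antipode (R_comult \<Gamma> F)) = counit F \<odot>\<^bsub>RT\<^esub> unit_seq"
  proof (rule RT_eqI[OF lin_closed[OF R_mult_lin lin_closed[OF m2 D]] u])
    fix k w assume w: "w \<in> E k"
    then have wc: "w \<in> carrier (G k)" by simp
    show "R_mult \<Gamma> (tmap RT RT RT RT (\<lambda>b. b) antipode (R_comult \<Gamma> F)) k w = (counit F \<odot>\<^bsub>RT\<^esub> unit_seq) k w"
      unfolding R_mult_ev[OF lin_closed[OF m2 D] wc] RT_simps antipode_sums_all(2)[OF F w, symmetric]
      by (rule sum.cong[OF HOL.refl]) (rule t2[OF split_parts(1,2)])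
  qed
qed

lemma R_hopf_algebra: "hopf_algebra complex_ring RT (R_mult \<Gamma>) unit_seq (R_comult \<Gamma>) counit antipode"
  by (intro hopf_algebra.intro hopf_algebra_axioms.intro R_bialgebra antipode_lin R_antipode)

end

theorem theorem3p8:
  fixes \<Gamma> :: "('a, 'b) monoid_scheme"
  assumes "group \<Gamma>" and "finite (carrier \<Gamma>)"
  shows "\<exists>e \<epsilon> S. hopf_algebra complex_ring (R_total \<Gamma>) (R_mult \<Gamma>) e (R_comult \<Gamma>) \<epsilon> S"
proof -
  interpret finite_base \<Gamma> using assms by (intro finite_base.intro finite_base_axioms.intro)
  show ?thesis using R_hopf_algebra by blast
qed

end
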